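(* Let $k$ be a field. The abstract differentiation $N'(X)=X_N/\hat J_X$, from cosimplicial $k$-algebras to (connective) differential graded $k$-algebras, is left adjoint to the denormalization functor $K$, making differential graded algebras a reflective subcategory of cosimplicial algebras: $$N':c\mathrm{Alg}\leftrightarrows dg\mathrm{Alg}:K,\qquad N'\dashv K .$$ Moreover, $N'$ preserves commutativity (it sends degreewise commutative cosimplicial algebras to graded commutative differential graded algebras), and for a simplicial manifold $G$ (with $k=\mathbb R$) it recovers the geometric differentiation: $N'(C(G))\cong CE(A_G)$.
   Context: Algebras are associative unital over $k$. A cosimplicial algebra is a covariant functor $X:\Delta\to\mathrm{Alg}$, $(X^n,d^i,s^j)$, with cofaces $d^i:X^{n-1}\to X^n$ and codegeneracies $s^j:X^{n+1}\to X^n$. $dg\mathrm{Alg}$ denotes differential graded algebras $Y=\bigoplus_{n\ge0}Y^n$ concentrated in non-negative degrees with differential of degree $+1$. Normalization: with $I_{n,j}=\ker(s^{j-1}:X^n\to X^{n-1})$, $1\le j\le n$, set $X_N^n=\bigcap_{j=1}^nI_{n,j}$ and $d=\sum_{i=0}^{n+1}(-1)^id^i:X_N^n\to X_N^{n+1}$; $X_N$ is a dga with cup product $f\cup g=(d^{p+1})^q(f)\cdot(d^0)^p(g)$, $f\in X_N^p$, $g\in X_N^q$ (the images under the front-$p$ and back-$q$ inclusions $[p]\to[p+q]$, $[q]\to[p+q]$). Differentiating ideal: $\hat J_X\subset X_N$ is the differential ideal generated by $J_X^n=\sum_{j=1}^nI_{n,j}^2\cap X_N^n$, where $I_{n,j}^2=I_{n,j}I_{n,j}\subset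 X^n$ is the square ideal. Abstract differentiation: $N'(X)=X_N/\hat J_X$. Denormalization: for a dga $Y$, $K(Y)=Y_K$ is the cosimplicial algebra with $Y_K^n=\bigoplus_{k=0}^nY^k\otimes\Lambda^k(\mathbb Z^n)$, spanned by $f\otimes e^n_\alpha$, $\alpha\subset\{1,\dots,n\}$, $f\in Y^{|\alpha|}$, where $e^n_\alpha=e^n_{\alpha_1}\wedge\dots\wedge e^n_{\alpha_k}$ for $\alpha=\{\alpha_1<\dots<\alpha_k\}$. Let $\delta_i:[n]\to[n+1]$ be the injection missing $i$, and $\sigma_j:[n]\to[n-1]$ the surjection repeating $j$. Structure maps: $s^{j-1}(f\otimes e^n_\alpha)=f\otimes e^{n-1}_{\sigma_{j-1}(\alpha)}$ if $j\notin\alpha$, and $0$ if $j\in\alpha$; for $i>0$, $d^i(f\otimes e_\alpha^n)=f\otimes e^{n+1}_{\delta_i(\alpha)}$ if $i\notin\alpha$, and $f\otimes(e^{n+1}_{\delta_i(\alpha)}+e^{n+1}_{\delta_{i+1}(\alpha)})$ if $i\in\alpha$; $d^0(f\otimes e^n_\alpha)=f\otimes e^{n+1}_{\delta_1(\alpha)}+df\otimes e_1^{n+1}\wedge e^{n+1}_{\delta_1(\alpha)}$. Product: $(f\otimes e^n_\alpha)(g\otimes e^n_\beta)=(f\cup g)\otimes e^n_\alpha\wedge e^n_\beta$, where $\cup$ is the product of $Y$. Geometric differentiation: for a simplicial manifold $G=(G_n,d_i,s_j)$, $C(G)$ is the cosimplicial $\mathbb R$-algebra $n\mapsto C^\infty(G_n)$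 with pointwise product and cofaces/codegeneracies $d_i^*,s_j^*$. With $S_{n,j}=s_{j-1}(G_{n-1})$, $I(S_{n,j})\subset C^\infty(G_n)$ the ideal of functions vanishing on it, $C_N^\infty(G_n)=\bigcap_jI(S_{n,j})$, $C_N(G)=\bigoplus_nC_N^\infty(G_n)$ with cup product and $\delta=\sum(-1)^id_i^*$, $J_n=\sum_j(C^\infty_N(G_n)\cap I(S_{n,j})^2)$ and $\hat J=J+\delta(J)$ with $J=\bigoplus_{n\ge1} J_n$, the Chevalley-Eilenberg algebra of the higher Lie algebroid of $G$ is $CE(A_G)=C_N(G)/\hat J$. *)

theory Defs
  imports
    "HOL-Analysis.Abstract_Euclidean_Space"
    "HOL-Algebra.Algebraic_Closure_Type"
    "HOL-Algebra.Ideal_Product"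
    "HOL-Algebra.Module"
begin

text \<open>Frees the letter \<open>X\<close> for cosimplicial objects.\<close>

no_notation var (\<open>X\<index>\<close>)

section \<open>Categories and functors\<close>

text \<open>
  Morphisms are compared with equality, so all hom sets below consist of functions that are
  \<^const>\<open>extensional\<close> on the carrier of their source; this is why composition takes the source
  object as an argument.
\<close>

record ('o, 'm) category =
  Ob :: "'o set"
  Hom :: "'o \<Rightarrow> 'o \<Rightarrow> 'm set"
  Ident :: "'o \<Rightarrow> 'm"
  Comp :: "'o \<Rightarrow> 'm \<Rightarrow> 'm \<Rightarrow> 'm"

definition is_functor ::
    "('o, 'm) category \<Rightarrow> ('p, 'n) category \<Rightarrow> ('o \<Rightarrow> 'p) \<Rightarrow> ('o \<Rightarrow> 'o \<Rightarrow> 'm \<Rightarrow> 'n) \<Rightarrow> bool"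
  where "is_functor C D F Fm \<longleftrightarrow>
    (\<forall>X\<in>Ob C. F X \<in> Ob D) \<and>
    (\<forall>X\<in>Ob C. \<forall>Y\<in>Ob C. \<forall>f\<in>Hom C X Y. Fm X Y f \<in> Hom D (F X) (F Y)) \<and>
    (\<forall>X\<in>Ob C. Fm X X (Ident C X) = Ident D (F X)) \<and>
    (\<forall>X\<in>Ob C. \<forall>Y\<in>Ob C. \<forall>Z\<in>Ob C. \<forall>f\<in>Hom C X Y. \<forall>g\<in>Hom C Y Z.
       Fm X Z (Comp C X g f) = Comp D (F X) (Fm Y Z g) (Fm X Y f))"

definition fully_faithful ::
    "('o, 'm) category \<Rightarrow> ('p, 'n) category \<Rightarrow> ('o \<Rightarrow> 'p) \<Rightarrow> ('o \<Rightarrow> 'o \<Rightarrow> 'm \<Rightarrow> 'n) \<Rightarrow> bool"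
  where "fully_faithful C D F Fm \<longleftrightarrow>
    (\<forall>X\<in>Ob C. \<forall>Y\<in>Ob C. bij_betw (Fm X Y) (Hom C X Y) (Hom D (F X) (F Y)))"


section \<open>Algebras and cosimplicial algebras\<close>

text \<open>The library's \<^locale>\<open>algebra\<close> is commutative.\<close>

definition assoc_algebra :: "'k ring \<Rightarrow> ('k, 'a) module \<Rightarrow> bool"
  where "assoc_algebra k A \<longleftrightarrow>
    Module.module k A \<and> ring A \<and>
    (\<forall>a\<in>carrier k. \<forall>x\<in>carrier A. \<forall>y\<in>carrier A.
       (a \<odot>\<^bsub>A\<^esub> x) \<otimes>\<^bsub>A\<^esub> y = a \<odot>\<^bsub>A\<^esub> (x \<otimes>\<^bsub>A\<^esub> y) \<and>
       x \<otimes>\<^bsub>A\<^esub> (a \<odot>\<^bsub>A\<^esub> y) = a \<odot>\<^bsub>A\<^esub> (x \<otimes>\<^bsub>A\<^esub> y))"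

definition alg_hom :: "'k ring \<Rightarrow> ('k, 'a) module \<Rightarrow> ('k, 'b) module \<Rightarrow> ('a \<Rightarrow> 'b) set"
  where "alg_hom k A B =
    {h \<in> ring_hom A B. \<forall>a\<in>carrier k. \<forall>x\<in>carrier A. h (a \<odot>\<^bsub>A\<^esub> x) = a \<odot>\<^bsub>B\<^esub> h x}"

text \<open>
  \<open>cs_coface X n i\<close> is \<open>d\<^sup>i : X\<^sup>n \<rightarrow> X\<^sup>n\<^sup>+\<^sup>1\<close> for \<open>i \<le> n + 1\<close>, and
  \<open>cs_codegen X n j\<close> is \<open>s\<^sup>j : X\<^sup>n\<^sup>+\<^sup>1 \<rightarrow> X\<^sup>n\<close> for \<open>j \<le> n\<close>.
\<close>

record ('k, 'a) cosimplicial =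
  cs_obj :: "nat \<Rightarrow> ('k, 'a) module"
  cs_coface :: "nat \<Rightarrow> nat \<Rightarrow> 'a \<Rightarrow> 'a"
  cs_codegen :: "nat \<Rightarrow> nat \<Rightarrow> 'a \<Rightarrow> 'a"

locale cosimplicial_algebra =
  fixes k :: "'k ring" and X :: "('k, 'a) cosimplicial"
  assumes obj_algebra: "assoc_algebra k (cs_obj X n)"
    and coface_hom: "i \<le> Suc n \<Longrightarrow> cs_coface X n i \<in> alg_hom k (cs_obj X n) (cs_obj X (Suc n))"
    and codegen_hom: "j \<le> n \<Longrightarrow> cs_codegen X n j \<in> alg_hom k (cs_obj X (Suc n)) (cs_obj X n)"
    and coface_coface:
      "\<lbrakk> i < j; j \<le> Suc (Suc n); x \<in> carrier (cs_obj X n) \<rbrakk> \<Longrightarrow>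
        cs_coface X (Suc n) j (cs_coface X n i x) = cs_coface X (Suc n) i (cs_coface X n (j - 1) x)"
    and codegen_codegen:
      "\<lbrakk> i \<le> j; j \<le> n; x \<in> carrier (cs_obj X (Suc (Suc n))) \<rbrakk> \<Longrightarrow>
        cs_codegen X n j (cs_codegen X (Suc n) i x) = cs_codegen X n i (cs_codegen X (Suc n) (Suc j) x)"
    and codegen_coface_less:
      "\<lbrakk> i < j; j \<le> Suc n; x \<in> carrier (cs_obj X (Suc n)) \<rbrakk> \<Longrightarrow>
        cs_codegen X (Suc n) j (cs_coface X (Suc n) i x) = cs_coface X n i (cs_codegen X n (j - 1) x)"
    and codegen_coface_id:
      "\<lbrakk> j \<le> n; i = j \<or> i = Suc j; x \<in> carrier (cs_obj X n) \<rbrakk> \<Longrightarrow>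
        cs_codegen X n j (cs_coface X n i x) = x"
    and codegen_coface_greater:
      "\<lbrakk> Suc j < i; i \<le> Suc (Suc n); x \<in> carrier (cs_obj X (Suc n)) \<rbrakk> \<Longrightarrow>
        cs_codegen X (Suc n) j (cs_coface X (Suc n) i x) = cs_coface X n (i - 1) (cs_codegen X n j x)"

definition cs_commutative :: "('k, 'a) cosimplicial \<Rightarrow> bool"
  where "cs_commutative X \<longleftrightarrow> (\<forall>n. cring (cs_obj X n))"

definition cs_hom ::
    "'k ring \<Rightarrow> ('k, 'a) cosimplicial \<Rightarrow> ('k, 'b) cosimplicial \<Rightarrow> (nat \<Rightarrow> 'a \<Rightarrow> 'b) set"
  where "cs_hom k X X' = {f.
    (\<forall>n. f n \<in> alg_hom k (cs_obj X n) (cs_obj X' n) \<and> f n \<in> extensional (carrier (cs_obj X n))) \<and>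
    (\<forall>n. \<forall>i\<le>Suc n. \<forall>x\<in>carrier (cs_obj X n).
       f (Suc n) (cs_coface X n i x) = cs_coface X' n i (f n x)) \<and>
    (\<forall>n. \<forall>j\<le>n. \<forall>x\<in>carrier (cs_obj X (Suc n)).
       f n (cs_codegen X n j x) = cs_codegen X' n j (f (Suc n) x))}"

definition cs_id :: "('k, 'a) cosimplicial \<Rightarrow> nat \<Rightarrow> 'a \<Rightarrow> 'a"
  where "cs_id X = (\<lambda>n. \<lambda>x\<in>carrier (cs_obj X n). x)"

definition cs_comp ::
    "('k, 'a) cosimplicial \<Rightarrow> (nat \<Rightarrow> 'b \<Rightarrow> 'c) \<Rightarrow> (nat \<Rightarrow> 'a \<Rightarrow> 'b) \<Rightarrow> nat \<Rightarrow> 'a \<Rightarrow> 'c"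
  where "cs_comp X g f = (\<lambda>n. compose (carrier (cs_obj X n)) (g n) (f n))"

definition cAlg :: "'k ring \<Rightarrow> (('k, 'a) cosimplicial, nat \<Rightarrow> 'a \<Rightarrow> 'a) category"
  where "cAlg k =
    \<lparr> Ob = {X. cosimplicial_algebra k X}, Hom = cs_hom k, Ident = cs_id, Comp = cs_comp \<rparr>"


section \<open>Differential graded algebras\<close>

text \<open>
  The graded pieces \<open>dg_gr Y n\<close> are modules; as usual for \<^locale>\<open>Module.module\<close>, the fields
  \<^const>\<open>monoid.mult\<close> and \<^const>\<open>monoid.one\<close> of that record carry no meaning for them.
  The product \<open>Y\<^sup>p \<times> Y\<^sup>q \<rightarrow> Y\<^sup>p\<^sup>+\<^sup>q\<close> is \<open>dg_mult Y p q\<close>.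
\<close>

record ('k, 'a) dga =
  dg_gr :: "nat \<Rightarrow> ('k, 'a) module"
  dg_mult :: "nat \<Rightarrow> nat \<Rightarrow> 'a \<Rightarrow> 'a \<Rightarrow> 'a"
  dg_one :: 'a
  dg_diff :: "nat \<Rightarrow> 'a \<Rightarrow> 'a"

text \<open>\<open>signed M m x\<close> is \<open>(-1)\<^sup>m x\<close>.\<close>

definition signed :: "('k, 'a) module \<Rightarrow> nat \<Rightarrow> 'a \<Rightarrow> 'a"
  where "signed M m x = (if even m then x else \<ominus>\<^bsub>M\<^esub> x)"

locale dg_algebra =
  fixes k :: "'k ring" and Y :: "('k, 'a) dga"
  assumes gr_module: "Module.module k (dg_gr Y n)"
    and one_closed: "dg_one Y \<in> carrier (dg_gr Y 0)"
    and mult_closed: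
      "\<lbrakk> x \<in> carrier (dg_gr Y p); y \<in> carrier (dg_gr Y q) \<rbrakk> \<Longrightarrow>
        dg_mult Y p q x y \<in> carrier (dg_gr Y (p + q))"
    and mult_add_left:
      "\<lbrakk> x \<in> carrier (dg_gr Y p); x' \<in> carrier (dg_gr Y p); y \<in> carrier (dg_gr Y q) \<rbrakk> \<Longrightarrow>
        dg_mult Y p q (x \<oplus>\<^bsub>dg_gr Y p\<^esub> x') y =
          dg_mult Y p q x y \<oplus>\<^bsub>dg_gr Y (p + q)\<^esub> dg_mult Y p q x' y"
    and mult_add_right:
      "\<lbrakk> x \<in> carrier (dg_gr Y p); y \<in> carrier (dg_gr Y q); y' \<in> carrier (dg_gr Y q) \<rbrakk> \<Longrightarrow>
        dg_mult Y p q x (y \<oplus>\<^bsub>dg_gr Y q\<^esub> y') =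
          dg_mult Y p q x y \<oplus>\<^bsub>dg_gr Y (p + q)\<^esub> dg_mult Y p q x y'"
    and mult_smult_left:
      "\<lbrakk> a \<in> carrier k; x \<in> carrier (dg_gr Y p); y \<in> carrier (dg_gr Y q) \<rbrakk> \<Longrightarrow>
        dg_mult Y p q (a \<odot>\<^bsub>dg_gr Y p\<^esub> x) y = a \<odot>\<^bsub>dg_gr Y (p + q)\<^esub> dg_mult Y p q x y"
    and mult_smult_right:
      "\<lbrakk> a \<in> carrier k; x \<in> carrier (dg_gr Y p); y \<in> carrier (dg_gr Y q) \<rbrakk> \<Longrightarrow>
        dg_mult Y p q x (a \<odot>\<^bsub>dg_gr Y q\<^esub> y) = a \<odot>\<^bsub>dg_gr Y (p + q)\<^esub> dg_mult Y p q x y"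
    and mult_assoc:
      "\<lbrakk> x \<in> carrier (dg_gr Y p); y \<in> carrier (dg_gr Y q); z \<in> carrier (dg_gr Y r) \<rbrakk> \<Longrightarrow>
        dg_mult Y (p + q) r (dg_mult Y p q x y) z = dg_mult Y p (q + r) x (dg_mult Y q r y z)"
    and one_left: "x \<in> carrier (dg_gr Y p) \<Longrightarrow> dg_mult Y 0 p (dg_one Y) x = x"
    and one_right: "x \<in> carrier (dg_gr Y p) \<Longrightarrow> dg_mult Y p 0 x (dg_one Y) = x"
    and diff_closed: "x \<in> carrier (dg_gr Y p) \<Longrightarrow> dg_diff Y p x \<in> carrier (dg_gr Y (Suc p))"
    and diff_add:
      "\<lbrakk> x \<in> carrier (dg_gr Y p); x' \<in> carrier (dg_gr Y p) \<rbrakk> \<Longrightarrow>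
        dg_diff Y p (x \<oplus>\<^bsub>dg_gr Y p\<^esub> x') = dg_diff Y p x \<oplus>\<^bsub>dg_gr Y (Suc p)\<^esub> dg_diff Y p x'"
    and diff_smult:
      "\<lbrakk> a \<in> carrier k; x \<in> carrier (dg_gr Y p) \<rbrakk> \<Longrightarrow>
        dg_diff Y p (a \<odot>\<^bsub>dg_gr Y p\<^esub> x) = a \<odot>\<^bsub>dg_gr Y (Suc p)\<^esub> dg_diff Y p x"
    and diff_diff:
      "x \<in> carrier (dg_gr Y p) \<Longrightarrow> dg_diff Y (Suc p) (dg_diff Y p x) = \<zero>\<^bsub>dg_gr Y (Suc (Suc p))\<^esub>"
    and leibniz:
      "\<lbrakk> x \<in> carrier (dg_gr Y p); y \<in> carrier (dg_gr Y q) \<rbrakk> \<Longrightarrow>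
        dg_diff Y (p + q) (dg_mult Y p q x y) =
          dg_mult Y (Suc p) q (dg_diff Y p x) y \<oplus>\<^bsub>dg_gr Y (Suc (p + q))\<^esub>
          signed (dg_gr Y (Suc (p + q))) p (dg_mult Y p (Suc q) x (dg_diff Y q y))"

definition graded_commutative :: "('k, 'a) dga \<Rightarrow> bool"
  where "graded_commutative Y \<longleftrightarrow>
    (\<forall>p q. \<forall>x\<in>carrier (dg_gr Y p). \<forall>y\<in>carrier (dg_gr Y q).
       dg_mult Y p q x y = signed (dg_gr Y (p + q)) (p * q) (dg_mult Y q p y x))"

definition dg_hom :: "'k ring \<Rightarrow> ('k, 'a) dga \<Rightarrow> ('k, 'b) dga \<Rightarrow> (nat \<Rightarrow> 'a \<Rightarrow> 'b) set"
  where "dg_hom k Y Z = {\<phi>.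
    (\<forall>n. \<phi> n \<in> carrier (dg_gr Y n) \<rightarrow>\<^sub>E carrier (dg_gr Z n)) \<and>
    (\<forall>n. \<forall>x\<in>carrier (dg_gr Y n). \<forall>y\<in>carrier (dg_gr Y n).
       \<phi> n (x \<oplus>\<^bsub>dg_gr Y n\<^esub> y) = \<phi> n x \<oplus>\<^bsub>dg_gr Z n\<^esub> \<phi> n y) \<and>
    (\<forall>n. \<forall>a\<in>carrier k. \<forall>x\<in>carrier (dg_gr Y n).
       \<phi> n (a \<odot>\<^bsub>dg_gr Y n\<^esub> x) = a \<odot>\<^bsub>dg_gr Z n\<^esub> \<phi> n x) \<and>
    (\<forall>p q. \<forall>x\<in>carrier (dg_gr Y p). \<forall>y\<in>carrier (dg_gr Y q).
       \<phi> (p + q) (dg_mult Y p q x y) = dg_mult Z p q (\<phi> p x) (\<phi> q y)) \<and>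
    \<phi> 0 (dg_one Y) = dg_one Z \<and>
    (\<forall>n. \<forall>x\<in>carrier (dg_gr Y n). \<phi> (Suc n) (dg_diff Y n x) = dg_diff Z n (\<phi> n x))}"

definition dg_id :: "('k, 'a) dga \<Rightarrow> nat \<Rightarrow> 'a \<Rightarrow> 'a"
  where "dg_id Y = (\<lambda>n. \<lambda>x\<in>carrier (dg_gr Y n). x)"

definition dg_comp ::
    "('k, 'a) dga \<Rightarrow> (nat \<Rightarrow> 'b \<Rightarrow> 'c) \<Rightarrow> (nat \<Rightarrow> 'a \<Rightarrow> 'b) \<Rightarrow> nat \<Rightarrow> 'a \<Rightarrow> 'c"
  where "dg_comp Y g f = (\<lambda>n. compose (carrier (dg_gr Y n)) (g n) (f n))"

definition dgAlg :: "'k ring \<Rightarrow> (('k, 'a) dga, nat \<Rightarrow> 'a \<Rightarrow> 'a) category"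
  where "dgAlg k =
    \<lparr> Ob = {Y. dg_algebra k Y}, Hom = dg_hom k, Ident = dg_id, Comp = dg_comp \<rparr>"

definition dg_isomorphic :: "'k ring \<Rightarrow> ('k, 'a) dga \<Rightarrow> ('k, 'b) dga \<Rightarrow> bool"
  where "dg_isomorphic k Y Z \<longleftrightarrow>
    dg_algebra k Y \<and> dg_algebra k Z \<and>
    (\<exists>\<phi>\<in>dg_hom k Y Z. \<forall>n. bij_betw (\<phi> n) (carrier (dg_gr Y n)) (carrier (dg_gr Z n)))"


section \<open>Differential ideals and quotients\<close>

text \<open>
  Ideals are two-sided and homogeneous. They are automatically closed under scalars, since \<open>Y\<close> is
  unital.
\<close>

definition dg_ideal :: "('k, 'a) dga \<Rightarrow> (nat \<Rightarrow> 'a set) \<Rightarrow> bool"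
  where "dg_ideal Y A \<longleftrightarrow>
    (\<forall>n. additive_subgroup (A n) (dg_gr Y n)) \<and>
    (\<forall>p q. \<forall>x\<in>A p. \<forall>y\<in>carrier (dg_gr Y q). dg_mult Y p q x y \<in> A (p + q)) \<and>
    (\<forall>p q. \<forall>x\<in>carrier (dg_gr Y p). \<forall>y\<in>A q. dg_mult Y p q x y \<in> A (p + q)) \<and>
    (\<forall>n. \<forall>x\<in>A n. dg_diff Y n x \<in> A (Suc n))"

definition dg_genideal :: "('k, 'a) dga \<Rightarrow> (nat \<Rightarrow> 'a set) \<Rightarrow> nat \<Rightarrow> 'a set"
  where "dg_genideal Y S n = \<Inter> {A n | A. dg_ideal Y A \<and> (\<forall>m. S m \<subseteq> A m)}"

text \<open>Operations on cosets, in the style of \<^const>\<open>rcoset_mult\<close>.\<close>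

definition module_quot :: "('k, 'a) module \<Rightarrow> 'a set \<Rightarrow> ('k, 'a set) module"
  where "module_quot M A =
    \<lparr> carrier = a_rcosets\<^bsub>M\<^esub> A, monoid.mult = undefined, one = undefined, ring.zero = A, add = set_add M,
      module.smult = (\<lambda>a S. \<Union>x\<in>S. A +>\<^bsub>M\<^esub> (a \<odot>\<^bsub>M\<^esub> x)) \<rparr>"

definition dg_quot :: "('k, 'a) dga \<Rightarrow> (nat \<Rightarrow> 'a set) \<Rightarrow> ('k, 'a set) dga"
  where "dg_quot Y A =
    \<lparr> dg_gr = (\<lambda>n. module_quot (dg_gr Y n) (A n)),
      dg_mult = (\<lambda>p q S T. \<Union>x\<in>S. \<Union>y\<in>T. A (p + q) +>\<^bsub>dg_gr Y (p + q)\<^esub> dg_mult Y p q x y),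
      dg_one = A 0 +>\<^bsub>dg_gr Y 0\<^esub> dg_one Y,
      dg_diff = (\<lambda>n S. \<Union>x\<in>S. A (Suc n) +>\<^bsub>dg_gr Y (Suc n)\<^esub> dg_diff Y n x) \<rparr>"


section \<open>Normalization and abstract differentiation\<close>

text \<open>\<open>I\<^sub>n\<^sub>,\<^sub>j = ker (s\<^sup>j\<^sup>-\<^sup>1 : X\<^sup>n \<rightarrow> X\<^sup>n\<^sup>-\<^sup>1)\<close>, for \<open>1 \<le> j \<le> n\<close>.\<close>

definition codegen_ker :: "('k, 'a) cosimplicial \<Rightarrow> nat \<Rightarrow> nat \<Rightarrow> 'a set"
  where "codegen_ker X n j =
    a_kernel (cs_obj X n) (cs_obj X (n - 1)) (cs_codegen X (n - 1) (j - 1))"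

definition normalized :: "('k, 'a) cosimplicial \<Rightarrow> nat \<Rightarrow> 'a set"
  where "normalized X n = {x \<in> carrier (cs_obj X n). \<forall>j\<in>{1..n}. x \<in> codegen_ker X n j}"

text \<open>\<open>coface_iter X n i q\<close> is \<open>(d\<^sup>i)\<^sup>q : X\<^sup>n \<rightarrow> X\<^sup>n\<^sup>+\<^sup>q\<close>.\<close>

primrec coface_iter :: "('k, 'a) cosimplicial \<Rightarrow> nat \<Rightarrow> nat \<Rightarrow> nat \<Rightarrow> 'a \<Rightarrow> 'a"
  where
    "coface_iter X n i 0 x = x"
  | "coface_iter X n i (Suc q) x = cs_coface X (n + q) i (coface_iter X n i q x)"

definition cup :: "('k, 'a) cosimplicial \<Rightarrow> nat \<Rightarrow> nat \<Rightarrow> 'a \<Rightarrow> 'a \<Rightarrow> 'a"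
  where "cup X p q f g =
    coface_iter X p (Suc p) q f \<otimes>\<^bsub>cs_obj X (p + q)\<^esub> coface_iter X q 0 p g"

definition alt_diff :: "('k, 'a) cosimplicial \<Rightarrow> nat \<Rightarrow> 'a \<Rightarrow> 'a"
  where "alt_diff X n x =
    (\<Oplus>\<^bsub>cs_obj X (Suc n)\<^esub>i\<in>{0..Suc n}. signed (cs_obj X (Suc n)) i (cs_coface X n i x))"

definition normalization :: "('k, 'a) cosimplicial \<Rightarrow> ('k, 'a) dga"
  where "normalization X =
    \<lparr> dg_gr = (\<lambda>n. (cs_obj X n)\<lparr>carrier := normalized X n\<rparr>),
      dg_mult = cup X,
      dg_one = \<one>\<^bsub>cs_obj X 0\<^esub>,
      dg_diff = alt_diff X \<rparr>"

text \<open>\<open>J\<^sub>X\<^sup>n = \<Sum>\<^sub>j (I\<^sub>n\<^sub>,\<^sub>j\<^sup>2 \<inter> X\<^sub>N\<^sup>n)\<close>, a sum of subgroups indexed by \<open>j = 1, \<dots>, n\<close>.\<close>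

definition differentiating :: "('k, 'a) cosimplicial \<Rightarrow> nat \<Rightarrow> 'a set"
  where "differentiating X n =
    {finsum (cs_obj X n) x {1..n} | x. x \<in> (\<Pi> j\<in>{1..n}.
       ideal_prod (cs_obj X n) (codegen_ker X n j) (codegen_ker X n j) \<inter> normalized X n)}"

definition differentiating_ideal :: "('k, 'a) cosimplicial \<Rightarrow> nat \<Rightarrow> 'a set"
  where "differentiating_ideal X = dg_genideal (normalization X) (differentiating X)"

definition abs_diff :: "('k, 'a) cosimplicial \<Rightarrow> ('k, 'a set) dga"
  where "abs_diff X = dg_quot (normalization X) (differentiating_ideal X)"

definition abs_diff_map ::
    "('k, 'a) cosimplicial \<Rightarrow> ('k, 'b) cosimplicial \<Rightarrow> (nat \<Rightarrow> 'a \<Rightarrow> 'b) \<Rightarrow> nat \<Rightarrow> 'a set \<Rightarrow> 'b set"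
  where "abs_diff_map X X' f = (\<lambda>n. \<lambda>S\<in>carrier (dg_gr (abs_diff X) n).
    \<Union>x\<in>S. differentiating_ideal X' n +>\<^bsub>dg_gr (normalization X') n\<^esub> f n x)"


section \<open>Denormalization\<close>

text \<open>
  An element \<open>\<Sum>\<^sub>\<alpha> c\<^sub>\<alpha> \<otimes> e\<^sup>n\<^sub>\<alpha>\<close> of \<open>\<Oplus>\<^sub>k Y\<^sup>k \<otimes> \<Lambda>\<^sup>k(\<int>\<^sup>n)\<close>, with \<open>\<alpha>\<close> ranging over the subsets of
  \<open>{1..n}\<close>, is represented by the family of its coefficients \<open>c\<^sub>\<alpha> \<in> Y\<^bsup>|\<alpha>|\<^esup>\<close>. The structure maps are given
  on the generators \<open>f \<otimes> e\<^sup>n\<^sub>\<alpha>\<close> and extended additively.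
\<close>

definition denorm_mod :: "('k, 'a) dga \<Rightarrow> nat \<Rightarrow> ('k, nat set \<Rightarrow> 'a) module"
  where "denorm_mod Y n =
    \<lparr> carrier = (\<Pi>\<^sub>E \<alpha>\<in>Pow {1..n}. carrier (dg_gr Y (card \<alpha>))),
      monoid.mult = undefined, one = undefined,
      ring.zero = (\<lambda>\<alpha>\<in>Pow {1..n}. \<zero>\<^bsub>dg_gr Y (card \<alpha>)\<^esub>),
      add = (\<lambda>c c'. \<lambda>\<alpha>\<in>Pow {1..n}. c \<alpha> \<oplus>\<^bsub>dg_gr Y (card \<alpha>)\<^esub> c' \<alpha>),
      module.smult = (\<lambda>a c. \<lambda>\<alpha>\<in>Pow {1..n}. a \<odot>\<^bsub>dg_gr Y (card \<alpha>)\<^esub> c \<alpha>) \<rparr>"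

text \<open>\<open>tens Y n \<alpha> f\<close> is \<open>f \<otimes> e\<^sup>n\<^sub>\<alpha>\<close>.\<close>

definition tens :: "('k, 'a) dga \<Rightarrow> nat \<Rightarrow> nat set \<Rightarrow> 'a \<Rightarrow> nat set \<Rightarrow> 'a"
  where "tens Y n \<alpha> f = (\<lambda>\<beta>\<in>Pow {1..n}. if \<beta> = \<alpha> then f else \<zero>\<^bsub>dg_gr Y (card \<beta>)\<^esub>)"

text \<open>
  \<open>tens_wedge Y n \<alpha> \<beta> f\<close> is \<open>f \<otimes> (e\<^sup>n\<^sub>\<alpha> \<and> e\<^sup>n\<^sub>\<beta>)\<close>: the wedge vanishes if \<open>\<alpha>\<close> and \<open>\<beta>\<close> meet, and otherwise
  it is \<open>e\<^sup>n\<^bsub>\<alpha> \<union> \<beta>\<^esub>\<close> up to the sign of the shuffle that sorts \<open>\<alpha>\<close> followed by \<open>\<beta>\<close>.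
\<close>

definition tens_wedge :: "('k, 'a) dga \<Rightarrow> nat \<Rightarrow> nat set \<Rightarrow> nat set \<Rightarrow> 'a \<Rightarrow> nat set \<Rightarrow> 'a"
  where "tens_wedge Y n \<alpha> \<beta> f =
    (if \<alpha> \<inter> \<beta> = {}
     then signed (denorm_mod Y n) (card {(a, b). a \<in> \<alpha> \<and> b \<in> \<beta> \<and> b < a}) (tens Y n (\<alpha> \<union> \<beta>) f)
     else \<zero>\<^bsub>denorm_mod Y n\<^esub>)"

definition delta :: "nat \<Rightarrow> nat \<Rightarrow> nat"
  where "delta i a = (if a < i then a else Suc a)"

definition sigma :: "nat \<Rightarrow> nat \<Rightarrow> nat"
  where "sigma j a = (if a \<le> j then a else a - 1)"

text \<open>\<open>d\<^sup>i(f \<otimes> e\<^sup>n\<^sub>\<alpha>)\<close> and \<open>s\<^sup>j(f \<otimes> e\<^bsup>n+1\<^esup>\<^sub>\<alpha>)\<close>, for \<open>f\<close> of degree \<open>|\<alpha>|\<close>.\<close>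

definition denorm_coface_gen ::
    "('k, 'a) dga \<Rightarrow> nat \<Rightarrow> nat \<Rightarrow> nat set \<Rightarrow> 'a \<Rightarrow> nat set \<Rightarrow> 'a"
  where "denorm_coface_gen Y n i \<alpha> f =
    (if i = 0 then
       tens Y (Suc n) (delta 1 ` \<alpha>) f \<oplus>\<^bsub>denorm_mod Y (Suc n)\<^esub>
       tens_wedge Y (Suc n) {1} (delta 1 ` \<alpha>) (dg_diff Y (card \<alpha>) f)
     else if i \<notin> \<alpha> then tens Y (Suc n) (delta i ` \<alpha>) f
     else tens Y (Suc n) (delta i ` \<alpha>) f \<oplus>\<^bsub>denorm_mod Y (Suc n)\<^esub>
       tens Y (Suc n) (delta (Suc i) ` \<alpha>) f)"

definition denorm_codegen_gen ::
    "('k, 'a) dga \<Rightarrow> nat \<Rightarrow> nat \<Rightarrow> nat set \<Rightarrow> 'a \<Rightarrow> nat set \<Rightarrow> 'a"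
  where "denorm_codegen_gen Y n j \<alpha> f =
    (if Suc j \<notin> \<alpha> then tens Y n (sigma j ` \<alpha>) f else \<zero>\<^bsub>denorm_mod Y n\<^esub>)"

definition denorm_mult ::
    "('k, 'a) dga \<Rightarrow> nat \<Rightarrow> (nat set \<Rightarrow> 'a) \<Rightarrow> (nat set \<Rightarrow> 'a) \<Rightarrow> nat set \<Rightarrow> 'a"
  where "denorm_mult Y n c c' =
    (\<Oplus>\<^bsub>denorm_mod Y n\<^esub>\<alpha>\<in>Pow {1..n}. \<Oplus>\<^bsub>denorm_mod Y n\<^esub>\<beta>\<in>Pow {1..n}.
       tens_wedge Y n \<alpha> \<beta> (dg_mult Y (card \<alpha>) (card \<beta>) (c \<alpha>) (c' \<beta>)))"

definition denorm :: "('k, 'a) dga \<Rightarrow> ('k, nat set \<Rightarrow> 'a) cosimplicial"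
  where "denorm Y =
    \<lparr> cs_obj = (\<lambda>n. (denorm_mod Y n)
        \<lparr>monoid.mult := denorm_mult Y n, one := tens Y n {} (dg_one Y)\<rparr>),
      cs_coface = (\<lambda>n i c. \<Oplus>\<^bsub>denorm_mod Y (Suc n)\<^esub>\<alpha>\<in>Pow {1..n}. denorm_coface_gen Y n i \<alpha> (c \<alpha>)),
      cs_codegen = (\<lambda>n j c. \<Oplus>\<^bsub>denorm_mod Y n\<^esub>\<alpha>\<in>Pow {1..Suc n}. denorm_codegen_gen Y n j \<alpha> (c \<alpha>)) \<rparr>"

definition denorm_map ::
    "('k, 'a) dga \<Rightarrow> ('k, 'b) dga \<Rightarrow> (nat \<Rightarrow> 'a \<Rightarrow> 'b) \<Rightarrow>
      nat \<Rightarrow> (nat set \<Rightarrow> 'a) \<Rightarrow> nat set \<Rightarrow> 'b"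
  where "denorm_map Y Z \<phi> = (\<lambda>n. \<lambda>c\<in>carrier (cs_obj (denorm Y) n).
    \<lambda>\<alpha>\<in>Pow {1..n}. \<phi> (card \<alpha>) (c \<alpha>))"


section \<open>Smooth manifolds\<close>

text \<open>
  Functions of class \<open>C\<^sup>r\<close> on an open subset \<open>U\<close> of \<open>\<real>\<^sup>d\<close>, where \<open>\<real>\<^sup>d\<close> is \<^const>\<open>Euclidean_space\<close>: all
  iterated partial derivatives up to order \<open>r\<close> exist and are continuous.
\<close>

primrec Cr_on :: "nat \<Rightarrow> nat \<Rightarrow> (nat \<Rightarrow> real) set \<Rightarrow> ((nat \<Rightarrow> real) \<Rightarrow> real) \<Rightarrow> bool"
  where
    "Cr_on d 0 U f \<longleftrightarrow> continuous_map (subtopology (Euclidean_space d) U) euclideanreal f"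
  | "Cr_on d (Suc r) U f \<longleftrightarrow>
      continuous_map (subtopology (Euclidean_space d) U) euclideanreal f \<and>
      (\<forall>i<d. \<exists>g. (\<forall>x\<in>U. ((\<lambda>t. f (x(i := t))) has_real_derivative g x) (at (x i))) \<and> Cr_on d r U g)"

definition smooth_on :: "nat \<Rightarrow> (nat \<Rightarrow> real) set \<Rightarrow> ((nat \<Rightarrow> real) \<Rightarrow> real) \<Rightarrow> bool"
  where "smooth_on d U f \<longleftrightarrow> (\<forall>r. Cr_on d r U f)"

text \<open>
  A chart \<open>(d, U, \<phi>)\<close> is a homeomorphism \<open>\<phi>\<close> from the open set \<open>U\<close> onto an open subset of \<open>\<real>\<^sup>d\<close>. The
  dimension is recorded with the chart, so components of different dimension are permitted.
\<close>

record 'p manifold =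
  mf_top :: "'p topology"
  mf_atlas :: "(nat \<times> 'p set \<times> ('p \<Rightarrow> nat \<Rightarrow> real)) set"

locale smooth_manifold =
  fixes M :: "'p manifold"
  assumes hausdorff: "Hausdorff_space (mf_top M)"
    and second_countable:
      "\<exists>\<B>. countable \<B> \<and> (\<forall>B\<in>\<B>. openin (mf_top M) B) \<and>
        (\<forall>W x. openin (mf_top M) W \<and> x \<in> W \<longrightarrow> (\<exists>B\<in>\<B>. x \<in> B \<and> B \<subseteq> W))"
    and charts:
      "(d, U, \<phi>) \<in> mf_atlas M \<Longrightarrow>
        openin (mf_top M) U \<and> openin (Euclidean_space d) (\<phi> ` U) \<and>
        homeomorphic_map (subtopology (mf_top M) U) (subtopology (Euclidean_space d) (\<phi> ` U)) \<phi>"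
    and covering: "(\<Union>(d, U, \<phi>)\<in>mf_atlas M. U) = topspace (mf_top M)"
    and transition:
      "\<lbrakk> (d, U, \<phi>) \<in> mf_atlas M; (e, V, \<psi>) \<in> mf_atlas M; i < e \<rbrakk> \<Longrightarrow>
        smooth_on d (\<phi> ` (U \<inter> V)) (\<lambda>x. \<psi> (inv_into U \<phi> x) i)"

definition smooth_map :: "'p manifold \<Rightarrow> 'q manifold \<Rightarrow> ('p \<Rightarrow> 'q) \<Rightarrow> bool"
  where "smooth_map M N F \<longleftrightarrow>
    continuous_map (mf_top M) (mf_top N) F \<and>
    (\<forall>(d, U, \<phi>)\<in>mf_atlas M. \<forall>(e, V, \<psi>)\<in>mf_atlas N. \<forall>i<e.
       smooth_on d (\<phi> ` {p \<in> U. F p \<in> V}) (\<lambda>x. \<psi> (F (inv_into U \<phi> x)) i))"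

definition smooth_functions :: "'p manifold \<Rightarrow> ('p \<Rightarrow> real) set"
  where "smooth_functions M = {f \<in> extensional (topspace (mf_top M)).
    \<forall>(d, U, \<phi>)\<in>mf_atlas M. smooth_on d (\<phi> ` U) (\<lambda>x. f (inv_into U \<phi> x))}"

definition smooth_algebra :: "'p manifold \<Rightarrow> (real, 'p \<Rightarrow> real) module"
  where "smooth_algebra M =
    \<lparr> carrier = smooth_functions M,
      monoid.mult = (\<lambda>f g. \<lambda>p\<in>topspace (mf_top M). f p * g p),
      one = (\<lambda>p\<in>topspace (mf_top M). 1),
      ring.zero = (\<lambda>p\<in>topspace (mf_top M). 0),
      add = (\<lambda>f g. \<lambda>p\<in>topspace (mf_top M). f p + g p),
      module.smult = (\<lambda>a f. \<lambda>p\<in>topspace (mf_top M). a * f p) \<rparr>"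


section \<open>Simplicial manifolds and geometric differentiation\<close>

text \<open>
  \<open>sm_face G n i\<close> is \<open>d\<^sub>i : G\<^sub>n\<^sub>+\<^sub>1 \<rightarrow> G\<^sub>n\<close> for \<open>i \<le> n + 1\<close>, and
  \<open>sm_degen G n j\<close> is \<open>s\<^sub>j : G\<^sub>n \<rightarrow> G\<^sub>n\<^sub>+\<^sub>1\<close> for \<open>j \<le> n\<close>.
\<close>

record 'p simplicial =
  sm_obj :: "nat \<Rightarrow> 'p manifold"
  sm_face :: "nat \<Rightarrow> nat \<Rightarrow> 'p \<Rightarrow> 'p"
  sm_degen :: "nat \<Rightarrow> nat \<Rightarrow> 'p \<Rightarrow> 'p"

definition sm_points :: "'p simplicial \<Rightarrow> nat \<Rightarrow> 'p set"
  where "sm_points G n = topspace (mf_top (sm_obj G n))"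

locale simplicial_manifold =
  fixes G :: "'p simplicial"
  assumes obj_manifold: "smooth_manifold (sm_obj G n)"
    and face_smooth: "i \<le> Suc n \<Longrightarrow> smooth_map (sm_obj G (Suc n)) (sm_obj G n) (sm_face G n i)"
    and degen_smooth: "j \<le> n \<Longrightarrow> smooth_map (sm_obj G n) (sm_obj G (Suc n)) (sm_degen G n j)"
    and face_face:
      "\<lbrakk> i < j; j \<le> Suc (Suc n); p \<in> sm_points G (Suc (Suc n)) \<rbrakk> \<Longrightarrow>
        sm_face G n i (sm_face G (Suc n) j p) = sm_face G n (j - 1) (sm_face G (Suc n) i p)"
    and degen_degen:
      "\<lbrakk> i \<le> j; j \<le> n; p \<in> sm_points G n \<rbrakk> \<Longrightarrow>
        sm_degen G (Suc n) i (sm_degen G n j p) = sm_degen G (Suc n) (Suc j) (sm_degen G n i p)"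
    and face_degen_less:
      "\<lbrakk> i < j; j \<le> Suc n; p \<in> sm_points G (Suc n) \<rbrakk> \<Longrightarrow>
        sm_face G (Suc n) i (sm_degen G (Suc n) j p) = sm_degen G n (j - 1) (sm_face G n i p)"
    and face_degen_id:
      "\<lbrakk> j \<le> n; i = j \<or> i = Suc j; p \<in> sm_points G n \<rbrakk> \<Longrightarrow>
        sm_face G n i (sm_degen G n j p) = p"
    and face_degen_greater:
      "\<lbrakk> Suc j < i; i \<le> Suc (Suc n); p \<in> sm_points G (Suc n) \<rbrakk> \<Longrightarrow>
        sm_face G (Suc n) i (sm_degen G (Suc n) j p) = sm_degen G n j (sm_face G n (i - 1) p)"

definition sm_functions :: "'p simplicial \<Rightarrow> (real, 'p \<Rightarrow> real) cosimplicial"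
  where "sm_functions G =
    \<lparr> cs_obj = (\<lambda>n. smooth_algebra (sm_obj G n)),
      cs_coface = (\<lambda>n i f. \<lambda>p\<in>sm_points G (Suc n). f (sm_face G n i p)),
      cs_codegen = (\<lambda>n j f. \<lambda>p\<in>sm_points G n. f (sm_degen G n j p)) \<rparr>"

text \<open>\<open>I(S\<^sub>n\<^sub>,\<^sub>j)\<close> with \<open>S\<^sub>n\<^sub>,\<^sub>j = s\<^sub>j\<^sub>-\<^sub>1(G\<^sub>n\<^sub>-\<^sub>1)\<close>, for \<open>1 \<le> j \<le> n\<close>.\<close>

definition vanishing_ideal :: "'p simplicial \<Rightarrow> nat \<Rightarrow> nat \<Rightarrow> ('p \<Rightarrow> real) set"
  where "vanishing_ideal G n j =
    {f \<in> smooth_functions (sm_obj G n). \<forall>p\<in>sm_degen G (n - 1) (j - 1) ` sm_points G (n - 1). f p = 0}"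

definition sm_normalized :: "'p simplicial \<Rightarrow> nat \<Rightarrow> ('p \<Rightarrow> real) set"
  where "sm_normalized G n =
    {f \<in> smooth_functions (sm_obj G n). \<forall>j\<in>{1..n}. f \<in> vanishing_ideal G n j}"

text \<open>The cup product and \<open>\<delta> = \<Sum>\<^sub>i (-1)\<^sup>i d\<^sub>i\<^sup>*\<close> are those of the cosimplicial algebra of functions.\<close>

definition sm_cochains :: "'p simplicial \<Rightarrow> (real, 'p \<Rightarrow> real) dga"
  where "sm_cochains G =
    \<lparr> dg_gr = (\<lambda>n. (smooth_algebra (sm_obj G n))\<lparr>carrier := sm_normalized G n\<rparr>),
      dg_mult = cup (sm_functions G),
      dg_one = \<one>\<^bsub>smooth_algebra (sm_obj G 0)\<^esub>,
      dg_diff = alt_diff (sm_functions G) \<rparr>"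

definition sm_J :: "'p simplicial \<Rightarrow> nat \<Rightarrow> ('p \<Rightarrow> real) set"
  where "sm_J G n =
    {finsum (smooth_algebra (sm_obj G n)) f {1..n} | f. f \<in> (\<Pi> j\<in>{1..n}.
       sm_normalized G n \<inter>
       ideal_prod (smooth_algebra (sm_obj G n)) (vanishing_ideal G n j) (vanishing_ideal G n j))}"

text \<open>\<open>J + \<delta>(J)\<close> in degree \<open>n\<close>; the empty sum \<open>sm_J G 0\<close> is zero.\<close>

definition sm_Jhat :: "'p simplicial \<Rightarrow> nat \<Rightarrow> ('p \<Rightarrow> real) set"
  where "sm_Jhat G n =
    (case n of 0 \<Rightarrow> sm_J G 0
     | Suc m \<Rightarrow> sm_J G n <+>\<^bsub>smooth_algebra (sm_obj G n)\<^esub> (alt_diff (sm_functions G) m ` sm_J G m))"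

definition CE_algebra :: "'p simplicial \<Rightarrow> (real, ('p \<Rightarrow> real) set) dga"
  where "CE_algebra G = dg_quot (sm_cochains G) (sm_Jhat G)"

end

theory Submission
  imports Defs
begin

text \<open>
  Everything rests on two descriptions that avoid generators. First, the cup product of \<open>X\<^sub>N\<close> maps
  \<open>X\<^sub>N \<times> J\<close> and \<open>J \<times> X\<^sub>N\<close> into \<open>J\<close>, because the front inclusion sends \<open>I\<^sub>p\<^sub>,\<^sub>j\<close> to \<open>I\<^bsub>p+q,j\<^esub>\<close> and the back
  inclusion sends \<open>I\<^sub>q\<^sub>,\<^sub>j\<close> to \<open>I\<^bsub>p+q,p+j\<^esub>\<close>. By the Leibniz rule the differential ideal generated by \<open>J\<close> is
  then \<open>J + \<delta>J\<close> (\<open>differentiating_ideal_explicit\<close>). For functions on a simplicial manifold this is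
  literally the ideal by which the Chevalley-Eilenberg algebra divides, since the kernel of \<open>s\<^sub>j\<^sup>*\<close> is the
  vanishing ideal of the \<open>j\<close>-th degeneracy; so the comparison with the geometric differentiation is an
  equality (\<open>CE_algebra_eq\<close>), once pullback along a smooth map is known to preserve smoothness
  (\<open>pullback_smooth\<close>, by the chain rule).

  Second, an element of \<open>K(Y)\<^sup>n\<close> is a family of coefficients indexed by the subsets of \<open>{1..n}\<close>, and every
  coefficient but the top one is a coefficient of some codegeneracy of that element. Hence an element is
  determined by its top coefficient and its codegeneracies (\<open>K_joint_inj\<close>), and an identity in \<open>K(Y)\<close>
  can be proved by induction on the degree by comparing top coefficients only. This gives that \<open>K(Y)\<close> is a
  cosimplicial algebra (\<open>K_cosimplicial\<close>) whose normalization is \<open>Y\<close>, by the top coefficient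
  (\<open>top_hom\<close>, \<open>top_incl_hom\<close>).

  The adjunction sends \<open>F : X \<rightarrow> K(Y)\<close> to the top coefficients of \<open>F\<close> on \<open>X\<^sub>N\<close>. They vanish on \<open>J\<close>, since
  the top coefficient of a product of two elements of one \<open>I\<^sub>n\<^sub>,\<^sub>j\<close> is zero (\<open>K_J_zero\<close>), and they
  determine \<open>F\<close> (\<open>cs_hom_K_eqI\<close>), because \<open>X\<^sup>n\<close> is spanned by \<open>X\<^sub>N\<^sup>n\<close> and the images of \<open>d\<^sup>1, \<dots>, d\<^sup>n\<close>, on
  which top coefficients vanish. Conversely let \<open>\<psi> : X\<^sub>N \<rightarrow> Y\<close> kill \<open>J\<close>, and extend it by zero on the images
  of \<open>d\<^sup>1, \<dots>, d\<^sup>n\<close> to \<open>\<tau> : X\<^sup>n \<rightarrow> Y\<^sup>n\<close>. Prescribing top coefficients by \<open>\<tau>\<close> and demanding compatibility with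
  codegeneracies defines \<open>F\<close>, and compatibility with cofaces is \<open>\<tau>(d\<^sup>0 x) = d \<tau>(x)\<close>. The hard point is that
  \<open>F\<close> is multiplicative, that is, that the defect \<open>B(x, y)\<close> between \<open>\<tau>(x y)\<close> and the top coefficient of
  \<open>F(x) F(y)\<close> vanishes. The defect is biadditive and is zero if \<open>x\<close> and \<open>y\<close> lie in one \<open>I\<^sub>n\<^sub>,\<^sub>j\<close> (here
  \<open>\<tau>\<close> has to vanish on all of \<open>I\<^sub>n\<^sub>,\<^sub>j\<^sup>2\<close> and not only on its normalized part, \<open>\<tau>_sq\<close>), if both lie in the
  image of one \<open>d\<^sup>j\<close> with \<open>j > 0\<close>, and if \<open>x\<close>, \<open>y\<close> are the front and back images of normalized elements.
  The \<open>shuffle_lemma\<close> shows that these three properties force \<open>B = 0\<close>.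

  With \<open>\<psi>\<close> the projection \<open>X\<^sub>N \<rightarrow> N'(X)\<close> the resulting \<open>F\<close> is the unit of the adjunction. If \<open>X\<close> is commutative,
  comparing the top coefficients of \<open>F(x y)\<close> and \<open>F(y x)\<close> for a front image \<open>x\<close> and a back image \<open>y\<close> yields
  graded commutativity of \<open>N'(X)\<close>. Finally \<open>K\<close> is fully faithful since the normalization of \<open>K(Y)\<close>
  is \<open>Y\<close> and morphisms into \<open>K(Z)\<close> are determined on normalized elements.
\<close>


section \<open>Additive maps and signed sums\<close>

text \<open>
  The predicate form of \<^locale>\<open>abelian_group_hom\<close>: additivity is then passed on by rules to compositions, sums
  and signs.
\<close>

definition additive_map where
  "additive_map M N f \<longleftrightarrow> abelian_group M \<and> abelian_group N \<and> f \<in> carrier M \<rightarrow> carrier N \<and>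
    (\<forall>x\<in>carrier M. \<forall>y\<in>carrier M. f (x \<oplus>\<^bsub>M\<^esub> y) = f x \<oplus>\<^bsub>N\<^esub> f y)"

lemma additive_mapI:
  assumes "abelian_group M" "abelian_group N"
    and "\<And>x. x \<in> carrier M \<Longrightarrow> f x \<in> carrier N"
    and "\<And>x y. x \<in> carrier M \<Longrightarrow> y \<in> carrier M \<Longrightarrow> f (x \<oplus>\<^bsub>M\<^esub> y) = f x \<oplus>\<^bsub>N\<^esub> f y"
  shows "additive_map M N f"
  using assms by (auto simp: additive_map_def)

lemma additive_map_hom:
  assumes "additive_map M N f"
  shows "abelian_group_hom M N f"
proof (rule abelian_group_homI)
  show "group_hom (add_monoid M) (add_monoid N) f"
    using assms unfolding additive_map_def
    by (intro group_hom.intro group_hom_axioms.intro) (auto simp: hom_def abelian_group.a_group)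
qed (use assms in \<open>simp_all add: additive_map_def\<close>)

lemma additive_map_closed: "additive_map M N f \<Longrightarrow> x \<in> carrier M \<Longrightarrow> f x \<in> carrier N"
  by (auto simp: additive_map_def)

lemma additive_map_add:
  "additive_map M N f \<Longrightarrow> x \<in> carrier M \<Longrightarrow> y \<in> carrier M \<Longrightarrow> f (x \<oplus>\<^bsub>M\<^esub> y) = f x \<oplus>\<^bsub>N\<^esub> f y"
  by (auto simp: additive_map_def)

lemma additive_map_zero: "additive_map M N f \<Longrightarrow> f \<zero>\<^bsub>M\<^esub> = \<zero>\<^bsub>N\<^esub>"
  by (rule abelian_group_hom.hom_zero[OF additive_map_hom])

lemma additive_map_neg: "additive_map M N f \<Longrightarrow> x \<in> carrier M \<Longrightarrow> f (\<ominus>\<^bsub>M\<^esub> x) = \<ominus>\<^bsub>N\<^esub> f x"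
  by (rule abelian_group_hom.hom_a_inv[OF additive_map_hom])

lemma additive_map_minus:
  assumes "additive_map M N f" "x \<in> carrier M" "y \<in> carrier M"
  shows "f (x \<ominus>\<^bsub>M\<^esub> y) = f x \<ominus>\<^bsub>N\<^esub> f y"
proof -
  interpret M: abelian_group M using assms by (simp add: additive_map_def)
  show ?thesis
    using assms by (simp add: a_minus_def additive_map_add additive_map_neg)
qed

lemma additive_map_signed:
  "additive_map M N f \<Longrightarrow> x \<in> carrier M \<Longrightarrow> f (signed M m x) = signed N m (f x)"
  by (simp add: signed_def additive_map_neg)

lemma additive_map_finsum:
  assumes f: "additive_map M N f" and "finite A" and "g \<in> A \<rightarrow> carrier M"
  shows "f (finsum M g A) = (\<Oplus>\<^bsub>N\<^esub>a\<in>A. f (g a))"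
  using assms(2,3)
proof (induction A)
  interpret M: abelian_group M using f by (simp add: additive_map_def)
  interpret N: abelian_group N using f by (simp add: additive_map_def)
  {
    case empty
    then show ?case using f by (simp add: additive_map_zero)
  next
    case (insert a A)
    then have "(\<lambda>a. f (g a)) \<in> A \<rightarrow> carrier N" "f (g a) \<in> carrier N"
      by (auto intro!: additive_map_closed[OF f])
    with insert show ?case by (simp add: additive_map_add[OF f] Pi_def)
  }
qed

lemma additive_map_comp:
  "additive_map M N f \<Longrightarrow> additive_map N P g \<Longrightarrow> additive_map M P (\<lambda>x. g (f x))"
  by (auto simp: additive_map_def Pi_iff)

locale module_group = abelian_group M for M :: "('k, 'a) module" (structure)
begin

lemma signed_closed [simp, intro]: "x \<in> carrier M \<Longrightarrow> signed M m x \<in> carrier M"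
  by (simp add: signed_def)

lemma signed_zero [simp]: "signed M m \<zero> = \<zero>"
  by (simp add: signed_def)

lemma signed_signed: "x \<in> carrier M \<Longrightarrow> signed M m (signed M n x) = signed M (m + n) x"
  by (simp add: signed_def)

lemma signed_Suc: "x \<in> carrier M \<Longrightarrow> signed M (Suc m) x = \<ominus> signed M m x"
  by (simp add: signed_def)

lemma signed_add: "x \<in> carrier M \<Longrightarrow> y \<in> carrier M \<Longrightarrow>
    signed M m (x \<oplus> y) = signed M m x \<oplus> signed M m y"
  by (simp add: signed_def minus_add)

lemma additive_map_of_signed: "additive_map M M (signed M m)"
  using abelian_group_axioms by (auto intro!: additive_mapI simp: signed_add)

lemma finsum_signed:
  "finite A \<Longrightarrow> g \<in> A \<rightarrow> carrier M \<Longrightarrow>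
    signed M m (finsum M g A) = (\<Oplus>a\<in>A. signed M m (g a))"
  by (rule additive_map_finsum[OF additive_map_of_signed])

end

context abelian_group
begin

lemma neg_zero [simp]: "\<ominus> \<zero> = \<zero>"
  by (rule minus_equality) simp_all

text \<open>The common form of all sums below that vanish because their terms cancel in pairs.\<close>

lemma finsum_pairing_zero:
  assumes fin: "finite P" and PQ: "bij_betw T P Q" "P \<inter> Q = {}"
    and a: "\<And>p. p \<in> P \<Longrightarrow> a p \<in> carrier G"
    and op: "\<And>p. p \<in> P \<Longrightarrow> a (T p) = \<ominus> a p"
  shows "finsum G a (P \<union> Q) = \<zero>"
proof -
  have Q: "Q = T ` P" and inj: "inj_on T P"
    using PQ by (auto simp: bij_betw_def)
  have aQ: "a \<in> T ` P \<rightarrow> carrier G"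
    using a op by auto
  have "finsum G a (P \<union> Q) = finsum G a P \<oplus> finsum G a (T ` P)"
    using fin PQ(2) aQ a by (subst finsum_Un_disjoint) (auto simp: Q)
  also have "finsum G a (T ` P) = finsum G (\<lambda>p. a (T p)) P"
    using finsum_reindex[OF aQ inj] .
  also have "\<dots> = finsum G (\<lambda>p. \<ominus> a p) P"
    by (rule finsum_cong') (use a op in auto)
  also have "finsum G a P \<oplus> \<dots> = finsum G (\<lambda>p. a p \<oplus> \<ominus> a p) P"
    using a by (subst finsum_addf) auto
  also have "\<dots> = finsum G (\<lambda>p. \<zero>) P"
    by (rule finsum_cong') (use a in \<open>auto simp: r_neg\<close>)
  finally show ?thesis by (simp add: finsum_zero)
qed

lemma finsum_zero':
  "(\<And>x. x \<in> A \<Longrightarrow> f x = \<zero>) \<Longrightarrow> finsum G f A = \<zero>"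
  by (rule add.finprod_one_eqI)

lemma finsum_single:
  assumes "finite A" "a \<in> A" "f a \<in> carrier G" "\<And>x. x \<in> A \<Longrightarrow> x \<noteq> a \<Longrightarrow> f x = \<zero>"
  shows "finsum G f A = f a"
proof -
  have "finsum G f A = finsum G (\<lambda>x. if a = x then f a else \<zero>) A"
    by (rule finsum_cong') (use assms in auto)
  also have "\<dots> = f a"
    using finsum_singleton[of a A "\<lambda>_. f a"] assms by simp
  finally show ?thesis .
qed

lemma minus_zero_iff: "x \<in> carrier G \<Longrightarrow> y \<in> carrier G \<Longrightarrow> x \<ominus> y = \<zero> \<longleftrightarrow> x = y"
proof
  assume x: "x \<in> carrier G" "y \<in> carrier G" and "x \<ominus> y = \<zero>"
  then have "(x \<oplus> \<ominus> y) \<oplus> y = y" by (simp add: a_minus_def)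
  with x show "x = y" by (simp add: a_assoc l_neg)
qed (simp add: a_minus_def r_neg)

end


section \<open>Quotients of differential graded algebras\<close>

lemma (in abelian_group) coset_eq_iff:
  assumes "additive_subgroup A G" "x \<in> carrier G" "y \<in> carrier G"
  shows "A +> x = A +> y \<longleftrightarrow> x \<ominus> y \<in> A"
proof -
  interpret A: abelian_subgroup A G
    using assms(1) abelian_group_axioms by (intro abelian_subgroupI3)
  have "x \<in> A +> y \<longleftrightarrow> x \<ominus> y \<in> A"
    using A.a_rcos_module[OF assms(3,2)] by (simp add: a_minus_def)
  moreover have "A +> x = A +> y \<longleftrightarrow> x \<in> A +> y"
    using A.a_repr_independence'[OF _ assms(3)] A.a_rcos_self[OF assms(2)] by metis
  ultimately show ?thesis by simp
qed

sublocale dg_algebra \<subseteq> gr: Module.module k "dg_gr Y n" for n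
  by (rule gr_module)

sublocale dg_algebra \<subseteq> gr: module_group "dg_gr Y n" for n
  by (rule module_group.intro) (rule gr.abelian_group_axioms)

context dg_algebra
begin

lemma mult_additive_left:
  "y \<in> carrier (dg_gr Y q) \<Longrightarrow> additive_map (dg_gr Y p) (dg_gr Y (p + q)) (\<lambda>x. dg_mult Y p q x y)"
  by (intro additive_mapI gr.abelian_group_axioms) (simp_all add: mult_closed mult_add_left)

lemma mult_additive_right:
  "x \<in> carrier (dg_gr Y p) \<Longrightarrow> additive_map (dg_gr Y q) (dg_gr Y (p + q)) (dg_mult Y p q x)"
  by (intro additive_mapI gr.abelian_group_axioms) (simp_all add: mult_closed mult_add_right)

lemma diff_additive: "additive_map (dg_gr Y p) (dg_gr Y (Suc p)) (dg_diff Y p)"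
  by (intro additive_mapI gr.abelian_group_axioms) (simp_all add: diff_closed diff_add)

end

lemma dg_hom_D:
  assumes "\<phi> \<in> dg_hom k Y Z"
  shows "x \<in> carrier (dg_gr Y n) \<Longrightarrow> \<phi> n x \<in> carrier (dg_gr Z n)"
    "\<phi> n \<in> extensional (carrier (dg_gr Y n))"
    "x \<in> carrier (dg_gr Y n) \<Longrightarrow> y \<in> carrier (dg_gr Y n) \<Longrightarrow>
       \<phi> n (x \<oplus>\<^bsub>dg_gr Y n\<^esub> y) = \<phi> n x \<oplus>\<^bsub>dg_gr Z n\<^esub> \<phi> n y"
    "a \<in> carrier k \<Longrightarrow> x \<in> carrier (dg_gr Y n) \<Longrightarrow>
       \<phi> n (a \<odot>\<^bsub>dg_gr Y n\<^esub> x) = a \<odot>\<^bsub>dg_gr Z n\<^esub> \<phi> n x"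
    "x \<in> carrier (dg_gr Y p) \<Longrightarrow> y \<in> carrier (dg_gr Y q) \<Longrightarrow>
       \<phi> (p + q) (dg_mult Y p q x y) = dg_mult Z p q (\<phi> p x) (\<phi> q y)"
    "\<phi> 0 (dg_one Y) = dg_one Z"
    "x \<in> carrier (dg_gr Y n) \<Longrightarrow> \<phi> (Suc n) (dg_diff Y n x) = dg_diff Z n (\<phi> n x)"
  using assms unfolding dg_hom_def by (auto simp: PiE_def)

lemma dg_homI:
  assumes "\<And>n x. x \<in> carrier (dg_gr Y n) \<Longrightarrow> \<phi> n x \<in> carrier (dg_gr Z n)"
    "\<And>n. \<phi> n \<in> extensional (carrier (dg_gr Y n))"
    "\<And>n x y. x \<in> carrier (dg_gr Y n) \<Longrightarrow> y \<in> carrier (dg_gr Y n) \<Longrightarrow>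
       \<phi> n (x \<oplus>\<^bsub>dg_gr Y n\<^esub> y) = \<phi> n x \<oplus>\<^bsub>dg_gr Z n\<^esub> \<phi> n y"
    "\<And>n a x. a \<in> carrier k \<Longrightarrow> x \<in> carrier (dg_gr Y n) \<Longrightarrow>
       \<phi> n (a \<odot>\<^bsub>dg_gr Y n\<^esub> x) = a \<odot>\<^bsub>dg_gr Z n\<^esub> \<phi> n x"
    "\<And>p q x y. x \<in> carrier (dg_gr Y p) \<Longrightarrow> y \<in> carrier (dg_gr Y q) \<Longrightarrow>
       \<phi> (p + q) (dg_mult Y p q x y) = dg_mult Z p q (\<phi> p x) (\<phi> q y)"
    "\<phi> 0 (dg_one Y) = dg_one Z"
    "\<And>n x. x \<in> carrier (dg_gr Y n) \<Longrightarrow> \<phi> (Suc n) (dg_diff Y n x) = dg_diff Z n (\<phi> n x)"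
  shows "\<phi> \<in> dg_hom k Y Z"
  using assms unfolding dg_hom_def by (auto simp: PiE_def)

lemma dg_hom_additive:
  assumes "\<phi> \<in> dg_hom k Y Z" "dg_algebra k Y" "dg_algebra k Z"
  shows "additive_map (dg_gr Y n) (dg_gr Z n) (\<phi> n)"
proof -
  interpret Y: dg_algebra k Y by fact
  interpret Z: dg_algebra k Z by fact
  show ?thesis
    by (intro additive_mapI Y.gr.abelian_group_axioms Z.gr.abelian_group_axioms)
      (simp_all add: dg_hom_D[OF assms(1)])
qed

lemma dg_hom_eqI:
  assumes "\<phi> \<in> dg_hom k Y Z" "\<phi>' \<in> dg_hom k Y Z'"
    and "\<And>n x. x \<in> carrier (dg_gr Y n) \<Longrightarrow> \<phi> n x = \<phi>' n x"
  shows "\<phi> = \<phi>'"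
  using extensionalityI[OF dg_hom_D(2)[OF assms(1)] dg_hom_D(2)[OF assms(2)]] assms(3) by blast

lemma dg_hom_comp:
  assumes f: "f \<in> dg_hom k Y Z" and g: "g \<in> dg_hom k Z W" and Y: "dg_algebra k Y"
  shows "dg_comp Y g f \<in> dg_hom k Y W"
proof -
  interpret Y: dg_algebra k Y by fact
  show ?thesis
    by (rule dg_homI) (simp_all add: dg_comp_def compose_def dg_hom_D[OF f] dg_hom_D[OF g]
        Y.one_closed Y.mult_closed Y.diff_closed)
qed

lemma dg_hom_id:
  assumes "dg_algebra k Y"
  shows "dg_id Y \<in> dg_hom k Y Y"
proof -
  interpret Y: dg_algebra k Y by fact
  show ?thesis
    by (rule dg_homI) (simp_all add: dg_id_def Y.one_closed Y.mult_closed Y.diff_closed)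
qed

locale dg_quotient = dg_algebra k Y for k :: "'k ring" and Y :: "('k, 'a) dga" +
  fixes A :: "nat \<Rightarrow> 'a set"
  assumes ideal: "dg_ideal Y A"
begin

abbreviation "Q \<equiv> dg_quot Y A"

definition cls :: "nat \<Rightarrow> 'a \<Rightarrow> 'a set"
  where "cls n x = A n +>\<^bsub>dg_gr Y n\<^esub> x"

lemma sub: "additive_subgroup (A n) (dg_gr Y n)"
  using ideal by (simp add: dg_ideal_def)

lemma abs_sub: "abelian_subgroup (A n) (dg_gr Y n)"
  using sub gr.abelian_group_axioms by (intro abelian_subgroupI3)

lemma ideal_carrier: "x \<in> A n \<Longrightarrow> x \<in> carrier (dg_gr Y n)"
  by (rule additive_subgroup.a_Hcarr[OF sub])

lemma ideal_add: "x \<in> A n \<Longrightarrow> y \<in> A n \<Longrightarrow> x \<oplus>\<^bsub>dg_gr Y n\<^esub> y \<in> A n"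
  by (rule additive_subgroup.a_closed[OF sub])

text \<open>
  Scalars act by multiplication with multiples of the unit, so an ideal is a submodule.
\<close>

lemma ideal_smult:
  assumes "a \<in> carrier k" "x \<in> A n"
  shows "a \<odot>\<^bsub>dg_gr Y n\<^esub> x \<in> A n"
proof -
  have "dg_mult Y 0 n (a \<odot>\<^bsub>dg_gr Y 0\<^esub> dg_one Y) x \<in> A (0 + n)"
    using ideal assms one_closed unfolding dg_ideal_def by blast
  then show ?thesis
    using assms ideal_carrier[of x n] by (simp add: mult_smult_left one_closed one_left)
qed

lemma cls_eq: "x \<in> carrier (dg_gr Y n) \<Longrightarrow> y \<in> carrier (dg_gr Y n) \<Longrightarrow>
    cls n x = cls n y \<longleftrightarrow> x \<ominus>\<^bsub>dg_gr Y n\<^esub> y \<in> A n"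
  unfolding cls_def by (rule gr.coset_eq_iff[OF sub])

lemma cls_eq_zero: "x \<in> carrier (dg_gr Y n) \<Longrightarrow> cls n x = cls n \<zero>\<^bsub>dg_gr Y n\<^esub> \<longleftrightarrow> x \<in> A n"
  by (simp add: cls_eq a_minus_def gr.neg_zero)

lemma cls_self: "x \<in> carrier (dg_gr Y n) \<Longrightarrow> x \<in> cls n x"
  unfolding cls_def by (rule abelian_subgroup.a_rcos_self[OF abs_sub])

lemma cls_memD:
  assumes "x \<in> carrier (dg_gr Y n)" "y \<in> cls n x"
  shows "y \<in> carrier (dg_gr Y n)" "cls n y = cls n x" "y \<ominus>\<^bsub>dg_gr Y n\<^esub> x \<in> A n"
proof -
  show y: "y \<in> carrier (dg_gr Y n)"
    using abelian_subgroup.a_elemrcos_carrier[OF abs_sub assms(1)] assms(2) by (simp add: cls_def)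
  show "cls n y = cls n x"
    using abelian_subgroup.a_repr_independence'[OF abs_sub] assms by (metis cls_def)
  then show "y \<ominus>\<^bsub>dg_gr Y n\<^esub> x \<in> A n" using y assms(1) by (simp add: cls_eq)
qed

lemma UN_cls:
  assumes "x \<in> carrier (dg_gr Y n)" "\<And>y. y \<in> cls n x \<Longrightarrow> g y = g x"
  shows "(\<Union>y\<in>cls n x. g y) = g x"
  using assms cls_self[OF assms(1)] by blast

lemma zero_Q: "\<zero>\<^bsub>dg_gr Q n\<^esub> = cls n \<zero>\<^bsub>dg_gr Y n\<^esub>"
proof -
  have "A n \<subseteq> carrier (dg_gr Y n)" using ideal_carrier by blast
  then show ?thesis
    by (simp add: dg_quot_def module_quot_def cls_def)
qed

lemma carrier_Q: "carrier (dg_gr Q n) = cls n ` carrier (dg_gr Y n)"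
  by (auto simp: dg_quot_def module_quot_def A_RCOSETS_def' cls_def)

lemma cls_closed: "x \<in> carrier (dg_gr Y n) \<Longrightarrow> cls n x \<in> carrier (dg_gr Q n)"
  by (simp add: carrier_Q)

lemma cls_cases:
  assumes "S \<in> carrier (dg_gr Q n)"
  obtains x where "x \<in> carrier (dg_gr Y n)" "S = cls n x"
  using assms by (auto simp: carrier_Q)

lemma cls_add: "x \<in> carrier (dg_gr Y n) \<Longrightarrow> y \<in> carrier (dg_gr Y n) \<Longrightarrow>
    cls n x \<oplus>\<^bsub>dg_gr Q n\<^esub> cls n y = cls n (x \<oplus>\<^bsub>dg_gr Y n\<^esub> y)"
  using abelian_subgroup.a_rcos_sum[OF abs_sub]
  by (simp add: dg_quot_def module_quot_def cls_def)

lemma cls_smult: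
  assumes "a \<in> carrier k" "x \<in> carrier (dg_gr Y n)"
  shows "a \<odot>\<^bsub>dg_gr Q n\<^esub> cls n x = cls n (a \<odot>\<^bsub>dg_gr Y n\<^esub> x)"
proof -
  have "(\<Union>y\<in>cls n x. cls n (a \<odot>\<^bsub>dg_gr Y n\<^esub> y)) = cls n (a \<odot>\<^bsub>dg_gr Y n\<^esub> x)"
  proof (rule UN_cls[OF assms(2)])
    fix y assume y: "y \<in> cls n x"
    note D = cls_memD[OF assms(2) y]
    have "a \<odot>\<^bsub>dg_gr Y n\<^esub> y \<ominus>\<^bsub>dg_gr Y n\<^esub> a \<odot>\<^bsub>dg_gr Y n\<^esub> x = a \<odot>\<^bsub>dg_gr Y n\<^esub> (y \<ominus>\<^bsub>dg_gr Y n\<^esub> x)"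
      using assms D(1) by (simp add: a_minus_def gr.smult_r_distr gr.smult_r_minus)
    then show "cls n (a \<odot>\<^bsub>dg_gr Y n\<^esub> y) = cls n (a \<odot>\<^bsub>dg_gr Y n\<^esub> x)"
      using assms D(1) ideal_smult[OF assms(1) D(3)] by (simp add: cls_eq)
  qed
  then show ?thesis by (simp add: dg_quot_def module_quot_def cls_def)
qed

lemma cls_mult:
  assumes x: "x \<in> carrier (dg_gr Y p)" and y: "y \<in> carrier (dg_gr Y q)"
  shows "dg_mult Q p q (cls p x) (cls q y) = cls (p + q) (dg_mult Y p q x y)"
proof -
  have "cls (p + q) (dg_mult Y p q x' y') = cls (p + q) (dg_mult Y p q x y)"
    if "x' \<in> cls p x" "y' \<in> cls q y" for x' y'
  proof -
    note D = cls_memD[OF x that(1)] and E = cls_memD[OF y that(2)]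
    have "dg_mult Y p q (x' \<ominus>\<^bsub>dg_gr Y p\<^esub> x) y' \<in> A (p + q)" "dg_mult Y p q x (y' \<ominus>\<^bsub>dg_gr Y q\<^esub> y) \<in> A (p + q)"
      using ideal D E x unfolding dg_ideal_def by blast+
    then have "cls (p + q) (dg_mult Y p q x' y') = cls (p + q) (dg_mult Y p q x y')"
      "cls (p + q) (dg_mult Y p q x y') = cls (p + q) (dg_mult Y p q x y)"
      using D(1) E(1) x y
      by (simp_all add: cls_eq mult_closed additive_map_minus[OF mult_additive_left]
          additive_map_minus[OF mult_additive_right])
    then show ?thesis by simp
  qed
  then have "(\<Union>x'\<in>cls p x. \<Union>y'\<in>cls q y. cls (p + q) (dg_mult Y p q x' y'))
      = cls (p + q) (dg_mult Y p q x y)"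
    using cls_self[OF x] cls_self[OF y] by blast
  then show ?thesis by (simp add: dg_quot_def cls_def)
qed

lemma cls_diff:
  assumes x: "x \<in> carrier (dg_gr Y n)"
  shows "dg_diff Q n (cls n x) = cls (Suc n) (dg_diff Y n x)"
proof -
  have "(\<Union>y\<in>cls n x. cls (Suc n) (dg_diff Y n y)) = cls (Suc n) (dg_diff Y n x)"
  proof (rule UN_cls[OF assms])
    fix y assume y: "y \<in> cls n x"
    note D = cls_memD[OF x y]
    have "dg_diff Y n (y \<ominus>\<^bsub>dg_gr Y n\<^esub> x) \<in> A (Suc n)"
      using ideal D unfolding dg_ideal_def by blast
    then show "cls (Suc n) (dg_diff Y n y) = cls (Suc n) (dg_diff Y n x)"
      using x D(1) by (simp add: cls_eq diff_closed additive_map_minus[OF diff_additive])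
  qed
  then show ?thesis by (simp add: dg_quot_def cls_def)
qed

lemma one_Q: "dg_one Q = cls 0 (dg_one Y)"
  by (simp add: dg_quot_def cls_def)

lemma abelian_group_Q: "abelian_group (dg_gr Q n)"
proof (rule abelian_groupI)
  show "\<exists>S'\<in>carrier (dg_gr Q n). S' \<oplus>\<^bsub>dg_gr Q n\<^esub> S = \<zero>\<^bsub>dg_gr Q n\<^esub>" if S: "S \<in> carrier (dg_gr Q n)" for S
  proof -
    obtain x where x: "x \<in> carrier (dg_gr Y n)" "S = cls n x" using S by (rule cls_cases)
    have "cls n (\<ominus>\<^bsub>dg_gr Y n\<^esub> x) \<oplus>\<^bsub>dg_gr Q n\<^esub> S = \<zero>\<^bsub>dg_gr Q n\<^esub>"
      using x by (simp add: cls_add zero_Q gr.l_neg)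
    then show ?thesis using x(1) by (blast intro: cls_closed gr.a_inv_closed)
  qed
qed (auto simp: zero_Q carrier_Q cls_add gr.a_ac)

lemma module_Q: "Module.module k (dg_gr Q n)"
  by (rule moduleI[OF gr.R.is_cring abelian_group_Q])
    (auto simp: carrier_Q cls_add cls_smult gr.smult_l_distr gr.smult_r_distr gr.smult_assoc1)

lemma cls_additive: "additive_map (dg_gr Y n) (dg_gr Q n) (cls n)"
  by (intro additive_mapI gr.abelian_group_axioms abelian_group_Q) (simp_all add: cls_closed cls_add)

lemma cls_signed: "x \<in> carrier (dg_gr Y n) \<Longrightarrow> signed (dg_gr Q n) m (cls n x) = cls n (signed (dg_gr Y n) m x)"
  using additive_map_signed[OF cls_additive] by metis

lemma dg_algebra_Q: "dg_algebra k Q"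
proof (rule dg_algebra.intro)
  show "Module.module k (dg_gr Q n)" for n by (rule module_Q)
  show "dg_mult Q (p + q) r (dg_mult Q p q S T) U = dg_mult Q p (q + r) S (dg_mult Q q r T U)"
    if S: "S \<in> carrier (dg_gr Q p)" and T: "T \<in> carrier (dg_gr Q q)" and U: "U \<in> carrier (dg_gr Q r)" for
        p q r S T U
  proof -
    obtain x where x: "x \<in> carrier (dg_gr Y p)" "S = cls p x" using S by (rule cls_cases)
    obtain y where y: "y \<in> carrier (dg_gr Y q)" "T = cls q y" using T by (rule cls_cases)
    obtain z where z: "z \<in> carrier (dg_gr Y r)" "U = cls r z" using U by (rule cls_cases)
    from x y z show ?thesis
      using cls_mult[of "dg_mult Y p q x y" "p + q" z r] cls_mult[of x p "dg_mult Y q r y z" "q + r"]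
      by (simp add: cls_mult mult_closed mult_assoc add.assoc)
  qed
  show "dg_diff Q (p + q) (dg_mult Q p q S T) =
      dg_mult Q (Suc p) q (dg_diff Q p S) T \<oplus>\<^bsub>dg_gr Q (Suc (p + q))\<^esub>
      signed (dg_gr Q (Suc (p + q))) p (dg_mult Q p (Suc q) S (dg_diff Q q T))"
    if S: "S \<in> carrier (dg_gr Q p)" and T: "T \<in> carrier (dg_gr Q q)" for p q S T
  proof -
    obtain x where x: "x \<in> carrier (dg_gr Y p)" "S = cls p x" using S by (rule cls_cases)
    obtain y where y: "y \<in> carrier (dg_gr Y q)" "T = cls q y" using T by (rule cls_cases)
    note xy = x y
    have "dg_mult Y p (Suc q) x (dg_diff Y q y) \<in> carrier (dg_gr Y (Suc (p + q)))"
      "dg_mult Y (Suc p) q (dg_diff Y p x) y \<in> carrier (dg_gr Y (Suc (p + q)))"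
      using mult_closed[of x p "dg_diff Y q y" "Suc q"] mult_closed[of "dg_diff Y p x" "Suc p" y q]
        xy diff_closed by auto
    then show ?thesis
      using xy cls_mult[of x p "dg_diff Y q y" "Suc q"] cls_mult[of "dg_diff Y p x" "Suc p" y q]
      by (simp add: cls_mult cls_diff diff_closed mult_closed leibniz cls_signed cls_add)
  qed
qed (auto simp: carrier_Q one_Q cls_add cls_smult cls_mult cls_diff zero_Q one_closed mult_closed
    mult_add_left mult_add_right mult_smult_left mult_smult_right one_left one_right diff_closed
    diff_add diff_smult diff_diff)

lemma dg_hom_Q_eqI:
  assumes "\<phi> \<in> dg_hom k Q Z" "\<phi>' \<in> dg_hom k Q Z'"
    and "\<And>n x. x \<in> carrier (dg_gr Y n) \<Longrightarrow> \<phi> n (cls n x) = \<phi>' n (cls n x)"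
  shows "\<phi> = \<phi>'"
  using dg_hom_eqI[OF assms(1,2)] assms(3) by (auto simp: carrier_Q)

lemma restrict_hom:
  assumes \<phi>: "\<phi> \<in> dg_hom k Q Z"
  shows "(\<lambda>n. \<lambda>x\<in>carrier (dg_gr Y n). \<phi> n (cls n x)) \<in> dg_hom k Y Z"
  by (rule dg_homI)
    (simp_all add: cls_closed dg_hom_D[OF \<phi>] cls_add[symmetric] cls_smult[symmetric]
      cls_mult[symmetric] cls_diff[symmetric] one_Q[symmetric] one_closed mult_closed diff_closed)

text \<open>
  The value on a class is read off from a chosen representative; for a map that kills the ideal the choice
  is immaterial, by \<open>quot_lift_cls\<close>.
\<close>

definition quot_lift :: "(nat \<Rightarrow> 'a \<Rightarrow> 'c) \<Rightarrow> nat \<Rightarrow> 'a set \<Rightarrow> 'c"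
  where "quot_lift \<psi> n = (\<lambda>S\<in>carrier (dg_gr Q n). \<psi> n (SOME x. x \<in> S))"

lemma quot_lift_cls:
  assumes Z: "dg_algebra k Z" and \<psi>: "\<psi> \<in> dg_hom k Y Z"
    and kills: "\<And>n x. x \<in> A n \<Longrightarrow> \<psi> n x = \<zero>\<^bsub>dg_gr Z n\<^esub>"
    and x: "x \<in> carrier (dg_gr Y n)"
  shows "quot_lift \<psi> n (cls n x) = \<psi> n x"
proof -
  interpret Z: dg_algebra k Z by fact
  define y where "y = (SOME y. y \<in> cls n x)"
  have "y \<in> cls n x" unfolding y_def using cls_self[OF x] by (rule someI)
  note D = cls_memD[OF x this]
  have "\<psi> n y \<ominus>\<^bsub>dg_gr Z n\<^esub> \<psi> n x = \<zero>\<^bsub>dg_gr Z n\<^esub>"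
    using kills[OF D(3)] D(1) x
    by (simp add: additive_map_minus[OF dg_hom_additive[OF \<psi> dg_algebra_axioms Z]])
  then have "\<psi> n y = \<psi> n x"
    using D(1) x by (simp add: Z.gr.minus_zero_iff dg_hom_D[OF \<psi>])
  then show ?thesis using cls_closed[OF x] by (simp add: quot_lift_def y_def)
qed

lemma quot_lift_hom:
  assumes Z: "dg_algebra k Z" and \<psi>: "\<psi> \<in> dg_hom k Y Z"
    and kills: "\<And>n x. x \<in> A n \<Longrightarrow> \<psi> n x = \<zero>\<^bsub>dg_gr Z n\<^esub>"
  shows "quot_lift \<psi> \<in> dg_hom k Q Z"
proof (rule dg_homI)
  show "quot_lift \<psi> n \<in> extensional (carrier (dg_gr Q n))" for n
    by (simp add: quot_lift_def)
qed (auto simp: carrier_Q cls_add cls_smult cls_mult cls_diff one_Q quot_lift_cls[OF assms]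
    dg_hom_D[OF \<psi>] one_closed mult_closed diff_closed)

end

section \<open>The normalized cochain algebra\<close>

lemma alg_hom_D:
  assumes "h \<in> alg_hom k A B"
  shows "x \<in> carrier A \<Longrightarrow> h x \<in> carrier B"
    "x \<in> carrier A \<Longrightarrow> y \<in> carrier A \<Longrightarrow> h (x \<oplus>\<^bsub>A\<^esub> y) = h x \<oplus>\<^bsub>B\<^esub> h y"
    "x \<in> carrier A \<Longrightarrow> y \<in> carrier A \<Longrightarrow> h (x \<otimes>\<^bsub>A\<^esub> y) = h x \<otimes>\<^bsub>B\<^esub> h y"
    "h \<one>\<^bsub>A\<^esub> = \<one>\<^bsub>B\<^esub>"
    "a \<in> carrier k \<Longrightarrow> x \<in> carrier A \<Longrightarrow> h (a \<odot>\<^bsub>A\<^esub> x) = a \<odot>\<^bsub>B\<^esub> h x"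
  using assms by (auto simp: alg_hom_def ring_hom_def)

lemma alg_homI:
  assumes "\<And>x. x \<in> carrier A \<Longrightarrow> h x \<in> carrier B"
    "\<And>x y. x \<in> carrier A \<Longrightarrow> y \<in> carrier A \<Longrightarrow> h (x \<oplus>\<^bsub>A\<^esub> y) = h x \<oplus>\<^bsub>B\<^esub> h y"
    "\<And>x y. x \<in> carrier A \<Longrightarrow> y \<in> carrier A \<Longrightarrow> h (x \<otimes>\<^bsub>A\<^esub> y) = h x \<otimes>\<^bsub>B\<^esub> h y"
    "h \<one>\<^bsub>A\<^esub> = \<one>\<^bsub>B\<^esub>"
    "\<And>a x. a \<in> carrier k \<Longrightarrow> x \<in> carrier A \<Longrightarrow> h (a \<odot>\<^bsub>A\<^esub> x) = a \<odot>\<^bsub>B\<^esub> h x"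
  shows "h \<in> alg_hom k A B"
  using assms by (auto simp: alg_hom_def ring_hom_def)

lemma alg_hom_additive:
  "h \<in> alg_hom k A B \<Longrightarrow> assoc_algebra k A \<Longrightarrow> assoc_algebra k B \<Longrightarrow> additive_map A B h"
  by (intro additive_mapI) (auto simp: assoc_algebra_def alg_hom_D intro: ring.is_abelian_group)

lemma alg_hom_comp:
  "h \<in> alg_hom k A B \<Longrightarrow> g \<in> alg_hom k B C \<Longrightarrow> (\<lambda>x. g (h x)) \<in> alg_hom k A C"
  by (rule alg_homI) (simp_all add: alg_hom_D)

lemma ideal_prod_hom_image:
  assumes h: "h \<in> ring_hom A B" and I: "I \<subseteq> carrier A" "ring A"
    and IJ: "\<And>x. x \<in> I \<Longrightarrow> h x \<in> J" and w: "w \<in> ideal_prod A I I"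
  shows "h w \<in> ideal_prod B J J"
proof -
  have "w \<in> carrier A \<and> h w \<in> ideal_prod B J J"
    using w
  proof (induction rule: ideal_prod.induct)
    case (prod i j)
    then have "i \<in> carrier A" "j \<in> carrier A" using I by auto
    then show ?case
      using prod IJ ring.ring_simprules(5)[OF I(2)] h
      by (auto simp: ring_hom_def intro!: ideal_prod.prod)
  next
    case (sum a b)
    then show ?case
      using ring.ring_simprules(1)[OF I(2)] h
      by (auto simp: ring_hom_def intro!: ideal_prod.sum)
  qed
  then show ?thesis by blast
qed

lemma (in abelian_group) finsum_Sigma:
  assumes "finite A" "\<And>a. a \<in> A \<Longrightarrow> finite (B a)"
    "\<And>a b. a \<in> A \<Longrightarrow> b \<in> B a \<Longrightarrow> f a b \<in> carrier G"
  shows "(\<Oplus>a\<in>A. \<Oplus>b\<in>B a. f a b) = (\<Oplus>p\<in>Sigma A B. f (fst p) (snd p))"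
  using assms
proof (induction A)
  case (insert a A)
  have "(\<Oplus>p\<in>Sigma (insert a A) B. f (fst p) (snd p)) = (\<Oplus>p\<in>Pair a ` B a \<union> Sigma A B. f (fst p) (snd p))"
    by (rule arg_cong[where f = "finsum G _"]) auto
  also have "\<dots> = (\<Oplus>p\<in>Pair a ` B a. f (fst p) (snd p)) \<oplus> (\<Oplus>p\<in>Sigma A B. f (fst p) (snd p))"
    by (rule finsum_Un_disjoint) (use insert in auto)
  also have "(\<Oplus>p\<in>Pair a ` B a. f (fst p) (snd p)) = (\<Oplus>b\<in>B a. f a b)"
    by (subst finsum_reindex) (use insert in \<open>auto intro: inj_onI\<close>)
  finally have "(\<Oplus>p\<in>Sigma (insert a A) B. f (fst p) (snd p)) =
      (\<Oplus>b\<in>B a. f a b) \<oplus> (\<Oplus>p\<in>Sigma A B. f (fst p) (snd p))" .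
  moreover have "(\<Oplus>a\<in>insert a A. \<Oplus>b\<in>B a. f a b) = (\<Oplus>b\<in>B a. f a b) \<oplus> (\<Oplus>a\<in>A. \<Oplus>b\<in>B a. f a b)"
    by (rule finsum_insert) (use insert in \<open>auto intro!: finsum_closed\<close>)
  ultimately show ?case using insert by simp
qed simp

sublocale cosimplicial_algebra \<subseteq> obj: ring "cs_obj X n" for n
  using obj_algebra by (simp add: assoc_algebra_def)

sublocale cosimplicial_algebra \<subseteq> md: Module.module k "cs_obj X n" for n
  using obj_algebra by (simp add: assoc_algebra_def)

sublocale cosimplicial_algebra \<subseteq> obj: module_group "cs_obj X n" for n
  by (rule module_group.intro) (rule obj.is_abelian_group)

context cosimplicial_algebra
begin

abbreviation "C n \<equiv> carrier (cs_obj X n)"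
abbreviation "dd \<equiv> cs_coface X"
abbreviation "ss \<equiv> cs_codegen X"
abbreviation "N \<equiv> normalized X"
abbreviation "I \<equiv> codegen_ker X"
abbreviation "XN \<equiv> normalization X"

lemma smult_mult_left:
  "a \<in> carrier k \<Longrightarrow> x \<in> C n \<Longrightarrow> y \<in> C n \<Longrightarrow>
    (a \<odot>\<^bsub>cs_obj X n\<^esub> x) \<otimes>\<^bsub>cs_obj X n\<^esub> y = a \<odot>\<^bsub>cs_obj X n\<^esub> (x \<otimes>\<^bsub>cs_obj X n\<^esub> y)"
  using obj_algebra[of n] by (simp add: assoc_algebra_def)

lemma smult_mult_right:
  "a \<in> carrier k \<Longrightarrow> x \<in> C n \<Longrightarrow> y \<in> C n \<Longrightarrow>
    x \<otimes>\<^bsub>cs_obj X n\<^esub> (a \<odot>\<^bsub>cs_obj X n\<^esub> y) = a \<odot>\<^bsub>cs_obj X n\<^esub> (x \<otimes>\<^bsub>cs_obj X n\<^esub> y)"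
  using obj_algebra[of n] by (simp add: assoc_algebra_def)

lemmas coface_D = alg_hom_D[OF coface_hom]
lemmas codegen_D = alg_hom_D[OF codegen_hom]

lemma coface_additive: "i \<le> Suc n \<Longrightarrow> additive_map (cs_obj X n) (cs_obj X (Suc n)) (dd n i)"
  by (rule alg_hom_additive[OF coface_hom obj_algebra obj_algebra])

lemma codegen_additive: "j \<le> n \<Longrightarrow> additive_map (cs_obj X (Suc n)) (cs_obj X n) (ss n j)"
  by (rule alg_hom_additive[OF codegen_hom obj_algebra obj_algebra])

lemma ker_Suc: "I (Suc m) (Suc i) = {x \<in> C (Suc m). ss m i x = \<zero>\<^bsub>cs_obj X m\<^esub>}"
  by (simp add: codegen_ker_def a_kernel_def')

lemma N_0: "N 0 = C 0"
  by (auto simp: normalized_def)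

lemma N_Suc: "x \<in> N (Suc m) \<longleftrightarrow> x \<in> C (Suc m) \<and> (\<forall>i\<le>m. ss m i x = \<zero>\<^bsub>cs_obj X m\<^esub>)"
proof -
  have "(\<forall>j\<in>{1..Suc m}. x \<in> I (Suc m) j) \<longleftrightarrow> (\<forall>i\<le>m. x \<in> I (Suc m) (Suc i))"
    by (metis One_nat_def Suc_le_D Suc_le_mono atLeastAtMost_iff le0)
  then show ?thesis by (auto simp: normalized_def ker_Suc)
qed

lemma N_carrier: "x \<in> N n \<Longrightarrow> x \<in> C n"
  by (simp add: normalized_def)

lemma ker_ideal:
  assumes "i \<le> m"
  shows "ideal (I (Suc m) (Suc i)) (cs_obj X (Suc m))"
proof (rule idealI)
  show "ring (cs_obj X (Suc m))" by (rule obj.ring_axioms)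
  have "I (Suc m) (Suc i) \<subseteq> C (Suc m)" "\<zero>\<^bsub>cs_obj X (Suc m)\<^esub> \<in> I (Suc m) (Suc i)"
    using assms by (auto simp: ker_Suc additive_map_zero[OF codegen_additive])
  moreover have "\<ominus>\<^bsub>cs_obj X (Suc m)\<^esub> x \<in> I (Suc m) (Suc i)" if "x \<in> I (Suc m) (Suc i)" for x
    using assms that by (auto simp: ker_Suc additive_map_neg[OF codegen_additive])
  moreover have "x \<oplus>\<^bsub>cs_obj X (Suc m)\<^esub> y \<in> I (Suc m) (Suc i)"
    if "x \<in> I (Suc m) (Suc i)" "y \<in> I (Suc m) (Suc i)" for x y
    using assms that by (auto simp: ker_Suc codegen_D)
  ultimately show "subgroup (I (Suc m) (Suc i)) (add_monoid (cs_obj X (Suc m)))"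
    by (intro group.subgroupI) (auto simp: obj.a_group a_inv_def[symmetric])
qed (use assms in \<open>auto simp: ker_Suc codegen_D\<close>)

lemma N_smult: "a \<in> carrier k \<Longrightarrow> x \<in> N n \<Longrightarrow> a \<odot>\<^bsub>cs_obj X n\<^esub> x \<in> N n"
  by (cases n) (auto simp: N_0 N_Suc codegen_D)

lemma N_add: "x \<in> N n \<Longrightarrow> y \<in> N n \<Longrightarrow> x \<oplus>\<^bsub>cs_obj X n\<^esub> y \<in> N n"
  by (cases n) (auto simp: N_0 N_Suc codegen_D)

lemma N_zero: "\<zero>\<^bsub>cs_obj X n\<^esub> \<in> N n"
  by (cases n) (auto simp: N_0 N_Suc additive_map_zero[OF codegen_additive])

lemma N_neg: "x \<in> N n \<Longrightarrow> \<ominus>\<^bsub>cs_obj X n\<^esub> x \<in> N n"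
  by (cases n) (auto simp: N_0 N_Suc additive_map_neg[OF codegen_additive])

lemma XN_simps [simp]:
  "carrier (dg_gr XN n) = N n"
  "x \<oplus>\<^bsub>dg_gr XN n\<^esub> y = x \<oplus>\<^bsub>cs_obj X n\<^esub> y"
  "\<zero>\<^bsub>dg_gr XN n\<^esub> = \<zero>\<^bsub>cs_obj X n\<^esub>"
  "a \<odot>\<^bsub>dg_gr XN n\<^esub> x = a \<odot>\<^bsub>cs_obj X n\<^esub> x"
  "dg_mult XN = cup X" "dg_diff XN = alt_diff X" "dg_one XN = \<one>\<^bsub>cs_obj X 0\<^esub>"
  by (simp_all add: normalization_def)

lemma XN_module: "Module.module k (dg_gr XN n)"
proof (rule moduleI)
  show "abelian_group (dg_gr XN n)"
  proof (rule abelian_groupI)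
    show "\<exists>y\<in>carrier (dg_gr XN n). y \<oplus>\<^bsub>dg_gr XN n\<^esub> x = \<zero>\<^bsub>dg_gr XN n\<^esub>"
      if "x \<in> carrier (dg_gr XN n)" for x
      using that by (auto simp: obj.l_neg N_carrier intro!: bexI[OF _ N_neg])
  qed (auto simp: N_add N_zero N_carrier obj.a_ac)
qed (auto simp: N_smult N_carrier md.smult_l_distr md.smult_r_distr md.smult_assoc1
    md.R.is_cring)

lemma XN_neg [simp]:
  assumes "x \<in> N n"
  shows "\<ominus>\<^bsub>dg_gr XN n\<^esub> x = \<ominus>\<^bsub>cs_obj X n\<^esub> x"
proof -
  interpret M: Module.module k "dg_gr XN n" by (rule XN_module)
  show ?thesis
    using M.minus_equality[of "\<ominus>\<^bsub>cs_obj X n\<^esub> x" x] assms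
    by (simp add: N_neg N_carrier obj.l_neg)
qed

lemma XN_signed [simp]: "x \<in> N n \<Longrightarrow> signed (dg_gr XN n) m x = signed (cs_obj X n) m x"
  by (simp add: signed_def)

lemma XN_minus [simp]:
  "x \<in> N n \<Longrightarrow> y \<in> N n \<Longrightarrow> x \<ominus>\<^bsub>dg_gr XN n\<^esub> y = x \<ominus>\<^bsub>cs_obj X n\<^esub> y"
  by (simp add: a_minus_def)

lemma iter_hom: "c \<le> Suc n \<Longrightarrow> coface_iter X n c q \<in> alg_hom k (cs_obj X n) (cs_obj X (n + q))"
proof (induction q)
  case 0
  show ?case by (rule alg_homI) auto
next
  case (Suc q)
  then show ?case
    using alg_hom_comp[OF Suc.IH coface_hom[of c "n + q"]] by simp
qed

lemmas iter_D = alg_hom_D[OF iter_hom]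

lemma iter_closed: "c \<le> Suc n \<Longrightarrow> x \<in> C n \<Longrightarrow> coface_iter X n c q x \<in> C (n + q)"
  by (rule iter_D)

lemma iter_additive:
  "c \<le> Suc n \<Longrightarrow> additive_map (cs_obj X n) (cs_obj X (n + q)) (coface_iter X n c q)"
  by (rule alg_hom_additive[OF iter_hom obj_algebra obj_algebra])

text \<open>
  How cofaces and codegeneracies pass the front inclusion \<open>(d\<^bsup>p+1\<^esup>)\<^sup>q\<close> and the back inclusion
  \<open>(d\<^sup>0)\<^sup>p\<close>.
\<close>

lemma coface_front_low:
  "f \<in> C p \<Longrightarrow> i \<le> Suc p \<Longrightarrow>
    dd (p + q) i (coface_iter X p (Suc p) q f) = coface_iter X (Suc p) (Suc (Suc p)) q (dd p i f)"
proof (induction q)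
  case (Suc q)
  then show ?case
    using coface_coface[of i "Suc (Suc p)" "p + q" "coface_iter X p (Suc p) q f"]
    by (simp add: iter_closed)
qed simp

lemma coface_front_high:
  "f \<in> C p \<Longrightarrow> Suc p \<le> i \<Longrightarrow> i \<le> Suc (p + q) \<Longrightarrow>
    dd (p + q) i (coface_iter X p (Suc p) q f) = coface_iter X p (Suc p) (Suc q) f"
proof (induction q arbitrary: i)
  case 0
  then have "i = Suc p" by simp
  then show ?case by simp
next
  case (Suc q)
  show ?case
  proof (cases "i = Suc p")
    case False
    then have "Suc p < i" using Suc.prems by simp
    then show ?thesis
      using Suc.prems Suc.IH[of "i - 1"]
        coface_coface[of "Suc p" i "p + q" "coface_iter X p (Suc p) q f"]
      by (simp add: iter_closed)
  qed simp
qed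

lemma coface_back_low:
  "g \<in> C q \<Longrightarrow> i \<le> p \<Longrightarrow>
    dd (q + p) i (coface_iter X q 0 p g) = coface_iter X q 0 (Suc p) g"
proof (induction p arbitrary: i)
  case (Suc p)
  show ?case
  proof (cases "i = 0")
    case False
    then show ?thesis
      using Suc.prems Suc.IH[of "i - 1"] coface_coface[of 0 i "q + p" "coface_iter X q 0 p g"]
      by (simp add: iter_closed)
  qed simp
qed simp

lemma coface_back_high:
  "g \<in> C q \<Longrightarrow> i \<le> Suc q \<Longrightarrow>
    dd (q + p) (i + p) (coface_iter X q 0 p g) = coface_iter X (Suc q) 0 p (dd q i g)"
proof (induction p)
  case (Suc p)
  then show ?case
    using coface_coface[of 0 "Suc (i + p)" "q + p" "coface_iter X q 0 p g"]
    by (simp add: iter_closed)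
qed simp

lemma codegen_front:
  "f \<in> C (Suc p) \<Longrightarrow> j \<le> p \<Longrightarrow>
    ss (p + q) j (coface_iter X (Suc p) (Suc (Suc p)) q f) = coface_iter X p (Suc p) q (ss p j f)"
proof (induction q)
  case (Suc q)
  then show ?case
    using codegen_coface_greater[of j "Suc (Suc p)" "p + q" "coface_iter X (Suc p) (Suc (Suc p)) q f"]
      iter_closed[of "Suc (Suc p)" "Suc p" f q]
    by simp
qed simp

lemma codegen_back:
  "g \<in> C (Suc q) \<Longrightarrow> j \<le> q \<Longrightarrow>
    ss (q + p) (j + p) (coface_iter X (Suc q) 0 p g) = coface_iter X q 0 p (ss q j g)"
proof (induction p)
  case (Suc p)
  then show ?case
    using codegen_coface_less[of 0 "Suc (j + p)" "q + p" "coface_iter X (Suc q) 0 p g"]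
      iter_closed[of 0 "Suc q" g p]
    by simp
qed simp

lemma front_closed: "f \<in> C p \<Longrightarrow> coface_iter X p (Suc p) q f \<in> C (p + q)"
  by (rule iter_closed) simp_all

lemma back_closed: "g \<in> C q \<Longrightarrow> coface_iter X q 0 p g \<in> C (p + q)"
  using iter_closed[of 0 q g p] by (simp add: add.commute)

lemma cup_closed: "f \<in> C p \<Longrightarrow> g \<in> C q \<Longrightarrow> cup X p q f g \<in> C (p + q)"
  by (simp add: cup_def front_closed back_closed)

lemma front_ker:
  assumes "f \<in> I p j" "1 \<le> j" "j \<le> p"
  shows "coface_iter X p (Suc p) q f \<in> I (p + q) j"
proof -
  obtain m i where "p = Suc m" "j = Suc i" using assms by (metis Suc_le_D One_nat_def le_trans)
  then show ?thesis
    using assms codegen_front[of f m i q] front_closed[of f p q]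
      additive_map_zero[OF iter_additive, of "Suc m" m q]
    by (simp add: ker_Suc)
qed

lemma back_ker:
  assumes "g \<in> I q j" "1 \<le> j" "j \<le> q"
  shows "coface_iter X q 0 p g \<in> I (p + q) (p + j)"
proof -
  obtain m i where "q = Suc m" "j = Suc i" using assms by (metis Suc_le_D One_nat_def le_trans)
  then show ?thesis
    using assms codegen_back[of g m i p] back_closed[of g q p]
      additive_map_zero[OF iter_additive, of 0 m p]
    by (simp add: ker_Suc add.commute)
qed

lemma N_I: "x \<in> N n \<Longrightarrow> 1 \<le> j \<Longrightarrow> j \<le> n \<Longrightarrow> x \<in> I n j"
  by (simp add: normalized_def)

lemma NI: "x \<in> C n \<Longrightarrow> (\<And>j. 1 \<le> j \<Longrightarrow> j \<le> n \<Longrightarrow> x \<in> I n j) \<Longrightarrow> x \<in> N n"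
  by (simp add: normalized_def)

lemma ker_ideal': "1 \<le> j \<Longrightarrow> j \<le> n \<Longrightarrow> ideal (I n j) (cs_obj X n)"
  using ker_ideal by (metis One_nat_def Suc_le_D Suc_le_mono)

text \<open>
  On \<open>f \<union> g\<close> the codegeneracy \<open>s\<^bsup>j-1\<^esup>\<close> acts on the front factor if \<open>j \<le> p\<close> and on the back factor otherwise, and
  kills it.
\<close>

lemma cup_N:
  assumes f: "f \<in> N p" and g: "g \<in> N q"
  shows "cup X p q f g \<in> N (p + q)"
proof (rule NI)
  note fg = N_carrier[OF f] N_carrier[OF g]
  show "cup X p q f g \<in> C (p + q)" using fg by (rule cup_closed)
  fix j assume j: "1 \<le> j" "j \<le> p + q"
  interpret J: ideal "I (p + q) j" "cs_obj X (p + q)" using j by (rule ker_ideal')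
  show "cup X p q f g \<in> I (p + q) j"
  proof (cases "j \<le> p")
    case True
    then show ?thesis
      using front_ker[OF N_I[OF f j(1) True] j(1) True] back_closed[OF fg(2)]
      by (simp add: cup_def J.I_r_closed)
  next
    case False
    then have "1 \<le> j - p" "j - p \<le> q" "p + (j - p) = j" using j by auto
    then show ?thesis
      using back_ker[OF N_I[OF g], of "j - p" p] front_closed[OF fg(1)]
      by (simp add: cup_def J.I_l_closed)
  qed
qed

end

context cosimplicial_algebra
begin

lemma front_front:
  assumes "f \<in> C p"
  shows "coface_iter X (p + q) (Suc (p + q)) r (coface_iter X p (Suc p) q f) = coface_iter X p (Suc p) (q
      + r) f"
proof (induction r)
  case (Suc r)
  then show ?case
    using coface_front_high[of f p "Suc (p + q)" "q + r"] assms by (simp add: add.assoc)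
qed simp

lemma front_back:
  assumes "g \<in> C q"
  shows "coface_iter X (p + q) (Suc (p + q)) r (coface_iter X q 0 p g) =
    coface_iter X (q + r) 0 p (coface_iter X q (Suc q) r g)"
proof (induction r)
  case (Suc r)
  then show ?case
    using coface_back_high[of "coface_iter X q (Suc q) r g" "q + r" "Suc q" p] assms
      front_closed[of g q r] by (simp add: ac_simps)
qed simp

lemma back_back:
  "coface_iter X (q + r) 0 p (coface_iter X r 0 q h) = coface_iter X r 0 (p + q) h"
  by (induction p) (simp_all add: ac_simps)

lemma cup_assoc:
  assumes f: "f \<in> C p" and g: "g \<in> C q" and h: "h \<in> C r"
  shows "cup X (p + q) r (cup X p q f g) h = cup X p (q + r) f (cup X q r g h)"
proof -
  note cl = front_closed[OF f] back_closed[OF g] front_closed[OF g] back_closed[OF h]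
  have "cup X (p + q) r (cup X p q f g) h =
      (coface_iter X p (Suc p) (q + r) f \<otimes>\<^bsub>cs_obj X (p + q + r)\<^esub>
       coface_iter X (q + r) 0 p (coface_iter X q (Suc q) r g)) \<otimes>\<^bsub>cs_obj X (p + q + r)\<^esub>
      coface_iter X r 0 (p + q) h"
    using iter_D(3)[of "Suc (p + q)" "p + q" "coface_iter X p (Suc p) q f" "coface_iter X q 0 p g" r] cl
    by (simp add: cup_def front_front[OF f] front_back[OF g])
  also have "\<dots> = coface_iter X p (Suc p) (q + r) f \<otimes>\<^bsub>cs_obj X (p + q + r)\<^esub>
       (coface_iter X (q + r) 0 p (coface_iter X q (Suc q) r g) \<otimes>\<^bsub>cs_obj X (p + q + r)\<^esub>
       coface_iter X (q + r) 0 p (coface_iter X r 0 q h))"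
    using front_closed[OF f, of "q + r"] back_closed[OF cl(3)[of r], of p] back_closed[OF cl(4)[of q], of p]
    by (subst obj.m_assoc) (simp_all add: add.assoc back_back[symmetric])
  also have "\<dots> = cup X p (q + r) f (cup X q r g h)"
    using iter_D(3)[of 0 "q + r" "coface_iter X q (Suc q) r g" "coface_iter X r 0 q h" p] cl
    by (simp add: cup_def ac_simps)
  finally show ?thesis .
qed

lemma cup_one_left: "f \<in> C p \<Longrightarrow> cup X 0 p \<one>\<^bsub>cs_obj X 0\<^esub> f = f"
  using iter_D(4)[of "Suc 0" 0 p] by (simp add: cup_def)

lemma cup_one_right: "f \<in> C p \<Longrightarrow> cup X p 0 f \<one>\<^bsub>cs_obj X 0\<^esub> = f"
  using iter_D(4)[of 0 0 p] by (simp add: cup_def)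

lemma back_D:
  "x \<in> C q \<Longrightarrow> y \<in> C q \<Longrightarrow>
    coface_iter X q 0 p (x \<oplus>\<^bsub>cs_obj X q\<^esub> y) = coface_iter X q 0 p x \<oplus>\<^bsub>cs_obj X (p + q)\<^esub> coface_iter X q 0 p y"
  "a \<in> carrier k \<Longrightarrow> x \<in> C q \<Longrightarrow>
    coface_iter X q 0 p (a \<odot>\<^bsub>cs_obj X q\<^esub> x) = a \<odot>\<^bsub>cs_obj X (p + q)\<^esub> coface_iter X q 0 p x"
  "x \<in> C q \<Longrightarrow> y \<in> C q \<Longrightarrow>
    coface_iter X q 0 p (x \<otimes>\<^bsub>cs_obj X q\<^esub> y) = coface_iter X q 0 p x \<otimes>\<^bsub>cs_obj X (p + q)\<^esub> coface_iter X q 0 p y"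
  using iter_D(2,3,5)[of 0 q _ _ p] iter_D(5)[of 0 q _ _ p] by (simp_all add: add.commute)

lemma cup_bilinear:
  "f \<in> C p \<Longrightarrow> f' \<in> C p \<Longrightarrow> g \<in> C q \<Longrightarrow>
    cup X p q (f \<oplus>\<^bsub>cs_obj X p\<^esub> f') g = cup X p q f g \<oplus>\<^bsub>cs_obj X (p + q)\<^esub> cup X p q f' g"
  "f \<in> C p \<Longrightarrow> g \<in> C q \<Longrightarrow> g' \<in> C q \<Longrightarrow>
    cup X p q f (g \<oplus>\<^bsub>cs_obj X q\<^esub> g') = cup X p q f g \<oplus>\<^bsub>cs_obj X (p + q)\<^esub> cup X p q f g'"
  "a \<in> carrier k \<Longrightarrow> f \<in> C p \<Longrightarrow> g \<in> C q \<Longrightarrow>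
    cup X p q (a \<odot>\<^bsub>cs_obj X p\<^esub> f) g = a \<odot>\<^bsub>cs_obj X (p + q)\<^esub> cup X p q f g"
  "a \<in> carrier k \<Longrightarrow> f \<in> C p \<Longrightarrow> g \<in> C q \<Longrightarrow>
    cup X p q f (a \<odot>\<^bsub>cs_obj X q\<^esub> g) = a \<odot>\<^bsub>cs_obj X (p + q)\<^esub> cup X p q f g"
     apply (simp add: cup_def front_closed back_closed iter_D obj.l_distr)
    apply (simp add: cup_def front_closed back_closed back_D obj.r_distr)
   apply (simp add: cup_def front_closed back_closed iter_D smult_mult_left)
  apply (simp add: cup_def front_closed back_closed back_D smult_mult_right)
  done

lemma alt_diff_closed: "x \<in> C n \<Longrightarrow> alt_diff X n x \<in> C (Suc n)"
  by (auto simp: alt_diff_def coface_D intro!: obj.finsum_closed)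

lemma alt_diff_add:
  "x \<in> C n \<Longrightarrow> y \<in> C n \<Longrightarrow>
    alt_diff X n (x \<oplus>\<^bsub>cs_obj X n\<^esub> y) = alt_diff X n x \<oplus>\<^bsub>cs_obj X (Suc n)\<^esub> alt_diff X n y"
  unfolding alt_diff_def
  by (rule trans[OF obj.finsum_cong' obj.finsum_addf]) (auto simp: coface_D obj.signed_add)

lemma alt_diff_additive: "additive_map (cs_obj X n) (cs_obj X (Suc n)) (alt_diff X n)"
  by (intro additive_mapI obj.is_abelian_group) (simp_all add: alt_diff_closed alt_diff_add)

lemma smult_additive: "a \<in> carrier k \<Longrightarrow> additive_map (cs_obj X n) (cs_obj X n) (\<lambda>x. a \<odot>\<^bsub>cs_obj X n\<^esub> x)"
  by (intro additive_mapI obj.is_abelian_group) (simp_all add: md.smult_r_distr)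

lemma alt_diff_smult:
  assumes "a \<in> carrier k" "x \<in> C n"
  shows "alt_diff X n (a \<odot>\<^bsub>cs_obj X n\<^esub> x) = a \<odot>\<^bsub>cs_obj X (Suc n)\<^esub> alt_diff X n x"
proof -
  have "a \<odot>\<^bsub>cs_obj X (Suc n)\<^esub> alt_diff X n x =
      (\<Oplus>\<^bsub>cs_obj X (Suc n)\<^esub>i\<in>{0..Suc n}. a \<odot>\<^bsub>cs_obj X (Suc n)\<^esub> signed (cs_obj X (Suc n)) i (dd n i x))"
    unfolding alt_diff_def
    by (rule additive_map_finsum[OF smult_additive]) (use assms in \<open>auto simp: coface_D\<close>)
  also have "\<dots> = alt_diff X n (a \<odot>\<^bsub>cs_obj X n\<^esub> x)"
    unfolding alt_diff_def
    by (rule obj.finsum_cong')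
      (use assms in \<open>auto simp: coface_D additive_map_signed[OF smult_additive]\<close>)
  finally show ?thesis by simp
qed

text \<open>
  By the cosimplicial identities \<open>s\<^sup>j\<close> kills \<open>d\<^sup>i x\<close> except for \<open>i = j\<close> and \<open>i = j + 1\<close>, and these two terms
  carry opposite signs.
\<close>

lemma alt_diff_N:
  assumes x: "x \<in> N n"
  shows "alt_diff X n x \<in> N (Suc n)"
proof -
  note xC = N_carrier[OF x]
  have "ss n j (alt_diff X n x) = \<zero>\<^bsub>cs_obj X n\<^esub>" if j: "j \<le> n" for j
  proof -
    have s0: "ss n j (dd n i x) = \<zero>\<^bsub>cs_obj X n\<^esub>" if i: "i \<le> Suc n" "i \<noteq> j" "i \<noteq> Suc j" for i
    proof (cases n)
      case 0
      then show ?thesis using i j by simp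
    next
      case (Suc m)
      show ?thesis
      proof (cases "i < j")
        case True
        then show ?thesis
          using j x xC Suc codegen_coface_less[of i j m x] additive_map_zero[OF coface_additive, of i m]
            N_Suc[of x m] by auto
      next
        case False
        then show ?thesis
          using i j x xC Suc codegen_coface_greater[of j i m x] additive_map_zero[OF coface_additive, of
              "i - 1" m]
            N_Suc[of x m] by auto
      qed
    qed
    have "ss n j (alt_diff X n x) =
        (\<Oplus>\<^bsub>cs_obj X n\<^esub>i\<in>{0..Suc n}. ss n j (signed (cs_obj X (Suc n)) i (dd n i x)))"
      unfolding alt_diff_def
      by (rule additive_map_finsum[OF codegen_additive[OF j]]) (use xC in \<open>auto simp: coface_D\<close>)
    also have "\<dots> = (\<Oplus>\<^bsub>cs_obj X n\<^esub>i\<in>{0..Suc n}. signed (cs_obj X n) i (ss n j (dd n i x)))"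
      by (rule obj.finsum_cong')
        (use xC j in \<open>auto simp: coface_D codegen_D additive_map_signed[OF codegen_additive]\<close>)
    also have "\<dots> = (\<Oplus>\<^bsub>cs_obj X n\<^esub>i\<in>{j} \<union> {Suc j}. signed (cs_obj X n) i (ss n j (dd n i x)))"
      by (rule obj.add.finprod_mono_neutral_cong_right) (use xC j s0 in \<open>auto simp: coface_D codegen_D\<close>)
    also have "\<dots> = \<zero>\<^bsub>cs_obj X n\<^esub>"
      by (rule obj.finsum_pairing_zero[where T = Suc])
        (use xC j in \<open>auto simp: bij_betw_def codegen_coface_id obj.signed_Suc\<close>)
    finally show ?thesis .
  qed
  then show ?thesis using xC by (simp add: N_Suc alt_diff_closed)
qed

text \<open>
  In the double sum the term \<open>d\<^sup>j d\<^sup>i\<close> with \<open>i < j\<close> cancels against \<open>d\<^sup>i d\<^bsup>j-1\<^esup>\<close>.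
\<close>

lemma alt_diff_alt_diff:
  assumes x: "x \<in> C n"
  shows "alt_diff X (Suc n) (alt_diff X n x) = \<zero>\<^bsub>cs_obj X (Suc (Suc n))\<^esub>"
proof -
  let ?R = "cs_obj X (Suc (Suc n))"
  define a where "a = (\<lambda>p. signed ?R (fst p + snd p) (dd (Suc n) (fst p) (dd n (snd p) x)))"
  have a: "a p \<in> carrier ?R" if "p \<in> {0..Suc (Suc n)} \<times> {0..Suc n}" for p
    using that x by (auto simp: a_def coface_D)
  define P where "P = {p \<in> {0..Suc (Suc n)} \<times> {0..Suc n}. snd p < fst p}"
  define Q where "Q = {p \<in> {0..Suc (Suc n)} \<times> {0..Suc n}. fst p \<le> snd p}"
  have "alt_diff X (Suc n) (alt_diff X n x) =
      (\<Oplus>\<^bsub>?R\<^esub>j\<in>{0..Suc (Suc n)}. \<Oplus>\<^bsub>?R\<^esub>i\<in>{0..Suc n}. a (j, i))"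
  proof -
    have "dd (Suc n) j (alt_diff X n x) =
        (\<Oplus>\<^bsub>?R\<^esub>i\<in>{0..Suc n}. signed ?R i (dd (Suc n) j (dd n i x)))" if "j \<le> Suc (Suc n)" for j
      unfolding alt_diff_def
      by (subst additive_map_finsum[OF coface_additive[OF that]])
        (use x that in \<open>auto simp: coface_D additive_map_signed[OF coface_additive] intro!: obj.finsum_cong'\<close>)
    then have "alt_diff X (Suc n) (alt_diff X n x) = (\<Oplus>\<^bsub>?R\<^esub>j\<in>{0..Suc (Suc n)}.
        signed ?R j (\<Oplus>\<^bsub>?R\<^esub>i\<in>{0..Suc n}. signed ?R i (dd (Suc n) j (dd n i x))))"
      by (subst alt_diff_def, intro obj.finsum_cong')
        (use x in \<open>auto simp: coface_D intro!: obj.finsum_closed\<close>)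
    also have "\<dots> = (\<Oplus>\<^bsub>?R\<^esub>j\<in>{0..Suc (Suc n)}. \<Oplus>\<^bsub>?R\<^esub>i\<in>{0..Suc n}. a (j, i))"
      by (intro obj.finsum_cong' refl, use x a in \<open>auto intro!: obj.finsum_closed\<close>)
        (subst obj.finsum_signed, use x in \<open>auto simp: coface_D obj.signed_signed a_def intro!:
            obj.finsum_cong'\<close>)
    finally show ?thesis .
  qed
  also have "\<dots> = (\<Oplus>\<^bsub>?R\<^esub>p\<in>{0..Suc (Suc n)} \<times> {0..Suc n}. a (fst p, snd p))"
    by (rule obj.finsum_Sigma) (use a in auto)
  also have "\<dots> = finsum ?R a (P \<union> Q)"
    by (rule obj.finsum_cong') (use a in \<open>auto simp: P_def Q_def\<close>)
  also have "\<dots> = \<zero>\<^bsub>?R\<^esub>"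
  proof (rule obj.finsum_pairing_zero[where T = "\<lambda>p. (snd p, fst p - 1)"])
    show "finite P" by (simp add: P_def)
    show "bij_betw (\<lambda>p. (snd p, fst p - 1)) P Q"
      by (rule bij_betw_byWitness[where f' = "\<lambda>p. (Suc (snd p), fst p)"]) (auto simp: P_def Q_def)
    show "a (snd p, fst p - 1) = \<ominus>\<^bsub>?R\<^esub> a p" if "p \<in> P" for p
    proof -
      obtain j i where ji: "p = (j, i)" by (cases p)
      then have p: "p = (j, i)" "i < j" "j \<le> Suc (Suc n)" using that by (auto simp: P_def)
      have "dd (Suc n) j (dd n i x) = dd (Suc n) i (dd n (j - 1) x)"
        using p x by (simp add: coface_coface)
      moreover have "signed ?R (i + (j - 1)) y = \<ominus>\<^bsub>?R\<^esub> signed ?R (j + i) y" if "y \<in> carrier ?R" for y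
        using p(2) that obj.signed_Suc[OF that, of "i + (j - 1)"]
        by (simp add: ac_simps)
      ultimately show ?thesis
        using p x by (simp add: a_def coface_D)
    qed
  qed (use a in \<open>auto simp: P_def Q_def\<close>)
  finally show ?thesis .
qed

text \<open>
  The cofaces \<open>d\<^sup>i\<close> with \<open>i \<le> p\<close> act on the front factor and the others on the back factor. On the right hand
  side there are two further terms, the last coface on \<open>f\<close> and \<open>d\<^sup>0\<close> on \<open>g\<close>; they agree up to the sign that
  cancels
  them.
\<close>

lemma alt_diff_cup:
  assumes f: "f \<in> C p" and g: "g \<in> C q"
  shows "alt_diff X (p + q) (cup X p q f g) =
    cup X (Suc p) q (alt_diff X p f) g \<oplus>\<^bsub>cs_obj X (Suc (p + q))\<^esub>
    signed (cs_obj X (Suc (p + q))) p (cup X p (Suc q) f (alt_diff X q g))"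
proof -
  let ?R = "cs_obj X (Suc (p + q))"
  let ?F = "coface_iter X p (Suc p) (Suc q) f" and ?G = "coface_iter X q 0 (Suc p) g"
  have FG: "?F \<in> carrier ?R" "?G \<in> carrier ?R"
    using front_closed[OF f, of "Suc q"] back_closed[OF g, of "Suc p"] by simp_all
  define lo where "lo = (\<lambda>i. coface_iter X (Suc p) (Suc (Suc p)) q (dd p i f) \<otimes>\<^bsub>?R\<^esub> ?G)"
  define hi where "hi = (\<lambda>i. ?F \<otimes>\<^bsub>?R\<^esub> coface_iter X (Suc q) 0 p (dd q i g))"
  have loC: "lo i \<in> carrier ?R" if "i \<le> Suc p" for i
    using front_closed[of "dd p i f" "Suc p" q] f FG that by (simp add: lo_def coface_D)
  have hiC: "hi i \<in> carrier ?R" if "i \<le> Suc q" for i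
    using back_closed[of "dd q i g" "Suc q" p] g FG that by (simp add: hi_def coface_D)
  have d: "dd (p + q) i (cup X p q f g) =
      dd (p + q) i (coface_iter X p (Suc p) q f) \<otimes>\<^bsub>?R\<^esub> dd (p + q) i (coface_iter X q 0 p g)"
    if "i \<le> Suc (p + q)" for i
    using that front_closed[OF f, of q] back_closed[OF g, of p] by (simp add: cup_def coface_D)
  have dlo: "dd (p + q) i (cup X p q f g) = lo i" if "i \<le> p" for i
    using that d[of i] coface_front_low[OF f, of i q] coface_back_low[OF g, of i p]
    by (simp add: lo_def add.commute)
  have dhi: "dd (p + q) (Suc i + p) (cup X p q f g) = hi (Suc i)" if "i \<le> q" for i
    using that d[of "Suc i + p"] coface_front_high[OF f, of "Suc i + p" q]
      coface_back_high[OF g, of "Suc i" p]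
    by (simp add: hi_def add.commute)
  have join: "lo (Suc p) = hi 0"
    using coface_front_low[OF f, of "Suc p" q] coface_back_high[OF g, of 0 p] coface_back_low[OF g, of p p]
    by (simp add: lo_def hi_def)
  have L: "cup X (Suc p) q (alt_diff X p f) g = (\<Oplus>\<^bsub>?R\<^esub>i\<in>{..Suc p}. signed ?R i (lo i))"
  proof -
    have A: "additive_map (cs_obj X (Suc p)) ?R (\<lambda>x. cup X (Suc p) q x g)"
      using cup_bilinear(1)[of _ "Suc p" _ g q] cup_closed[of _ "Suc p" g q] g
      by (intro additive_mapI obj.is_abelian_group) simp_all
    have "lo i = cup X (Suc p) q (dd p i f) g" for i by (simp add: lo_def cup_def)
    then show ?thesis
      unfolding alt_diff_def atLeast0AtMost
      by (subst additive_map_finsum[OF A])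
        (use f loC in \<open>auto simp: coface_D additive_map_signed[OF A] intro!: obj.finsum_cong'\<close>)
  qed
  have H: "cup X p (Suc q) f (alt_diff X q g) = (\<Oplus>\<^bsub>?R\<^esub>i\<in>{..Suc q}. signed ?R i (hi i))"
  proof -
    have A: "additive_map (cs_obj X (Suc q)) ?R (cup X p (Suc q) f)"
      using cup_bilinear(2)[of f p _ "Suc q"] cup_closed[of f p _ "Suc q"] f
      by (intro additive_mapI obj.is_abelian_group) simp_all
    have "hi i = cup X p (Suc q) f (dd q i g)" for i by (simp add: hi_def cup_def)
    then show ?thesis
      unfolding alt_diff_def atLeast0AtMost
      by (subst additive_map_finsum[OF A])
        (use g hiC in \<open>auto simp: coface_D additive_map_signed[OF A] intro!: obj.finsum_cong'\<close>)
  qed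
  define A where "A = (\<Oplus>\<^bsub>?R\<^esub>i\<in>{..p}. signed ?R i (lo i))"
  define B where "B = (\<Oplus>\<^bsub>?R\<^esub>i\<in>{..q}. signed ?R (Suc i) (hi (Suc i)))"
  have AC: "A \<in> carrier ?R" "B \<in> carrier ?R"
    unfolding A_def B_def using loC hiC by (auto intro!: obj.finsum_closed)
  have L': "cup X (Suc p) q (alt_diff X p f) g = signed ?R (Suc p) (hi 0) \<oplus>\<^bsub>?R\<^esub> A"
    unfolding L A_def join[symmetric] by (rule obj.finsum_Suc) (use loC in auto)
  have H': "cup X p (Suc q) f (alt_diff X q g) = B \<oplus>\<^bsub>?R\<^esub> hi 0"
    unfolding H B_def by (subst obj.finsum_Suc2) (use hiC in \<open>auto simp: signed_def\<close>)
  have "alt_diff X (p + q) (cup X p q f g) =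
      (\<Oplus>\<^bsub>?R\<^esub>i\<in>{..p} \<union> (\<lambda>i. Suc i + p) ` {..q}. signed ?R i (dd (p + q) i (cup X p q f g)))"
    unfolding alt_diff_def
  proof (rule arg_cong[where f = "finsum ?R _"])
    have "(\<lambda>i. Suc i + p) ` {..q} = {Suc p..Suc (p + q)}"
    proof (intro Set.set_eqI iffI)
      fix i assume "i \<in> {Suc p..Suc (p + q)}"
      then show "i \<in> (\<lambda>i. Suc i + p) ` {..q}"
        by (intro image_eqI[where x = "i - Suc p"]) auto
    qed auto
    then show "{0..Suc (p + q)} = {..p} \<union> (\<lambda>i. Suc i + p) ` {..q}" by auto
  qed
  also have "\<dots> = A \<oplus>\<^bsub>?R\<^esub>
      (\<Oplus>\<^bsub>?R\<^esub>i\<in>(\<lambda>i. Suc i + p) ` {..q}. signed ?R i (dd (p + q) i (cup X p q f g)))"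
    unfolding A_def
    by (subst obj.finsum_Un_disjoint)
      (use f g in \<open>auto simp: coface_D cup_closed dlo loC intro!: arg_cong2[where f = "add _"]
          obj.finsum_cong'\<close>)
  also have "(\<Oplus>\<^bsub>?R\<^esub>i\<in>(\<lambda>i. Suc i + p) ` {..q}. signed ?R i (dd (p + q) i (cup X p q f g))) =
      (\<Oplus>\<^bsub>?R\<^esub>i\<in>{..q}. signed ?R (Suc i + p) (dd (p + q) (Suc i + p) (cup X p q f g)))"
    by (rule obj.finsum_reindex) (use f g in \<open>auto simp: coface_D cup_closed inj_on_def\<close>)
  also have "\<dots> = signed ?R p B"
    unfolding B_def
    by (subst obj.finsum_signed)
      (use hiC dhi in \<open>auto simp: obj.signed_signed add.commute intro!: obj.finsum_cong'\<close>)
  also have "A \<oplus>\<^bsub>?R\<^esub> signed ?R p B =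
      (signed ?R (Suc p) (hi 0) \<oplus>\<^bsub>?R\<^esub> A) \<oplus>\<^bsub>?R\<^esub> signed ?R p (B \<oplus>\<^bsub>?R\<^esub> hi 0)"
    using AC hiC[of 0] by (simp add: obj.signed_add obj.signed_Suc obj.a_ac obj.r_neg obj.r_neg1 obj.r_neg2)
  finally show ?thesis unfolding L' H' .
qed

theorem dg_algebra_XN: "dg_algebra k XN"
proof (rule dg_algebra.intro)
  show "Module.module k (dg_gr XN n)" for n by (rule XN_module)
  show "dg_diff XN (p + q) (dg_mult XN p q f g) =
      dg_mult XN (Suc p) q (dg_diff XN p f) g \<oplus>\<^bsub>dg_gr XN (Suc (p + q))\<^esub>
      signed (dg_gr XN (Suc (p + q))) p (dg_mult XN p (Suc q) f (dg_diff XN q g))"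
    if "f \<in> carrier (dg_gr XN p)" "g \<in> carrier (dg_gr XN q)" for f g p q
    using that alt_diff_cup[of f p g q] cup_N[of f p "alt_diff X q g" "Suc q"]
    by (simp add: N_carrier alt_diff_N)
qed (auto simp: N_0 N_carrier cup_N cup_assoc cup_one_left cup_one_right cup_bilinear alt_diff_N
    alt_diff_add alt_diff_smult alt_diff_alt_diff)

end

section \<open>The differentiating ideal\<close>

text \<open>
  \<open>J + \<delta>J\<close>, written as in the definition of the ideal \<^const>\<open>sm_Jhat\<close>.
\<close>

definition explicit_ideal :: "('k, 'a) cosimplicial \<Rightarrow> nat \<Rightarrow> 'a set"
  where "explicit_ideal X n = (case n of 0 \<Rightarrow> differentiating X 0
     | Suc m \<Rightarrow> differentiating X n <+>\<^bsub>cs_obj X n\<^esub> (alt_diff X m ` differentiating X m))"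

context cosimplicial_algebra
begin

abbreviation "J \<equiv> differentiating X"
abbreviation "Jhat \<equiv> explicit_ideal X"

definition sq :: "nat \<Rightarrow> nat \<Rightarrow> 'a set"
  where "sq n j = ideal_prod (cs_obj X n) (I n j) (I n j)"

lemma sq_ideal: "1 \<le> j \<Longrightarrow> j \<le> n \<Longrightarrow> ideal (sq n j) (cs_obj X n)"
  unfolding sq_def using obj.ideal_prod_is_ideal ker_ideal' by blast

lemma sq_carrier: "1 \<le> j \<Longrightarrow> j \<le> n \<Longrightarrow> x \<in> sq n j \<Longrightarrow> x \<in> C n"
  using ideal.Icarr[OF sq_ideal] .

lemma sq_zero: "1 \<le> j \<Longrightarrow> j \<le> n \<Longrightarrow> \<zero>\<^bsub>cs_obj X n\<^esub> \<in> sq n j"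
  by (rule additive_subgroup.zero_closed[OF ideal.axioms(1)[OF sq_ideal]])

lemma sq_add: "1 \<le> j \<Longrightarrow> j \<le> n \<Longrightarrow> x \<in> sq n j \<Longrightarrow> y \<in> sq n j \<Longrightarrow> x \<oplus>\<^bsub>cs_obj X n\<^esub> y \<in> sq n j"
  by (rule additive_subgroup.a_closed[OF ideal.axioms(1)[OF sq_ideal]])

lemma sq_neg: "1 \<le> j \<Longrightarrow> j \<le> n \<Longrightarrow> x \<in> sq n j \<Longrightarrow> \<ominus>\<^bsub>cs_obj X n\<^esub> x \<in> sq n j"
  by (rule additive_subgroup.a_inv_closed[OF ideal.axioms(1)[OF sq_ideal]])

lemma sq_mult:
  "1 \<le> j \<Longrightarrow> j \<le> n \<Longrightarrow> x \<in> sq n j \<Longrightarrow> y \<in> C n \<Longrightarrow> x \<otimes>\<^bsub>cs_obj X n\<^esub> y \<in> sq n j"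
  "1 \<le> j \<Longrightarrow> j \<le> n \<Longrightarrow> x \<in> sq n j \<Longrightarrow> y \<in> C n \<Longrightarrow> y \<otimes>\<^bsub>cs_obj X n\<^esub> x \<in> sq n j"
  using ideal.I_r_closed[OF sq_ideal] ideal.I_l_closed[OF sq_ideal] by blast+

lemma sq_hom:
  assumes "h \<in> alg_hom k (cs_obj X n) B" "1 \<le> j" "j \<le> n" "\<And>x. x \<in> I n j \<Longrightarrow> h x \<in> I'"
    and "w \<in> sq n j"
  shows "h w \<in> ideal_prod B I' I'"
proof (rule ideal_prod_hom_image[where A = "cs_obj X n" and I = "I n j"])
  show "h \<in> ring_hom (cs_obj X n) B" using assms(1) by (simp add: alg_hom_def)
  show "I n j \<subseteq> C n" using ideal.Icarr[OF ker_ideal'[OF assms(2,3)]] by blast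
qed (use assms in \<open>simp_all add: obj.ring_axioms sq_def\<close>)

lemma J_def': "J n = {finsum (cs_obj X n) x {1..n} | x. x \<in> (\<Pi> j\<in>{1..n}. sq n j \<inter> N n)}"
  by (simp add: differentiating_def sq_def)

lemma J_memI: "x \<in> (\<Pi> j\<in>{1..n}. sq n j \<inter> N n) \<Longrightarrow> finsum (cs_obj X n) x {1..n} \<in> J n"
  unfolding J_def' by blast

text \<open>
  Membership in \<open>J\<close> as an induction rule over the summands. Normality of the partial
  sums is carried along, so that maps that are additive on \<open>X\<^sub>N\<close> can be treated in the step for sums.
\<close>

lemma J_induct:
  assumes "x \<in> J n" "P \<zero>\<^bsub>cs_obj X n\<^esub>"
    and "\<And>j y. 1 \<le> j \<Longrightarrow> j \<le> n \<Longrightarrow> y \<in> sq n j \<Longrightarrow> y \<in> N n \<Longrightarrow> P y"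
    and "\<And>y z. y \<in> N n \<Longrightarrow> z \<in> N n \<Longrightarrow> P y \<Longrightarrow> P z \<Longrightarrow> P (y \<oplus>\<^bsub>cs_obj X n\<^esub> z)"
  shows "x \<in> N n \<and> P x"
proof -
  obtain f where f: "f \<in> (\<Pi> j\<in>{1..n}. sq n j \<inter> N n)" and x: "x = finsum (cs_obj X n) f {1..n}"
    using assms(1) by (auto simp: J_def')
  have "finsum (cs_obj X n) f B \<in> N n \<and> P (finsum (cs_obj X n) f B)" if "finite B" "B \<subseteq> {1..n}" for B
    using that
  proof (induction B)
    case empty
    then show ?case using assms(2) by (simp add: N_zero)
  next
    case (insert j B)
    have j: "1 \<le> j" "j \<le> n" "f j \<in> sq n j" "f j \<in> N n" using insert f by auto
    have "finsum (cs_obj X n) f (insert j B) = f j \<oplus>\<^bsub>cs_obj X n\<^esub> finsum (cs_obj X n) f B"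
      using insert f j by (intro obj.finsum_insert) (blast intro: N_carrier)+
    with insert j assms(3)[OF j] show ?case by (auto simp: N_add intro!: assms(4))
  qed
  then show ?thesis unfolding x by blast
qed

lemma J_N: "x \<in> J n \<Longrightarrow> x \<in> N n"
  using J_induct[of x n "\<lambda>_. True"] by simp

lemma J_zero: "\<zero>\<^bsub>cs_obj X n\<^esub> \<in> J n"
  unfolding J_def'
  by (rule CollectI, rule exI[of _ "\<lambda>_. \<zero>\<^bsub>cs_obj X n\<^esub>"]) (auto simp: sq_zero N_zero obj.finsum_zero)

lemma J_add:
  assumes "x \<in> J n" "y \<in> J n"
  shows "x \<oplus>\<^bsub>cs_obj X n\<^esub> y \<in> J n"
proof -
  obtain f g where f: "f \<in> (\<Pi> j\<in>{1..n}. sq n j \<inter> N n)" "x = finsum (cs_obj X n) f {1..n}"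
    and g: "g \<in> (\<Pi> j\<in>{1..n}. sq n j \<inter> N n)" "y = finsum (cs_obj X n) g {1..n}"
    using assms by (auto simp: J_def')
  have "x \<oplus>\<^bsub>cs_obj X n\<^esub> y = finsum (cs_obj X n) (\<lambda>j. f j \<oplus>\<^bsub>cs_obj X n\<^esub> g j) {1..n}"
    using f g by (subst obj.finsum_addf) (auto simp: Pi_iff N_carrier)
  moreover have "(\<lambda>j. f j \<oplus>\<^bsub>cs_obj X n\<^esub> g j) \<in> (\<Pi> j\<in>{1..n}. sq n j \<inter> N n)"
    using f g by (auto simp: Pi_iff sq_add N_add)
  ultimately show ?thesis using J_memI by simp
qed

lemma sq_J:
  assumes "1 \<le> j" "j \<le> n" "x \<in> sq n j" "x \<in> N n"
  shows "x \<in> J n"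
proof -
  let ?f = "\<lambda>i. if i = j then x else \<zero>\<^bsub>cs_obj X n\<^esub>"
  have "finsum (cs_obj X n) ?f {1..n} = x"
    using obj.finsum_single[of "{1..n}" j ?f] assms by (simp add: N_carrier)
  moreover have "?f \<in> (\<Pi> j\<in>{1..n}. sq n j \<inter> N n)"
    using assms by (auto simp: sq_zero N_zero)
  ultimately show ?thesis using J_memI[of ?f n] by simp
qed

lemma J_neg:
  assumes "x \<in> J n"
  shows "\<ominus>\<^bsub>cs_obj X n\<^esub> x \<in> J n"
proof (rule conjunct2[OF J_induct[OF assms, where P = "\<lambda>x. \<ominus>\<^bsub>cs_obj X n\<^esub> x \<in> J n"]])
  show "\<ominus>\<^bsub>cs_obj X n\<^esub> y \<in> J n" if "1 \<le> j" "j \<le> n" "y \<in> sq n j" "y \<in> N n" for j y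
    using that by (intro sq_J[of j] sq_neg N_neg)
qed (simp_all add: J_zero J_add obj.minus_add N_carrier)

lemma back_hom: "coface_iter X q 0 p \<in> alg_hom k (cs_obj X q) (cs_obj X (p + q))"
  using iter_hom[of 0 q p] by (simp add: add.commute)

text \<open>
  The back inclusion carries \<open>I\<^sub>q\<^sub>,\<^sub>j\<close> into \<open>I\<^bsub>p+q,p+j\<^esub>\<close>, hence squares into squares, and these are ideals.
\<close>

lemma J_cup_left:
  assumes f: "f \<in> N p" and g: "g \<in> J q"
  shows "cup X p q f g \<in> J (p + q)"
proof -
  note fC = N_carrier[OF f]
  have A: "additive_map (cs_obj X q) (cs_obj X (p + q)) (cup X p q f)"
    by (intro additive_mapI obj.is_abelian_group) (use fC in \<open>simp_all add: cup_closed cup_bilinear\<close>)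
  have "cup X p q f y \<in> J (p + q)" if j: "1 \<le> j" "j \<le> q" "y \<in> sq q j" "y \<in> N q" for j y
  proof -
    have "coface_iter X q 0 p y \<in> sq (p + q) (p + j)"
      unfolding sq_def
      by (rule sq_hom[OF _ j(1,2) _ j(3)]) (use back_hom[of q p] j back_ker in auto)
    then have "cup X p q f y \<in> sq (p + q) (p + j)"
      unfolding cup_def using j front_closed[OF fC] by (intro sq_mult) auto
    then show ?thesis using j cup_N[OF f j(4)] by (intro sq_J[of "p + j"]) auto
  qed
  then show ?thesis
    using J_induct[OF g, of "\<lambda>y. cup X p q f y \<in> J (p + q)"]
    by (auto simp: additive_map_zero[OF A] additive_map_add[OF A] J_zero J_add N_carrier)
qed

lemma J_cup_right:
  assumes f: "f \<in> J p" and g: "g \<in> N q"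
  shows "cup X p q f g \<in> J (p + q)"
proof -
  note gC = N_carrier[OF g]
  have A: "additive_map (cs_obj X p) (cs_obj X (p + q)) (\<lambda>f. cup X p q f g)"
    by (intro additive_mapI obj.is_abelian_group) (use gC in \<open>simp_all add: cup_closed cup_bilinear\<close>)
  have "cup X p q y g \<in> J (p + q)" if j: "1 \<le> j" "j \<le> p" "y \<in> sq p j" "y \<in> N p" for j y
  proof -
    have "coface_iter X p (Suc p) q y \<in> sq (p + q) j"
      unfolding sq_def
      by (rule sq_hom[OF _ j(1,2) _ j(3)]) (use iter_hom[of "Suc p" p q] j front_ker in auto)
    then have "cup X p q y g \<in> sq (p + q) j"
      unfolding cup_def using j back_closed[OF gC] by (intro sq_mult) auto
    then show ?thesis using j cup_N[OF j(4) g] by (intro sq_J[of j]) auto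
  qed
  then show ?thesis
    using J_induct[OF f, of "\<lambda>y. cup X p q y g \<in> J (p + q)"]
    by (auto simp: additive_map_zero[OF A] additive_map_add[OF A] J_zero J_add N_carrier)
qed

lemma Jhat_0: "Jhat 0 = J 0"
  by (simp add: explicit_ideal_def)

lemma Jhat_Suc: "Jhat (Suc m) = {a \<oplus>\<^bsub>cs_obj X (Suc m)\<^esub> alt_diff X m b | a b. a \<in> J (Suc m) \<and> b \<in> J m}"
  by (auto simp: explicit_ideal_def set_add_def' simp del: Un_iff)

lemma J_Jhat: "x \<in> J n \<Longrightarrow> x \<in> Jhat n"
proof (cases n)
  case (Suc m)
  assume x: "x \<in> J n"
  have "x = x \<oplus>\<^bsub>cs_obj X (Suc m)\<^esub> alt_diff X m \<zero>\<^bsub>cs_obj X m\<^esub>"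
    using N_carrier[OF J_N[OF x]] Suc by (simp add: additive_map_zero[OF alt_diff_additive])
  then show ?thesis using x J_zero[of m] unfolding Suc Jhat_Suc by blast
qed (simp add: Jhat_0)

lemma dJ_Jhat: "x \<in> J n \<Longrightarrow> alt_diff X n x \<in> Jhat (Suc n)"
proof -
  assume x: "x \<in> J n"
  have "alt_diff X n x = \<zero>\<^bsub>cs_obj X (Suc n)\<^esub> \<oplus>\<^bsub>cs_obj X (Suc n)\<^esub> alt_diff X n x"
    using alt_diff_closed[OF N_carrier[OF J_N[OF x]]] by simp
  then show ?thesis using x J_zero[of "Suc n"] unfolding Jhat_Suc by blast
qed

lemma Jhat_cases:
  assumes "x \<in> Jhat n"
  obtains (J) "x \<in> J n"
  | (dJ) m a b where "n = Suc m" "a \<in> J n" "b \<in> J m" "x = a \<oplus>\<^bsub>cs_obj X n\<^esub> alt_diff X m b"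
  using assms by (cases n) (auto simp: Jhat_0 Jhat_Suc)

lemma Jhat_N: "x \<in> Jhat n \<Longrightarrow> x \<in> N n"
  by (erule Jhat_cases) (auto simp: J_N N_add alt_diff_N)

lemma Jhat_add:
  assumes "x \<in> Jhat n" "y \<in> Jhat n"
  shows "x \<oplus>\<^bsub>cs_obj X n\<^esub> y \<in> Jhat n"
proof (cases n)
  case 0
  then show ?thesis using assms by (simp add: Jhat_0 J_add)
next
  case (Suc m)
  obtain a b a' b' where ab: "a \<in> J n" "b \<in> J m" "x = a \<oplus>\<^bsub>cs_obj X n\<^esub> alt_diff X m b"
    "a' \<in> J n" "b' \<in> J m" "y = a' \<oplus>\<^bsub>cs_obj X n\<^esub> alt_diff X m b'"
    using assms unfolding Suc Jhat_Suc by blast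
  have "a \<in> C n" "a' \<in> C n" "b \<in> C m" "b' \<in> C m"
    using ab by (auto simp: N_carrier J_N)
  moreover from this have "alt_diff X m b \<in> C n" "alt_diff X m b' \<in> C n"
    using alt_diff_closed Suc by auto
  ultimately have "x \<oplus>\<^bsub>cs_obj X n\<^esub> y = (a \<oplus>\<^bsub>cs_obj X n\<^esub> a') \<oplus>\<^bsub>cs_obj X n\<^esub> alt_diff X m (b \<oplus>\<^bsub>cs_obj X m\<^esub> b')"
    using ab Suc by (simp add: alt_diff_add obj.a_ac)
  then show ?thesis using ab J_add unfolding Suc Jhat_Suc by blast
qed

lemma Jhat_neg:
  assumes "x \<in> Jhat n"
  shows "\<ominus>\<^bsub>cs_obj X n\<^esub> x \<in> Jhat n"
proof (cases rule: Jhat_cases[OF assms])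
  case 1
  then show ?thesis by (simp add: J_Jhat J_neg)
next
  case (2 m a b)
  then have "\<ominus>\<^bsub>cs_obj X n\<^esub> x = \<ominus>\<^bsub>cs_obj X n\<^esub> a \<oplus>\<^bsub>cs_obj X n\<^esub> alt_diff X m (\<ominus>\<^bsub>cs_obj X m\<^esub> b)"
    using alt_diff_closed[of b m]
    by (simp add: additive_map_neg[OF alt_diff_additive] N_carrier J_N obj.minus_add)
  then show ?thesis using 2 by (auto intro!: Jhat_add simp: J_Jhat J_neg dJ_Jhat)
qed

lemma Jhat_signed: "x \<in> Jhat n \<Longrightarrow> signed (cs_obj X n) m x \<in> Jhat n"
  by (simp add: signed_def Jhat_neg)

text \<open>
  By the Leibniz rule \<open>f \<union> \<delta>b\<close> is, up to sign, \<open>\<delta>(f \<union> b) - \<delta>f \<union> b\<close>, and both \<open>f \<union> b\<close> and \<open>\<delta>f \<union> b\<close> lie in \<open>J\<close>.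
\<close>

lemma cup_dJ:
  assumes f: "f \<in> N p" and b: "b \<in> J m"
  shows "cup X p (Suc m) f (alt_diff X m b) \<in> Jhat (p + Suc m)"
proof -
  let ?R = "cs_obj X (Suc (p + m))"
  note fC = N_carrier[OF f] and bC = N_carrier[OF J_N[OF b]]
  define u v w where "u = alt_diff X (p + m) (cup X p m f b)"
    and "v = cup X (Suc p) m (alt_diff X p f) b"
    and "w = cup X p (Suc m) f (alt_diff X m b)"
  have C: "u \<in> carrier ?R" "v \<in> carrier ?R" "w \<in> carrier ?R"
    using cup_closed[OF fC bC] cup_closed[OF alt_diff_closed[OF fC] bC]
      cup_closed[OF fC alt_diff_closed[OF bC]] by (simp_all add: u_def v_def w_def alt_diff_closed)
  have eq: "u = v \<oplus>\<^bsub>?R\<^esub> signed ?R p w"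
    unfolding u_def v_def w_def by (rule alt_diff_cup[OF fC bC])
  have "w = signed ?R p (u \<oplus>\<^bsub>?R\<^esub> \<ominus>\<^bsub>?R\<^esub> v)"
    using C unfolding eq by (simp add: obj.a_ac obj.r_neg1 obj.r_neg2 obj.r_neg obj.signed_signed)
      (simp add: signed_def)
  moreover have "u \<in> Jhat (Suc (p + m))" unfolding u_def by (intro dJ_Jhat J_cup_left f b)
  moreover have "v \<in> Jhat (Suc (p + m))"
    unfolding v_def using J_cup_left[OF alt_diff_N[OF f] b] by (intro J_Jhat) simp
  ultimately show ?thesis
    unfolding w_def[symmetric] by (simp add: Jhat_signed Jhat_add Jhat_neg)
qed

lemma dJ_cup:
  assumes b: "b \<in> J m" and g: "g \<in> N q"
  shows "cup X (Suc m) q (alt_diff X m b) g \<in> Jhat (Suc m + q)"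
proof -
  let ?R = "cs_obj X (Suc (m + q))"
  note gC = N_carrier[OF g] and bC = N_carrier[OF J_N[OF b]]
  define u v w where "u = alt_diff X (m + q) (cup X m q b g)"
    and "v = cup X (Suc m) q (alt_diff X m b) g"
    and "w = cup X m (Suc q) b (alt_diff X q g)"
  have C: "u \<in> carrier ?R" "v \<in> carrier ?R" "w \<in> carrier ?R"
    using cup_closed[OF bC gC] cup_closed[OF alt_diff_closed[OF bC] gC]
      cup_closed[OF bC alt_diff_closed[OF gC]] by (simp_all add: u_def v_def w_def alt_diff_closed)
  have eq: "u = v \<oplus>\<^bsub>?R\<^esub> signed ?R m w"
    unfolding u_def v_def w_def by (rule alt_diff_cup[OF bC gC])
  have "v = u \<oplus>\<^bsub>?R\<^esub> \<ominus>\<^bsub>?R\<^esub> signed ?R m w"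
    using C unfolding eq by (simp add: obj.a_assoc obj.r_neg)
  moreover have "u \<in> Jhat (Suc (m + q))" unfolding u_def by (intro dJ_Jhat J_cup_right g b)
  moreover have "w \<in> Jhat (Suc (m + q))"
    unfolding w_def using J_cup_right[OF b alt_diff_N[OF g]] by (intro J_Jhat) simp
  ultimately show ?thesis
    unfolding v_def[symmetric] by (simp add: Jhat_signed Jhat_add Jhat_neg)
qed

theorem Jhat_dg_ideal: "dg_ideal XN Jhat"
proof -
  have "additive_subgroup (Jhat n) (dg_gr XN n)" for n
  proof -
    interpret M: Module.module k "dg_gr XN n" by (rule XN_module)
    show ?thesis
    proof (rule additive_subgroup.intro, rule group.subgroupI)
      show "group (add_monoid (dg_gr XN n))" by (rule M.a_group)
      show "inv\<^bsub>add_monoid (dg_gr XN n)\<^esub> a \<in> Jhat n" if "a \<in> Jhat n" for a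
      proof -
        have "\<ominus>\<^bsub>dg_gr XN n\<^esub> a \<in> Jhat n" using that by (simp add: Jhat_N Jhat_neg)
        then show ?thesis by (simp only: a_inv_def)
      qed
      show "Jhat n \<noteq> {}" using J_Jhat[OF J_zero] by blast
    qed (auto simp: Jhat_N Jhat_add)
  qed
  moreover have "cup X p q x y \<in> Jhat (p + q)" if x: "x \<in> Jhat p" and y: "y \<in> N q" for p q x y
  proof (cases rule: Jhat_cases[OF x])
    case 1
    then show ?thesis using y by (intro J_Jhat J_cup_right)
  next
    case (2 m a b)
    then have "cup X p q x y = cup X p q a y \<oplus>\<^bsub>cs_obj X (p + q)\<^esub> cup X p q (alt_diff X m b) y"
      using y by (simp add: cup_bilinear N_carrier J_N alt_diff_closed)
    moreover have "cup X p q a y \<in> Jhat (p + q)" using 2 y by (intro J_Jhat J_cup_right)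
    ultimately show ?thesis using 2 y dJ_cup[of b m y q] Jhat_add by simp
  qed
  moreover have "cup X p q x y \<in> Jhat (p + q)" if x: "x \<in> N p" and y: "y \<in> Jhat q" for p q x y
  proof (cases rule: Jhat_cases[OF y])
    case 1
    then show ?thesis using x by (intro J_Jhat J_cup_left)
  next
    case (2 m a b)
    then have "cup X p q x y = cup X p q x a \<oplus>\<^bsub>cs_obj X (p + q)\<^esub> cup X p q x (alt_diff X m b)"
      using x by (simp add: cup_bilinear N_carrier J_N alt_diff_closed)
    moreover have "cup X p q x a \<in> Jhat (p + q)" using 2 x by (intro J_Jhat J_cup_left)
    ultimately show ?thesis using 2 x cup_dJ[of x p b m] Jhat_add by simp
  qed
  moreover have "alt_diff X n x \<in> Jhat (Suc n)" if x: "x \<in> Jhat n" for n x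
  proof (cases rule: Jhat_cases[OF x])
    case 1
    then show ?thesis by (rule dJ_Jhat)
  next
    case (2 m a b)
    then have "alt_diff X n x = alt_diff X n a"
      using alt_diff_closed[of a "Suc m"]
      by (simp add: alt_diff_add alt_diff_closed alt_diff_alt_diff N_carrier J_N)
    then show ?thesis using 2 by (simp add: dJ_Jhat)
  qed
  ultimately show ?thesis unfolding dg_ideal_def by simp
qed

text \<open>
  Any differential ideal containing \<open>J\<close> contains \<open>\<delta>J\<close>, and \<open>J + \<delta>J\<close> is one.
\<close>

theorem differentiating_ideal_explicit: "differentiating_ideal X = Jhat"
proof
  fix n
  have "Jhat n \<subseteq> A n" if A: "dg_ideal XN A" "\<forall>m. J m \<subseteq> A m" for A
  proof
    interpret Q: dg_quotient k XN A
      using A(1) dg_algebra_XN by (intro dg_quotient.intro dg_quotient_axioms.intro)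
    fix x assume x: "x \<in> Jhat n"
    then show "x \<in> A n"
    proof (cases rule: Jhat_cases)
      case J
      then show ?thesis using A by blast
    next
      case (dJ m a b)
      moreover have "a \<in> A n" "b \<in> A m" using A(2) dJ by blast+
      ultimately have "a \<in> A n" "alt_diff X m b \<in> A n" using A(1) by (auto simp: dg_ideal_def)
      then show ?thesis using dJ Q.ideal_add by simp
    qed
  qed
  then show "differentiating_ideal X n = Jhat n"
    unfolding differentiating_ideal_def dg_genideal_def
  proof (intro equalityI Inter_greatest Inter_lower)
    show "Jhat n \<in> {A n | A. dg_ideal XN A \<and> (\<forall>m. J m \<subseteq> A m)}"
      using Jhat_dg_ideal J_Jhat by auto
  qed auto
qed

end

sublocale cosimplicial_algebra \<subseteq> nd: dg_quotient k "normalization X" "differentiating_ideal X"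
  using dg_algebra_XN Jhat_dg_ideal
  by (simp add: dg_quotient_def dg_quotient_axioms_def differentiating_ideal_explicit)

section \<open>Functoriality of the abstract differentiation\<close>

lemma cs_hom_D:
  assumes "f \<in> cs_hom k X X'"
  shows "f n \<in> alg_hom k (cs_obj X n) (cs_obj X' n)"
    "f n \<in> extensional (carrier (cs_obj X n))"
    "i \<le> Suc n \<Longrightarrow> x \<in> carrier (cs_obj X n) \<Longrightarrow>
       f (Suc n) (cs_coface X n i x) = cs_coface X' n i (f n x)"
    "j \<le> n \<Longrightarrow> x \<in> carrier (cs_obj X (Suc n)) \<Longrightarrow>
       f n (cs_codegen X n j x) = cs_codegen X' n j (f (Suc n) x)"
  using assms by (auto simp: cs_hom_def)

lemma cs_homI:
  assumes "\<And>n. f n \<in> alg_hom k (cs_obj X n) (cs_obj X' n)"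
    "\<And>n. f n \<in> extensional (carrier (cs_obj X n))"
    "\<And>n i x. i \<le> Suc n \<Longrightarrow> x \<in> carrier (cs_obj X n) \<Longrightarrow>
       f (Suc n) (cs_coface X n i x) = cs_coface X' n i (f n x)"
    "\<And>n j x. j \<le> n \<Longrightarrow> x \<in> carrier (cs_obj X (Suc n)) \<Longrightarrow>
       f n (cs_codegen X n j x) = cs_codegen X' n j (f (Suc n) x)"
  shows "f \<in> cs_hom k X X'"
  using assms by (auto simp: cs_hom_def)

lemma cs_hom_eqI:
  assumes "f \<in> cs_hom k X X'" "g \<in> cs_hom k X X''"
    and "\<And>n x. x \<in> carrier (cs_obj X n) \<Longrightarrow> f n x = g n x"
  shows "f = g"
  using extensionalityI[OF cs_hom_D(2)[OF assms(1)] cs_hom_D(2)[OF assms(2)]] assms(3) by blast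

lemma alg_hom_restrict:
  assumes "h \<in> alg_hom k A B" "assoc_algebra k A"
  shows "restrict h (carrier A) \<in> alg_hom k A B"
proof -
  interpret A: ring A using assms(2) by (simp add: assoc_algebra_def)
  interpret M: Module.module k A using assms(2) by (simp add: assoc_algebra_def)
  show ?thesis
    by (rule alg_homI) (simp_all add: alg_hom_D[OF assms(1)] M.smult_closed)
qed

lemma cs_hom_id:
  assumes "cosimplicial_algebra k X"
  shows "cs_id X \<in> cs_hom k X X"
proof -
  interpret X: cosimplicial_algebra k X by fact
  show ?thesis
  proof (rule cs_homI)
    show "cs_id X n \<in> alg_hom k (cs_obj X n) (cs_obj X n)" for n
      unfolding cs_id_def by (rule alg_hom_restrict[OF _ X.obj_algebra]) (rule alg_homI, auto)
  qed (simp_all add: cs_id_def X.coface_D X.codegen_D)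
qed

lemma cs_hom_comp:
  assumes f: "f \<in> cs_hom k X Y" and g: "g \<in> cs_hom k Y Z" and X: "cosimplicial_algebra k X"
  shows "cs_comp X g f \<in> cs_hom k X Z"
proof -
  interpret X: cosimplicial_algebra k X by fact
  show ?thesis
  proof (rule cs_homI)
    show "cs_comp X g f n \<in> alg_hom k (cs_obj X n) (cs_obj Z n)" for n
      unfolding cs_comp_def compose_def
      by (rule alg_hom_restrict[OF _ X.obj_algebra])
        (rule alg_hom_comp[OF cs_hom_D(1)[OF f] cs_hom_D(1)[OF g]])
  qed (simp_all add: cs_comp_def compose_def X.coface_D X.codegen_D cs_hom_D[OF f] cs_hom_D[OF g]
      alg_hom_D[OF cs_hom_D(1)[OF f]])
qed

locale cosimplicial_morphism =
  src: cosimplicial_algebra k X + tgt: cosimplicial_algebra k X'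
  for k :: "'k ring" and X :: "('k, 'a) cosimplicial" and X' :: "('k, 'b) cosimplicial" +
  fixes h
  assumes h: "h \<in> cs_hom k X X'"
begin

lemmas h_alg = cs_hom_D(1)[OF h]
lemmas h_D = alg_hom_D[OF h_alg]
lemmas h_coface = cs_hom_D(3)[OF h]
lemmas h_codegen = cs_hom_D(4)[OF h]

lemma h_additive: "additive_map (cs_obj X n) (cs_obj X' n) (h n)"
  by (rule alg_hom_additive[OF h_alg src.obj_algebra tgt.obj_algebra])

lemma h_iter: "c \<le> Suc n \<Longrightarrow> x \<in> src.C n \<Longrightarrow>
    h (n + q) (coface_iter X n c q x) = coface_iter X' n c q (h n x)"
  by (induction q) (simp_all add: h_coface src.iter_closed)

lemma h_cup:
  assumes "f \<in> src.C p" "g \<in> src.C q"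
  shows "h (p + q) (cup X p q f g) = cup X' p q (h p f) (h q g)"
  using assms h_iter[of 0 q g p]
  by (simp add: cup_def h_D src.front_closed src.back_closed h_iter add.commute)

lemma h_alt_diff:
  assumes "x \<in> src.C n"
  shows "h (Suc n) (alt_diff X n x) = alt_diff X' n (h n x)"
  unfolding alt_diff_def
  by (subst additive_map_finsum[OF h_additive])
    (use assms in \<open>auto simp: src.coface_D additive_map_signed[OF h_additive] h_coface h_D
        tgt.coface_D intro!: tgt.obj.finsum_cong'\<close>)

lemma h_ker:
  assumes "x \<in> src.I n j" "1 \<le> j" "j \<le> n"
  shows "h n x \<in> tgt.I n j"
proof -
  obtain m i where m: "n = Suc m" "j = Suc i" using assms by (metis Suc_le_D One_nat_def le_trans)
  then show ?thesis
    using assms h_codegen[of i m x]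
    by (auto simp: src.ker_Suc tgt.ker_Suc h_D additive_map_zero[OF h_additive])
qed

lemma h_N: "x \<in> src.N n \<Longrightarrow> h n x \<in> tgt.N n"
  by (intro tgt.NI h_ker) (auto simp: src.N_carrier h_D src.N_I)

lemma h_J:
  assumes "x \<in> src.J n"
  shows "h n x \<in> tgt.J n"
proof (rule conjunct2[OF src.J_induct[OF assms, where P = "\<lambda>x. h n x \<in> tgt.J n"]])
  show "h n y \<in> tgt.J n" if j: "1 \<le> j" "j \<le> n" "y \<in> src.sq n j" "y \<in> src.N n" for j y
  proof (rule tgt.sq_J[OF j(1,2)])
    show "h n y \<in> tgt.sq n j"
      unfolding tgt.sq_def using j h_ker by (intro src.sq_hom[OF h_alg j(1,2) _ j(3)]) auto
  qed (simp add: h_N j)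
qed (simp_all add: additive_map_zero[OF h_additive] tgt.J_zero h_D src.N_carrier tgt.J_add)

lemma h_Jhat:
  assumes "x \<in> src.Jhat n"
  shows "h n x \<in> tgt.Jhat n"
proof (cases rule: src.Jhat_cases[OF assms])
  case 1
  then show ?thesis by (intro tgt.J_Jhat h_J)
next
  case (2 m a b)
  then have "h n x = h n a \<oplus>\<^bsub>cs_obj X' n\<^esub> alt_diff X' m (h m b)"
    by (simp add: h_D src.N_carrier src.J_N src.alt_diff_closed h_alt_diff)
  moreover have "h n a \<in> tgt.Jhat n" "alt_diff X' m (h m b) \<in> tgt.Jhat n"
    using 2 by (auto intro!: tgt.J_Jhat h_J tgt.dJ_Jhat)
  ultimately show ?thesis by (simp add: tgt.Jhat_add)
qed

lemma h_ideal: "x \<in> differentiating_ideal X n \<Longrightarrow> h n x \<in> differentiating_ideal X' n"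
  using h_Jhat by (simp add: src.differentiating_ideal_explicit tgt.differentiating_ideal_explicit)

lemma normalized_hom: "(\<lambda>n. restrict (h n) (src.N n)) \<in> dg_hom k (normalization X) (normalization X')"
  by (rule dg_homI)
    (simp_all add: src.cup_N src.alt_diff_N h_N h_D src.N_carrier h_cup h_alt_diff src.N_add src.N_smult
      src.N_0)

lemma abs_diff_map_cls:
  assumes x: "x \<in> src.N n"
  shows "abs_diff_map X X' h n (src.nd.cls n x) = tgt.nd.cls n (h n x)"
proof -
  have "(\<Union>y\<in>src.nd.cls n x. tgt.nd.cls n (h n y)) = tgt.nd.cls n (h n x)"
  proof (rule src.nd.UN_cls)
    fix y assume "y \<in> src.nd.cls n x"
    then have y: "y \<in> src.N n" "y \<ominus>\<^bsub>cs_obj X n\<^esub> x \<in> differentiating_ideal X n"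
      using src.nd.cls_memD[of x n y] x by simp_all
    have "h n (y \<ominus>\<^bsub>cs_obj X n\<^esub> x) \<in> differentiating_ideal X' n" by (rule h_ideal[OF y(2)])
    then show "tgt.nd.cls n (h n y) = tgt.nd.cls n (h n x)"
      using x y by (simp add: tgt.nd.cls_eq h_N additive_map_minus[OF h_additive] src.N_carrier)
  qed (simp add: x)
  moreover have "src.nd.cls n x \<in> carrier (dg_gr (abs_diff X) n)"
    using x src.nd.cls_closed[of x n] by (simp add: abs_diff_def)
  ultimately show ?thesis
    by (simp add: abs_diff_map_def tgt.nd.cls_def)
qed

lemma abs_diff_map_hom: "abs_diff_map X X' h \<in> dg_hom k (abs_diff X) (abs_diff X')"
proof (rule dg_homI)
  show "abs_diff_map X X' h n \<in> extensional (carrier (dg_gr (abs_diff X) n))" for n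
    by (simp add: abs_diff_map_def)
qed (unfold abs_diff_def,
    auto simp: src.nd.carrier_Q abs_diff_map_cls src.nd.cls_add src.nd.cls_smult src.nd.cls_mult
      src.nd.cls_diff src.nd.one_Q tgt.nd.cls_add tgt.nd.cls_smult tgt.nd.cls_mult
      tgt.nd.cls_diff tgt.nd.one_Q h_N src.N_add src.N_smult src.cup_N src.alt_diff_N src.N_0
      h_D src.N_carrier h_cup h_alt_diff intro!: tgt.nd.cls_closed)

end

lemma abs_diff_hom_eqI:
  assumes "cosimplicial_algebra k X" "\<phi> \<in> dg_hom k (abs_diff X) Z" "\<phi>' \<in> dg_hom k (abs_diff X) Z'"
    and "\<And>n x. x \<in> normalized X n \<Longrightarrow>
      \<phi> n (dg_quotient.cls (normalization X) (differentiating_ideal X) n x) =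
      \<phi>' n (dg_quotient.cls (normalization X) (differentiating_ideal X) n x)"
  shows "\<phi> = \<phi>'"
proof -
  interpret X: cosimplicial_algebra k X by fact
  show ?thesis
    using assms(2-) by (intro X.nd.dg_hom_Q_eqI[of \<phi> Z \<phi>' Z']) (auto simp: abs_diff_def)
qed

theorem abs_diff_functor:
  fixes k :: "'k ring"
  shows "is_functor (cAlg k :: (('k, 'a) cosimplicial, _) category) (dgAlg k) abs_diff abs_diff_map"
proof -
  have alg: "dg_algebra k (abs_diff X)" if "cosimplicial_algebra k X" for X :: "('k, 'a) cosimplicial"
  proof -
    interpret X: cosimplicial_algebra k X by fact
    show ?thesis unfolding abs_diff_def by (rule X.nd.dg_algebra_Q)
  qed
  have hom: "abs_diff_map X Y f \<in> dg_hom k (abs_diff X) (abs_diff Y)"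
    if "cosimplicial_algebra k X" "cosimplicial_algebra k Y" "f \<in> cs_hom k X Y"
    for X Y :: "('k, 'a) cosimplicial" and f
  proof -
    interpret cosimplicial_morphism k X Y f
      using that by (simp add: cosimplicial_morphism_def cosimplicial_morphism_axioms_def)
    show ?thesis by (rule abs_diff_map_hom)
  qed
  have id: "abs_diff_map X X (cs_id X) = dg_id (abs_diff X)"
    if X: "cosimplicial_algebra k X" for X :: "('k, 'a) cosimplicial"
  proof -
    interpret cosimplicial_morphism k X X "cs_id X"
      using X cs_hom_id[OF X] by (simp add: cosimplicial_morphism_def cosimplicial_morphism_axioms_def)
    show ?thesis
    proof (rule abs_diff_hom_eqI[OF X abs_diff_map_hom dg_hom_id[OF alg[OF X]]])
      fix n x assume x: "x \<in> src.N n"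
      then have "src.nd.cls n x \<in> carrier (dg_gr (abs_diff X) n)"
        using src.nd.cls_closed[of x n] by (simp add: abs_diff_def)
      then show "abs_diff_map X X (cs_id X) n (src.nd.cls n x) = dg_id (abs_diff X) n (src.nd.cls n x)"
        using abs_diff_map_cls[OF x] x by (simp add: dg_id_def) (simp add: cs_id_def src.N_carrier)
    qed
  qed
  have comp: "abs_diff_map X Z (cs_comp X g f) =
      dg_comp (abs_diff X) (abs_diff_map Y Z g) (abs_diff_map X Y f)"
    if X: "cosimplicial_algebra k X" and Y: "cosimplicial_algebra k Y" and Z: "cosimplicial_algebra k Z"
      and f: "f \<in> cs_hom k X Y" and g: "g \<in> cs_hom k Y Z"
    for X Y Z :: "('k, 'a) cosimplicial" and f g
  proof -
    interpret F: cosimplicial_morphism k X Y f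
      using X Y f by (simp add: cosimplicial_morphism_def cosimplicial_morphism_axioms_def)
    interpret G: cosimplicial_morphism k Y Z g
      using Y Z g by (simp add: cosimplicial_morphism_def cosimplicial_morphism_axioms_def)
    interpret GF: cosimplicial_morphism k X Z "cs_comp X g f"
      using X Z cs_hom_comp[OF f g X]
      by (simp add: cosimplicial_morphism_def cosimplicial_morphism_axioms_def)
    show ?thesis
    proof (rule abs_diff_hom_eqI[OF X GF.abs_diff_map_hom
          dg_hom_comp[OF F.abs_diff_map_hom G.abs_diff_map_hom alg[OF X]]])
      fix n x assume x: "x \<in> F.src.N n"
      then have "F.src.nd.cls n x \<in> carrier (dg_gr (abs_diff X) n)"
        using F.src.nd.cls_closed[of x n] by (simp add: abs_diff_def)
      then show "abs_diff_map X Z (cs_comp X g f) n (F.src.nd.cls n x) =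
          dg_comp (abs_diff X) (abs_diff_map Y Z g) (abs_diff_map X Y f) n (F.src.nd.cls n x)"
        using x GF.abs_diff_map_cls[OF x]
        by (simp add: F.abs_diff_map_cls G.abs_diff_map_cls F.h_N dg_comp_def compose_def)
          (simp add: cs_comp_def compose_def F.src.N_carrier)
    qed
  qed
  show ?thesis
    using alg hom id comp by (simp add: is_functor_def cAlg_def dgAlg_def)
qed

section \<open>The denormalization in coefficients\<close>

lemma delta_less_iff [simp]: "delta i a < delta i b \<longleftrightarrow> a < b"
  by (auto simp: delta_def)

lemma delta_inj: "inj_on (delta i) A"
  by (auto simp: inj_on_def delta_def split: if_splits)

lemma card_delta [simp]: "card (delta i ` \<alpha>) = card \<alpha>"
  by (rule card_image[OF delta_inj])

lemma delta_range: "\<alpha> \<subseteq> {1..n} \<Longrightarrow> delta i ` \<alpha> \<subseteq> {1..Suc n}"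
  by (auto simp: delta_def)

lemma delta_neq [simp]: "delta i a \<noteq> i"
  by (simp add: delta_def)

lemma sigma_delta [simp]: "sigma i (delta i a) = a" "sigma i (delta (Suc i) a) = a"
  by (auto simp: sigma_def delta_def)

lemma sigma_delta_image [simp]: "sigma i ` delta i ` \<alpha> = \<alpha>" "sigma i ` delta (Suc i) ` \<alpha> = \<alpha>"
  by (auto simp: image_image)

lemma delta_sigma_image: "Suc j \<notin> \<alpha> \<Longrightarrow> delta (Suc j) ` sigma j ` \<alpha> = \<alpha>"
proof -
  assume "Suc j \<notin> \<alpha>"
  then have "delta (Suc j) (sigma j a) = a" if "a \<in> \<alpha>" for a
    using that by (cases "a = Suc j") (auto simp: delta_def sigma_def)
  then show ?thesis by (simp add: image_image)
qed

text \<open>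
  The exponent of the sign in \<open>e\<^sub>\<alpha> \<and> e\<^sub>\<beta> = \<plusminus> e\<^bsub>\<alpha> \<union> \<beta>\<^esub>\<close> for disjoint \<open>\<alpha>\<close> and \<open>\<beta>\<close>.
\<close>

definition inversions :: "nat set \<Rightarrow> nat set \<Rightarrow> nat"
  where "inversions \<alpha> \<beta> = card {(a, b). a \<in> \<alpha> \<and> b \<in> \<beta> \<and> b < a}"

text \<open>
  The index set from which \<open>d\<^sup>0\<close> reaches the coefficient at \<open>\<gamma>\<close>: up to the point \<open>1\<close>, \<open>\<gamma>\<close> is the image of
  \<open>drop_shift \<gamma>\<close> under \<open>\<delta>\<^sub>1\<close>.
\<close>

definition drop_shift :: "nat set \<Rightarrow> nat set"
  where "drop_shift \<gamma> = (\<lambda>a. a - 1) ` (\<gamma> - {1})"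

text \<open>
  The structure maps of the denormalization, which are defined on generators, are replaced by their effect
  on coefficients: \<open>codegen_apply\<close>, \<open>coface_apply\<close>, \<open>coface_0_apply\<close> and \<open>denorm_mult_apply\<close>.
\<close>

context dg_algebra
begin

abbreviation "G n \<equiv> carrier (dg_gr Y n)"
abbreviation "K \<equiv> denorm Y"
abbreviation "KC n \<equiv> carrier (cs_obj K n)"

lemma K_simps [simp]:
  "KC n = (\<Pi>\<^sub>E \<alpha>\<in>Pow {1..n}. G (card \<alpha>))"
  "\<zero>\<^bsub>cs_obj K n\<^esub> = (\<lambda>\<alpha>\<in>Pow {1..n}. \<zero>\<^bsub>dg_gr Y (card \<alpha>)\<^esub>)"
  "c \<oplus>\<^bsub>cs_obj K n\<^esub> c' = (\<lambda>\<alpha>\<in>Pow {1..n}. c \<alpha> \<oplus>\<^bsub>dg_gr Y (card \<alpha>)\<^esub> c' \<alpha>)"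
  "a \<odot>\<^bsub>cs_obj K n\<^esub> c = (\<lambda>\<alpha>\<in>Pow {1..n}. a \<odot>\<^bsub>dg_gr Y (card \<alpha>)\<^esub> c \<alpha>)"
  "c \<otimes>\<^bsub>cs_obj K n\<^esub> c' = denorm_mult Y n c c'"
  "\<one>\<^bsub>cs_obj K n\<^esub> = tens Y n {} (dg_one Y)"
  by (simp_all add: denorm_def denorm_mod_def)

lemma mod_simps [simp]:
  "carrier (denorm_mod Y n) = (\<Pi>\<^sub>E \<alpha>\<in>Pow {1..n}. G (card \<alpha>))"
  "\<zero>\<^bsub>denorm_mod Y n\<^esub> = (\<lambda>\<alpha>\<in>Pow {1..n}. \<zero>\<^bsub>dg_gr Y (card \<alpha>)\<^esub>)"
  "c \<oplus>\<^bsub>denorm_mod Y n\<^esub> c' = (\<lambda>\<alpha>\<in>Pow {1..n}. c \<alpha> \<oplus>\<^bsub>dg_gr Y (card \<alpha>)\<^esub> c' \<alpha>)"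
  "a \<odot>\<^bsub>denorm_mod Y n\<^esub> c = (\<lambda>\<alpha>\<in>Pow {1..n}. a \<odot>\<^bsub>dg_gr Y (card \<alpha>)\<^esub> c \<alpha>)"
  by (simp_all add: denorm_mod_def)

lemma KC_eqI:
  assumes "c \<in> (\<Pi>\<^sub>E \<alpha>\<in>Pow {1..n}. A \<alpha>)" "c' \<in> (\<Pi>\<^sub>E \<alpha>\<in>Pow {1..n}. B \<alpha>)"
    and "\<And>\<gamma>. \<gamma> \<subseteq> {1..n} \<Longrightarrow> c \<gamma> = c' \<gamma>"
  shows "c = c'"
proof (rule extensionalityI)
  show "c \<in> extensional (Pow {1..n})" "c' \<in> extensional (Pow {1..n})"
    using assms(1,2) by (auto simp: PiE_iff)
qed (use assms(3) in auto)

lemma KC_coeff: "c \<in> (\<Pi>\<^sub>E \<alpha>\<in>Pow {1..n}. G (card \<alpha>)) \<Longrightarrow> \<alpha> \<subseteq> {1..n} \<Longrightarrow> c \<alpha> \<in> G (card \<alpha>)"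
  by auto

lemma mod_group: "abelian_group (denorm_mod Y n)"
proof (rule abelian_groupI)
  show "\<exists>c'\<in>carrier (denorm_mod Y n). c' \<oplus>\<^bsub>denorm_mod Y n\<^esub> c = \<zero>\<^bsub>denorm_mod Y n\<^esub>"
    if "c \<in> carrier (denorm_mod Y n)" for c
    using that
    by (intro bexI[where x = "\<lambda>\<alpha>\<in>Pow {1..n}. \<ominus>\<^bsub>dg_gr Y (card \<alpha>)\<^esub> c \<alpha>"])
      (auto simp: gr.l_neg KC_coeff intro!: restrict_ext)
qed (auto simp: gr.a_ac KC_coeff fun_eq_iff PiE_iff extensional_def restrict_def)

lemma eval_additive: "\<gamma> \<subseteq> {1..n} \<Longrightarrow> additive_map (denorm_mod Y n) (dg_gr Y (card \<gamma>)) (\<lambda>c. c \<gamma>)"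
  by (intro additive_mapI mod_group gr.abelian_group_axioms) auto

lemma mod_finsum:
  assumes "finite A" "\<And>a. a \<in> A \<Longrightarrow> f a \<in> carrier (denorm_mod Y n)" "\<gamma> \<subseteq> {1..n}"
  shows "finsum (denorm_mod Y n) f A \<gamma> = (\<Oplus>\<^bsub>dg_gr Y (card \<gamma>)\<^esub>a\<in>A. f a \<gamma>)"
  by (rule additive_map_finsum[OF eval_additive]) (use assms in blast)+

lemma mod_finsum_closed:
  assumes "\<And>a. a \<in> A \<Longrightarrow> f a \<in> carrier (denorm_mod Y n)"
  shows "finsum (denorm_mod Y n) f A \<in> carrier (denorm_mod Y n)"
proof -
  interpret M: abelian_group "denorm_mod Y n" by (rule mod_group)
  show ?thesis by (rule M.finsum_closed) (use assms in blast)
qed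

lemma mod_signed:
  "c \<in> carrier (denorm_mod Y n) \<Longrightarrow> \<gamma> \<subseteq> {1..n} \<Longrightarrow>
    signed (denorm_mod Y n) m c \<gamma> = signed (dg_gr Y (card \<gamma>)) m (c \<gamma>)"
  by (rule additive_map_signed[OF eval_additive])

lemma tens_closed: "f \<in> G (card \<alpha>) \<Longrightarrow> tens Y n \<alpha> f \<in> carrier (denorm_mod Y n)"
  by (auto simp: tens_def)

lemma tens_apply: "\<gamma> \<subseteq> {1..n} \<Longrightarrow> tens Y n \<alpha> f \<gamma> = (if \<gamma> = \<alpha> then f else \<zero>\<^bsub>dg_gr Y (card \<gamma>)\<^esub>)"
  by (simp add: tens_def)

lemma tens_wedge_closed:
  assumes "\<alpha> \<subseteq> {1..n}" "\<beta> \<subseteq> {1..n}" "f \<in> G (card \<alpha> + card \<beta>)"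
  shows "tens_wedge Y n \<alpha> \<beta> f \<in> carrier (denorm_mod Y n)"
proof -
  interpret M: module_group "denorm_mod Y n" by (rule module_group.intro) (rule mod_group)
  show ?thesis
  proof (cases "\<alpha> \<inter> \<beta> = {}")
    case True
    have "finite \<alpha>" "finite \<beta>" using assms finite_subset by blast+
    then have "card (\<alpha> \<union> \<beta>) = card \<alpha> + card \<beta>" using True by (simp add: card_Un_disjoint)
    then show ?thesis
      using True assms tens_closed[of f "\<alpha> \<union> \<beta>" n] M.signed_closed by (simp add: tens_wedge_def del: mod_simps)
  next
    case False
    then show ?thesis using M.zero_closed by (simp add: tens_wedge_def del: mod_simps)
  qed
qed

lemma tens_wedge_apply:
  assumes "\<alpha> \<subseteq> {1..n}" "\<beta> \<subseteq> {1..n}" "f \<in> G (card \<alpha> + card \<beta>)" "\<gamma> \<subseteq> {1..n}"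
  shows "tens_wedge Y n \<alpha> \<beta> f \<gamma> =
    (if \<alpha> \<inter> \<beta> = {} \<and> \<gamma> = \<alpha> \<union> \<beta> then signed (dg_gr Y (card \<gamma>)) (inversions \<alpha> \<beta>) f else \<zero>\<^bsub>dg_gr Y (card \<gamma>)\<^esub>)"
proof (cases "\<alpha> \<inter> \<beta> = {}")
  case True
  have "finite \<alpha>" "finite \<beta>" using assms finite_subset by blast+
  then have "card (\<alpha> \<union> \<beta>) = card \<alpha> + card \<beta>" using True by (simp add: card_Un_disjoint)
  then have "tens Y n (\<alpha> \<union> \<beta>) f \<in> carrier (denorm_mod Y n)"
    using tens_closed[of f "\<alpha> \<union> \<beta>" n] assms by simp
  then show ?thesis
    using True assms(4) by (simp add: tens_wedge_def mod_signed tens_apply inversions_def del: mod_simps)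
next
  case False
  then show ?thesis using assms(4) by (simp add: tens_wedge_def)
qed

lemma finite_idx: "\<alpha> \<subseteq> {1..n::nat} \<Longrightarrow> finite \<alpha>"
  by (rule finite_subset[OF _ finite_atLeastAtMost])

subsection \<open>Codegeneracies\<close>

lemma codegen_gen_closed:
  assumes "\<alpha> \<subseteq> {1..Suc n}" "f \<in> G (card \<alpha>)"
  shows "denorm_codegen_gen Y n j \<alpha> f \<in> carrier (denorm_mod Y n)"
proof -
  have "card (sigma j ` \<alpha>) = card \<alpha>" if "Suc j \<notin> \<alpha>"
    using card_delta[of "Suc j" "sigma j ` \<alpha>"] delta_sigma_image[OF that] by simp
  then show ?thesis
    using assms tens_closed[of f "sigma j ` \<alpha>" n] by (auto simp: denorm_codegen_gen_def)
qed

lemma codegen_closed: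
  assumes "c \<in> KC (Suc n)"
  shows "cs_codegen K n j c \<in> KC n"
  unfolding denorm_def using assms
  by (simp del: mod_simps K_simps add: denorm_mod_def[symmetric])
    (rule mod_finsum_closed, rule codegen_gen_closed, auto)

lemma codegen_apply:
  assumes c: "c \<in> KC (Suc n)" and \<gamma>: "\<gamma> \<subseteq> {1..n}" and j: "j \<le> n"
  shows "cs_codegen K n j c \<gamma> = c (delta (Suc j) ` \<gamma>)"
proof -
  have cl: "denorm_codegen_gen Y n j \<alpha> (c \<alpha>) \<in> carrier (denorm_mod Y n)" if "\<alpha> \<in> Pow {1..Suc n}" for \<alpha>
    using that c by (intro codegen_gen_closed) auto
  have val: "denorm_codegen_gen Y n j \<alpha> (c \<alpha>) \<gamma> =
      (if \<alpha> = delta (Suc j) ` \<gamma> then c \<alpha> else \<zero>\<^bsub>dg_gr Y (card \<gamma>)\<^esub>)" if "\<alpha> \<subseteq> {1..Suc n}" for \<alpha>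
  proof (cases "Suc j \<in> \<alpha>")
    case True
    then have "\<alpha> \<noteq> delta (Suc j) ` \<gamma>" using delta_neq by (metis imageE)
    then show ?thesis using True \<gamma> by (simp add: denorm_codegen_gen_def)
  next
    case False
    then have "\<gamma> = sigma j ` \<alpha> \<longleftrightarrow> \<alpha> = delta (Suc j) ` \<gamma>"
      using delta_sigma_image[OF False] by auto
    then show ?thesis using False \<gamma> by (simp add: denorm_codegen_gen_def tens_apply)
  qed
  have "cs_codegen K n j c \<gamma> = (\<Oplus>\<^bsub>dg_gr Y (card \<gamma>)\<^esub>\<alpha>\<in>Pow {1..Suc n}. denorm_codegen_gen Y n j \<alpha> (c \<alpha>) \<gamma>)"
    by (simp add: denorm_def) (rule mod_finsum, use \<gamma> cl in auto)
  also have "\<dots> = denorm_codegen_gen Y n j (delta (Suc j) ` \<gamma>) (c (delta (Suc j) ` \<gamma>)) \<gamma>"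
    by (rule gr.finsum_single)
      (use delta_range[OF \<gamma>, of "Suc j"] val KC_coeff[of c "Suc n" "delta (Suc j) ` \<gamma>"] c in auto)
  also have "\<dots> = c (delta (Suc j) ` \<gamma>)"
    using val[OF delta_range[OF \<gamma>]] by simp
  finally show ?thesis .
qed

end

lemma mem_sigma_image:
  "a \<in> sigma i ` \<alpha> \<longleftrightarrow> (if a < i then a \<in> \<alpha> else if a = i then i \<in> \<alpha> \<or> Suc i \<in> \<alpha> else Suc a \<in> \<alpha>)"
proof
  assume "a \<in> sigma i ` \<alpha>"
  then show "if a < i then a \<in> \<alpha> else if a = i then i \<in> \<alpha> \<or> Suc i \<in> \<alpha> else Suc a \<in> \<alpha>"
  proof
    fix b assume "a = sigma i b" "b \<in> \<alpha>"
    moreover have "b = i \<or> b = Suc i" if "a = i"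
      using that \<open>a = sigma i b\<close> by (auto simp: sigma_def split: if_splits)
    ultimately show ?thesis
      by (auto simp: sigma_def split: if_splits)
  qed
next
  assume R: "if a < i then a \<in> \<alpha> else if a = i then i \<in> \<alpha> \<or> Suc i \<in> \<alpha> else Suc a \<in> \<alpha>"
  consider "a < i" | "a = i" "i \<in> \<alpha>" | "a = i" "Suc i \<in> \<alpha>" | "i < a"
    using R by (metis linorder_neqE_nat)
  then show "a \<in> sigma i ` \<alpha>"
  proof cases
    case 1
    then show ?thesis using R by (intro image_eqI[of _ _ a]) (auto simp: sigma_def)
  next
    case 2
    then show ?thesis by (intro image_eqI[of _ _ i]) (auto simp: sigma_def)
  next
    case 3
    then show ?thesis by (intro image_eqI[of _ _ "Suc i"]) (auto simp: sigma_def)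
  next
    case 4
    then show ?thesis using R by (intro image_eqI[of _ _ "Suc a"]) (auto simp: sigma_def)
  qed
qed

lemma delta_sigma_image': "i \<notin> \<gamma> \<Longrightarrow> delta i ` sigma i ` \<gamma> = \<gamma>"
proof -
  assume "i \<notin> \<gamma>"
  then have "delta i (sigma i a) = a" if "a \<in> \<gamma>" for a
    using that by (cases "a = i") (auto simp: delta_def sigma_def)
  then show ?thesis by (simp add: image_image)
qed

lemma mem_drop_shift: "0 \<notin> \<gamma> \<Longrightarrow> a \<in> drop_shift \<gamma> \<longleftrightarrow> a \<noteq> 0 \<and> Suc a \<in> \<gamma>"
proof
  assume "0 \<notin> \<gamma>" "a \<in> drop_shift \<gamma>"
  then obtain b where "a = b - 1" "b \<in> \<gamma>" "b \<noteq> 1" "b \<noteq> 0" by (auto simp: drop_shift_def)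
  then show "a \<noteq> 0 \<and> Suc a \<in> \<gamma>" by (cases b) auto
next
  assume "a \<noteq> 0 \<and> Suc a \<in> \<gamma>"
  then show "a \<in> drop_shift \<gamma>"
    unfolding drop_shift_def by (intro image_eqI[of _ _ "Suc a"]) auto
qed

lemma Suc_drop_shift: "\<gamma> \<subseteq> {1..n} \<Longrightarrow> Suc ` drop_shift \<gamma> = \<gamma> - {1}"
  by (force simp: drop_shift_def image_image)

lemma drop_shift_range: "\<gamma> \<subseteq> {1..Suc n} \<Longrightarrow> drop_shift \<gamma> \<subseteq> {1..n}"
  by (force simp: drop_shift_def)

lemma card_drop_shift: "\<gamma> \<subseteq> {1..n} \<Longrightarrow> card (drop_shift \<gamma>) = card (\<gamma> - {1})"
  using card_image[of Suc "drop_shift \<gamma>"] by (simp add: Suc_drop_shift)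

lemma delta_1: "\<alpha> \<subseteq> {1..n} \<Longrightarrow> delta (Suc 0) ` \<alpha> = Suc ` \<alpha>"
  by (rule image_cong) (auto simp: delta_def)

context dg_algebra
begin

subsection \<open>Cofaces\<close>

text \<open>
  The index sets \<open>\<gamma>\<close> that are not hit by \<open>d\<^sup>i\<close>. A generator at \<open>\<alpha>\<close> contributes at \<open>\<delta>\<^sub>i(\<alpha>)\<close>, which misses
  \<open>i\<close>, and, if
  \<open>i \<in> \<alpha>\<close>, at \<open>\<delta>\<^bsub>i+1\<^esub>(\<alpha>)\<close>, which misses \<open>i + 1\<close>; and no \<open>\<alpha> \<subseteq> {1..n}\<close> contains \<open>n + 1\<close>.
\<close>

definition merges :: "nat \<Rightarrow> nat \<Rightarrow> nat set \<Rightarrow> bool"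
  where "merges n i \<gamma> \<longleftrightarrow> i \<in> \<gamma> \<and> (Suc i \<in> \<gamma> \<or> i = Suc n)"

lemma sigma_range:
  assumes "\<gamma> \<subseteq> {1..Suc n}" "1 \<le> i" "i \<le> Suc n" "\<not> merges n i \<gamma>"
  shows "sigma i ` \<gamma> \<subseteq> {1..n}"
proof
  fix a assume "a \<in> sigma i ` \<gamma>"
  then obtain b where b: "b \<in> \<gamma>" "a = sigma i b" by blast
  then have "1 \<le> b" "b \<le> Suc n" using assms by auto
  moreover have "b \<noteq> Suc n \<or> i \<noteq> Suc n" using assms b by (auto simp: merges_def)
  ultimately show "a \<in> {1..n}" using assms b by (auto simp: sigma_def)
qed

lemma card_sigma:
  assumes "\<not> (i \<in> \<gamma> \<and> Suc i \<in> \<gamma>)"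
  shows "card (sigma i ` \<gamma>) = card \<gamma>"
proof (cases "i \<in> \<gamma>")
  case True
  then show ?thesis using assms card_delta[of "Suc i" "sigma i ` \<gamma>"] by (simp add: delta_sigma_image)
next
  case False
  then show ?thesis using card_delta[of i "sigma i ` \<gamma>"] by (simp add: delta_sigma_image')
qed

lemma coface_gen_closed:
  assumes "\<alpha> \<subseteq> {1..n}" "f \<in> G (card \<alpha>)"
  shows "denorm_coface_gen Y n i \<alpha> f \<in> carrier (denorm_mod Y (Suc n))"
proof -
  interpret M: module_group "denorm_mod Y (Suc n)" by (rule module_group.intro) (rule mod_group)
  have t: "tens Y (Suc n) (delta i ` \<alpha>) f \<in> carrier (denorm_mod Y (Suc n))" for i
    using assms tens_closed[of f "delta i ` \<alpha>" "Suc n"] by simp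
  have "tens_wedge Y (Suc n) {1} (delta 1 ` \<alpha>) (dg_diff Y (card \<alpha>) f) \<in> carrier (denorm_mod Y (Suc n))"
    using assms delta_range[OF assms(1), of 1] diff_closed[OF assms(2)] by (intro tens_wedge_closed) auto
  then show ?thesis using t M.a_closed by (simp add: denorm_coface_gen_def del: mod_simps)
qed

lemma coface_closed:
  assumes "c \<in> KC n"
  shows "cs_coface K n i c \<in> KC (Suc n)"
  unfolding denorm_def using assms
  by (simp del: mod_simps K_simps add: denorm_mod_def[symmetric])
    (rule mod_finsum_closed, rule coface_gen_closed, auto)

lemma coface_finsum:
  assumes c: "c \<in> KC n" and \<gamma>: "\<gamma> \<subseteq> {1..Suc n}"
  shows "cs_coface K n i c \<gamma> = (\<Oplus>\<^bsub>dg_gr Y (card \<gamma>)\<^esub>\<alpha>\<in>Pow {1..n}. denorm_coface_gen Y n i \<alpha> (c \<alpha>) \<gamma>)"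
  by (simp add: denorm_def) (rule mod_finsum, use \<gamma> c in \<open>auto intro!: coface_gen_closed simp del: mod_simps\<close>)

lemma coface_apply:
  assumes c: "c \<in> KC n" and \<gamma>: "\<gamma> \<subseteq> {1..Suc n}" and i: "1 \<le> i" "i \<le> Suc n"
  shows "cs_coface K n i c \<gamma> = (if merges n i \<gamma> then \<zero>\<^bsub>dg_gr Y (card \<gamma>)\<^esub> else c (sigma i ` \<gamma>))"
proof -
  let ?Z = "\<zero>\<^bsub>dg_gr Y (card \<gamma>)\<^esub>"
  have cG: "c \<alpha> \<in> G (card \<alpha>)" if "\<alpha> \<subseteq> {1..n}" for \<alpha>
    using c that by auto
  have val: "denorm_coface_gen Y n i \<alpha> (c \<alpha>) \<gamma> =
      (if \<gamma> = delta i ` \<alpha> \<or> i \<in> \<alpha> \<and> \<gamma> = delta (Suc i) ` \<alpha> then c \<alpha> else ?Z)" if \<alpha>: "\<alpha> \<subseteq> {1..n}" for \<alpha>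
  proof -
    have ne: "delta i ` \<alpha> \<noteq> delta (Suc i) ` \<alpha>" if "i \<in> \<alpha>"
    proof
      assume "delta i ` \<alpha> = delta (Suc i) ` \<alpha>"
      moreover have "Suc i \<in> delta i ` \<alpha>" using that by (auto simp: delta_def image_iff)
      ultimately show False using delta_neq by (metis imageE)
    qed
    show ?thesis
    proof (cases "\<gamma> = delta i ` \<alpha> \<or> i \<in> \<alpha> \<and> \<gamma> = delta (Suc i) ` \<alpha>")
      case True
      then have "card \<gamma> = card \<alpha>" by auto
      then show ?thesis
        using True i \<gamma> ne cG[OF \<alpha>] by (auto simp: denorm_coface_gen_def tens_apply)
    next
      case False
      then show ?thesis using i \<gamma> by (auto simp: denorm_coface_gen_def tens_apply)
    qed
  qed
  have *: "\<alpha> = sigma i ` \<gamma>" if "\<gamma> = delta i ` \<alpha> \<or> i \<in> \<alpha> \<and> \<gamma> = delta (Suc i) ` \<alpha>" for \<alpha>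
    using that by auto
  show ?thesis
  proof (cases "merges n i \<gamma>")
    case True
    have nm: "\<not> (\<gamma> = delta i ` \<alpha> \<or> i \<in> \<alpha> \<and> \<gamma> = delta (Suc i) ` \<alpha>)" if "\<alpha> \<subseteq> {1..n}" for \<alpha>
    proof
      assume "\<gamma> = delta i ` \<alpha> \<or> i \<in> \<alpha> \<and> \<gamma> = delta (Suc i) ` \<alpha>"
      moreover have "i \<notin> delta i ` \<alpha>" "Suc i \<notin> delta (Suc i) ` \<alpha>" using delta_neq by (metis imageE)+
      ultimately have "i \<in> \<alpha>" "i = Suc n" using True by (auto simp: merges_def)
      then show False using that by auto
    qed
    have "cs_coface K n i c \<gamma> = ?Z"
      unfolding coface_finsum[OF c \<gamma>]
      by (rule gr.finsum_zero') (use val nm in simp)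
    then show ?thesis using True by simp
  next
    case False
    then have r: "sigma i ` \<gamma> \<subseteq> {1..n}" using sigma_range[OF \<gamma> i] by simp
    have d: "\<gamma> = delta i ` sigma i ` \<gamma> \<or> i \<in> sigma i ` \<gamma> \<and> \<gamma> = delta (Suc i) ` sigma i ` \<gamma>"
    proof (cases "i \<in> \<gamma>")
      case True
      then have "Suc i \<notin> \<gamma>" using False by (simp add: merges_def)
      then show ?thesis using True by (simp add: delta_sigma_image mem_sigma_image)
    qed (simp add: delta_sigma_image')
    have v: "denorm_coface_gen Y n i (sigma i ` \<gamma>) (c (sigma i ` \<gamma>)) \<gamma> = c (sigma i ` \<gamma>)"
      using val[OF r] d by simp
    have "card (sigma i ` \<gamma>) = card \<gamma>"
      using False by (intro card_sigma) (auto simp: merges_def)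
    then have "cs_coface K n i c \<gamma> = denorm_coface_gen Y n i (sigma i ` \<gamma>) (c (sigma i ` \<gamma>)) \<gamma>"
      unfolding coface_finsum[OF c \<gamma>] using r v cG[OF r] val * by (intro gr.finsum_single) auto
    then show ?thesis using False v by simp
  qed
qed

lemma coface_0_apply:
  assumes c: "c \<in> KC n" and \<gamma>: "\<gamma> \<subseteq> {1..Suc n}"
  shows "cs_coface K n 0 c \<gamma> = (if 1 \<in> \<gamma> then dg_diff Y (card (drop_shift \<gamma>)) (c (drop_shift \<gamma>)) else c
      (drop_shift \<gamma>))"
proof -
  let ?Z = "\<zero>\<^bsub>dg_gr Y (card \<gamma>)\<^esub>"
  have cG: "c \<alpha> \<in> G (card \<alpha>)" if "\<alpha> \<subseteq> {1..n}" for \<alpha>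
    using c that by auto
  have val: "denorm_coface_gen Y n 0 \<alpha> (c \<alpha>) \<gamma> =
      (if \<gamma> = Suc ` \<alpha> then c \<alpha> else if \<gamma> = insert 1 (Suc ` \<alpha>) then dg_diff Y (card \<alpha>) (c \<alpha>) else ?Z)"
    if \<alpha>: "\<alpha> \<subseteq> {1..n}" for \<alpha>
  proof -
    have 1: "1 \<notin> Suc ` \<alpha>" using \<alpha> by auto
    have cS: "card (Suc ` \<alpha>) = card \<alpha>" "finite (Suc ` \<alpha>)" "finite \<alpha>"
      using finite_idx[OF \<alpha>] by (simp_all add: card_image)
    have "{(a, b). a \<in> {1} \<and> b \<in> Suc ` \<alpha> \<and> b < a} = {}" by auto
    then have S: "inversions {1} (Suc ` \<alpha>) = 0" by (simp only: inversions_def card.empty)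
    have w: "tens_wedge Y (Suc n) {1} (delta 1 ` \<alpha>) (dg_diff Y (card \<alpha>) (c \<alpha>)) \<gamma> =
        (if \<gamma> = insert 1 (Suc ` \<alpha>) then dg_diff Y (card \<alpha>) (c \<alpha>) else ?Z)"
      using tens_wedge_apply[of "{1}" "Suc n" "delta 1 ` \<alpha>" "dg_diff Y (card \<alpha>) (c \<alpha>)" \<gamma>]
        delta_range[OF \<alpha>, of 1] diff_closed[OF cG[OF \<alpha>]] \<gamma> 1 S
      by (auto simp: delta_1[OF \<alpha>] cS signed_def)
    consider "\<gamma> = Suc ` \<alpha>" | "\<gamma> = insert 1 (Suc ` \<alpha>)" "\<gamma> \<noteq> Suc ` \<alpha>"
      | "\<gamma> \<noteq> Suc ` \<alpha>" "\<gamma> \<noteq> insert 1 (Suc ` \<alpha>)" by blast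
    then show ?thesis
    proof cases
      case 1
      then have "\<gamma> \<noteq> insert 1 (Suc ` \<alpha>)" using \<open>1 \<notin> Suc ` \<alpha>\<close> by blast
      then show ?thesis
        using 1 \<gamma> cG[OF \<alpha>] w by (simp add: denorm_coface_gen_def tens_apply delta_1[OF \<alpha>] cS)
    next
      case 2
      then have "card \<gamma> = Suc (card \<alpha>)" using cS \<open>1 \<notin> Suc ` \<alpha>\<close> by simp
      then show ?thesis
        using 2 \<gamma> diff_closed[OF cG[OF \<alpha>]] w
        by (simp add: denorm_coface_gen_def tens_apply delta_1[OF \<alpha>])
    next
      case 3
      then show ?thesis using \<gamma> w by (simp add: denorm_coface_gen_def tens_apply delta_1[OF \<alpha>])
    qed
  qed
  have *: "\<alpha> = drop_shift \<gamma>" if "\<gamma> = Suc ` \<alpha> \<or> \<gamma> = insert 1 (Suc ` \<alpha>)" "\<alpha> \<subseteq> {1..n}" for \<alpha>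
  proof -
    have "\<gamma> - {1} = Suc ` \<alpha>" using that by auto
    then show ?thesis by (simp add: drop_shift_def image_image)
  qed
  have r: "drop_shift \<gamma> \<subseteq> {1..n}" by (rule drop_shift_range[OF \<gamma>])
  have S: "Suc ` drop_shift \<gamma> = \<gamma> - {1}" by (rule Suc_drop_shift[OF \<gamma>])
  have v: "denorm_coface_gen Y n 0 (drop_shift \<gamma>) (c (drop_shift \<gamma>)) \<gamma> =
      (if 1 \<in> \<gamma> then dg_diff Y (card (drop_shift \<gamma>)) (c (drop_shift \<gamma>)) else c (drop_shift \<gamma>))"
    using val[OF r] unfolding S by (auto simp: insert_absorb)
  have "(if 1 \<in> \<gamma> then dg_diff Y (card (drop_shift \<gamma>)) (c (drop_shift \<gamma>)) else c (drop_shift \<gamma>)) \<in> G (card \<gamma>)"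
  proof (cases "1 \<in> \<gamma>")
    case True
    then have "card \<gamma> = Suc (card (drop_shift \<gamma>))"
      using finite_idx[OF \<gamma>] card_drop_shift[OF \<gamma>] by (metis card.remove)
    then show ?thesis using True diff_closed[OF cG[OF r]] by simp
  next
    case False
    then show ?thesis using cG[OF r] card_drop_shift[OF \<gamma>] by simp
  qed
  then have "cs_coface K n 0 c \<gamma> = denorm_coface_gen Y n 0 (drop_shift \<gamma>) (c (drop_shift \<gamma>)) \<gamma>"
    unfolding coface_finsum[OF c \<gamma>]
  proof (intro gr.finsum_single)
    show "denorm_coface_gen Y n 0 \<alpha> (c \<alpha>) \<gamma> = ?Z" if "\<alpha> \<in> Pow {1..n}" "\<alpha> \<noteq> drop_shift \<gamma>" for \<alpha>
      using that *[of \<alpha>] val[of \<alpha>] by auto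
  qed (use r v in auto)
  then show ?thesis using v by simp
qed

subsection \<open>Product\<close>

lemma card_split:
  fixes \<gamma> :: "nat set"
  shows "\<alpha> \<subseteq> \<gamma> \<Longrightarrow> \<gamma> \<subseteq> {1..n} \<Longrightarrow> card \<alpha> + card (\<gamma> - \<alpha>) = card \<gamma>"
  using finite_idx[of \<gamma> n] card_mono[of \<gamma> \<alpha>] finite_subset[of \<alpha> \<gamma>] by (simp add: card_Diff_subset)

lemma mult_closed':
  fixes \<gamma> :: "nat set"
  assumes "f \<in> G (card \<alpha>)" "g \<in> G (card (\<gamma> - \<alpha>))" "\<alpha> \<subseteq> \<gamma>" "\<gamma> \<subseteq> {1..n}"
  shows "dg_mult Y (card \<alpha>) (card (\<gamma> - \<alpha>)) f g \<in> G (card \<gamma>)"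
  using mult_closed[OF assms(1,2)] card_split[OF assms(3,4)] by simp

lemma denorm_mult_closed:
  assumes c: "c \<in> KC n" and c': "c' \<in> KC n"
  shows "denorm_mult Y n c c' \<in> KC n"
proof -
  have "denorm_mult Y n c c' \<in> carrier (denorm_mod Y n)"
    unfolding denorm_mult_def
    by (intro mod_finsum_closed tens_wedge_closed mult_closed) (use c c' in auto)
  then show ?thesis by simp
qed

lemma denorm_mult_apply:
  assumes c: "c \<in> KC n" and c': "c' \<in> KC n" and \<gamma>: "\<gamma> \<subseteq> {1..n}"
  shows "denorm_mult Y n c c' \<gamma> = (\<Oplus>\<^bsub>dg_gr Y (card \<gamma>)\<^esub>\<alpha>\<in>Pow \<gamma>.
    signed (dg_gr Y (card \<gamma>)) (inversions \<alpha> (\<gamma> - \<alpha>)) (dg_mult Y (card \<alpha>) (card (\<gamma> - \<alpha>)) (c \<alpha>) (c' (\<gamma> - \<alpha>))))"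
proof -
  let ?R = "dg_gr Y (card \<gamma>)"
  define t where "t = (\<lambda>\<alpha>. signed ?R (inversions \<alpha> (\<gamma> - \<alpha>)) (dg_mult Y (card \<alpha>) (card (\<gamma> - \<alpha>)) (c \<alpha>) (c'
      (\<gamma> - \<alpha>))))"
  have cG: "c \<alpha> \<in> G (card \<alpha>)" "c' \<alpha> \<in> G (card \<alpha>)" if "\<alpha> \<subseteq> {1..n}" for \<alpha>
    using c c' that by auto
  have tC: "t \<alpha> \<in> carrier ?R" if "\<alpha> \<subseteq> \<gamma>" for \<alpha>
    using that \<gamma> mult_closed'[of "c \<alpha>" \<alpha> "c' (\<gamma> - \<alpha>)" \<gamma> n] cG[of \<alpha>] cG[of "\<gamma> - \<alpha>"]
    unfolding t_def by (intro gr.signed_closed) blast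
  have w: "tens_wedge Y n \<alpha> \<beta> (dg_mult Y (card \<alpha>) (card \<beta>) (c \<alpha>) (c' \<beta>)) \<gamma> =
      (if \<alpha> \<subseteq> \<gamma> \<and> \<beta> = \<gamma> - \<alpha> then t \<alpha> else \<zero>\<^bsub>?R\<^esub>)"
    if "\<alpha> \<subseteq> {1..n}" "\<beta> \<subseteq> {1..n}" for \<alpha> \<beta>
  proof -
    have "\<alpha> \<inter> \<beta> = {} \<and> \<gamma> = \<alpha> \<union> \<beta> \<longleftrightarrow> \<alpha> \<subseteq> \<gamma> \<and> \<beta> = \<gamma> - \<alpha>" by blast
    then show ?thesis
      using tens_wedge_apply[OF that mult_closed[OF cG(1)[OF that(1)] cG(2)[OF that(2)]] \<gamma>]
      by (auto simp: t_def)
  qed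
  have inner: "(\<Oplus>\<^bsub>denorm_mod Y n\<^esub>\<beta>\<in>Pow {1..n}.
      tens_wedge Y n \<alpha> \<beta> (dg_mult Y (card \<alpha>) (card \<beta>) (c \<alpha>) (c' \<beta>))) \<gamma> =
      (if \<alpha> \<subseteq> \<gamma> then t \<alpha> else \<zero>\<^bsub>?R\<^esub>)" if \<alpha>: "\<alpha> \<subseteq> {1..n}" for \<alpha>
  proof -
    have "(\<Oplus>\<^bsub>denorm_mod Y n\<^esub>\<beta>\<in>Pow {1..n}.
        tens_wedge Y n \<alpha> \<beta> (dg_mult Y (card \<alpha>) (card \<beta>) (c \<alpha>) (c' \<beta>))) \<gamma> =
        (\<Oplus>\<^bsub>?R\<^esub>\<beta>\<in>Pow {1..n}. tens_wedge Y n \<alpha> \<beta> (dg_mult Y (card \<alpha>) (card \<beta>) (c \<alpha>) (c' \<beta>)) \<gamma>)"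
      by (rule mod_finsum) (use \<alpha> \<gamma> cG in \<open>auto intro!: tens_wedge_closed mult_closed simp del: mod_simps\<close>)
    also have "\<dots> = (\<Oplus>\<^bsub>?R\<^esub>\<beta>\<in>Pow {1..n}. if \<alpha> \<subseteq> \<gamma> \<and> \<beta> = \<gamma> - \<alpha> then t \<alpha> else \<zero>\<^bsub>?R\<^esub>)"
      by (rule gr.finsum_cong') (use \<alpha> w tC in auto)
    also have "\<dots> = (if \<alpha> \<subseteq> \<gamma> then t \<alpha> else \<zero>\<^bsub>?R\<^esub>)"
    proof (cases "\<alpha> \<subseteq> \<gamma>")
      case True
      then show ?thesis
        using gr.finsum_single[of "Pow {1..n}" "\<gamma> - \<alpha>" "\<lambda>\<beta>. if \<alpha> \<subseteq> \<gamma> \<and> \<beta> = \<gamma> - \<alpha> then t \<alpha> else \<zero>\<^bsub>?R\<^esub>" "card \<gamma>"]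
          tC[OF True] \<gamma> by auto
    qed (simp add: gr.finsum_zero)
    finally show ?thesis .
  qed
  have "denorm_mult Y n c c' \<gamma> = (\<Oplus>\<^bsub>?R\<^esub>\<alpha>\<in>Pow {1..n}. (\<Oplus>\<^bsub>denorm_mod Y n\<^esub>\<beta>\<in>Pow {1..n}.
      tens_wedge Y n \<alpha> \<beta> (dg_mult Y (card \<alpha>) (card \<beta>) (c \<alpha>) (c' \<beta>))) \<gamma>)"
    unfolding denorm_mult_def
    by (rule mod_finsum)
      (use \<gamma> cG in \<open>auto intro!: mod_finsum_closed tens_wedge_closed mult_closed simp del: mod_simps\<close>)
  also have "\<dots> = (\<Oplus>\<^bsub>?R\<^esub>\<alpha>\<in>Pow {1..n}. if \<alpha> \<subseteq> \<gamma> then t \<alpha> else \<zero>\<^bsub>?R\<^esub>)"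
    by (rule gr.finsum_cong') (use inner tC in auto)
  also have "\<dots> = (\<Oplus>\<^bsub>?R\<^esub>\<alpha>\<in>Pow \<gamma>. t \<alpha>)"
    by (rule gr.add.finprod_mono_neutral_cong_right) (use \<gamma> tC in auto)
  finally show ?thesis by (simp add: t_def)
qed

end

lemma inversions_image:
  assumes "\<And>a b. a < b \<longleftrightarrow> f a < f b"
  shows "inversions (f ` \<alpha>) (f ` \<beta>) = inversions \<alpha> \<beta>"
proof -
  have inj: "inj f" using assms by (metis injI less_irrefl linorder_neqE_nat)
  have "{(a, b). a \<in> f ` \<alpha> \<and> b \<in> f ` \<beta> \<and> b < a} = map_prod f f ` {(a, b). a \<in> \<alpha> \<and> b \<in> \<beta> \<and> b < a}"
    using assms by (auto simp: image_iff)
  moreover have "inj_on (map_prod f f) A" for A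
    using map_prod_inj_on[OF inj inj] by (auto intro: inj_on_subset)
  ultimately show ?thesis unfolding inversions_def by (simp add: card_image)
qed

lemma inversions_finite: "finite \<alpha> \<Longrightarrow> finite \<beta> \<Longrightarrow> finite {(a, b). a \<in> \<alpha> \<and> b \<in> \<beta> \<and> b < (a::nat)}"
  by (rule finite_subset[of _ "\<alpha> \<times> \<beta>"]) auto

lemma inversions_Un_left:
  assumes "finite \<alpha>" "finite \<alpha>'" "finite \<beta>" "\<alpha> \<inter> \<alpha>' = {}"
  shows "inversions (\<alpha> \<union> \<alpha>') \<beta> = inversions \<alpha> \<beta> + inversions \<alpha>' \<beta>"
proof -
  have "{(a, b). a \<in> \<alpha> \<union> \<alpha>' \<and> b \<in> \<beta> \<and> b < a} =
      {(a, b). a \<in> \<alpha> \<and> b \<in> \<beta> \<and> b < a} \<union> {(a, b). a \<in> \<alpha>' \<and> b \<in> \<beta> \<and> b < a}" by auto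
  then show ?thesis
    unfolding inversions_def using assms by (simp only:) (rule card_Un_disjoint, auto intro: inversions_finite)
qed

lemma inversions_Un_right:
  assumes "finite \<alpha>" "finite \<beta>" "finite \<beta>'" "\<beta> \<inter> \<beta>' = {}"
  shows "inversions \<alpha> (\<beta> \<union> \<beta>') = inversions \<alpha> \<beta> + inversions \<alpha> \<beta>'"
proof -
  have "{(a, b). a \<in> \<alpha> \<and> b \<in> \<beta> \<union> \<beta>' \<and> b < a} =
      {(a, b). a \<in> \<alpha> \<and> b \<in> \<beta> \<and> b < a} \<union> {(a, b). a \<in> \<alpha> \<and> b \<in> \<beta>' \<and> b < a}" by auto
  then show ?thesis
    unfolding inversions_def using assms by (simp only:) (rule card_Un_disjoint, auto intro: inversions_finite)
qed

lemma inversions_above: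
  assumes "\<And>a b. a \<in> \<alpha> \<Longrightarrow> b \<in> \<beta> \<Longrightarrow> b < a"
  shows "inversions \<alpha> \<beta> = card \<alpha> * card \<beta>"
proof -
  have "{(a, b). a \<in> \<alpha> \<and> b \<in> \<beta> \<and> b < a} = \<alpha> \<times> \<beta>" using assms by auto
  then show ?thesis by (simp only: inversions_def card_cartesian_product)
qed

lemma inversions_below:
  assumes "\<And>a b. a \<in> \<alpha> \<Longrightarrow> b \<in> \<beta> \<Longrightarrow> a \<le> b"
  shows "inversions \<alpha> \<beta> = 0"
proof -
  have "{(a, b). a \<in> \<alpha> \<and> b \<in> \<beta> \<and> b < a} = {}" using assms by (auto simp: not_less[symmetric])
  then show ?thesis by (simp only: inversions_def card.empty)
qed

text \<open>
  Exchanging two neighbours creates one inversion, between the two, and leaves all others in place.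
\<close>

lemma inversions_swap:
  assumes fin: "finite \<alpha>" "finite \<beta>" and i: "i \<in> \<alpha>" "Suc i \<notin> \<alpha>" "Suc i \<in> \<beta>" "i \<notin> \<beta>"
  shows "inversions (insert (Suc i) (\<alpha> - {i})) (insert i (\<beta> - {Suc i})) = Suc (inversions \<alpha> \<beta>)"
proof -
  define A B where AB: "A = \<alpha> - {i}" "B = \<beta> - {Suc i}"
  have a: "\<alpha> = A \<union> {i}" and b: "\<beta> = B \<union> {Suc i}" using i by (auto simp: AB)
  have f: "finite A" "finite B" and n: "i \<notin> A" "Suc i \<notin> A" "i \<notin> B" "Suc i \<notin> B"
    using fin i by (auto simp: AB)
  have "inversions A {i} = inversions A {Suc i}"
  proof -
    have "bij_betw (\<lambda>p. (fst p, Suc (snd p))) {(a, b). a \<in> A \<and> b \<in> {i} \<and> b < a} {(a, b). a \<in> A \<and> b \<in> {Suc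
        i} \<and> b < a}"
      by (rule bij_betw_byWitness[where f' = "\<lambda>p. (fst p, i)"]) (use n in \<open>auto intro: Suc_lessI\<close>)
    then show ?thesis unfolding inversions_def by (rule bij_betw_same_card)
  qed
  moreover have "inversions {Suc i} B = inversions {i} B"
  proof -
    have "bij_betw (\<lambda>p. (i, snd p)) {(a, b). a \<in> {Suc i} \<and> b \<in> B \<and> b < a} {(a, b). a \<in> {i} \<and> b \<in> B \<and> b < a}"
      by (rule bij_betw_byWitness[where f' = "\<lambda>p. (Suc i, snd p)"]) (use n in \<open>auto simp: less_Suc_eq\<close>)
    then show ?thesis unfolding inversions_def by (rule bij_betw_same_card)
  qed
  moreover have "inversions {Suc i} {i} = 1" "inversions {i} {Suc i} = 0"
    using inversions_above[of "{Suc i}" "{i}"] inversions_below[of "{i}" "{Suc i}"] by simp_all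
  moreover have "inversions (A \<union> {Suc i}) (B \<union> {i}) =
      inversions A B + inversions A {i} + (inversions {Suc i} B + inversions {Suc i} {i})"
    using f n by (simp add: inversions_Un_left inversions_Un_right del: Un_insert_right Un_insert_left)
  moreover have "inversions (A \<union> {i}) (B \<union> {Suc i}) =
      inversions A B + inversions A {Suc i} + (inversions {i} B + inversions {i} {Suc i})"
    using f n by (simp add: inversions_Un_left inversions_Un_right del: Un_insert_right Un_insert_left)
  ultimately have "inversions (A \<union> {Suc i}) (B \<union> {i}) = Suc (inversions (A \<union> {i}) (B \<union> {Suc i}))" by simp
  moreover have "A \<union> {Suc i} = insert (Suc i) (\<alpha> - {i})" "B \<union> {i} = insert i (\<beta> - {Suc i})"
    by (auto simp: AB)
  ultimately show ?thesis by (simp only: a[symmetric] b[symmetric])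
qed

lemma sigma_minus_range:
  assumes "\<gamma> \<subseteq> {1..Suc m}" "Suc j \<notin> \<gamma>" "j \<le> m"
  shows "sigma j ` \<gamma> \<subseteq> {1..m}"
proof
  fix a assume "a \<in> sigma j ` \<gamma>"
  then obtain b where b: "b \<in> \<gamma>" "a = sigma j b" by blast
  then have "1 \<le> b" "b \<le> Suc m" "b \<noteq> Suc j" using assms by auto
  then show "a \<in> {1..m}" using assms b by (auto simp: sigma_def)
qed

lemma delta_delta_image: "i \<le> j \<Longrightarrow> delta (Suc i) ` delta (Suc j) ` \<gamma> = delta (Suc (Suc j)) ` delta (Suc i) ` \<gamma>"
  unfolding image_image by (rule image_cong) (auto simp: delta_def)

lemma sigma_delta_less: "i < j \<Longrightarrow> sigma i ` delta (Suc j) ` \<gamma> = delta j ` sigma i ` \<gamma>"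
  unfolding image_image by (rule image_cong) (auto simp: delta_def sigma_def)

lemma sigma_delta_greater: "Suc j < i \<Longrightarrow> sigma i ` delta (Suc j) ` \<gamma> = delta (Suc j) ` sigma (i - 1) ` \<gamma>"
  unfolding image_image by (rule image_cong) (auto simp: delta_def sigma_def)

lemma sigma_sigma_image: "i < j \<Longrightarrow> sigma i ` sigma j ` \<gamma> = sigma (j - 1) ` sigma i ` \<gamma>"
  unfolding image_image by (rule image_cong) (auto simp: sigma_def)

lemma mem_delta_image:
  "a \<in> delta i ` \<gamma> \<longleftrightarrow> (if a < i then a \<in> \<gamma> else a \<noteq> i \<and> a - 1 \<in> \<gamma>)"
proof
  assume R: "if a < i then a \<in> \<gamma> else a \<noteq> i \<and> a - 1 \<in> \<gamma>"
  show "a \<in> delta i ` \<gamma>"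
  proof (cases "a < i")
    case True
    then show ?thesis using R by (intro image_eqI[of _ _ a]) (auto simp: delta_def)
  next
    case False
    then show ?thesis using R by (intro image_eqI[of _ _ "a - 1"]) (auto simp: delta_def)
  qed
qed (auto simp: delta_def split: if_splits)

lemma drop_shift_delta:
  assumes "1 \<le> j" "0 \<notin> \<gamma>"
  shows "drop_shift (delta (Suc j) ` \<gamma>) = delta j ` drop_shift \<gamma>"
proof (rule Set.set_eqI)
  fix a
  have 0: "0 \<notin> delta (Suc j) ` \<gamma>" using assms by (auto simp: mem_delta_image)
  show "a \<in> drop_shift (delta (Suc j) ` \<gamma>) \<longleftrightarrow> a \<in> delta j ` drop_shift \<gamma>"
    unfolding mem_drop_shift[OF 0] mem_delta_image mem_drop_shift[OF assms(2)] using assms by (cases a) auto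
qed

lemma drop_shift_delta_1: "0 \<notin> \<gamma> \<Longrightarrow> drop_shift (delta (Suc 0) ` \<gamma>) = \<gamma>"
proof (rule Set.set_eqI)
  fix a assume \<gamma>: "0 \<notin> \<gamma>"
  then have 0: "0 \<notin> delta (Suc 0) ` \<gamma>" by (auto simp: mem_delta_image)
  show "a \<in> drop_shift (delta (Suc 0) ` \<gamma>) \<longleftrightarrow> a \<in> \<gamma>"
    unfolding mem_drop_shift[OF 0] mem_delta_image using \<gamma> by (cases a) auto
qed

lemma drop_shift_sigma:
  assumes "2 \<le> j" "0 \<notin> \<gamma>"
  shows "drop_shift (sigma j ` \<gamma>) = sigma (j - 1) ` drop_shift \<gamma>"
proof (rule Set.set_eqI)
  fix a
  have 0: "0 \<notin> sigma j ` \<gamma>" using assms by (auto simp: mem_sigma_image)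
  show "a \<in> drop_shift (sigma j ` \<gamma>) \<longleftrightarrow> a \<in> sigma (j - 1) ` drop_shift \<gamma>"
    unfolding mem_drop_shift[OF 0] mem_sigma_image mem_drop_shift[OF assms(2)] using assms by (cases j) auto
qed

lemma drop_shift_sigma_1:
  assumes "0 \<notin> \<gamma>"
  shows "drop_shift (sigma (Suc 0) ` \<gamma>) = drop_shift (drop_shift \<gamma>)"
proof (rule Set.set_eqI)
  fix a
  have 0: "0 \<notin> sigma (Suc 0) ` \<gamma>" "0 \<notin> drop_shift \<gamma>" using assms by (auto simp: mem_sigma_image mem_drop_shift)
  show "a \<in> drop_shift (sigma (Suc 0) ` \<gamma>) \<longleftrightarrow> a \<in> drop_shift (drop_shift \<gamma>)"
    unfolding mem_drop_shift[OF 0(1)] mem_drop_shift[OF 0(2)] mem_sigma_image mem_drop_shift[OF assms] by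
        (cases a) auto
qed

lemma drop_shift_interval: "drop_shift {1..Suc n} = {1..n}"
  by (rule Set.set_eqI) (auto simp: mem_drop_shift)

context dg_algebra
begin

lemma idx_0: "\<gamma> \<subseteq> {1..n::nat} \<Longrightarrow> 0 \<notin> \<gamma>"
  by auto

lemma K_mem: "c \<in> KC n \<Longrightarrow> \<alpha> \<subseteq> {1..n} \<Longrightarrow> c \<alpha> \<in> G (card \<alpha>)"
  by auto

text \<open>
  If \<open>\<gamma>\<close> misses \<open>j + 1\<close>, the coefficient at \<open>\<gamma>\<close> is a coefficient of the \<open>j\<close>-th codegeneracy. This is the
  principle by which identities in the denormalization are reduced to their top coefficients.
\<close>

lemma K_joint_inj:
  assumes c: "c \<in> KC n" and c': "c' \<in> KC n" and top: "c {1..n} = c' {1..n}"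
    and s: "\<And>m j. n = Suc m \<Longrightarrow> j \<le> m \<Longrightarrow> cs_codegen K m j c = cs_codegen K m j c'"
  shows "c = c'"
proof (rule KC_eqI)
  fix \<gamma> assume \<gamma>: "\<gamma> \<subseteq> {1..n}"
  show "c \<gamma> = c' \<gamma>"
  proof (cases "\<gamma> = {1..n}")
    case False
    then obtain i where i: "i \<in> {1..n}" "i \<notin> \<gamma>" using \<gamma> by blast
    then obtain m j where n: "n = Suc m" and j: "i = Suc j" "j \<le> m"
      by (cases n; cases i) auto
    have r: "sigma j ` \<gamma> \<subseteq> {1..m}" using sigma_minus_range \<gamma> i n j by blast
    have D: "delta (Suc j) ` sigma j ` \<gamma> = \<gamma>" using delta_sigma_image i j by blast
    have "cs_codegen K m j c (sigma j ` \<gamma>) = c \<gamma>" "cs_codegen K m j c' (sigma j ` \<gamma>) = c' \<gamma>"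
      using codegen_apply[OF _ r j(2), of c] codegen_apply[OF _ r j(2), of c'] c c' n D
      by (simp_all del: K_simps)
    then show ?thesis using s[OF n j(2)] by simp
  qed (use top in simp)
qed (use c c' in simp_all)

lemma K_eqI: "c \<in> KC n \<Longrightarrow> c' \<in> KC n \<Longrightarrow> (\<And>\<gamma>. \<gamma> \<subseteq> {1..n} \<Longrightarrow> c \<gamma> = c' \<gamma>) \<Longrightarrow> c = c'"
  using KC_eqI[of c n "\<lambda>\<alpha>. G (card \<alpha>)" c' "\<lambda>\<alpha>. G (card \<alpha>)"] by simp

lemma K_codegen_codegen:
  assumes "i \<le> j" "j \<le> n" "c \<in> KC (Suc (Suc n))"
  shows "cs_codegen K n j (cs_codegen K (Suc n) i c) = cs_codegen K n i (cs_codegen K (Suc n) (Suc j) c)"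
proof (rule K_eqI)
  fix \<gamma> assume \<gamma>: "\<gamma> \<subseteq> {1..n}"
  show "cs_codegen K n j (cs_codegen K (Suc n) i c) \<gamma> = cs_codegen K n i (cs_codegen K (Suc n) (Suc j) c) \<gamma>"
    using assms \<gamma> codegen_closed[OF assms(3)] delta_range[OF \<gamma>]
    by (simp add: codegen_apply delta_delta_image del: K_simps)
qed (use codegen_closed[OF codegen_closed[OF assms(3)]] in blast)+

lemma K_codegen_coface_less:
  assumes "i < j" "j \<le> Suc n" "c \<in> KC (Suc n)"
  shows "cs_codegen K (Suc n) j (cs_coface K (Suc n) i c) = cs_coface K n i (cs_codegen K n (j - 1) c)"
proof (rule K_eqI)
  fix \<gamma> assume \<gamma>: "\<gamma> \<subseteq> {1..Suc n}"
  note d = delta_range[OF \<gamma>, of "Suc j"]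
  show "cs_codegen K (Suc n) j (cs_coface K (Suc n) i c) \<gamma> = cs_coface K n i (cs_codegen K n (j - 1) c) \<gamma>"
  proof (cases "i = 0")
    case True
    have 1: "1 \<in> delta (Suc j) ` \<gamma> \<longleftrightarrow> 1 \<in> \<gamma>" using assms True by (simp add: mem_delta_image)
    show ?thesis
      using True assms \<gamma> d coface_closed[OF assms(3)] codegen_closed[OF assms(3)] drop_shift_range[OF \<gamma>]
        drop_shift_delta[of j \<gamma>] idx_0[OF \<gamma>] 1
      by (simp add: codegen_apply coface_0_apply del: K_simps)
  next
    case False
    have m: "merges (Suc n) i (delta (Suc j) ` \<gamma>) \<longleftrightarrow> merges n i \<gamma>"
      using assms by (auto simp: merges_def mem_delta_image)
    show ?thesis
      using False assms \<gamma> d coface_closed[OF assms(3)] codegen_closed[OF assms(3)]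
        sigma_range[OF \<gamma>, of i] m
      by (simp add: codegen_apply coface_apply sigma_delta_less del: K_simps)
  qed
qed (use coface_closed[OF codegen_closed[OF assms(3)]] codegen_closed[OF coface_closed[OF assms(3)]] in blast)+

lemma K_codegen_coface_id:
  assumes "j \<le> n" "i = j \<or> i = Suc j" "c \<in> KC n"
  shows "cs_codegen K n j (cs_coface K n i c) = c"
proof (rule K_eqI)
  fix \<gamma> assume \<gamma>: "\<gamma> \<subseteq> {1..n}"
  note d = delta_range[OF \<gamma>, of "Suc j"]
  show "cs_codegen K n j (cs_coface K n i c) \<gamma> = c \<gamma>"
  proof (cases "i = 0")
    case True
    then have "1 \<notin> delta (Suc j) ` \<gamma>" using assms by (simp add: mem_delta_image)
    then show ?thesis
      using True assms \<gamma> d coface_closed[OF assms(3)] drop_shift_delta_1[OF idx_0[OF \<gamma>]]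
      by (simp add: codegen_apply coface_0_apply del: K_simps)
  next
    case False
    have m: "\<not> merges n i (delta (Suc j) ` \<gamma>)"
      using assms by (auto simp: merges_def mem_delta_image)
    have "sigma i ` delta (Suc j) ` \<gamma> = \<gamma>" "1 \<le> i" "i \<le> Suc n" using assms False by auto
    then show ?thesis
      using assms \<gamma> d coface_closed[OF assms(3)] m
      by (simp add: codegen_apply coface_apply del: K_simps)
  qed
qed (use codegen_closed[OF coface_closed[OF assms(3)]] assms(3) in blast)+

lemma K_codegen_coface_greater:
  assumes "Suc j < i" "i \<le> Suc (Suc n)" "c \<in> KC (Suc n)"
  shows "cs_codegen K (Suc n) j (cs_coface K (Suc n) i c) = cs_coface K n (i - 1) (cs_codegen K n j c)"
proof (rule K_eqI)
  fix \<gamma> assume \<gamma>: "\<gamma> \<subseteq> {1..Suc n}"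
  note d = delta_range[OF \<gamma>, of "Suc j"]
  have m: "merges (Suc n) i (delta (Suc j) ` \<gamma>) \<longleftrightarrow> merges n (i - 1) \<gamma>"
    using assms by (auto simp: merges_def mem_delta_image)
  show "cs_codegen K (Suc n) j (cs_coface K (Suc n) i c) \<gamma> = cs_coface K n (i - 1) (cs_codegen K n j c) \<gamma>"
    using assms \<gamma> d coface_closed[OF assms(3)] codegen_closed[OF assms(3)]
      sigma_range[OF \<gamma>, of "i - 1"] m
    by (simp add: codegen_apply coface_apply sigma_delta_greater del: K_simps)
qed (use coface_closed[OF codegen_closed[OF assms(3)]] codegen_closed[OF coface_closed[OF assms(3)]] in blast)+

lemma diff_zero: "dg_diff Y n \<zero>\<^bsub>dg_gr Y n\<^esub> = \<zero>\<^bsub>dg_gr Y (Suc n)\<^esub>"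
  by (rule additive_map_zero[OF diff_additive])

lemma card_drop_shift_1: "\<gamma> \<subseteq> {1..n} \<Longrightarrow> 1 \<in> \<gamma> \<Longrightarrow> card \<gamma> = Suc (card (drop_shift \<gamma>))"
  using finite_idx card_drop_shift by (metis card.remove)

lemma card_drop_shift_not_1: "\<gamma> \<subseteq> {1..n} \<Longrightarrow> 1 \<notin> \<gamma> \<Longrightarrow> card (drop_shift \<gamma>) = card \<gamma>"
  using card_drop_shift[of \<gamma> n] by simp

lemma K_coface_coface:
  assumes "i < j" "j \<le> Suc (Suc n)" "c \<in> KC n"
  shows "cs_coface K (Suc n) j (cs_coface K n i c) = cs_coface K (Suc n) i (cs_coface K n (j - 1) c)"
proof (rule K_eqI)
  fix \<gamma> assume \<gamma>: "\<gamma> \<subseteq> {1..Suc (Suc n)}"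
  note c = assms(3) and cc = coface_closed[OF assms(3)]
  have s: "\<not> merges (Suc n) j \<gamma> \<Longrightarrow> sigma j ` \<gamma> \<subseteq> {1..Suc n}"
    using sigma_range[OF \<gamma>, of j] assms by simp
  have cs: "\<not> merges (Suc n) j \<gamma> \<Longrightarrow> card (sigma j ` \<gamma>) = card \<gamma>" for j
    by (rule card_sigma) (auto simp: merges_def)
  have sh: "drop_shift \<gamma> \<subseteq> {1..Suc n}" by (rule drop_shift_range[OF \<gamma>])
  note cG = K_mem[OF c]
  show "cs_coface K (Suc n) j (cs_coface K n i c) \<gamma> = cs_coface K (Suc n) i (cs_coface K n (j - 1) c) \<gamma>"
  proof (cases "i = 0")
    case i: True
    show ?thesis
    proof (cases "j = 1")
      case True
      have m: "merges (Suc n) 1 \<gamma> \<longleftrightarrow> 1 \<in> \<gamma> \<and> 2 \<in> \<gamma>" by (auto simp: merges_def numeral_2_eq_2)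
      have 2: "1 \<in> drop_shift \<gamma> \<longleftrightarrow> 2 \<in> \<gamma>" using mem_drop_shift[OF idx_0[OF \<gamma>], of 1] by (simp add:
          numeral_2_eq_2)
      have L: "cs_coface K (Suc n) 1 (cs_coface K n 0 c) \<gamma> =
          (if 1 \<in> \<gamma> \<and> 2 \<in> \<gamma> then \<zero>\<^bsub>dg_gr Y (card \<gamma>)\<^esub>
           else if 1 \<in> \<gamma> \<or> 2 \<in> \<gamma> then dg_diff Y (card (drop_shift (drop_shift \<gamma>))) (c (drop_shift
               (drop_shift \<gamma>))) else c (drop_shift (drop_shift \<gamma>)))"
        using coface_apply[OF cc \<gamma>, of 1] coface_0_apply[OF c, of "sigma 1 ` \<gamma>"] s True m
          drop_shift_sigma_1[OF idx_0[OF \<gamma>]]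
        by (simp add: mem_sigma_image numeral_2_eq_2 del: K_simps)
      have "cs_coface K (Suc n) 0 (cs_coface K n 0 c) \<gamma> =
          (if 1 \<in> \<gamma> \<and> 2 \<in> \<gamma> then \<zero>\<^bsub>dg_gr Y (card \<gamma>)\<^esub>
           else if 1 \<in> \<gamma> \<or> 2 \<in> \<gamma> then dg_diff Y (card (drop_shift (drop_shift \<gamma>))) (c (drop_shift
               (drop_shift \<gamma>))) else c (drop_shift (drop_shift \<gamma>)))"
      proof (cases "1 \<in> \<gamma> \<and> 2 \<in> \<gamma>")
        case True
        then have "card \<gamma> = Suc (Suc (card (drop_shift (drop_shift \<gamma>))))"
          using card_drop_shift_1[OF \<gamma>] card_drop_shift_1[OF sh] 2 by simp
        then show ?thesis
          using True coface_0_apply[OF cc \<gamma>] coface_0_apply[OF c sh] 2 card_drop_shift_1[OF sh]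
            diff_diff[OF cG[OF drop_shift_range[OF sh]]] by (simp del: K_simps)
      next
        case False
        then show ?thesis
          using coface_0_apply[OF cc \<gamma>] coface_0_apply[OF c sh] 2 card_drop_shift_not_1[OF sh]
          by (auto simp del: K_simps)
      qed
      with L show ?thesis using i True by simp
    next
      case False
      then have j: "2 \<le> j" using assms i by simp
      have m: "merges n (j - 1) (drop_shift \<gamma>) \<longleftrightarrow> merges (Suc n) j \<gamma>"
        using j mem_drop_shift[OF idx_0[OF \<gamma>], of "j - 1"] mem_drop_shift[OF idx_0[OF \<gamma>], of j]
        by (cases j) (simp_all add: merges_def)
      have 1: "1 \<in> sigma j ` \<gamma> \<longleftrightarrow> 1 \<in> \<gamma>" using j by (simp add: mem_sigma_image)
      have S: "drop_shift (sigma j ` \<gamma>) = sigma (j - 1) ` drop_shift \<gamma>" by (rule drop_shift_sigma[OF j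
          idx_0[OF \<gamma>]])
      have cS: "card (sigma (j - 1) ` drop_shift \<gamma>) = card (drop_shift \<gamma>)" if "\<not> merges n (j - 1)
          (drop_shift \<gamma>)"
        using that by (intro card_sigma) (auto simp: merges_def)
      have J: "1 \<le> j" "j \<le> Suc (Suc n)" "1 \<le> j - 1" "j - 1 \<le> Suc n" using j assms by auto
      show ?thesis
        unfolding i coface_apply[OF cc \<gamma> J(1,2)] coface_0_apply[OF cc \<gamma>] coface_apply[OF c sh J(3,4)] m
      proof (cases "merges (Suc n) j \<gamma>")
        case True
        then show "(if merges (Suc n) j \<gamma> then \<zero>\<^bsub>dg_gr Y (card \<gamma>)\<^esub> else cs_coface K n 0 c (sigma j ` \<gamma>)) =
            (if 1 \<in> \<gamma> then dg_diff Y (card (drop_shift \<gamma>)) (if merges (Suc n) j \<gamma>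
               then \<zero>\<^bsub>dg_gr Y (card (drop_shift \<gamma>))\<^esub> else c (sigma (j - 1) ` drop_shift \<gamma>))
             else if merges (Suc n) j \<gamma> then \<zero>\<^bsub>dg_gr Y (card (drop_shift \<gamma>))\<^esub> else c (sigma (j - 1) `
                 drop_shift \<gamma>))"
          using card_drop_shift_1[OF \<gamma>] card_drop_shift_not_1[OF \<gamma>] by (cases "1 \<in> \<gamma>") (simp_all add: diff_zero)
      next
        case False
        then show "(if merges (Suc n) j \<gamma> then \<zero>\<^bsub>dg_gr Y (card \<gamma>)\<^esub> else cs_coface K n 0 c (sigma j ` \<gamma>)) =
            (if 1 \<in> \<gamma> then dg_diff Y (card (drop_shift \<gamma>)) (if merges (Suc n) j \<gamma>
               then \<zero>\<^bsub>dg_gr Y (card (drop_shift \<gamma>))\<^esub> else c (sigma (j - 1) ` drop_shift \<gamma>))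
             else if merges (Suc n) j \<gamma> then \<zero>\<^bsub>dg_gr Y (card (drop_shift \<gamma>))\<^esub> else c (sigma (j - 1) `
                 drop_shift \<gamma>))"
          using coface_0_apply[OF c s[OF False]] 1 cS m by (simp add: S del: K_simps)
      qed
    qed
  next
    case i: False
    have I: "1 \<le> i" "i \<le> Suc (Suc n)" "i \<le> Suc n" "1 \<le> j" "1 \<le> j - 1" "j - 1 \<le> Suc n"
      using i assms by auto
    have m: "merges (Suc n) j \<gamma> \<or> merges n i (sigma j ` \<gamma>) \<longleftrightarrow>
        merges (Suc n) i \<gamma> \<or> merges n (j - 1) (sigma i ` \<gamma>)"
      using assms i by (cases j) (auto simp: merges_def mem_sigma_image split: if_splits)
    have si: "\<not> merges (Suc n) i \<gamma> \<Longrightarrow> sigma i ` \<gamma> \<subseteq> {1..Suc n}"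
      using sigma_range[OF \<gamma> I(1,2)] .
    show ?thesis
      unfolding coface_apply[OF cc \<gamma> I(4) assms(2)] coface_apply[OF cc \<gamma> I(1,2)]
      using m s si cs coface_apply[OF c, of "sigma j ` \<gamma>" i] coface_apply[OF c, of "sigma i ` \<gamma>" "j - 1"] I
        sigma_sigma_image[OF assms(1), of \<gamma>]
      by (auto simp del: K_simps)
  qed
qed (use coface_closed[OF coface_closed[OF assms(3)]] in blast)+

end

context dg_algebra
begin

lemma K_add_monoid: "add_monoid (cs_obj K n) = add_monoid (denorm_mod Y n)"
  by (simp add: denorm_def denorm_mod_def)

lemma K_group: "abelian_group (cs_obj K n)"
  using mod_group[of n] unfolding abelian_group_def abelian_monoid_def abelian_group_axioms_def K_add_monoid .

lemma K_eval_additive: "\<gamma> \<subseteq> {1..n} \<Longrightarrow> additive_map (cs_obj K n) (dg_gr Y (card \<gamma>)) (\<lambda>c. c \<gamma>)"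
  by (intro additive_mapI K_group gr.abelian_group_axioms) auto

definition shuffle_term where
  "shuffle_term \<gamma> \<alpha> u v = signed (dg_gr Y (card \<gamma>)) (inversions \<alpha> (\<gamma> - \<alpha>)) (dg_mult Y (card \<alpha>) (card (\<gamma> -
      \<alpha>)) u v)"

lemma K_mult_apply:
  "c \<in> KC n \<Longrightarrow> c' \<in> KC n \<Longrightarrow> \<gamma> \<subseteq> {1..n} \<Longrightarrow> (c \<otimes>\<^bsub>cs_obj K n\<^esub> c') \<gamma> =
    (\<Oplus>\<^bsub>dg_gr Y (card \<gamma>)\<^esub>\<alpha>\<in>Pow \<gamma>. shuffle_term \<gamma> \<alpha> (c \<alpha>) (c' (\<gamma> - \<alpha>)))"
  unfolding shuffle_term_def using denorm_mult_apply by simp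

lemma shuffle_term_closed:
  assumes "\<gamma> \<subseteq> {1..n}" "\<alpha> \<subseteq> \<gamma>" "u \<in> G (card \<alpha>)" "v \<in> G (card (\<gamma> - \<alpha>))"
  shows "shuffle_term \<gamma> \<alpha> u v \<in> G (card \<gamma>)"
  unfolding shuffle_term_def using mult_closed'[OF assms(3,4,2,1)] by simp

lemma shuffle_term_additive:
  assumes "\<gamma> \<subseteq> {1..n}" "\<alpha> \<subseteq> \<gamma>"
  shows "v \<in> G (card (\<gamma> - \<alpha>)) \<Longrightarrow> additive_map (dg_gr Y (card \<alpha>)) (dg_gr Y (card \<gamma>)) (\<lambda>u. shuffle_term \<gamma> \<alpha> u v)"
    and "u \<in> G (card \<alpha>) \<Longrightarrow> additive_map (dg_gr Y (card (\<gamma> - \<alpha>))) (dg_gr Y (card \<gamma>)) (\<lambda>v. shuffle_term \<gamma> \<alpha> u v)"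
  using mult_additive_left[of v "card (\<gamma> - \<alpha>)" "card \<alpha>"] mult_additive_right[of u "card \<alpha>" "card (\<gamma> - \<alpha>)"]
    card_split[OF assms(2,1)]
  unfolding shuffle_term_def
  by (auto intro: additive_map_comp[OF _ gr.additive_map_of_signed])

lemma shuffle_term_zero:
  assumes "\<gamma> \<subseteq> {1..n}" "\<alpha> \<subseteq> \<gamma>" "u \<in> G (card \<alpha>)" "v \<in> G (card (\<gamma> - \<alpha>))"
    and "u = \<zero>\<^bsub>dg_gr Y (card \<alpha>)\<^esub> \<or> v = \<zero>\<^bsub>dg_gr Y (card (\<gamma> - \<alpha>))\<^esub>"
  shows "shuffle_term \<gamma> \<alpha> u v = \<zero>\<^bsub>dg_gr Y (card \<gamma>)\<^esub>"
  using additive_map_zero[OF shuffle_term_additive(1)[OF assms(1,2,4)]]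
    additive_map_zero[OF shuffle_term_additive(2)[OF assms(1,2,3)]] assms(5) by auto

lemma shuffle_term_smult:
  assumes "\<gamma> \<subseteq> {1..n}" "\<alpha> \<subseteq> \<gamma>" "u \<in> G (card \<alpha>)" "v \<in> G (card (\<gamma> - \<alpha>))" "a \<in> carrier k"
  shows "shuffle_term \<gamma> \<alpha> (a \<odot>\<^bsub>dg_gr Y (card \<alpha>)\<^esub> u) v = a \<odot>\<^bsub>dg_gr Y (card \<gamma>)\<^esub> shuffle_term \<gamma> \<alpha> u v"
    "shuffle_term \<gamma> \<alpha> u (a \<odot>\<^bsub>dg_gr Y (card (\<gamma> - \<alpha>))\<^esub> v) = a \<odot>\<^bsub>dg_gr Y (card \<gamma>)\<^esub> shuffle_term \<gamma> \<alpha> u v"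
  using mult_smult_left[OF assms(5,3,4)] mult_smult_right[OF assms(5,3,4)]
    card_split[OF assms(2,1)] mult_closed'[OF assms(3,4,2,1)] assms(5)
  by (simp_all add: shuffle_term_def signed_def gr.smult_r_minus)

lemma K_sub: "c \<in> KC n \<Longrightarrow> \<gamma> \<subseteq> {1..n} \<Longrightarrow> \<alpha> \<subseteq> \<gamma> \<Longrightarrow> c \<alpha> \<in> G (card \<alpha>)"
  "c \<in> KC n \<Longrightarrow> \<gamma> \<subseteq> {1..n} \<Longrightarrow> c (\<gamma> - \<alpha>) \<in> G (card (\<gamma> - \<alpha>))"
  by (rule K_mem; blast)+

lemma K_mult_closed: "c \<in> KC n \<Longrightarrow> c' \<in> KC n \<Longrightarrow> c \<otimes>\<^bsub>cs_obj K n\<^esub> c' \<in> KC n"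
  by (simp only: K_simps(5)) (rule denorm_mult_closed)

lemma K_add_closed: "c \<in> KC n \<Longrightarrow> c' \<in> KC n \<Longrightarrow> c \<oplus>\<^bsub>cs_obj K n\<^esub> c' \<in> KC n"
  by auto

lemma K_smult_closed: "a \<in> carrier k \<Longrightarrow> c \<in> KC n \<Longrightarrow> a \<odot>\<^bsub>cs_obj K n\<^esub> c \<in> KC n"
  by auto

lemma K_one_closed: "\<one>\<^bsub>cs_obj K n\<^esub> \<in> KC n"
  using tens_closed[of "dg_one Y" "{}" n] one_closed by simp

lemma K_one_apply: "\<gamma> \<subseteq> {1..n} \<Longrightarrow>
    \<one>\<^bsub>cs_obj K n\<^esub> \<gamma> = (if \<gamma> = {} then dg_one Y else \<zero>\<^bsub>dg_gr Y (card \<gamma>)\<^esub>)"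
  by (simp add: tens_apply)

lemma K_add_apply: "\<gamma> \<subseteq> {1..n} \<Longrightarrow> (c \<oplus>\<^bsub>cs_obj K n\<^esub> c') \<gamma> = c \<gamma> \<oplus>\<^bsub>dg_gr Y (card \<gamma>)\<^esub> c' \<gamma>"
  by simp

lemma K_smult_apply: "\<gamma> \<subseteq> {1..n} \<Longrightarrow> (a \<odot>\<^bsub>cs_obj K n\<^esub> c) \<gamma> = a \<odot>\<^bsub>dg_gr Y (card \<gamma>)\<^esub> c \<gamma>"
  by simp

lemma K_zero_apply: "\<gamma> \<subseteq> {1..n} \<Longrightarrow> \<zero>\<^bsub>cs_obj K n\<^esub> \<gamma> = \<zero>\<^bsub>dg_gr Y (card \<gamma>)\<^esub>"
  by simp

text \<open>
  Inversions between blocks add up, so that both bracketings carry the sign of the shuffle that sorts the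
  three blocks \<open>\<beta>\<close>, \<open>\<alpha> - \<beta>\<close>, \<open>\<gamma> - \<alpha>\<close>.
\<close>

lemma shuffle_assoc:
  assumes \<gamma>: "\<gamma> \<subseteq> {1..n}" and sub: "\<beta> \<subseteq> \<alpha>" "\<alpha> \<subseteq> \<gamma>"
    and u: "u \<in> G (card \<beta>)" "v \<in> G (card (\<alpha> - \<beta>))" "w \<in> G (card (\<gamma> - \<alpha>))"
  shows "shuffle_term \<gamma> \<alpha> (shuffle_term \<alpha> \<beta> u v) w =
    shuffle_term \<gamma> \<beta> u (shuffle_term (\<gamma> - \<beta>) (\<alpha> - \<beta>) v w)"
proof -
  have fin: "finite \<gamma>" "finite \<alpha>" "finite \<beta>"
    using finite_idx[OF \<gamma>] finite_subset[OF sub(2)] finite_subset[OF sub(1)] by simp_all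
  have D: "\<gamma> - \<beta> - (\<alpha> - \<beta>) = \<gamma> - \<alpha>" using sub by blast
  have cards: "card \<beta> + card (\<alpha> - \<beta>) = card \<alpha>" "card \<alpha> + card (\<gamma> - \<alpha>) = card \<gamma>"
    "card (\<alpha> - \<beta>) + card (\<gamma> - \<alpha>) = card (\<gamma> - \<beta>)" "card \<beta> + card (\<gamma> - \<beta>) = card \<gamma>"
    using card_split[of \<beta> \<alpha> n] card_split[of \<alpha> \<gamma> n] card_split[of "\<alpha> - \<beta>" "\<gamma> - \<beta>" n]
      card_split[of \<beta> \<gamma> n] sub \<gamma> D by auto
  have sh: "inversions \<alpha> (\<gamma> - \<alpha>) + inversions \<beta> (\<alpha> - \<beta>) = inversions \<beta> (\<gamma> - \<beta>) + inversions (\<alpha> - \<beta>) (\<gamma> - \<alpha>)"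
  proof -
    have "inversions \<alpha> (\<gamma> - \<alpha>) = inversions \<beta> (\<gamma> - \<alpha>) + inversions (\<alpha> - \<beta>) (\<gamma> - \<alpha>)"
      using inversions_Un_left[of \<beta> "\<alpha> - \<beta>" "\<gamma> - \<alpha>"] fin sub by (simp add: Un_absorb1)
    moreover have "inversions \<beta> (\<gamma> - \<beta>) = inversions \<beta> (\<alpha> - \<beta>) + inversions \<beta> (\<gamma> - \<alpha>)"
    proof -
      have "\<gamma> - \<beta> = (\<alpha> - \<beta>) \<union> (\<gamma> - \<alpha>)" using sub by blast
      then show ?thesis using inversions_Un_right[of \<beta> "\<alpha> - \<beta>" "\<gamma> - \<alpha>"] fin by auto
    qed
    ultimately show ?thesis by simp
  qed
  have uv: "dg_mult Y (card \<beta>) (card (\<alpha> - \<beta>)) u v \<in> G (card \<alpha>)"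
    using mult_closed[OF u(1,2)] cards by simp
  have vw: "dg_mult Y (card (\<alpha> - \<beta>)) (card (\<gamma> - \<alpha>)) v w \<in> G (card (\<gamma> - \<beta>))"
    using mult_closed[OF u(2,3)] cards by simp
  have assoc: "dg_mult Y (card \<alpha>) (card (\<gamma> - \<alpha>)) (dg_mult Y (card \<beta>) (card (\<alpha> - \<beta>)) u v) w =
      dg_mult Y (card \<beta>) (card (\<gamma> - \<beta>)) u (dg_mult Y (card (\<alpha> - \<beta>)) (card (\<gamma> - \<alpha>)) v w)"
    using mult_assoc[OF u] cards by simp
  have X: "dg_mult Y (card \<beta>) (card (\<gamma> - \<beta>)) u (dg_mult Y (card (\<alpha> - \<beta>)) (card (\<gamma> - \<alpha>)) v w) \<in> G (card \<gamma>)"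
    using mult_closed[OF u(1) vw] cards by simp
  show ?thesis
    using additive_map_signed[OF mult_additive_left[OF u(3), of "card \<alpha>"] uv]
      additive_map_signed[OF mult_additive_right[OF u(1), of "card (\<gamma> - \<beta>)"] vw] assoc cards sh X
    unfolding shuffle_term_def D by (simp add: gr.signed_signed)
qed

text \<open>
  Both sides are sums over the ordered partitions of \<open>\<gamma>\<close> into three blocks.
\<close>

lemma K_mult_assoc:
  assumes c: "c \<in> KC n" "c' \<in> KC n" "c'' \<in> KC n"
  shows "(c \<otimes>\<^bsub>cs_obj K n\<^esub> c') \<otimes>\<^bsub>cs_obj K n\<^esub> c'' = c \<otimes>\<^bsub>cs_obj K n\<^esub> (c' \<otimes>\<^bsub>cs_obj K n\<^esub> c'')"
proof (rule K_eqI)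
  fix \<gamma> assume \<gamma>: "\<gamma> \<subseteq> {1..n}"
  let ?R = "dg_gr Y (card \<gamma>)"
  define a where "a = (\<lambda>\<beta> \<delta>. shuffle_term \<gamma> \<beta> (c \<beta>) (shuffle_term (\<gamma> - \<beta>) \<delta> (c' \<delta>) (c'' (\<gamma> - \<beta> - \<delta>))))"
  note finP = finite_idx[OF \<gamma>]
  note mem = K_mem[OF c(1)] K_mem[OF c(2)] K_mem[OF c(3)]
  have aC: "a \<beta> \<delta> \<in> carrier ?R" if "\<beta> \<subseteq> \<gamma>" "\<delta> \<subseteq> \<gamma> - \<beta>" for \<beta> \<delta>
    unfolding a_def using that \<gamma>
    by (intro shuffle_term_closed[where n = n] mem) auto
  have aC': "a \<beta> (\<alpha> - \<beta>) \<in> carrier ?R" if "\<alpha> \<subseteq> \<gamma>" "\<beta> \<subseteq> \<alpha>" for \<alpha> \<beta>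
    using that by (intro aC) auto
  have "((c \<otimes>\<^bsub>cs_obj K n\<^esub> c') \<otimes>\<^bsub>cs_obj K n\<^esub> c'') \<gamma> =
      (\<Oplus>\<^bsub>?R\<^esub>\<alpha>\<in>Pow \<gamma>. \<Oplus>\<^bsub>?R\<^esub>\<beta>\<in>Pow \<alpha>. a \<beta> (\<alpha> - \<beta>))"
    unfolding K_mult_apply[OF K_mult_closed[OF c(1,2)] c(3) \<gamma>]
  proof (rule gr.finsum_cong'[OF refl])
    fix \<alpha> assume "\<alpha> \<in> Pow \<gamma>"
    then have \<alpha>: "\<alpha> \<subseteq> \<gamma>" "\<alpha> \<subseteq> {1..n}" using \<gamma> by auto
    have w: "c'' (\<gamma> - \<alpha>) \<in> G (card (\<gamma> - \<alpha>))" using \<gamma> by (intro mem) blast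
    show "shuffle_term \<gamma> \<alpha> ((c \<otimes>\<^bsub>cs_obj K n\<^esub> c') \<alpha>) (c'' (\<gamma> - \<alpha>)) = (\<Oplus>\<^bsub>?R\<^esub>\<beta>\<in>Pow \<alpha>. a \<beta> (\<alpha> - \<beta>))"
      unfolding K_mult_apply[OF c(1,2) \<alpha>(2)]
    proof (subst additive_map_finsum[OF shuffle_term_additive(1)[OF \<gamma> \<alpha>(1) w]])
      show "finite (Pow \<alpha>)" using finite_idx[OF \<alpha>(2)] by simp
      show "(\<lambda>\<beta>. shuffle_term \<alpha> \<beta> (c \<beta>) (c' (\<alpha> - \<beta>))) \<in> Pow \<alpha> \<rightarrow> G (card \<alpha>)"
        using \<alpha> by (auto intro!: shuffle_term_closed[where n = n] mem)
      show "(\<Oplus>\<^bsub>?R\<^esub>\<beta>\<in>Pow \<alpha>. shuffle_term \<gamma> \<alpha> (shuffle_term \<alpha> \<beta> (c \<beta>) (c' (\<alpha> - \<beta>))) (c'' (\<gamma> - \<alpha>))) =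
          (\<Oplus>\<^bsub>?R\<^esub>\<beta>\<in>Pow \<alpha>. a \<beta> (\<alpha> - \<beta>))"
      proof (rule gr.finsum_cong'[OF refl])
        fix \<beta> assume "\<beta> \<in> Pow \<alpha>"
        then have \<beta>: "\<beta> \<subseteq> \<alpha>" by blast
        then have D: "\<gamma> - \<beta> - (\<alpha> - \<beta>) = \<gamma> - \<alpha>" using \<alpha> by blast
        show "shuffle_term \<gamma> \<alpha> (shuffle_term \<alpha> \<beta> (c \<beta>) (c' (\<alpha> - \<beta>))) (c'' (\<gamma> - \<alpha>)) = a \<beta> (\<alpha> - \<beta>)"
          unfolding a_def D using \<alpha> \<beta> \<gamma> by (intro shuffle_assoc[OF \<gamma> \<beta> \<alpha>(1)] mem) auto
      qed (use \<alpha> aC' in auto)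
    qed
  qed (use aC' in \<open>auto intro!: gr.finsum_closed\<close>)
  also have "\<dots> = (\<Oplus>\<^bsub>?R\<^esub>p\<in>Sigma (Pow \<gamma>) Pow. a (snd p) (fst p - snd p))"
    by (rule gr.finsum_Sigma) (use aC' finP in \<open>auto intro: finite_subset\<close>)
  also have "\<dots> = (\<Oplus>\<^bsub>?R\<^esub>p\<in>(\<lambda>p. (snd p, fst p - snd p)) ` Sigma (Pow \<gamma>) Pow. a (fst p) (snd p))"
    by (subst gr.finsum_reindex) (use aC' in \<open>auto simp: inj_on_def\<close>)
  also have "(\<lambda>p. (snd p, fst p - snd p)) ` Sigma (Pow \<gamma>) Pow = Sigma (Pow \<gamma>) (\<lambda>\<beta>. Pow (\<gamma> - \<beta>))"
  proof (intro equalityI subsetI)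
    fix p assume "p \<in> Sigma (Pow \<gamma>) (\<lambda>\<beta>. Pow (\<gamma> - \<beta>))"
    then show "p \<in> (\<lambda>p. (snd p, fst p - snd p)) ` Sigma (Pow \<gamma>) Pow"
      by (intro image_eqI[of _ _ "(fst p \<union> snd p, fst p)"]) (auto simp: prod_eq_iff)
  qed auto
  also have "(\<Oplus>\<^bsub>?R\<^esub>p\<in>Sigma (Pow \<gamma>) (\<lambda>\<beta>. Pow (\<gamma> - \<beta>)). a (fst p) (snd p)) =
      (\<Oplus>\<^bsub>?R\<^esub>\<beta>\<in>Pow \<gamma>. \<Oplus>\<^bsub>?R\<^esub>\<delta>\<in>Pow (\<gamma> - \<beta>). a \<beta> \<delta>)"
    by (rule gr.finsum_Sigma[symmetric]) (use aC finP in auto)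
  also have "\<dots> = (c \<otimes>\<^bsub>cs_obj K n\<^esub> (c' \<otimes>\<^bsub>cs_obj K n\<^esub> c'')) \<gamma>"
    unfolding K_mult_apply[OF c(1) K_mult_closed[OF c(2,3)] \<gamma>]
  proof (rule gr.finsum_cong'[OF refl])
    show "(\<lambda>\<alpha>. shuffle_term \<gamma> \<alpha> (c \<alpha>) ((c' \<otimes>\<^bsub>cs_obj K n\<^esub> c'') (\<gamma> - \<alpha>))) \<in> Pow \<gamma> \<rightarrow> carrier ?R"
      using \<gamma> by (intro Pi_I shuffle_term_closed[OF \<gamma>] K_sub[OF c(1) \<gamma>] K_sub(2)[OF K_mult_closed[OF
          c(2,3)] \<gamma>]) auto
    fix \<beta> assume "\<beta> \<in> Pow \<gamma>"
    then have \<beta>: "\<beta> \<subseteq> \<gamma>" "\<gamma> - \<beta> \<subseteq> {1..n}" using \<gamma> by auto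
    have u: "c \<beta> \<in> G (card \<beta>)" using \<beta> \<gamma> by (intro mem) blast
    show "(\<Oplus>\<^bsub>?R\<^esub>\<delta>\<in>Pow (\<gamma> - \<beta>). a \<beta> \<delta>) = shuffle_term \<gamma> \<beta> (c \<beta>) ((c' \<otimes>\<^bsub>cs_obj K n\<^esub> c'') (\<gamma> - \<beta>))"
      unfolding K_mult_apply[OF c(2,3) \<beta>(2)] a_def
      by (rule additive_map_finsum[OF shuffle_term_additive(2)[OF \<gamma> \<beta>(1) u], symmetric])
        (use \<beta> finP in \<open>auto intro!: shuffle_term_closed[where n = n] mem\<close>)
  qed
  finally show "((c \<otimes>\<^bsub>cs_obj K n\<^esub> c') \<otimes>\<^bsub>cs_obj K n\<^esub> c'') \<gamma> =
      (c \<otimes>\<^bsub>cs_obj K n\<^esub> (c' \<otimes>\<^bsub>cs_obj K n\<^esub> c'')) \<gamma>" .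
qed (intro K_mult_closed c)+

lemma K_ring: "ring (cs_obj K n)"
proof (rule ringI[OF K_group])
  show "monoid (cs_obj K n)"
  proof (rule monoidI)
    fix c assume c: "c \<in> KC n"
    show "\<one>\<^bsub>cs_obj K n\<^esub> \<otimes>\<^bsub>cs_obj K n\<^esub> c = c"
    proof (rule K_eqI)
      fix \<gamma> assume \<gamma>: "\<gamma> \<subseteq> {1..n}"
      have "(\<one>\<^bsub>cs_obj K n\<^esub> \<otimes>\<^bsub>cs_obj K n\<^esub> c) \<gamma> = shuffle_term \<gamma> {} (\<one>\<^bsub>cs_obj K n\<^esub> {}) (c (\<gamma> - {}))"
        unfolding K_mult_apply[OF K_one_closed c \<gamma>]
      proof (rule gr.finsum_single)
        show "shuffle_term \<gamma> \<alpha> (\<one>\<^bsub>cs_obj K n\<^esub> \<alpha>) (c (\<gamma> - \<alpha>)) = \<zero>\<^bsub>dg_gr Y (card \<gamma>)\<^esub>"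
          if "\<alpha> \<in> Pow \<gamma>" "\<alpha> \<noteq> {}" for \<alpha>
          using that \<gamma> K_one_apply[of \<alpha> n] K_sub(1)[OF K_one_closed \<gamma>] K_sub[OF c \<gamma>]
          by (intro shuffle_term_zero[OF \<gamma>]) auto
        show "shuffle_term \<gamma> {} (\<one>\<^bsub>cs_obj K n\<^esub> {}) (c (\<gamma> - {})) \<in> G (card \<gamma>)"
          by (rule shuffle_term_closed[OF \<gamma> _ K_sub(1)[OF K_one_closed \<gamma>] K_sub(2)[OF c \<gamma>]]) auto
      qed (use finite_idx[OF \<gamma>] in auto)
      also have "\<dots> = c \<gamma>"
        using one_left[OF K_mem[OF c \<gamma>]] inversions_below[of "{}" \<gamma>] K_one_apply[of "{}" n]
        by (simp add: shuffle_term_def signed_def)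
      finally show "(\<one>\<^bsub>cs_obj K n\<^esub> \<otimes>\<^bsub>cs_obj K n\<^esub> c) \<gamma> = c \<gamma>" .
    qed (use c K_mult_closed K_one_closed in blast)+
    show "c \<otimes>\<^bsub>cs_obj K n\<^esub> \<one>\<^bsub>cs_obj K n\<^esub> = c"
    proof (rule K_eqI)
      fix \<gamma> assume \<gamma>: "\<gamma> \<subseteq> {1..n}"
      have "(c \<otimes>\<^bsub>cs_obj K n\<^esub> \<one>\<^bsub>cs_obj K n\<^esub>) \<gamma> = shuffle_term \<gamma> \<gamma> (c \<gamma>) (\<one>\<^bsub>cs_obj K n\<^esub> (\<gamma> - \<gamma>))"
        unfolding K_mult_apply[OF c K_one_closed \<gamma>]
      proof (rule gr.finsum_single)
        show "shuffle_term \<gamma> \<alpha> (c \<alpha>) (\<one>\<^bsub>cs_obj K n\<^esub> (\<gamma> - \<alpha>)) = \<zero>\<^bsub>dg_gr Y (card \<gamma>)\<^esub>"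
          if "\<alpha> \<in> Pow \<gamma>" "\<alpha> \<noteq> \<gamma>" for \<alpha>
        proof -
          have "\<gamma> - \<alpha> \<noteq> {}" "\<gamma> - \<alpha> \<subseteq> {1..n}" using that \<gamma> by auto
          then show ?thesis
            using that \<gamma> K_one_apply[of "\<gamma> - \<alpha>" n] K_sub(2)[OF K_one_closed \<gamma>] K_sub[OF c \<gamma>]
            by (intro shuffle_term_zero[OF \<gamma>]) auto
        qed
        show "shuffle_term \<gamma> \<gamma> (c \<gamma>) (\<one>\<^bsub>cs_obj K n\<^esub> (\<gamma> - \<gamma>)) \<in> G (card \<gamma>)"
          by (rule shuffle_term_closed[OF \<gamma> _ K_sub(1)[OF c \<gamma>] K_sub(2)[OF K_one_closed \<gamma>]]) auto
      qed (use finite_idx[OF \<gamma>] in auto)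
      also have "\<dots> = c \<gamma>"
        using one_right[OF K_mem[OF c \<gamma>]] inversions_below[of \<gamma> "{}"] K_one_apply[of "{}" n]
        by (simp add: shuffle_term_def signed_def)
      finally show "(c \<otimes>\<^bsub>cs_obj K n\<^esub> \<one>\<^bsub>cs_obj K n\<^esub>) \<gamma> = c \<gamma>" .
    qed (use c K_mult_closed K_one_closed in blast)+
  qed (intro K_mult_closed K_one_closed K_mult_assoc; assumption)+
  fix c c' e assume C: "c \<in> KC n" "c' \<in> KC n" "e \<in> KC n"
  show "(c \<oplus>\<^bsub>cs_obj K n\<^esub> c') \<otimes>\<^bsub>cs_obj K n\<^esub> e = c \<otimes>\<^bsub>cs_obj K n\<^esub> e \<oplus>\<^bsub>cs_obj K n\<^esub> c' \<otimes>\<^bsub>cs_obj K n\<^esub> e"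
  proof (rule K_eqI)
    fix \<gamma> assume \<gamma>: "\<gamma> \<subseteq> {1..n}"
    show "((c \<oplus>\<^bsub>cs_obj K n\<^esub> c') \<otimes>\<^bsub>cs_obj K n\<^esub> e) \<gamma> =
        (c \<otimes>\<^bsub>cs_obj K n\<^esub> e \<oplus>\<^bsub>cs_obj K n\<^esub> c' \<otimes>\<^bsub>cs_obj K n\<^esub> e) \<gamma>"
      unfolding K_add_apply[OF \<gamma>] K_mult_apply[OF C(1,3) \<gamma>] K_mult_apply[OF C(2,3) \<gamma>]
        K_mult_apply[OF K_add_closed[OF C(1,2)] C(3) \<gamma>]
    proof (subst gr.finsum_addf[symmetric])
      show "(\<Oplus>\<^bsub>dg_gr Y (card \<gamma>)\<^esub>\<alpha>\<in>Pow \<gamma>. shuffle_term \<gamma> \<alpha> ((c \<oplus>\<^bsub>cs_obj K n\<^esub> c') \<alpha>) (e (\<gamma> - \<alpha>))) =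
        (\<Oplus>\<^bsub>dg_gr Y (card \<gamma>)\<^esub>\<alpha>\<in>Pow \<gamma>. shuffle_term \<gamma> \<alpha> (c \<alpha>) (e (\<gamma> - \<alpha>)) \<oplus>\<^bsub>dg_gr Y (card \<gamma>)\<^esub>
          shuffle_term \<gamma> \<alpha> (c' \<alpha>) (e (\<gamma> - \<alpha>)))"
      proof (rule gr.finsum_cong'[OF refl])
        fix \<alpha> assume "\<alpha> \<in> Pow \<gamma>"
        then have \<alpha>: "\<alpha> \<subseteq> \<gamma>" "\<alpha> \<subseteq> {1..n}" using \<gamma> by auto
        show "shuffle_term \<gamma> \<alpha> ((c \<oplus>\<^bsub>cs_obj K n\<^esub> c') \<alpha>) (e (\<gamma> - \<alpha>)) =
            shuffle_term \<gamma> \<alpha> (c \<alpha>) (e (\<gamma> - \<alpha>)) \<oplus>\<^bsub>dg_gr Y (card \<gamma>)\<^esub> shuffle_term \<gamma> \<alpha> (c' \<alpha>) (e (\<gamma> - \<alpha>))"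
          unfolding K_add_apply[OF \<alpha>(2)]
          by (rule additive_map_add[OF shuffle_term_additive(1)[OF \<gamma> \<alpha>(1)]])
            (use K_sub[OF C(1) \<gamma>] K_sub[OF C(2) \<gamma>] K_sub[OF C(3) \<gamma>] \<alpha> in auto)
      qed (use shuffle_term_closed[OF \<gamma>] K_sub[OF C(1) \<gamma>] K_sub[OF C(2) \<gamma>] K_sub[OF C(3) \<gamma>] in auto)
    qed (use shuffle_term_closed[OF \<gamma>] K_sub[OF C(1) \<gamma>] K_sub[OF C(2) \<gamma>] K_sub[OF C(3) \<gamma>] in auto)
  qed (use C K_mult_closed K_add_closed in blast)+
  show "e \<otimes>\<^bsub>cs_obj K n\<^esub> (c \<oplus>\<^bsub>cs_obj K n\<^esub> c') = e \<otimes>\<^bsub>cs_obj K n\<^esub> c \<oplus>\<^bsub>cs_obj K n\<^esub> e \<otimes>\<^bsub>cs_obj K n\<^esub> c'"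
  proof (rule K_eqI)
    fix \<gamma> assume \<gamma>: "\<gamma> \<subseteq> {1..n}"
    show "(e \<otimes>\<^bsub>cs_obj K n\<^esub> (c \<oplus>\<^bsub>cs_obj K n\<^esub> c')) \<gamma> =
        (e \<otimes>\<^bsub>cs_obj K n\<^esub> c \<oplus>\<^bsub>cs_obj K n\<^esub> e \<otimes>\<^bsub>cs_obj K n\<^esub> c') \<gamma>"
      unfolding K_add_apply[OF \<gamma>] K_mult_apply[OF C(3,1) \<gamma>] K_mult_apply[OF C(3,2) \<gamma>]
        K_mult_apply[OF C(3) K_add_closed[OF C(1,2)] \<gamma>]
    proof (subst gr.finsum_addf[symmetric])
      show "(\<Oplus>\<^bsub>dg_gr Y (card \<gamma>)\<^esub>\<alpha>\<in>Pow \<gamma>. shuffle_term \<gamma> \<alpha> (e \<alpha>) ((c \<oplus>\<^bsub>cs_obj K n\<^esub> c') (\<gamma> - \<alpha>))) =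
        (\<Oplus>\<^bsub>dg_gr Y (card \<gamma>)\<^esub>\<alpha>\<in>Pow \<gamma>. shuffle_term \<gamma> \<alpha> (e \<alpha>) (c (\<gamma> - \<alpha>)) \<oplus>\<^bsub>dg_gr Y (card \<gamma>)\<^esub>
          shuffle_term \<gamma> \<alpha> (e \<alpha>) (c' (\<gamma> - \<alpha>)))"
      proof (rule gr.finsum_cong'[OF refl])
        fix \<alpha> assume "\<alpha> \<in> Pow \<gamma>"
        then have \<alpha>: "\<alpha> \<subseteq> \<gamma>" "\<gamma> - \<alpha> \<subseteq> {1..n}" using \<gamma> by auto
        show "shuffle_term \<gamma> \<alpha> (e \<alpha>) ((c \<oplus>\<^bsub>cs_obj K n\<^esub> c') (\<gamma> - \<alpha>)) =
            shuffle_term \<gamma> \<alpha> (e \<alpha>) (c (\<gamma> - \<alpha>)) \<oplus>\<^bsub>dg_gr Y (card \<gamma>)\<^esub> shuffle_term \<gamma> \<alpha> (e \<alpha>) (c' (\<gamma> - \<alpha>))"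
          unfolding K_add_apply[OF \<alpha>(2)]
          by (rule additive_map_add[OF shuffle_term_additive(2)[OF \<gamma> \<alpha>(1)]])
            (use K_sub[OF C(1) \<gamma>] K_sub[OF C(2) \<gamma>] K_sub[OF C(3) \<gamma>] \<alpha> in auto)
      qed (use shuffle_term_closed[OF \<gamma>] K_sub[OF C(1) \<gamma>] K_sub[OF C(2) \<gamma>] K_sub[OF C(3) \<gamma>] in auto)
    qed (use shuffle_term_closed[OF \<gamma>] K_sub[OF C(1) \<gamma>] K_sub[OF C(2) \<gamma>] K_sub[OF C(3) \<gamma>] in auto)
  qed (use C K_mult_closed K_add_closed in blast)+
qed

lemma smult_additive: "a \<in> carrier k \<Longrightarrow> additive_map (dg_gr Y n) (dg_gr Y n) (\<lambda>x. a \<odot>\<^bsub>dg_gr Y n\<^esub> x)"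
  by (intro additive_mapI gr.abelian_group_axioms) (simp_all add: gr.smult_r_distr)

lemma K_module: "Module.module k (cs_obj K n)"
  by (rule moduleI[OF gr.R.is_cring K_group])
    (auto simp: gr.smult_l_distr gr.smult_r_distr gr.smult_assoc1 KC_coeff fun_eq_iff PiE_iff
      extensional_def restrict_def)

lemma K_algebra: "assoc_algebra k (cs_obj K n)"
  unfolding assoc_algebra_def
proof (intro conjI ballI K_module K_ring)
  fix a c e assume a: "a \<in> carrier k" and C: "c \<in> KC n" "e \<in> KC n"
  note aC = K_smult_closed[OF a]
  show "(a \<odot>\<^bsub>cs_obj K n\<^esub> c) \<otimes>\<^bsub>cs_obj K n\<^esub> e = a \<odot>\<^bsub>cs_obj K n\<^esub> (c \<otimes>\<^bsub>cs_obj K n\<^esub> e)"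
  proof (rule K_eqI)
    fix \<gamma> assume \<gamma>: "\<gamma> \<subseteq> {1..n}"
    show "((a \<odot>\<^bsub>cs_obj K n\<^esub> c) \<otimes>\<^bsub>cs_obj K n\<^esub> e) \<gamma> = (a \<odot>\<^bsub>cs_obj K n\<^esub> (c \<otimes>\<^bsub>cs_obj K n\<^esub> e)) \<gamma>"
      unfolding K_smult_apply[OF \<gamma>] K_mult_apply[OF C \<gamma>] K_mult_apply[OF aC[OF C(1)] C(2) \<gamma>]
    proof (subst additive_map_finsum[OF smult_additive[OF a]])
      show "(\<Oplus>\<^bsub>dg_gr Y (card \<gamma>)\<^esub>\<alpha>\<in>Pow \<gamma>. shuffle_term \<gamma> \<alpha> ((a \<odot>\<^bsub>cs_obj K n\<^esub> c) \<alpha>) (e (\<gamma> - \<alpha>))) =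
          (\<Oplus>\<^bsub>dg_gr Y (card \<gamma>)\<^esub>\<alpha>\<in>Pow \<gamma>. a \<odot>\<^bsub>dg_gr Y (card \<gamma>)\<^esub> shuffle_term \<gamma> \<alpha> (c \<alpha>) (e (\<gamma> - \<alpha>)))"
      proof (rule gr.finsum_cong'[OF refl])
        fix \<alpha> assume "\<alpha> \<in> Pow \<gamma>"
        then have \<alpha>: "\<alpha> \<subseteq> \<gamma>" "\<alpha> \<subseteq> {1..n}" using \<gamma> by auto
        show "shuffle_term \<gamma> \<alpha> ((a \<odot>\<^bsub>cs_obj K n\<^esub> c) \<alpha>) (e (\<gamma> - \<alpha>)) =
            a \<odot>\<^bsub>dg_gr Y (card \<gamma>)\<^esub> shuffle_term \<gamma> \<alpha> (c \<alpha>) (e (\<gamma> - \<alpha>))"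
          unfolding K_smult_apply[OF \<alpha>(2)]
          by (rule shuffle_term_smult(1)[OF \<gamma> \<alpha>(1)]) (use K_sub[OF C(1) \<gamma>] K_sub[OF C(2) \<gamma>] \<alpha> a in auto)
      qed (use a shuffle_term_closed[OF \<gamma>] K_sub[OF C(1) \<gamma>] K_sub[OF C(2) \<gamma>] in auto)
    qed (use finite_idx[OF \<gamma>] shuffle_term_closed[OF \<gamma>] K_sub[OF C(1) \<gamma>] K_sub[OF C(2) \<gamma>] in auto)
  qed (use C aC K_mult_closed in blast)+
  show "c \<otimes>\<^bsub>cs_obj K n\<^esub> (a \<odot>\<^bsub>cs_obj K n\<^esub> e) = a \<odot>\<^bsub>cs_obj K n\<^esub> (c \<otimes>\<^bsub>cs_obj K n\<^esub> e)"
  proof (rule K_eqI)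
    fix \<gamma> assume \<gamma>: "\<gamma> \<subseteq> {1..n}"
    show "(c \<otimes>\<^bsub>cs_obj K n\<^esub> (a \<odot>\<^bsub>cs_obj K n\<^esub> e)) \<gamma> = (a \<odot>\<^bsub>cs_obj K n\<^esub> (c \<otimes>\<^bsub>cs_obj K n\<^esub> e)) \<gamma>"
      unfolding K_smult_apply[OF \<gamma>] K_mult_apply[OF C \<gamma>] K_mult_apply[OF C(1) aC[OF C(2)] \<gamma>]
    proof (subst additive_map_finsum[OF smult_additive[OF a]])
      show "(\<Oplus>\<^bsub>dg_gr Y (card \<gamma>)\<^esub>\<alpha>\<in>Pow \<gamma>. shuffle_term \<gamma> \<alpha> (c \<alpha>) ((a \<odot>\<^bsub>cs_obj K n\<^esub> e) (\<gamma> - \<alpha>))) =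
          (\<Oplus>\<^bsub>dg_gr Y (card \<gamma>)\<^esub>\<alpha>\<in>Pow \<gamma>. a \<odot>\<^bsub>dg_gr Y (card \<gamma>)\<^esub> shuffle_term \<gamma> \<alpha> (c \<alpha>) (e (\<gamma> - \<alpha>)))"
      proof (rule gr.finsum_cong'[OF refl])
        fix \<alpha> assume "\<alpha> \<in> Pow \<gamma>"
        then have \<alpha>: "\<alpha> \<subseteq> \<gamma>" "\<gamma> - \<alpha> \<subseteq> {1..n}" using \<gamma> by auto
        show "shuffle_term \<gamma> \<alpha> (c \<alpha>) ((a \<odot>\<^bsub>cs_obj K n\<^esub> e) (\<gamma> - \<alpha>)) =
            a \<odot>\<^bsub>dg_gr Y (card \<gamma>)\<^esub> shuffle_term \<gamma> \<alpha> (c \<alpha>) (e (\<gamma> - \<alpha>))"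
          unfolding K_smult_apply[OF \<alpha>(2)]
          by (rule shuffle_term_smult(2)[OF \<gamma> \<alpha>(1)]) (use K_sub[OF C(1) \<gamma>] K_sub[OF C(2) \<gamma>] \<alpha> a in auto)
      qed (use a shuffle_term_closed[OF \<gamma>] K_sub[OF C(1) \<gamma>] K_sub[OF C(2) \<gamma>] in auto)
    qed (use finite_idx[OF \<gamma>] shuffle_term_closed[OF \<gamma>] K_sub[OF C(1) \<gamma>] K_sub[OF C(2) \<gamma>] in auto)
  qed (use C aC K_mult_closed in blast)+
qed

end

context dg_algebra
begin

lemma K_codegen_add:
  assumes "c \<in> KC (Suc n)" "c' \<in> KC (Suc n)" "j \<le> n"
  shows "cs_codegen K n j (c \<oplus>\<^bsub>cs_obj K (Suc n)\<^esub> c') = cs_codegen K n j c \<oplus>\<^bsub>cs_obj K n\<^esub> cs_codegen K n j c'"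
proof (rule K_eqI)
  fix \<gamma> assume \<gamma>: "\<gamma> \<subseteq> {1..n}"
  show "cs_codegen K n j (c \<oplus>\<^bsub>cs_obj K (Suc n)\<^esub> c') \<gamma> = (cs_codegen K n j c \<oplus>\<^bsub>cs_obj K n\<^esub> cs_codegen K n j c') \<gamma>"
    using assms \<gamma> delta_range[OF \<gamma>, of "Suc j"] K_add_closed[OF assms(1,2)]
    by (simp add: codegen_apply K_add_apply del: K_simps)
qed (use assms codegen_closed K_add_closed in blast)+

lemma K_codegen_smult:
  assumes "a \<in> carrier k" "c \<in> KC (Suc n)" "j \<le> n"
  shows "cs_codegen K n j (a \<odot>\<^bsub>cs_obj K (Suc n)\<^esub> c) = a \<odot>\<^bsub>cs_obj K n\<^esub> cs_codegen K n j c"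
proof (rule K_eqI)
  fix \<gamma> assume \<gamma>: "\<gamma> \<subseteq> {1..n}"
  show "cs_codegen K n j (a \<odot>\<^bsub>cs_obj K (Suc n)\<^esub> c) \<gamma> = (a \<odot>\<^bsub>cs_obj K n\<^esub> cs_codegen K n j c) \<gamma>"
    using assms \<gamma> delta_range[OF \<gamma>, of "Suc j"] K_smult_closed[OF assms(1,2)]
    by (simp add: codegen_apply K_smult_apply del: K_simps)
qed (use assms codegen_closed K_smult_closed in blast)+

lemma K_codegen_one:
  assumes "j \<le> n"
  shows "cs_codegen K n j \<one>\<^bsub>cs_obj K (Suc n)\<^esub> = \<one>\<^bsub>cs_obj K n\<^esub>"
proof (rule K_eqI)
  fix \<gamma> assume \<gamma>: "\<gamma> \<subseteq> {1..n}"
  show "cs_codegen K n j \<one>\<^bsub>cs_obj K (Suc n)\<^esub> \<gamma> = \<one>\<^bsub>cs_obj K n\<^esub> \<gamma>"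
    unfolding codegen_apply[OF K_one_closed \<gamma> assms] K_one_apply[OF \<gamma>] K_one_apply[OF delta_range[OF \<gamma>]]
    by simp
qed (use codegen_closed K_one_closed in blast)+

lemma delta_image_Diff: "\<alpha> \<subseteq> \<gamma> \<Longrightarrow> delta j ` \<gamma> - delta j ` \<alpha> = delta j ` (\<gamma> - \<alpha>)"
  using inj_on_image_set_diff[OF delta_inj[of j UNIV], of \<gamma> \<alpha>] by auto

lemma K_codegen_mult:
  assumes c: "c \<in> KC (Suc n)" "c' \<in> KC (Suc n)" and j: "j \<le> n"
  shows "cs_codegen K n j (c \<otimes>\<^bsub>cs_obj K (Suc n)\<^esub> c') = cs_codegen K n j c \<otimes>\<^bsub>cs_obj K n\<^esub> cs_codegen K n j c'"
proof (rule K_eqI)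
  note sc = codegen_closed[OF c(1), of j] codegen_closed[OF c(2), of j]
  fix \<gamma> assume \<gamma>: "\<gamma> \<subseteq> {1..n}"
  let ?d = "(`) (delta (Suc j))"
  note d = delta_range[OF \<gamma>, of "Suc j"]
  have inj: "inj_on ?d (Pow \<gamma>)"
    using inj_on_image_Pow[OF delta_inj[of "Suc j" \<gamma>]] .
  have cl: "shuffle_term (?d \<gamma>) \<alpha> (c \<alpha>) (c' (?d \<gamma> - \<alpha>)) \<in> G (card \<gamma>)" if "\<alpha> \<subseteq> ?d \<gamma>" for \<alpha>
    using shuffle_term_closed[OF d that K_sub(1)[OF c(1) d that] K_sub(2)[OF c(2) d]] by simp
  have eq: "shuffle_term (?d \<gamma>) (?d \<alpha>) (c (?d \<alpha>)) (c' (?d \<gamma> - ?d \<alpha>)) =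
      shuffle_term \<gamma> \<alpha> (cs_codegen K n j c \<alpha>) (cs_codegen K n j c' (\<gamma> - \<alpha>))" if "\<alpha> \<subseteq> \<gamma>" for \<alpha>
  proof -
    have "\<alpha> \<subseteq> {1..n}" "\<gamma> - \<alpha> \<subseteq> {1..n}" using that \<gamma> by auto
    then show ?thesis
      using inversions_image[of "delta (Suc j)" \<alpha> "\<gamma> - \<alpha>"]
      by (simp add: codegen_apply[OF c(1) _ j] codegen_apply[OF c(2) _ j] shuffle_term_def
          delta_image_Diff[OF that])
  qed
  have "cs_codegen K n j (c \<otimes>\<^bsub>cs_obj K (Suc n)\<^esub> c') \<gamma> =
      (\<Oplus>\<^bsub>dg_gr Y (card \<gamma>)\<^esub>\<alpha>\<in>Pow (?d \<gamma>). shuffle_term (?d \<gamma>) \<alpha> (c \<alpha>) (c' (?d \<gamma> - \<alpha>)))"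
    unfolding codegen_apply[OF K_mult_closed[OF c] \<gamma> j] K_mult_apply[OF c d] by simp
  also have "\<dots> = (\<Oplus>\<^bsub>dg_gr Y (card \<gamma>)\<^esub>\<alpha>\<in>?d ` Pow \<gamma>. shuffle_term (?d \<gamma>) \<alpha> (c \<alpha>) (c' (?d \<gamma> - \<alpha>)))"
    by (rule arg_cong[where f = "finsum _ _"]) (rule image_Pow_surj[OF refl, symmetric])
  also have "\<dots> = (\<Oplus>\<^bsub>dg_gr Y (card \<gamma>)\<^esub>\<alpha>\<in>Pow \<gamma>. shuffle_term (?d \<gamma>) (?d \<alpha>) (c (?d \<alpha>)) (c' (?d \<gamma> - ?d \<alpha>)))"
    by (rule gr.finsum_reindex[OF _ inj]) (auto intro!: cl)
  also have "\<dots> = (\<Oplus>\<^bsub>dg_gr Y (card \<gamma>)\<^esub>\<alpha>\<in>Pow \<gamma>.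
      shuffle_term \<gamma> \<alpha> (cs_codegen K n j c \<alpha>) (cs_codegen K n j c' (\<gamma> - \<alpha>)))"
  proof (rule gr.finsum_cong'[OF refl])
    show "(\<lambda>\<alpha>. shuffle_term \<gamma> \<alpha> (cs_codegen K n j c \<alpha>) (cs_codegen K n j c' (\<gamma> - \<alpha>))) \<in> Pow \<gamma> \<rightarrow> G (card \<gamma>)"
      by (intro Pi_I shuffle_term_closed[OF \<gamma>] K_sub(1)[OF sc(1) \<gamma>] K_sub(2)[OF sc(2) \<gamma>]) auto
  qed (use eq in auto)
  also have "\<dots> = (cs_codegen K n j c \<otimes>\<^bsub>cs_obj K n\<^esub> cs_codegen K n j c') \<gamma>"
    by (rule K_mult_apply[OF sc \<gamma>, symmetric])
  finally show "cs_codegen K n j (c \<otimes>\<^bsub>cs_obj K (Suc n)\<^esub> c') \<gamma> =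
      (cs_codegen K n j c \<otimes>\<^bsub>cs_obj K n\<^esub> cs_codegen K n j c') \<gamma>" .
qed (use c codegen_closed K_mult_closed in blast)+

lemma K_codegen_hom: "j \<le> n \<Longrightarrow> cs_codegen K n j \<in> alg_hom k (cs_obj K (Suc n)) (cs_obj K n)"
  by (rule alg_homI)
    (rule codegen_closed K_codegen_add K_codegen_mult K_codegen_one K_codegen_smult; assumption)+

lemma K_coface_add:
  assumes c: "c \<in> KC n" "c' \<in> KC n" and i: "i \<le> Suc n"
  shows "cs_coface K n i (c \<oplus>\<^bsub>cs_obj K n\<^esub> c') = cs_coface K n i c \<oplus>\<^bsub>cs_obj K (Suc n)\<^esub> cs_coface K n i c'"
proof (rule K_eqI)
  fix \<gamma> assume \<gamma>: "\<gamma> \<subseteq> {1..Suc n}"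
  show "cs_coface K n i (c \<oplus>\<^bsub>cs_obj K n\<^esub> c') \<gamma> = (cs_coface K n i c \<oplus>\<^bsub>cs_obj K (Suc n)\<^esub> cs_coface K n i c') \<gamma>"
  proof (cases "i = 0")
    case True
    note sh = drop_shift_range[OF \<gamma>]
    show ?thesis
      unfolding True K_add_apply[OF \<gamma>] coface_0_apply[OF c(1) \<gamma>] coface_0_apply[OF c(2) \<gamma>]
        coface_0_apply[OF K_add_closed[OF c] \<gamma>] K_add_apply[OF sh]
      using card_drop_shift_1[OF \<gamma>] card_drop_shift_not_1[OF \<gamma>] diff_add[OF K_mem[OF c(1) sh] K_mem[OF
          c(2) sh]] by simp
  next
    case False
    then have i: "1 \<le> i" "i \<le> Suc n" using i by auto
    show ?thesis
      unfolding K_add_apply[OF \<gamma>] coface_apply[OF c(1) \<gamma> i] coface_apply[OF c(2) \<gamma> i]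
        coface_apply[OF K_add_closed[OF c] \<gamma> i]
      using K_add_apply[OF sigma_range[OF \<gamma> i], of c c'] card_sigma[of i \<gamma>]
      by (auto simp: merges_def simp del: K_simps)
  qed
qed (use c coface_closed K_add_closed in blast)+

lemma K_coface_smult:
  assumes c: "c \<in> KC n" and a: "a \<in> carrier k" and i: "i \<le> Suc n"
  shows "cs_coface K n i (a \<odot>\<^bsub>cs_obj K n\<^esub> c) = a \<odot>\<^bsub>cs_obj K (Suc n)\<^esub> cs_coface K n i c"
proof (rule K_eqI)
  fix \<gamma> assume \<gamma>: "\<gamma> \<subseteq> {1..Suc n}"
  show "cs_coface K n i (a \<odot>\<^bsub>cs_obj K n\<^esub> c) \<gamma> = (a \<odot>\<^bsub>cs_obj K (Suc n)\<^esub> cs_coface K n i c) \<gamma>"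
  proof (cases "i = 0")
    case True
    note sh = drop_shift_range[OF \<gamma>]
    show ?thesis
      unfolding True K_smult_apply[OF \<gamma>] coface_0_apply[OF c \<gamma>]
        coface_0_apply[OF K_smult_closed[OF a c] \<gamma>] K_smult_apply[OF sh]
      using card_drop_shift_1[OF \<gamma>] card_drop_shift_not_1[OF \<gamma>] diff_smult[OF a K_mem[OF c sh]] by simp
  next
    case False
    then have i: "1 \<le> i" "i \<le> Suc n" using i by auto
    show ?thesis
      unfolding K_smult_apply[OF \<gamma>] coface_apply[OF c \<gamma> i] coface_apply[OF K_smult_closed[OF a c] \<gamma> i]
      using K_smult_apply[OF sigma_range[OF \<gamma> i], of a c] card_sigma[of i \<gamma>] a
      by (auto simp: merges_def gr.smult_r_null simp del: K_simps)
  qed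
qed (use c a coface_closed K_smult_closed in blast)+

lemma diff_one: "dg_diff Y 0 (dg_one Y) = \<zero>\<^bsub>dg_gr Y 1\<^esub>"
proof -
  have d: "dg_diff Y 0 (dg_one Y) \<in> G 1" using diff_closed[OF one_closed] by simp
  have "dg_diff Y 0 (dg_one Y) = dg_diff Y 0 (dg_one Y) \<oplus>\<^bsub>dg_gr Y 1\<^esub> dg_diff Y 0 (dg_one Y)"
    using leibniz[OF one_closed one_closed] one_left[OF one_closed] one_right[of "dg_diff Y 0 (dg_one Y)" 1]
      one_left[of "dg_diff Y 0 (dg_one Y)" 1] d
    by (simp add: signed_def)
  then show ?thesis using d gr.add.l_cancel_one[of "dg_diff Y 0 (dg_one Y)" 1 "dg_diff Y 0 (dg_one Y)"] by simp
qed

lemma K_coface_one: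
  assumes i: "i \<le> Suc n"
  shows "cs_coface K n i \<one>\<^bsub>cs_obj K n\<^esub> = \<one>\<^bsub>cs_obj K (Suc n)\<^esub>"
proof (rule K_eqI)
  fix \<gamma> assume \<gamma>: "\<gamma> \<subseteq> {1..Suc n}"
  show "cs_coface K n i \<one>\<^bsub>cs_obj K n\<^esub> \<gamma> = \<one>\<^bsub>cs_obj K (Suc n)\<^esub> \<gamma>"
  proof (cases "i = 0")
    case True
    note sh = drop_shift_range[OF \<gamma>]
    have S: "Suc ` drop_shift \<gamma> = \<gamma> - {1}" by (rule Suc_drop_shift[OF \<gamma>])
    show ?thesis
      unfolding True coface_0_apply[OF K_one_closed \<gamma>] K_one_apply[OF sh] K_one_apply[OF \<gamma>]
      using card_drop_shift_1[OF \<gamma>] card_drop_shift_not_1[OF \<gamma>] S diff_one diff_zero[of "card (drop_shift \<gamma>)"]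
      by (cases "drop_shift \<gamma> = {}"; cases "1 \<in> \<gamma>") auto
  next
    case False
    then have i: "1 \<le> i" "i \<le> Suc n" using i by auto
    show ?thesis
    proof (cases "merges n i \<gamma>")
      case True
      then have "\<gamma> \<noteq> {}" by (auto simp: merges_def)
      then show ?thesis unfolding coface_apply[OF K_one_closed \<gamma> i] K_one_apply[OF \<gamma>] using True by simp
    next
      case False
      then have "card (sigma i ` \<gamma>) = card \<gamma>" by (intro card_sigma) (auto simp: merges_def)
      then show ?thesis
        unfolding coface_apply[OF K_one_closed \<gamma> i] K_one_apply[OF \<gamma>]
        using False K_one_apply[OF sigma_range[OF \<gamma> i]] by (simp del: K_simps)
    qed
  qed
qed (use coface_closed K_one_closed in blast)+

lemma sigma_swap:
  "i \<in> \<alpha> \<Longrightarrow> Suc i \<notin> \<alpha> \<Longrightarrow> sigma i ` insert (Suc i) (\<alpha> - {i}) = sigma i ` \<alpha>"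
  "Suc i \<in> \<alpha> \<Longrightarrow> i \<notin> \<alpha> \<Longrightarrow> sigma i ` insert i (\<alpha> - {Suc i}) = sigma i ` \<alpha>"
  unfolding set_eq_iff mem_sigma_image by auto

text \<open>
  A summand vanishes if \<open>i\<close> and \<open>i + 1\<close> belong to the same factor. Otherwise it cancels against the summand
  in which \<open>i\<close> and \<open>i + 1\<close> are exchanged: the coefficients agree, and the sign of the shuffle changes.
\<close>

lemma K_coface_mult_top:
  assumes c: "c \<in> KC n" "c' \<in> KC n" and i: "1 \<le> i" "i \<le> Suc n"
  shows "(cs_coface K n i c \<otimes>\<^bsub>cs_obj K (Suc n)\<^esub> cs_coface K n i c') {1..Suc n} = \<zero>\<^bsub>dg_gr Y (Suc n)\<^esub>"
proof -
  let ?T = "{1..Suc n}" and ?R = "dg_gr Y (Suc n)"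
  note dc = coface_closed[OF c(1), of i] coface_closed[OF c(2), of i]
  note \<gamma> = subset_refl[of ?T]
  define t where "t = (\<lambda>\<alpha>. shuffle_term ?T \<alpha> (cs_coface K n i c \<alpha>) (cs_coface K n i c' (?T - \<alpha>)))"
  have tC: "t \<alpha> \<in> carrier ?R" if "\<alpha> \<subseteq> ?T" for \<alpha>
    using shuffle_term_closed[OF \<gamma> that K_sub(1)[OF dc(1) \<gamma> that] K_sub(2)[OF dc(2) \<gamma>]]
    by (simp add: t_def)
  have t0: "t \<alpha> = \<zero>\<^bsub>?R\<^esub>" if \<alpha>: "\<alpha> \<subseteq> ?T" and m: "merges n i \<alpha> \<or> merges n i (?T - \<alpha>)" for \<alpha>
    using shuffle_term_zero[OF \<gamma> \<alpha> K_sub(1)[OF dc(1) \<gamma> \<alpha>] K_sub(2)[OF dc(2) \<gamma>]] m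
      coface_apply[OF c(1) \<alpha> i] coface_apply[OF c(2) Diff_subset i, of \<alpha>]
    by (auto simp: t_def)
  have e: "(cs_coface K n i c \<otimes>\<^bsub>cs_obj K (Suc n)\<^esub> cs_coface K n i c') ?T = (\<Oplus>\<^bsub>?R\<^esub>\<alpha>\<in>Pow ?T. t \<alpha>)"
    using K_mult_apply[OF dc \<gamma>] by (simp add: t_def)
  show ?thesis
  proof (cases "i = Suc n")
    case True
    have "t \<alpha> = \<zero>\<^bsub>?R\<^esub>" if "\<alpha> \<in> Pow ?T" for \<alpha>
      using that True by (intro t0) (auto simp: merges_def)
    then show ?thesis unfolding e by (rule gr.finsum_zero')
  next
    case False
    then have i': "i \<le> n" using i by simp
    define P where "P = {\<alpha> \<in> Pow ?T. i \<in> \<alpha> \<and> Suc i \<notin> \<alpha>}"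
    define Q where "Q = {\<alpha> \<in> Pow ?T. i \<notin> \<alpha> \<and> Suc i \<in> \<alpha>}"
    define T where "T = (\<lambda>\<alpha>. insert (Suc i) (\<alpha> - {i}))"
    have "(\<Oplus>\<^bsub>?R\<^esub>\<alpha>\<in>Pow ?T. t \<alpha>) = (\<Oplus>\<^bsub>?R\<^esub>\<alpha>\<in>P \<union> Q. t \<alpha>)"
    proof (rule gr.add.finprod_mono_neutral_cong_right)
      fix \<alpha> assume "\<alpha> \<in> Pow ?T - (P \<union> Q)"
      then have "\<alpha> \<subseteq> ?T" "i \<in> \<alpha> \<longleftrightarrow> Suc i \<in> \<alpha>" by (auto simp: P_def Q_def)
      then show "t \<alpha> = \<zero>\<^bsub>?R\<^esub>" using i i' by (intro t0) (auto simp: merges_def)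
    qed (use tC in \<open>auto simp: P_def Q_def\<close>)
    also have "\<dots> = \<zero>\<^bsub>?R\<^esub>"
    proof (rule gr.finsum_pairing_zero[where T = T])
      show "bij_betw T P Q"
        by (rule bij_betw_byWitness[where f' = "\<lambda>\<alpha>. insert i (\<alpha> - {Suc i})"])
          (use i i' in \<open>auto simp: P_def Q_def T_def\<close>)
      show "t (T \<alpha>) = \<ominus>\<^bsub>?R\<^esub> t \<alpha>" if "\<alpha> \<in> P" for \<alpha>
      proof -
        have \<alpha>: "\<alpha> \<subseteq> ?T" "i \<in> \<alpha>" "Suc i \<notin> \<alpha>" using that by (auto simp: P_def)
        have T': "T \<alpha> \<subseteq> ?T" using \<alpha> i' by (auto simp: T_def)
        have D: "?T - T \<alpha> = insert i ((?T - \<alpha>) - {Suc i})" using \<alpha> i i' by (auto simp: T_def)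
        have fin: "finite \<alpha>" using finite_idx[OF \<alpha>(1)] .
        have s: "inversions (T \<alpha>) (?T - T \<alpha>) = Suc (inversions \<alpha> (?T - \<alpha>))"
          unfolding D unfolding T_def using \<alpha> i i' fin by (intro inversions_swap) auto
        have sg: "sigma i ` T \<alpha> = sigma i ` \<alpha>" "sigma i ` (?T - T \<alpha>) = sigma i ` (?T - \<alpha>)"
        proof -
          show "sigma i ` T \<alpha> = sigma i ` \<alpha>"
            unfolding T_def by (rule sigma_swap(1)[OF \<alpha>(2,3)])
          show "sigma i ` (?T - T \<alpha>) = sigma i ` (?T - \<alpha>)"
            unfolding D by (rule sigma_swap(2)) (use \<alpha> i i' in auto)
        qed
        have cd: "card (T \<alpha>) = card \<alpha>" "card (?T - T \<alpha>) = card (?T - \<alpha>)"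
        proof -
          show "card (T \<alpha>) = card \<alpha>"
            using \<alpha> fin card.remove[OF fin \<alpha>(2)] by (simp add: T_def)
          then show "card (?T - T \<alpha>) = card (?T - \<alpha>)"
            using card_split[OF T' \<gamma>] card_split[OF \<alpha>(1) \<gamma>] by simp
        qed
        have nm: "\<not> merges n i \<alpha>" "\<not> merges n i (T \<alpha>)" "\<not> merges n i (?T - \<alpha>)" "\<not> merges n i (?T - T \<alpha>)"
          using \<alpha> i' by (auto simp: merges_def T_def)
        have v: "cs_coface K n i c (T \<alpha>) = cs_coface K n i c \<alpha>"
          "cs_coface K n i c' (?T - T \<alpha>) = cs_coface K n i c' (?T - \<alpha>)"
          using coface_apply[OF c(1) T' i] coface_apply[OF c(1) \<alpha>(1) i]
            coface_apply[OF c(2) Diff_subset i, of "T \<alpha>"] coface_apply[OF c(2) Diff_subset i, of \<alpha>] nm sg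
          by simp_all
        have "dg_mult Y (card \<alpha>) (card (?T - \<alpha>)) (cs_coface K n i c \<alpha>) (cs_coface K n i c' (?T - \<alpha>)) \<in>
            carrier ?R"
          using mult_closed'[OF K_sub(1)[OF dc(1) \<gamma> \<alpha>(1)] K_sub(2)[OF dc(2) \<gamma>] \<alpha>(1) \<gamma>] by simp
        then show ?thesis
          unfolding t_def shuffle_term_def s cd v by (simp add: gr.signed_Suc)
      qed
    qed (use tC in \<open>auto simp: P_def Q_def\<close>)
    finally show ?thesis unfolding e .
  qed
qed

text \<open>
  The summands in which \<open>1\<close> belongs to the first factor sum to the top coefficient of \<open>dc c'\<close>, the others to
  that of \<open>\<plusminus>c dc'\<close>: this is the Leibniz rule of \<open>Y\<close>.
\<close>

lemma K_coface_0_mult_top: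
  assumes c: "c \<in> KC n" "c' \<in> KC n"
  shows "(cs_coface K n 0 c \<otimes>\<^bsub>cs_obj K (Suc n)\<^esub> cs_coface K n 0 c') {1..Suc n} =
    dg_diff Y n ((c \<otimes>\<^bsub>cs_obj K n\<^esub> c') {1..n})"
proof -
  let ?T = "{1..Suc n}" and ?R = "dg_gr Y (Suc n)" and ?S = "{1..n}"
  note dc = coface_closed[OF c(1), of 0] coface_closed[OF c(2), of 0]
  note \<gamma> = subset_refl[of ?T] and \<gamma>' = subset_refl[of ?S]
  define t where "t = (\<lambda>\<alpha>. shuffle_term ?T \<alpha> (cs_coface K n 0 c \<alpha>) (cs_coface K n 0 c' (?T - \<alpha>)))"
  have tC: "t \<alpha> \<in> carrier ?R" if "\<alpha> \<subseteq> ?T" for \<alpha>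
    using shuffle_term_closed[OF \<gamma> that K_sub(1)[OF dc(1) \<gamma> that] K_sub(2)[OF dc(2) \<gamma>]]
    by (simp add: t_def)
  define P where "P = (\<lambda>\<alpha>. Suc ` \<alpha>) ` Pow ?S"
  define Q where "Q = (\<lambda>\<alpha>. insert 1 (Suc ` \<alpha>)) ` Pow ?S"
  have PQ: "Pow ?T = Q \<union> P"
  proof (intro equalityI subsetI)
    fix \<alpha> assume "\<alpha> \<in> Pow ?T"
    then have \<alpha>: "\<alpha> \<subseteq> ?T" by simp
    have S: "Suc ` drop_shift \<alpha> = \<alpha> - {1}" "drop_shift \<alpha> \<in> Pow ?S" using Suc_drop_shift[OF \<alpha>]
        drop_shift_range[OF \<alpha>] by auto
    show "\<alpha> \<in> Q \<union> P"
    proof (cases "1 \<in> \<alpha>")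
      case True
      then have "\<alpha> = insert 1 (Suc ` drop_shift \<alpha>)" using S by auto
      then show ?thesis using S(2) unfolding Q_def by blast
    next
      case False
      then have "\<alpha> = Suc ` drop_shift \<alpha>" using S by auto
      then show ?thesis using S(2) unfolding P_def by blast
    qed
  qed (auto simp: P_def Q_def)
  have inj: "inj_on (\<lambda>\<alpha>. Suc ` \<alpha>) (Pow ?S)" "inj_on (\<lambda>\<alpha>. insert 1 (Suc ` \<alpha>)) (Pow ?S)"
  proof -
    show "inj_on (\<lambda>\<alpha>. Suc ` \<alpha>) (Pow ?S)" by (rule inj_on_image_Pow) simp
    show "inj_on (\<lambda>\<alpha>. insert 1 (Suc ` \<alpha>)) (Pow ?S)"
    proof (rule inj_onI)
      fix \<alpha> \<beta> assume ab: "\<alpha> \<in> Pow ?S" "\<beta> \<in> Pow ?S" "insert 1 (Suc ` \<alpha>) = insert 1 (Suc ` \<beta>)"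
      then have "1 \<notin> Suc ` \<alpha>" "1 \<notin> Suc ` \<beta>" by auto
      then have "Suc ` \<alpha> = Suc ` \<beta>" using ab(3) by (metis insert_ident)
      then show "\<alpha> = \<beta>" by (simp add: inj_image_eq_iff)
    qed
  qed
  have disj: "Q \<inter> P = {}"
  proof -
    have "1 \<notin> \<alpha>" if "\<alpha> \<in> P" for \<alpha> using that by (auto simp: P_def)
    then show ?thesis by (auto simp: Q_def)
  qed
  have tm: "t (insert 1 (Suc ` \<alpha>)) \<oplus>\<^bsub>?R\<^esub> t (Suc ` \<alpha>) = dg_diff Y n (shuffle_term ?S \<alpha> (c \<alpha>) (c' (?S - \<alpha>)))"
    if "\<alpha> \<in> Pow ?S" for \<alpha>
  proof -
    have \<alpha>: "\<alpha> \<subseteq> ?S" "?S - \<alpha> \<subseteq> ?S" using that by auto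
    let ?\<beta> = "?S - \<alpha>"
    have fin: "finite \<alpha>" "finite ?\<beta>" using finite_idx \<alpha> by blast+
    have 1: "1 \<notin> Suc ` \<alpha>" "1 \<notin> Suc ` ?\<beta>" using \<alpha> by auto
    have T: "Suc ` \<alpha> \<subseteq> ?T" "insert 1 (Suc ` \<alpha>) \<subseteq> ?T" "Suc ` ?\<beta> \<subseteq> ?T" "insert 1 (Suc ` ?\<beta>) \<subseteq> ?T"
      using \<alpha> by auto
    have TS: "?T = insert 1 (Suc ` ?S)" by (simp add: atLeastAtMost_insertL image_Suc_atLeastAtMost)
    have D: "?T - insert 1 (Suc ` \<alpha>) = Suc ` ?\<beta>" "?T - Suc ` \<alpha> = insert 1 (Suc ` ?\<beta>)"
      unfolding TS using 1 \<alpha> image_set_diff[OF inj_Suc, of ?S \<alpha>] by auto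
    have sh: "drop_shift (Suc ` \<alpha>) = \<alpha>" "drop_shift (insert 1 (Suc ` \<alpha>)) = \<alpha>" "drop_shift (Suc ` ?\<beta>) = ?\<beta>"
        "drop_shift (insert 1 (Suc ` ?\<beta>)) = ?\<beta>"
      using 1 by (simp_all add: drop_shift_def image_image)
    have cd: "card (Suc ` \<alpha>) = card \<alpha>" "card (insert 1 (Suc ` \<alpha>)) = Suc (card \<alpha>)"
      "card (Suc ` ?\<beta>) = card ?\<beta>" "card (insert 1 (Suc ` ?\<beta>)) = Suc (card ?\<beta>)" "card \<alpha> + card ?\<beta> = n"
      using 1 fin card_split[OF \<alpha>(1) \<gamma>'] by (simp_all add: card_image)
    have s0: "inversions (Suc ` \<alpha>) (Suc ` ?\<beta>) = inversions \<alpha> ?\<beta>" by (rule inversions_image) simp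
    have s1: "inversions (insert 1 (Suc ` \<alpha>)) (Suc ` ?\<beta>) = inversions \<alpha> ?\<beta>"
    proof -
      have "inversions ({1} \<union> Suc ` \<alpha>) (Suc ` ?\<beta>) = inversions {1} (Suc ` ?\<beta>) + inversions (Suc ` \<alpha>) (Suc ` ?\<beta>)"
        by (rule inversions_Un_left) (use 1 fin in auto)
      moreover have "inversions {1} (Suc ` ?\<beta>) = 0" by (rule inversions_below) auto
      ultimately show ?thesis using s0 by simp
    qed
    have s2: "inversions (Suc ` \<alpha>) (insert 1 (Suc ` ?\<beta>)) = card \<alpha> + inversions \<alpha> ?\<beta>"
    proof -
      have "inversions (Suc ` \<alpha>) {1} = card \<alpha>"
      proof -
        have "inversions (Suc ` \<alpha>) {1} = card (Suc ` \<alpha>) * card {1::nat}"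
          by (rule inversions_above) (use \<alpha> in auto)
        then show ?thesis using cd(1) by simp
      qed
      moreover have "inversions (Suc ` \<alpha>) ({1} \<union> Suc ` ?\<beta>) = inversions (Suc ` \<alpha>) {1} + inversions (Suc `
          \<alpha>) (Suc ` ?\<beta>)"
        by (rule inversions_Un_right) (use 1 fin in auto)
      ultimately show ?thesis using s0 by simp
    qed
    have ca: "c \<alpha> \<in> G (card \<alpha>)" and cb: "c' ?\<beta> \<in> G (card ?\<beta>)" using K_mem c \<alpha> by blast+
    have m: "dg_mult Y (card \<alpha>) (card ?\<beta>) (c \<alpha>) (c' ?\<beta>) \<in> G n"
      "dg_mult Y (Suc (card \<alpha>)) (card ?\<beta>) (dg_diff Y (card \<alpha>) (c \<alpha>)) (c' ?\<beta>) \<in> carrier ?R"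
      "dg_mult Y (card \<alpha>) (Suc (card ?\<beta>)) (c \<alpha>) (dg_diff Y (card ?\<beta>) (c' ?\<beta>)) \<in> carrier ?R"
      using mult_closed[OF ca cb] mult_closed[OF diff_closed[OF ca] cb] mult_closed[OF ca diff_closed[OF
          cb]] cd(5)
      by simp_all
    have t1: "t (insert 1 (Suc ` \<alpha>)) = signed ?R (inversions \<alpha> ?\<beta>)
        (dg_mult Y (Suc (card \<alpha>)) (card ?\<beta>) (dg_diff Y (card \<alpha>) (c \<alpha>)) (c' ?\<beta>))"
      unfolding t_def D shuffle_term_def coface_0_apply[OF c(1) T(2)] coface_0_apply[OF c(2) T(3)] cd sh s1
      using 1 by simp
    have t2: "t (Suc ` \<alpha>) = signed ?R (card \<alpha> + inversions \<alpha> ?\<beta>)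
        (dg_mult Y (card \<alpha>) (Suc (card ?\<beta>)) (c \<alpha>) (dg_diff Y (card ?\<beta>) (c' ?\<beta>)))"
      unfolding t_def D shuffle_term_def coface_0_apply[OF c(1) T(1)] coface_0_apply[OF c(2) T(4)] cd sh s2
      using 1 by simp
    have "dg_diff Y n (shuffle_term ?S \<alpha> (c \<alpha>) (c' ?\<beta>)) =
        signed ?R (inversions \<alpha> ?\<beta>) (dg_diff Y n (dg_mult Y (card \<alpha>) (card ?\<beta>) (c \<alpha>) (c' ?\<beta>)))"
      unfolding shuffle_term_def using m(1) by (simp add: additive_map_signed[OF diff_additive])
    also have "dg_diff Y n (dg_mult Y (card \<alpha>) (card ?\<beta>) (c \<alpha>) (c' ?\<beta>)) =
        dg_mult Y (Suc (card \<alpha>)) (card ?\<beta>) (dg_diff Y (card \<alpha>) (c \<alpha>)) (c' ?\<beta>) \<oplus>\<^bsub>?R\<^esub>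
        signed ?R (card \<alpha>) (dg_mult Y (card \<alpha>) (Suc (card ?\<beta>)) (c \<alpha>) (dg_diff Y (card ?\<beta>) (c' ?\<beta>)))"
      using leibniz[OF ca cb] cd(5) by simp
    finally show ?thesis
      unfolding t1 t2 using m by (simp add: gr.signed_add gr.signed_signed add.commute)
  qed
  have cl: "shuffle_term ?S \<alpha> (c \<alpha>) (c' (?S - \<alpha>)) \<in> G n" if "\<alpha> \<in> Pow ?S" for \<alpha>
  proof -
    have "shuffle_term ?S \<alpha> (c \<alpha>) (c' (?S - \<alpha>)) \<in> G (card ?S)"
      by (rule shuffle_term_closed[OF \<gamma>' _ K_sub(1)[OF c(1) \<gamma>'] K_sub(2)[OF c(2) \<gamma>']]) (use that in auto)
    then show ?thesis by simp
  qed
  have tS: "t (Suc ` \<alpha>) \<in> carrier ?R" "t (insert (Suc 0) (Suc ` \<alpha>)) \<in> carrier ?R" if "\<alpha> \<subseteq> ?S" for \<alpha>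
    by (rule tC; use that in auto)+
  have "(cs_coface K n 0 c \<otimes>\<^bsub>cs_obj K (Suc n)\<^esub> cs_coface K n 0 c') ?T = (\<Oplus>\<^bsub>?R\<^esub>\<alpha>\<in>Q \<union> P. t \<alpha>)"
    using K_mult_apply[OF dc \<gamma>] by (simp add: t_def PQ[symmetric])
  also have "\<dots> = (\<Oplus>\<^bsub>?R\<^esub>\<alpha>\<in>Q. t \<alpha>) \<oplus>\<^bsub>?R\<^esub> (\<Oplus>\<^bsub>?R\<^esub>\<alpha>\<in>P. t \<alpha>)"
    by (rule gr.finsum_Un_disjoint) (use disj tS in \<open>auto simp: P_def Q_def\<close>)
  also have "(\<Oplus>\<^bsub>?R\<^esub>\<alpha>\<in>Q. t \<alpha>) = (\<Oplus>\<^bsub>?R\<^esub>\<alpha>\<in>Pow ?S. t (insert 1 (Suc ` \<alpha>)))"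
    unfolding Q_def by (rule gr.finsum_reindex[OF _ inj(2)]) (use tS in auto)
  also have "(\<Oplus>\<^bsub>?R\<^esub>\<alpha>\<in>P. t \<alpha>) = (\<Oplus>\<^bsub>?R\<^esub>\<alpha>\<in>Pow ?S. t (Suc ` \<alpha>))"
    unfolding P_def by (rule gr.finsum_reindex[OF _ inj(1)]) (use tS in auto)
  also have "(\<Oplus>\<^bsub>?R\<^esub>\<alpha>\<in>Pow ?S. t (insert 1 (Suc ` \<alpha>))) \<oplus>\<^bsub>?R\<^esub> (\<Oplus>\<^bsub>?R\<^esub>\<alpha>\<in>Pow ?S. t (Suc ` \<alpha>)) =
      (\<Oplus>\<^bsub>?R\<^esub>\<alpha>\<in>Pow ?S. t (insert 1 (Suc ` \<alpha>)) \<oplus>\<^bsub>?R\<^esub> t (Suc ` \<alpha>))"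
    by (rule gr.finsum_addf[symmetric]) (use tS in auto)
  also have "\<dots> = (\<Oplus>\<^bsub>?R\<^esub>\<alpha>\<in>Pow ?S. dg_diff Y n (shuffle_term ?S \<alpha> (c \<alpha>) (c' (?S - \<alpha>))))"
    by (rule gr.finsum_cong'[OF refl]) (use tm cl diff_closed in auto)
  also have "\<dots> = dg_diff Y n (\<Oplus>\<^bsub>dg_gr Y n\<^esub>\<alpha>\<in>Pow ?S. shuffle_term ?S \<alpha> (c \<alpha>) (c' (?S - \<alpha>)))"
    by (rule additive_map_finsum[OF diff_additive, symmetric]) (use cl in auto)
  also have "\<dots> = dg_diff Y n ((c \<otimes>\<^bsub>cs_obj K n\<^esub> c') ?S)"
    using K_mult_apply[OF c \<gamma>'] by simp
  finally show ?thesis .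
qed

lemma K_coface_top:
  assumes c: "c \<in> KC n"
  shows "1 \<le> i \<Longrightarrow> i \<le> Suc n \<Longrightarrow> cs_coface K n i c {1..Suc n} = \<zero>\<^bsub>dg_gr Y (Suc n)\<^esub>"
    and "cs_coface K n 0 c {1..Suc n} = dg_diff Y n (c {1..n})"
  using coface_apply[OF c subset_refl, of i] coface_0_apply[OF c subset_refl]
  by (auto simp: merges_def drop_shift_interval[unfolded One_nat_def] simp del: K_simps)

lemma K_coface_mult:
  "c \<in> KC n \<Longrightarrow> c' \<in> KC n \<Longrightarrow> i \<le> Suc n \<Longrightarrow>
    cs_coface K n i (c \<otimes>\<^bsub>cs_obj K n\<^esub> c') = cs_coface K n i c \<otimes>\<^bsub>cs_obj K (Suc n)\<^esub> cs_coface K n i c'"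
proof (induction n arbitrary: c c' i)
  case (0 c c' i)
  note cl = coface_closed[OF 0(1), of i] coface_closed[OF 0(2), of i] K_mult_closed[OF 0(1,2)]
  show ?case
  proof (rule K_joint_inj[OF coface_closed[OF cl(3)] K_mult_closed[OF cl(1,2)]])
    show "cs_coface K 0 i (c \<otimes>\<^bsub>cs_obj K 0\<^esub> c') {1..Suc 0} =
        (cs_coface K 0 i c \<otimes>\<^bsub>cs_obj K (Suc 0)\<^esub> cs_coface K 0 i c') {1..Suc 0}"
      using K_coface_mult_top[OF 0(1,2), of i] K_coface_0_mult_top[OF 0(1,2)] K_coface_top(1)[OF cl(3), of
          i] K_coface_top(2)[OF cl(3)] 0(3)
      by (cases "i = 0") (simp_all del: K_simps)
    fix m j assume m: "Suc 0 = Suc m" "j \<le> m"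
    then have [simp]: "m = 0" "j = 0" by simp_all
    have i: "i = 0 \<or> i = Suc 0" using 0(3) by auto
    show "cs_codegen K m j (cs_coface K 0 i (c \<otimes>\<^bsub>cs_obj K 0\<^esub> c')) =
        cs_codegen K m j (cs_coface K 0 i c \<otimes>\<^bsub>cs_obj K (Suc 0)\<^esub> cs_coface K 0 i c')"
      using K_codegen_mult[OF cl(1,2), of 0] K_codegen_coface_id[OF _ i cl(3)]
        K_codegen_coface_id[OF _ i 0(1)] K_codegen_coface_id[OF _ i 0(2)] by (simp del: K_simps)
  qed
next
  case (Suc n c c' i)
  note cl = coface_closed[OF Suc.prems(1), of i] coface_closed[OF Suc.prems(2), of i] K_mult_closed[OF
      Suc.prems(1,2)]
  show ?case
  proof (rule K_joint_inj[OF coface_closed[OF cl(3)] K_mult_closed[OF cl(1,2)]])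
    show "cs_coface K (Suc n) i (c \<otimes>\<^bsub>cs_obj K (Suc n)\<^esub> c') {1..Suc (Suc n)} =
        (cs_coface K (Suc n) i c \<otimes>\<^bsub>cs_obj K (Suc (Suc n))\<^esub> cs_coface K (Suc n) i c') {1..Suc (Suc n)}"
      using K_coface_mult_top[OF Suc.prems(1,2), of i] K_coface_0_mult_top[OF Suc.prems(1,2)]
        K_coface_top(1)[OF cl(3), of i] K_coface_top(2)[OF cl(3)] Suc.prems(3)
      by (cases "i = 0") (simp_all del: K_simps)
    fix m j assume m: "Suc (Suc n) = Suc m" "j \<le> m"
    then have [simp]: "m = Suc n" by simp
    have j: "j \<le> Suc n" using m by simp
    note mm = K_codegen_mult[OF cl(1,2) j]
    note c = Suc.prems(1,2)
    consider "i < j" | "i = j \<or> i = Suc j" | "Suc j < i" by linarith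
    then have "cs_codegen K (Suc n) j (cs_coface K (Suc n) i (c \<otimes>\<^bsub>cs_obj K (Suc n)\<^esub> c')) =
        cs_codegen K (Suc n) j (cs_coface K (Suc n) i c) \<otimes>\<^bsub>cs_obj K (Suc n)\<^esub>
        cs_codegen K (Suc n) j (cs_coface K (Suc n) i c')"
    proof cases
      case 1
      then have j1: "j - 1 \<le> n" "i \<le> Suc n" using j by auto
      show ?thesis
        unfolding K_codegen_coface_less[OF 1 j cl(3)] K_codegen_coface_less[OF 1 j c(1)]
          K_codegen_coface_less[OF 1 j c(2)] K_codegen_mult[OF c j1(1)]
        by (rule Suc.IH[OF codegen_closed[OF c(1)] codegen_closed[OF c(2)] j1(2)])
    next
      case 2
      show ?thesis
        unfolding K_codegen_coface_id[OF j 2 cl(3)] K_codegen_coface_id[OF j 2 c(1)]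
          K_codegen_coface_id[OF j 2 c(2)] ..
    next
      case 3
      then have j1: "j \<le> n" "i - 1 \<le> Suc n" using Suc.prems(3) by auto
      show ?thesis
        unfolding K_codegen_coface_greater[OF 3 Suc.prems(3) cl(3)] K_codegen_coface_greater[OF 3
            Suc.prems(3) c(1)]
          K_codegen_coface_greater[OF 3 Suc.prems(3) c(2)] K_codegen_mult[OF c j1(1)]
        by (rule Suc.IH[OF codegen_closed[OF c(1)] codegen_closed[OF c(2)] j1(2)])
    qed
    then show "cs_codegen K m j (cs_coface K (Suc n) i (c \<otimes>\<^bsub>cs_obj K (Suc n)\<^esub> c')) =
        cs_codegen K m j (cs_coface K (Suc n) i c \<otimes>\<^bsub>cs_obj K (Suc (Suc n))\<^esub> cs_coface K (Suc n) i c')"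
      using mm by (simp del: K_simps)
  qed
qed

lemma K_coface_hom: "i \<le> Suc n \<Longrightarrow> cs_coface K n i \<in> alg_hom k (cs_obj K n) (cs_obj K (Suc n))"
  by (rule alg_homI)
    (rule coface_closed K_coface_add K_coface_mult K_coface_one K_coface_smult; assumption)+

theorem K_cosimplicial: "cosimplicial_algebra k K"
  by (rule cosimplicial_algebra.intro)
    (rule K_algebra K_coface_hom K_codegen_hom K_coface_coface K_codegen_codegen
      K_codegen_coface_less K_codegen_coface_id K_codegen_coface_greater; assumption)+

end

section \<open>The normalization of a denormalization\<close>

context dg_algebra
begin

text \<open>
  The coefficients at sets missing \<open>j + 1\<close> are those of the \<open>j\<close>-th codegeneracy.
\<close>

lemma K_N_iff:
  assumes c: "c \<in> KC n"
  shows "c \<in> normalized K n \<longleftrightarrow> (\<forall>\<alpha>. \<alpha> \<subseteq> {1..n} \<longrightarrow> \<alpha> \<noteq> {1..n} \<longrightarrow> c \<alpha> = \<zero>\<^bsub>dg_gr Y (card \<alpha>)\<^esub>)"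
proof -
  interpret KK: cosimplicial_algebra k K by (rule K_cosimplicial)
  show ?thesis
  proof (cases n)
    case 0
    then show ?thesis using c by (simp add: KK.N_0 del: K_simps)
  next
    case (Suc m)
    show ?thesis
    proof (intro iffI allI impI)
      fix \<alpha> assume N: "c \<in> normalized K n" and \<alpha>: "\<alpha> \<subseteq> {1..n}" "\<alpha> \<noteq> {1..n}"
      then obtain i where i: "i \<in> {1..n}" "i \<notin> \<alpha>" by blast
      then obtain j where j: "i = Suc j" "j \<le> m" using Suc by (cases i) auto
      have r: "sigma j ` \<alpha> \<subseteq> {1..m}" using sigma_minus_range \<alpha> i Suc j by blast
      have D: "delta (Suc j) ` sigma j ` \<alpha> = \<alpha>" using delta_sigma_image i j by blast
      then have "card (sigma j ` \<alpha>) = card \<alpha>" using card_delta by metis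
      moreover have "cs_codegen K m j c (sigma j ` \<alpha>) = \<zero>\<^bsub>dg_gr Y (card (sigma j ` \<alpha>))\<^esub>"
        using N j(2) r unfolding Suc KK.N_Suc by (simp del: K_simps(1))
      ultimately show "c \<alpha> = \<zero>\<^bsub>dg_gr Y (card \<alpha>)\<^esub>"
        using codegen_apply[OF _ r j(2), of c] c Suc D by (simp del: K_simps)
    next
      assume z: "\<forall>\<alpha>. \<alpha> \<subseteq> {1..n} \<longrightarrow> \<alpha> \<noteq> {1..n} \<longrightarrow> c \<alpha> = \<zero>\<^bsub>dg_gr Y (card \<alpha>)\<^esub>"
      have "cs_codegen K m j c = \<zero>\<^bsub>cs_obj K m\<^esub>" if j: "j \<le> m" for j
      proof (rule K_eqI)
        fix \<gamma> assume \<gamma>: "\<gamma> \<subseteq> {1..m}"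
        have "Suc j \<notin> delta (Suc j) ` \<gamma>" using delta_neq by (metis imageE)
        then have "delta (Suc j) ` \<gamma> \<noteq> {1..n}" using j Suc by auto
        then show "cs_codegen K m j c \<gamma> = \<zero>\<^bsub>cs_obj K m\<^esub> \<gamma>"
          unfolding K_zero_apply[OF \<gamma>]
          using codegen_apply[OF _ \<gamma> j, of c] c z delta_range[OF \<gamma>, of "Suc j"] Suc by (simp del: K_simps)
      qed (use c codegen_closed[of c m j] Suc KK.obj.zero_closed[of m] in \<open>simp_all del: K_simps\<close>)
      then show "c \<in> normalized K n" using c unfolding Suc KK.N_Suc by blast
    qed
  qed
qed

lemma K_N_eqI:
  assumes "c \<in> normalized K n" "c' \<in> normalized K n" "c {1..n} = c' {1..n}"
  shows "c = c'"
proof -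
  have cc: "c \<in> KC n" "c' \<in> KC n" using assms by (auto simp: normalized_def simp del: K_simps)
  show ?thesis
  proof (rule K_eqI[OF cc])
    fix \<gamma> assume "\<gamma> \<subseteq> {1..n}"
    then show "c \<gamma> = c' \<gamma>"
      using assms K_N_iff[OF cc(1)] K_N_iff[OF cc(2)] by (cases "\<gamma> = {1..n}") auto
  qed
qed

lemma K_front_coeff:
  assumes f: "f \<in> normalized K p"
  shows "\<alpha> \<subseteq> {1..p + q} \<Longrightarrow>
    coface_iter K p (Suc p) q f \<alpha> = (if \<alpha> = {1..p} then f {1..p} else \<zero>\<^bsub>dg_gr Y (card \<alpha>)\<^esub>)"
proof (induction q arbitrary: \<alpha>)
  interpret KK: cosimplicial_algebra k K by (rule K_cosimplicial)
  note fC = KK.N_carrier[OF f]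
  {
    case 0
    then show ?case using f K_N_iff[OF fC] by auto
  next
    case (Suc q)
    note z = KK.front_closed[OF fC, of q]
    have \<alpha>: "\<alpha> \<subseteq> {1..Suc (p + q)}" using Suc.prems by simp
    have ap: "coface_iter K p (Suc p) (Suc q) f \<alpha> = (if merges (p + q) (Suc p) \<alpha> then \<zero>\<^bsub>dg_gr Y (card \<alpha>)\<^esub>
        else coface_iter K p (Suc p) q f (sigma (Suc p) ` \<alpha>))"
      using coface_apply[OF z \<alpha>, of "Suc p"] by (simp del: K_simps)
    show ?case
    proof (cases "\<alpha> = {1..p}")
      case True
      have "sigma (Suc p) ` {1..p} = {1..p}" by (auto simp: set_eq_iff mem_sigma_image)
      then show ?thesis using True ap Suc.IH[of "{1..p}"] by (simp add: merges_def)
    next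
      case False
      show ?thesis
      proof (cases "merges (p + q) (Suc p) \<alpha>")
        case nm: False
        have r: "sigma (Suc p) ` \<alpha> \<subseteq> {1..p + q}" using sigma_range[OF \<alpha> _ _ nm] by simp
        have "sigma (Suc p) ` \<alpha> \<noteq> {1..p}"
        proof
          assume s: "sigma (Suc p) ` \<alpha> = {1..p}"
          then have "Suc p \<notin> sigma (Suc p) ` \<alpha>" by simp
          then have "Suc p \<notin> \<alpha>" unfolding mem_sigma_image by simp
          then have "\<alpha> = delta (Suc p) ` {1..p}" using delta_sigma_image'[of "Suc p" \<alpha>] s by simp
          also have "\<dots> = {1..p}" by (auto simp: set_eq_iff mem_delta_image)
          finally show False using \<open>\<alpha> \<noteq> {1..p}\<close> by simp
        qed
        moreover have "card (sigma (Suc p) ` \<alpha>) = card \<alpha>" by (rule card_sigma) (use nm in \<open>auto simp: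
            merges_def\<close>)
        ultimately show ?thesis using ap nm Suc.IH[OF r] False by simp
      qed (use False ap in simp)
    qed
  }
qed

lemma K_back_coeff:
  assumes g: "g \<in> KC q"
  shows "\<beta> \<subseteq> {1..q} \<Longrightarrow> coface_iter K q 0 p g ((\<lambda>a. a + p) ` \<beta>) = g \<beta>"
proof (induction p)
  interpret KK: cosimplicial_algebra k K by (rule K_cosimplicial)
  {
    case (Suc p)
    note z = KK.iter_closed[of 0 q g p, OF _ g]
    let ?b = "(\<lambda>a. a + Suc p) ` \<beta>"
    have b: "?b \<subseteq> {1..Suc (q + p)}" "1 \<notin> ?b" using Suc.prems by auto
    have "?b - {1} = ?b" using b(2) by blast
    then have "drop_shift ?b = (\<lambda>a. a + p) ` \<beta>"
      unfolding drop_shift_def by (simp add: image_image)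
    then show ?case using coface_0_apply[OF z b(1)] b(2) Suc by (simp del: K_simps)
  }
qed simp

text \<open>
  The front image of \<open>f\<close> is concentrated at \<open>{1..p}\<close>, so that a single summand survives; in the opposite order
  its shuffle has \<open>p q\<close> inversions. The second identity is the source of graded commutativity.
\<close>

lemma K_front_back_top:
  assumes f: "f \<in> normalized K p" and g: "g \<in> KC q"
  shows "(coface_iter K p (Suc p) q f \<otimes>\<^bsub>cs_obj K (p + q)\<^esub> coface_iter K q 0 p g) {1..p + q} =
      dg_mult Y p q (f {1..p}) (g {1..q})"
    and "(coface_iter K q 0 p g \<otimes>\<^bsub>cs_obj K (p + q)\<^esub> coface_iter K p (Suc p) q f) {1..p + q} =
      signed (dg_gr Y (p + q)) (p * q) (dg_mult Y q p (g {1..q}) (f {1..p}))"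
proof -
  interpret KK: cosimplicial_algebra k K by (rule K_cosimplicial)
  let ?T = "{1..p + q}" and ?P = "{1..p}" and ?Q = "(\<lambda>a. a + p) ` {1..q}"
  let ?F = "coface_iter K p (Suc p) q f" and ?B = "coface_iter K q 0 p g"
  note fC = KK.N_carrier[OF f]
  note cl = KK.front_closed[OF fC, of q] KK.back_closed[OF g, of p]
  note \<gamma> = subset_refl[of ?T]
  have Q: "?Q = {p + 1..p + q}"
    using image_add_atLeastAtMost[of p 1 q] by (simp add: add.commute)
  have PQ: "?T - ?P = ?Q" "?T - ?Q = ?P" "?P \<subseteq> ?T" "?Q \<subseteq> ?T" unfolding Q by auto
  have card: "card ?P = p" "card ?Q = q" unfolding Q by simp_all
  have vals: "?F ?P = f ?P" "?B ?Q = g {1..q}" using K_front_coeff[OF f, of ?P q] K_back_coeff[OF g, of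
      "{1..q}" p] PQ(3) by auto
  have F0: "?F \<alpha> = \<zero>\<^bsub>dg_gr Y (card \<alpha>)\<^esub>" if "\<alpha> \<subseteq> ?T" "\<alpha> \<noteq> ?P" for \<alpha> using K_front_coeff[OF f that(1)] that(2)
      by simp
  have "(?F \<otimes>\<^bsub>cs_obj K (p + q)\<^esub> ?B) ?T = shuffle_term ?T ?P (?F ?P) (?B (?T - ?P))"
    unfolding K_mult_apply[OF cl \<gamma>]
  proof (rule gr.finsum_single)
    show "shuffle_term ?T ?P (?F ?P) (?B (?T - ?P)) \<in> G (card ?T)"
      by (rule shuffle_term_closed[OF \<gamma> PQ(3) K_sub(1)[OF cl(1) \<gamma> PQ(3)] K_sub(2)[OF cl(2) \<gamma>]])
    show "shuffle_term ?T \<alpha> (?F \<alpha>) (?B (?T - \<alpha>)) = \<zero>\<^bsub>dg_gr Y (card ?T)\<^esub>" if "\<alpha> \<in> Pow ?T" "\<alpha> \<noteq> ?P" for \<alpha>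
      by (rule shuffle_term_zero[OF \<gamma> _ K_sub(1)[OF cl(1) \<gamma>] K_sub(2)[OF cl(2) \<gamma>]]) (use that F0 in auto)
  qed (use PQ in auto)
  moreover have "inversions ?P ?Q = 0" unfolding Q by (rule inversions_below) auto
  ultimately show "(?F \<otimes>\<^bsub>cs_obj K (p + q)\<^esub> ?B) ?T = dg_mult Y p q (f ?P) (g {1..q})"
    unfolding PQ vals shuffle_term_def card by (simp add: signed_def)
  have "(?B \<otimes>\<^bsub>cs_obj K (p + q)\<^esub> ?F) ?T = shuffle_term ?T ?Q (?B ?Q) (?F (?T - ?Q))"
    unfolding K_mult_apply[OF cl(2,1) \<gamma>]
  proof (rule gr.finsum_single)
    show "shuffle_term ?T ?Q (?B ?Q) (?F (?T - ?Q)) \<in> G (card ?T)"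
      by (rule shuffle_term_closed[OF \<gamma> PQ(4) K_sub(1)[OF cl(2) \<gamma> PQ(4)] K_sub(2)[OF cl(1) \<gamma>]])
    show "shuffle_term ?T \<alpha> (?B \<alpha>) (?F (?T - \<alpha>)) = \<zero>\<^bsub>dg_gr Y (card ?T)\<^esub>" if "\<alpha> \<in> Pow ?T" "\<alpha> \<noteq> ?Q" for \<alpha>
    proof (rule shuffle_term_zero[OF \<gamma> _ K_sub(1)[OF cl(2) \<gamma>] K_sub(2)[OF cl(1) \<gamma>]])
      have "?T - \<alpha> \<noteq> ?P" using that PQ(1) double_diff[of \<alpha> ?T ?T] by auto
      then show "?B \<alpha> = \<zero>\<^bsub>dg_gr Y (card \<alpha>)\<^esub> \<or> ?F (?T - \<alpha>) = \<zero>\<^bsub>dg_gr Y (card (?T - \<alpha>))\<^esub>" using F0 by blast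
    qed (use that in auto)
  qed (use PQ in auto)
  moreover have "inversions ?Q ?P = card ?Q * card ?P" unfolding Q by (rule inversions_above) auto
  ultimately show "(?B \<otimes>\<^bsub>cs_obj K (p + q)\<^esub> ?F) ?T = signed (dg_gr Y (p + q)) (p * q) (dg_mult Y q p (g
      {1..q}) (f ?P))"
    unfolding PQ vals shuffle_term_def card by (simp add: mult.commute)
qed

lemma K_alt_diff_top:
  assumes c: "c \<in> KC n"
  shows "alt_diff K n c {1..Suc n} = dg_diff Y n (c {1..n})"
proof -
  interpret KK: cosimplicial_algebra k K by (rule K_cosimplicial)
  let ?T = "{1..Suc n}" and ?R = "dg_gr Y (Suc n)"
  have E: "additive_map (cs_obj K (Suc n)) ?R (\<lambda>c. c ?T)" using K_eval_additive[of ?T "Suc n"] by simp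
  have top: "cs_coface K n i c ?T = (if i = 0 then dg_diff Y n (c {1..n}) else \<zero>\<^bsub>?R\<^esub>)" if "i \<le> Suc n" for i
    using K_coface_top[OF c] that by (cases "i = 0") auto
  have d: "dg_diff Y n (c {1..n}) \<in> carrier ?R" using diff_closed K_mem[OF c, of "{1..n}"] by simp
  have "alt_diff K n c ?T = (\<Oplus>\<^bsub>?R\<^esub>i\<in>{0..Suc n}. signed (cs_obj K (Suc n)) i (cs_coface K n i c) ?T)"
    unfolding alt_diff_def
    by (rule additive_map_finsum[OF E]) (use c coface_closed in \<open>auto simp del: K_simps\<close>)
  also have "\<dots> = (\<Oplus>\<^bsub>?R\<^esub>i\<in>{0..Suc n}. signed ?R i (cs_coface K n i c ?T))"
  proof (rule gr.finsum_cong'[OF refl])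
    show "signed (cs_obj K (Suc n)) i (cs_coface K n i c) ?T = signed ?R i (cs_coface K n i c ?T)"
      if "i \<in> {0..Suc n}" for i
      by (rule additive_map_signed[OF E coface_closed[OF c]])
  qed (use top d in auto)
  also have "\<dots> = signed ?R 0 (cs_coface K n 0 c ?T)"
    by (rule gr.finsum_single) (use top d in auto)
  finally show ?thesis using top by (simp add: signed_def)
qed

lemma top_hom: "(\<lambda>n. \<lambda>c\<in>normalized K n. c {1..n}) \<in> dg_hom k (normalization K) Y"
proof -
  interpret KK: cosimplicial_algebra k K by (rule K_cosimplicial)
  note closed = KK.N_carrier KK.N_add KK.N_smult KK.cup_N KK.alt_diff_N
  show ?thesis
  proof (rule dg_homI)
    fix n c c' a assume c: "c \<in> carrier (dg_gr (normalization K) n)"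
    then have cN: "c \<in> normalized K n" and cK: "c \<in> KC n" using KK.N_carrier by simp_all
    show "(\<lambda>c\<in>normalized K n. c {1..n}) c \<in> G n" using cN K_mem[OF cK, of "{1..n}"] by simp
    show "(\<lambda>c\<in>normalized K (Suc n). c {1..Suc n}) (dg_diff (normalization K) n c) =
        dg_diff Y n ((\<lambda>c\<in>normalized K n. c {1..n}) c)"
      using cN KK.alt_diff_N[OF cN] K_alt_diff_top[OF cK] by simp
    show "(\<lambda>c\<in>normalized K n. c {1..n}) (a \<odot>\<^bsub>dg_gr (normalization K) n\<^esub> c) =
        a \<odot>\<^bsub>dg_gr Y n\<^esub> (\<lambda>c\<in>normalized K n. c {1..n}) c" if "a \<in> carrier k"
      using cN KK.N_smult[OF that cN] by simp
    assume c': "c' \<in> carrier (dg_gr (normalization K) n)"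
    then have cN': "c' \<in> normalized K n" by simp
    show "(\<lambda>c\<in>normalized K n. c {1..n}) (c \<oplus>\<^bsub>dg_gr (normalization K) n\<^esub> c') =
        (\<lambda>c\<in>normalized K n. c {1..n}) c \<oplus>\<^bsub>dg_gr Y n\<^esub> (\<lambda>c\<in>normalized K n. c {1..n}) c'"
      using cN cN' KK.N_add[OF cN cN'] by simp
  next
    fix p q f g assume "f \<in> carrier (dg_gr (normalization K) p)" "g \<in> carrier (dg_gr (normalization K) q)"
    then have fg: "f \<in> normalized K p" "g \<in> normalized K q" by simp_all
    then show "(\<lambda>c\<in>normalized K (p + q). c {1..p + q}) (dg_mult (normalization K) p q f g) =
        dg_mult Y p q ((\<lambda>c\<in>normalized K p. c {1..p}) f) ((\<lambda>c\<in>normalized K q. c {1..q}) g)"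
      using KK.cup_N[OF fg] K_front_back_top(1)[OF fg(1) KK.N_carrier[OF fg(2)]]
      by (simp add: cup_def del: K_simps)
  next
    have "\<one>\<^bsub>cs_obj K 0\<^esub> \<in> normalized K 0" using K_one_closed by (simp add: KK.N_0 del: K_simps)
    then show "(\<lambda>c\<in>normalized K 0. c {1..0}) (dg_one (normalization K)) = dg_one Y"
      using K_one_apply[of "{}" 0] by (simp del: K_simps)
  qed simp
qed

definition top_incl :: "nat \<Rightarrow> 'a \<Rightarrow> nat set \<Rightarrow> 'a"
  where "top_incl n = (\<lambda>f\<in>G n. tens Y n {1..n} f)"

lemma top_incl_N: "f \<in> G n \<Longrightarrow> top_incl n f \<in> normalized K n"
  using tens_closed[of f "{1..n}" n] by (subst K_N_iff) (auto simp: top_incl_def tens_apply)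

lemma top_incl_top: "f \<in> G n \<Longrightarrow> top_incl n f {1..n} = f"
  by (simp add: top_incl_def tens_apply)

lemma top_incl_hom: "top_incl \<in> dg_hom k Y (normalization K)"
proof -
  interpret KK: cosimplicial_algebra k K by (rule K_cosimplicial)
  note T = dg_hom_D[OF top_hom]
  show ?thesis
  proof (rule dg_homI)
    fix n f g a assume f: "f \<in> G n"
    note fN = top_incl_N[OF f]
    show "top_incl n f \<in> carrier (dg_gr (normalization K) n)" using fN by simp
    show "top_incl (Suc n) (dg_diff Y n f) = dg_diff (normalization K) n (top_incl n f)"
      by (rule K_N_eqI[where n = "Suc n"])
        (use T(7)[of "top_incl n f" n] fN f in \<open>simp_all add: top_incl_N top_incl_top[simplified]
            diff_closed KK.alt_diff_N\<close>)
    show "top_incl n (a \<odot>\<^bsub>dg_gr Y n\<^esub> f) = a \<odot>\<^bsub>dg_gr (normalization K) n\<^esub> top_incl n f" if "a \<in> carrier k"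
      by (rule K_N_eqI[where n = n])
        (use T(4)[of a "top_incl n f" n] fN f that in \<open>simp_all add: top_incl_N top_incl_top[simplified]
            KK.N_smult del: K_simps\<close>)
    assume g: "g \<in> G n"
    show "top_incl n (f \<oplus>\<^bsub>dg_gr Y n\<^esub> g) = top_incl n f \<oplus>\<^bsub>dg_gr (normalization K) n\<^esub> top_incl n g"
      by (rule K_N_eqI[where n = n])
        (use T(3)[of "top_incl n f" n "top_incl n g"] fN top_incl_N[OF g] f g in
          \<open>simp_all add: top_incl_N top_incl_top[simplified] KK.N_add del: K_simps\<close>)
  next
    fix p q f g assume fg: "f \<in> G p" "g \<in> G q"
    show "top_incl (p + q) (dg_mult Y p q f g) = dg_mult (normalization K) p q (top_incl p f) (top_incl q g)"
      by (rule K_N_eqI[where n = "p + q"])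
        (use T(5)[of "top_incl p f" p "top_incl q g" q] fg in
          \<open>simp_all add: top_incl_N top_incl_top[simplified] KK.cup_N mult_closed del: K_simps\<close>)
  next
    show "top_incl 0 (dg_one Y) = dg_one (normalization K)"
      using one_closed by (simp add: top_incl_def)
  qed (simp add: top_incl_def)
qed

end

section \<open>Functoriality of the denormalization\<close>

lemma denorm_map_apply:
  "c \<in> carrier (cs_obj (denorm Y) n) \<Longrightarrow> \<alpha> \<subseteq> {1..n} \<Longrightarrow> denorm_map Y Z \<phi> n c \<alpha> = \<phi> (card \<alpha>) (c \<alpha>)"
  by (simp add: denorm_map_def)

lemma denorm_map_hom:
  assumes Y: "dg_algebra k Y" and Z: "dg_algebra k Z" and \<phi>: "\<phi> \<in> dg_hom k Y Z"
  shows "denorm_map Y Z \<phi> \<in> cs_hom k (denorm Y) (denorm Z)"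
proof -
  interpret Y: dg_algebra k Y by fact
  interpret Z: dg_algebra k Z by fact
  let ?D = "denorm_map Y Z \<phi>"
  note [simp del] = Y.K_simps Z.K_simps
  note ap = denorm_map_apply[of _ Y _ _ Z \<phi>]
  note D = dg_hom_D[OF \<phi>]
  note add = dg_hom_additive[OF \<phi> Y Z]
  have cl: "?D n c \<in> Z.KC n" if "c \<in> Y.KC n" for n c
    using that D(1) by (auto simp: denorm_map_def Y.K_simps Z.K_simps)
  have mem: "c \<alpha> \<in> Y.G (card \<alpha>)" if "c \<in> Y.KC n" "\<alpha> \<subseteq> {1..n}" for n c \<alpha>
    using Y.K_mem[OF that] .
  show ?thesis
  proof (rule cs_homI)
    fix n
    show "?D n \<in> extensional (Y.KC n)" by (simp add: denorm_map_def)
    show "?D n \<in> alg_hom k (cs_obj (denorm Y) n) (cs_obj (denorm Z) n)"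
    proof (rule alg_homI)
      fix c c' assume c: "c \<in> Y.KC n" and c': "c' \<in> Y.KC n"
      show "?D n c \<in> Z.KC n" by (rule cl[OF c])
      show "?D n (c \<oplus>\<^bsub>cs_obj (denorm Y) n\<^esub> c') = ?D n c \<oplus>\<^bsub>cs_obj (denorm Z) n\<^esub> ?D n c'"
      proof (rule Z.K_eqI[OF cl[OF Y.K_add_closed[OF c c']] Z.K_add_closed[OF cl[OF c] cl[OF c']]])
        fix \<gamma> assume "\<gamma> \<subseteq> {1..n}"
        then show "?D n (c \<oplus>\<^bsub>cs_obj (denorm Y) n\<^esub> c') \<gamma> = (?D n c \<oplus>\<^bsub>cs_obj (denorm Z) n\<^esub> ?D n c') \<gamma>"
          by (simp add: ap c c' Y.K_add_closed Y.K_add_apply Z.K_add_apply D(3) mem[OF c] mem[OF c'])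
      qed
      show "?D n (c \<otimes>\<^bsub>cs_obj (denorm Y) n\<^esub> c') = ?D n c \<otimes>\<^bsub>cs_obj (denorm Z) n\<^esub> ?D n c'"
      proof (rule Z.K_eqI[OF cl[OF Y.K_mult_closed[OF c c']] Z.K_mult_closed[OF cl[OF c] cl[OF c']]])
        fix \<gamma> assume \<gamma>: "\<gamma> \<subseteq> {1..n}"
        have "?D n (c \<otimes>\<^bsub>cs_obj (denorm Y) n\<^esub> c') \<gamma> =
            \<phi> (card \<gamma>) (\<Oplus>\<^bsub>dg_gr Y (card \<gamma>)\<^esub>\<alpha>\<in>Pow \<gamma>. Y.shuffle_term \<gamma> \<alpha> (c \<alpha>) (c' (\<gamma> - \<alpha>)))"
          unfolding ap[OF Y.K_mult_closed[OF c c'] \<gamma>] Y.K_mult_apply[OF c c' \<gamma>] ..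
        also have "\<dots> = (\<Oplus>\<^bsub>dg_gr Z (card \<gamma>)\<^esub>\<alpha>\<in>Pow \<gamma>. \<phi> (card \<gamma>) (Y.shuffle_term \<gamma> \<alpha> (c \<alpha>) (c' (\<gamma> - \<alpha>))))"
        proof (rule additive_map_finsum[OF add])
          show "finite (Pow \<gamma>)" using finite_subset[OF \<gamma>] by simp
          show "(\<lambda>\<alpha>. Y.shuffle_term \<gamma> \<alpha> (c \<alpha>) (c' (\<gamma> - \<alpha>))) \<in> Pow \<gamma> \<rightarrow> Y.G (card \<gamma>)"
            by (intro Pi_I Y.shuffle_term_closed[OF \<gamma>] Y.K_sub(1)[OF c \<gamma>] Y.K_sub(2)[OF c' \<gamma>]) auto
        qed
        also have "\<dots> = (\<Oplus>\<^bsub>dg_gr Z (card \<gamma>)\<^esub>\<alpha>\<in>Pow \<gamma>. Z.shuffle_term \<gamma> \<alpha> (?D n c \<alpha>) (?D n c' (\<gamma> - \<alpha>)))"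
        proof (rule Z.gr.finsum_cong'[OF refl])
          show "(\<lambda>\<alpha>. Z.shuffle_term \<gamma> \<alpha> (?D n c \<alpha>) (?D n c' (\<gamma> - \<alpha>))) \<in> Pow \<gamma> \<rightarrow> Z.G (card \<gamma>)"
            by (intro Pi_I Z.shuffle_term_closed[OF \<gamma>] Z.K_sub(1)[OF cl[OF c] \<gamma>] Z.K_sub(2)[OF cl[OF c']
                \<gamma>]) auto
          fix \<alpha> assume "\<alpha> \<in> Pow \<gamma>"
          then have \<alpha>: "\<alpha> \<subseteq> \<gamma>" "\<alpha> \<subseteq> {1..n}" "\<gamma> - \<alpha> \<subseteq> {1..n}" using \<gamma> by auto
          note m = mem[OF c \<alpha>(2)] mem[OF c' \<alpha>(3)]
          show "\<phi> (card \<gamma>) (Y.shuffle_term \<gamma> \<alpha> (c \<alpha>) (c' (\<gamma> - \<alpha>))) =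
              Z.shuffle_term \<gamma> \<alpha> (?D n c \<alpha>) (?D n c' (\<gamma> - \<alpha>))"
            unfolding Y.shuffle_term_def Z.shuffle_term_def ap[OF c \<alpha>(2)] ap[OF c' \<alpha>(3)]
            using additive_map_signed[OF add Y.mult_closed'[OF m \<alpha>(1) \<gamma>]] D(5)[OF m] Y.card_split[OF \<alpha>(1) \<gamma>]
            by simp
        qed
        also have "\<dots> = (?D n c \<otimes>\<^bsub>cs_obj (denorm Z) n\<^esub> ?D n c') \<gamma>"
          by (rule Z.K_mult_apply[OF cl[OF c] cl[OF c'] \<gamma>, symmetric])
        finally show "?D n (c \<otimes>\<^bsub>cs_obj (denorm Y) n\<^esub> c') \<gamma> = (?D n c \<otimes>\<^bsub>cs_obj (denorm Z) n\<^esub> ?D n c') \<gamma>" .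
      qed
    next
      show "?D n \<one>\<^bsub>cs_obj (denorm Y) n\<^esub> = \<one>\<^bsub>cs_obj (denorm Z) n\<^esub>"
      proof (rule Z.K_eqI[OF cl[OF Y.K_one_closed] Z.K_one_closed])
        fix \<gamma> assume \<gamma>: "\<gamma> \<subseteq> {1..n}"
        then show "?D n \<one>\<^bsub>cs_obj (denorm Y) n\<^esub> \<gamma> = \<one>\<^bsub>cs_obj (denorm Z) n\<^esub> \<gamma>"
          by (simp add: ap Y.K_one_closed Y.K_one_apply Z.K_one_apply D(6) additive_map_zero[OF add])
      qed
    next
      fix a c assume a: "a \<in> carrier k" and c: "c \<in> Y.KC n"
      show "?D n (a \<odot>\<^bsub>cs_obj (denorm Y) n\<^esub> c) = a \<odot>\<^bsub>cs_obj (denorm Z) n\<^esub> ?D n c"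
      proof (rule Z.K_eqI[OF cl[OF Y.K_smult_closed[OF a c]] Z.K_smult_closed[OF a cl[OF c]]])
        fix \<gamma> assume "\<gamma> \<subseteq> {1..n}"
        then show "?D n (a \<odot>\<^bsub>cs_obj (denorm Y) n\<^esub> c) \<gamma> = (a \<odot>\<^bsub>cs_obj (denorm Z) n\<^esub> ?D n c) \<gamma>"
          by (simp add: ap a c Y.K_smult_closed Y.K_smult_apply Z.K_smult_apply D(4) mem[OF c])
      qed
    qed
  next
    fix n i c assume i: "i \<le> Suc n" and c: "c \<in> Y.KC n"
    note dc = Y.coface_closed[OF c, of i]
    show "?D (Suc n) (cs_coface (denorm Y) n i c) = cs_coface (denorm Z) n i (?D n c)"
    proof (rule Z.K_eqI[OF cl[OF dc] Z.coface_closed[OF cl[OF c]]])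
      fix \<gamma> assume \<gamma>: "\<gamma> \<subseteq> {1..Suc n}"
      show "?D (Suc n) (cs_coface (denorm Y) n i c) \<gamma> = cs_coface (denorm Z) n i (?D n c) \<gamma>"
      proof (cases "i = 0")
        case True
        note s = drop_shift_range[OF \<gamma>]
        have "card \<gamma> = Suc (card (drop_shift \<gamma>))" if "1 \<in> \<gamma>" using Y.card_drop_shift_1[OF \<gamma> that] .
        moreover have "card (drop_shift \<gamma>) = card \<gamma>" if "1 \<notin> \<gamma>" using Y.card_drop_shift_not_1[OF \<gamma> that] .
        ultimately show ?thesis
          unfolding ap[OF dc \<gamma>] unfolding True Y.coface_0_apply[OF c \<gamma>] Z.coface_0_apply[OF cl[OF c] \<gamma>]
            ap[OF c s]
          using D(7)[OF mem[OF c s]] by simp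
      next
        case False
        then have i1: "1 \<le> i" by simp
        show ?thesis
        proof (cases "Y.merges n i \<gamma>")
          case True
          then have "Z.merges n i \<gamma>" by (simp add: Y.merges_def Z.merges_def)
          then show ?thesis
            unfolding ap[OF dc \<gamma>] Y.coface_apply[OF c \<gamma> i1 i] Z.coface_apply[OF cl[OF c] \<gamma> i1 i]
            using True by (simp add: additive_map_zero[OF add])
        next
          case False
          then have nm: "\<not> Z.merges n i \<gamma>" by (simp add: Y.merges_def Z.merges_def)
          have "card (sigma i ` \<gamma>) = card \<gamma>" using False by (intro Y.card_sigma) (auto simp: Y.merges_def)
          then show ?thesis
            unfolding ap[OF dc \<gamma>] Y.coface_apply[OF c \<gamma> i1 i] Z.coface_apply[OF cl[OF c] \<gamma> i1 i]
            using False nm ap[OF c Y.sigma_range[OF \<gamma> i1 i False]] by simp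
        qed
      qed
    qed
  next
    fix n j c assume j: "j \<le> n" and c: "c \<in> Y.KC (Suc n)"
    note sc = Y.codegen_closed[OF c, of j]
    show "?D n (cs_codegen (denorm Y) n j c) = cs_codegen (denorm Z) n j (?D (Suc n) c)"
    proof (rule Z.K_eqI[OF cl[OF sc] Z.codegen_closed[OF cl[OF c]]])
      fix \<gamma> assume \<gamma>: "\<gamma> \<subseteq> {1..n}"
      show "?D n (cs_codegen (denorm Y) n j c) \<gamma> = cs_codegen (denorm Z) n j (?D (Suc n) c) \<gamma>"
        unfolding ap[OF sc \<gamma>] Y.codegen_apply[OF c \<gamma> j] Z.codegen_apply[OF cl[OF c] \<gamma> j]
          ap[OF c delta_range[OF \<gamma>]] by simp
    qed
  qed
qed

theorem denorm_functor:
  fixes k :: "'k ring"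
  shows "is_functor (dgAlg k :: (('k, 'b) dga, _) category) (cAlg k) denorm denorm_map"
proof -
  have id: "denorm_map Y Y (dg_id Y) = cs_id (denorm Y)"
    if Y: "dg_algebra k Y" for Y :: "('k, 'b) dga"
  proof -
    interpret Y: dg_algebra k Y by fact
    note hom = denorm_map_hom[OF Y Y dg_hom_id[OF Y]]
    show ?thesis
    proof (rule cs_hom_eqI[OF hom cs_hom_id[OF Y.K_cosimplicial]])
      fix n c assume c: "c \<in> Y.KC n"
      show "denorm_map Y Y (dg_id Y) n c = cs_id (denorm Y) n c"
      proof (rule Y.K_eqI)
        show "denorm_map Y Y (dg_id Y) n c \<in> Y.KC n" "cs_id (denorm Y) n c \<in> Y.KC n"
          using alg_hom_D(1)[OF cs_hom_D(1)[OF hom] c] c by (simp_all add: cs_id_def del: Y.K_simps)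
        fix \<gamma> assume \<gamma>: "\<gamma> \<subseteq> {1..n}"
        then show "denorm_map Y Y (dg_id Y) n c \<gamma> = cs_id (denorm Y) n c \<gamma>"
          using c Y.K_mem[OF c \<gamma>] by (simp add: denorm_map_apply cs_id_def dg_id_def del: Y.K_simps)
      qed
    qed
  qed
  have comp: "denorm_map Y W (dg_comp Y g f) = cs_comp (denorm Y) (denorm_map Z W g) (denorm_map Y Z f)"
    if Y: "dg_algebra k Y" and Z: "dg_algebra k Z" and W: "dg_algebra k W"
      and f: "f \<in> dg_hom k Y Z" and g: "g \<in> dg_hom k Z W"
    for Y Z W :: "('k, 'b) dga" and f g
  proof -
    interpret Y: dg_algebra k Y by fact
    interpret Z: dg_algebra k Z by fact
    interpret W: dg_algebra k W by fact
    note hf = denorm_map_hom[OF Y Z f] and hg = denorm_map_hom[OF Z W g]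
    note h1 = denorm_map_hom[OF Y W dg_hom_comp[OF f g Y]] and h2 = cs_hom_comp[OF hf hg Y.K_cosimplicial]
    show ?thesis
    proof (rule cs_hom_eqI[OF h1 h2])
      fix n c assume c: "c \<in> Y.KC n"
      note fc = alg_hom_D(1)[OF cs_hom_D(1)[OF hf] c]
      show "denorm_map Y W (dg_comp Y g f) n c = cs_comp (denorm Y) (denorm_map Z W g) (denorm_map Y Z f) n c"
      proof (rule W.K_eqI[OF alg_hom_D(1)[OF cs_hom_D(1)[OF h1] c] alg_hom_D(1)[OF cs_hom_D(1)[OF h2] c]])
        fix \<gamma> assume \<gamma>: "\<gamma> \<subseteq> {1..n}"
        then show "denorm_map Y W (dg_comp Y g f) n c \<gamma> =
            cs_comp (denorm Y) (denorm_map Z W g) (denorm_map Y Z f) n c \<gamma>"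
          using c fc Y.K_mem[OF c \<gamma>]
          by (simp add: denorm_map_apply cs_comp_def compose_def dg_comp_def del: Y.K_simps Z.K_simps W.K_simps)
      qed
    qed
  qed
  show ?thesis
    unfolding is_functor_def cAlg_def dgAlg_def
    using dg_algebra.K_cosimplicial denorm_map_hom id comp by auto
qed

section \<open>The Dold-Kan projection\<close>

context cosimplicial_algebra
begin

text \<open>
  The two idempotents \<open>1 - d\<^bsup>j+1\<^esup> s\<^sup>j\<close> and \<open>1 - d\<^sup>j s\<^sup>j\<close> that project onto the kernel of \<open>s\<^sup>j\<close>.
\<close>

definition split_upper :: "nat \<Rightarrow> nat \<Rightarrow> 'a \<Rightarrow> 'a"
  where "split_upper m j x = x \<ominus>\<^bsub>cs_obj X (Suc m)\<^esub> dd m (Suc j) (ss m j x)"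

definition split_lower :: "nat \<Rightarrow> nat \<Rightarrow> 'a \<Rightarrow> 'a"
  where "split_lower m j x = x \<ominus>\<^bsub>cs_obj X (Suc m)\<^esub> dd m j (ss m j x)"

primrec partial_proj :: "nat \<Rightarrow> nat \<Rightarrow> 'a \<Rightarrow> 'a"
  where "partial_proj m 0 x = x" | "partial_proj m (Suc j) x = split_upper m j (partial_proj m j x)"

text \<open>
  The classical projection \<open>(1 - d\<^sup>n s\<^bsup>n-1\<^esup>) \<cdots> (1 - d\<^sup>1 s\<^sup>0)\<close> of \<open>X\<^sup>n\<close> onto \<open>X\<^sub>N\<^sup>n\<close>.
\<close>

definition dk_proj :: "nat \<Rightarrow> 'a \<Rightarrow> 'a"
  where "dk_proj n = (case n of 0 \<Rightarrow> (\<lambda>x. x) | Suc m \<Rightarrow> partial_proj m (Suc m))"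

lemma ds_additive: "i \<le> Suc m \<Longrightarrow> j \<le> m \<Longrightarrow>
    additive_map (cs_obj X (Suc m)) (cs_obj X (Suc m)) (\<lambda>x. dd m i (ss m j x))"
  by (rule additive_map_comp[OF codegen_additive coface_additive])

lemma ds_closed: "i \<le> Suc m \<Longrightarrow> j \<le> m \<Longrightarrow> x \<in> C (Suc m) \<Longrightarrow> dd m i (ss m j x) \<in> C (Suc m)"
  by (simp add: coface_D codegen_D)

lemma minus_ds_additive: "i \<le> Suc m \<Longrightarrow> j \<le> m \<Longrightarrow>
    additive_map (cs_obj X (Suc m)) (cs_obj X (Suc m)) (\<lambda>x. x \<ominus>\<^bsub>cs_obj X (Suc m)\<^esub> dd m i (ss m j x))"
  by (intro additive_mapI obj.is_abelian_group)
    (simp_all add: a_minus_def ds_closed additive_map_add[OF ds_additive] obj.minus_add obj.a_ac)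

lemma split_upper_additive: "j \<le> m \<Longrightarrow> additive_map (cs_obj X (Suc m)) (cs_obj X (Suc m)) (split_upper m j)"
  unfolding split_upper_def by (rule minus_ds_additive) simp_all

lemma split_upper_closed: "j \<le> m \<Longrightarrow> x \<in> C (Suc m) \<Longrightarrow> split_upper m j x \<in> C (Suc m)"
  by (rule additive_map_closed[OF split_upper_additive])

lemma codegen_minus_ds:
  assumes "i \<le> m" "c \<le> Suc m" "j \<le> m" "x \<in> C (Suc m)"
  shows "ss m i (x \<ominus>\<^bsub>cs_obj X (Suc m)\<^esub> dd m c (ss m j x)) = ss m i x \<ominus>\<^bsub>cs_obj X m\<^esub> ss m i (dd m c (ss m j x))"
  by (rule additive_map_minus[OF codegen_additive[OF assms(1)]]) (use assms ds_closed in auto)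

lemma split_upper_ker: "j \<le> m \<Longrightarrow> x \<in> C (Suc m) \<Longrightarrow> ss m j (split_upper m j x) = \<zero>\<^bsub>cs_obj X m\<^esub>"
  unfolding split_upper_def
  by (subst codegen_minus_ds) (simp_all add: codegen_coface_id codegen_D obj.minus_zero_iff)

lemma split_lower_ker: "j \<le> m \<Longrightarrow> x \<in> C (Suc m) \<Longrightarrow> ss m j (split_lower m j x) = \<zero>\<^bsub>cs_obj X m\<^esub>"
  unfolding split_lower_def
  by (subst codegen_minus_ds) (simp_all add: codegen_coface_id codegen_D obj.minus_zero_iff)

text \<open>
  Elements in the kernel of \<open>s\<^sup>i\<close> stay there under \<open>1 - d\<^bsup>j+1\<^esup> s\<^sup>j\<close> if \<open>i < j\<close> and under \<open>1 - d\<^sup>j s\<^sup>j\<close> if \<open>i >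
  j\<close>; this
  is why the kernels can be reached one after the other, upwards by the former and downwards by the latter.
\<close>

lemma ds_ker_low:
  assumes "i < j" "j \<le> m" "x \<in> C (Suc m)" "ss m i x = \<zero>\<^bsub>cs_obj X m\<^esub>"
  shows "ss m i (dd m (Suc j) (ss m j x)) = \<zero>\<^bsub>cs_obj X m\<^esub>"
proof -
  obtain l h where l: "m = Suc l" "j = Suc h" using assms by (cases m; cases j) auto
  have "ss l i (ss (Suc l) (Suc h) x) = ss l h (ss (Suc l) i x)"
    using codegen_codegen[of i h l x] assms l by simp
  then show ?thesis
    using assms l codegen_coface_greater[of i "Suc j" l "ss m j x"] 
    by (simp add: codegen_D additive_map_zero[OF codegen_additive] additive_map_zero[OF coface_additive])
qed

lemma ds_ker_high:
  assumes "j < i" "i \<le> m" "x \<in> C (Suc m)" "ss m i x = \<zero>\<^bsub>cs_obj X m\<^esub>"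
  shows "ss m i (dd m j (ss m j x)) = \<zero>\<^bsub>cs_obj X m\<^esub>"
proof -
  obtain l h where l: "m = Suc l" "i = Suc h" using assms by (cases m; cases i) auto
  have "ss l h (ss (Suc l) j x) = ss l j (ss (Suc l) (Suc h) x)"
    using codegen_codegen[of j h l x] assms l by simp
  then show ?thesis
    using assms l codegen_coface_less[of j i l "ss m j x"]
    by (simp add: codegen_D additive_map_zero[OF codegen_additive] additive_map_zero[OF coface_additive])
qed

lemma split_upper_pres: "i < j \<Longrightarrow> j \<le> m \<Longrightarrow> x \<in> C (Suc m) \<Longrightarrow> ss m i x = \<zero>\<^bsub>cs_obj X m\<^esub> \<Longrightarrow>
    ss m i (split_upper m j x) = \<zero>\<^bsub>cs_obj X m\<^esub>"
  unfolding split_upper_def by (subst codegen_minus_ds) (simp_all add: ds_ker_low a_minus_def)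

lemma split_lower_pres: "j < i \<Longrightarrow> i \<le> m \<Longrightarrow> x \<in> C (Suc m) \<Longrightarrow> ss m i x = \<zero>\<^bsub>cs_obj X m\<^esub> \<Longrightarrow>
    ss m i (split_lower m j x) = \<zero>\<^bsub>cs_obj X m\<^esub>"
  unfolding split_lower_def by (subst codegen_minus_ds) (simp_all add: ds_ker_high a_minus_def)

lemma split_upper_coface:
  assumes "j < i" "i \<le> m" "y \<in> C m"
  shows "\<exists>y'\<in>C m. split_upper m j (dd m (Suc i) y) = dd m (Suc i) y'"
proof -
  obtain l where l: "m = Suc l" using assms by (cases m) auto
  have "ss m j (dd m (Suc i) y) = dd l i (ss l j y)"
    using codegen_coface_greater[of j "Suc i" l y] assms l by simp
  moreover have "dd m (Suc i) (dd l (Suc j) (ss l j y)) = dd m (Suc j) (dd l i (ss l j y))"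
    using coface_coface[of "Suc j" "Suc i" l "ss l j y"] assms l by (simp add: codegen_D)
  moreover have "dd l (Suc j) (ss l j y) \<in> C m" using ds_closed[of "Suc j" l j y] assms l by simp
  ultimately show ?thesis
    using assms unfolding split_upper_def
    by (intro bexI[of _ "y \<ominus>\<^bsub>cs_obj X m\<^esub> dd l (Suc j) (ss l j y)"])
      (simp_all add: additive_map_minus[OF coface_additive])
qed

lemma partial_proj_additive: "j \<le> Suc m \<Longrightarrow> additive_map (cs_obj X (Suc m)) (cs_obj X (Suc m)) (partial_proj m j)"
proof (induction j)
  case 0
  then show ?case by (auto intro!: additive_mapI obj.is_abelian_group)
next
  case (Suc j)
  then show ?case using additive_map_comp[OF Suc.IH split_upper_additive[of j m]] by simp
qed

lemma partial_proj_closed: "j \<le> Suc m \<Longrightarrow> x \<in> C (Suc m) \<Longrightarrow> partial_proj m j x \<in> C (Suc m)"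
  by (rule additive_map_closed[OF partial_proj_additive])

lemma partial_proj_ker: "j \<le> Suc m \<Longrightarrow> x \<in> C (Suc m) \<Longrightarrow> i < j \<Longrightarrow> ss m i (partial_proj m j x) = \<zero>\<^bsub>cs_obj X m\<^esub>"
  by (induction j) (auto simp: less_Suc_eq split_upper_pres split_upper_ker partial_proj_closed)

text \<open>
  The factors before the \<open>i\<close>-th one only replace \<open>d\<^bsup>i+1\<^esup> y\<close> by another element of the image of \<open>d\<^bsup>i+1\<^esup>\<close>, which the
  \<open>i\<close>-th factor then kills.
\<close>

lemma partial_proj_coface: "j \<le> i \<Longrightarrow> i \<le> m \<Longrightarrow> y \<in> C m \<Longrightarrow>
    \<exists>y'\<in>C m. partial_proj m j (dd m (Suc i) y) = dd m (Suc i) y'"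
proof (induction j)
  case (Suc j)
  then obtain y' where "y' \<in> C m" "partial_proj m j (dd m (Suc i) y) = dd m (Suc i) y'" by auto
  then show ?case using split_upper_coface[of j i m y'] Suc.prems by simp
qed auto

lemma partial_proj_coface_zero:
  assumes "i \<le> m" "y \<in> C m" "i < j" "j \<le> Suc m"
  shows "partial_proj m j (dd m (Suc i) y) = \<zero>\<^bsub>cs_obj X (Suc m)\<^esub>"
  using assms(3,4)
proof (induction j)
  case (Suc j)
  show ?case
  proof (cases "i = j")
    case True
    obtain y' where y': "y' \<in> C m" "partial_proj m j (dd m (Suc i) y) = dd m (Suc i) y'"
      using partial_proj_coface[of j i m y] True assms by auto
    have "ss m j (dd m (Suc i) y') = y'" using True assms y' by (intro codegen_coface_id) auto
    then show ?thesis
      using y' True assms by (simp add: split_upper_def coface_D obj.minus_zero_iff)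
  next
    case False
    then show ?thesis using Suc by (simp add: additive_map_zero[OF split_upper_additive])
  qed
qed simp

lemma partial_proj_N: "x \<in> N (Suc m) \<Longrightarrow> j \<le> Suc m \<Longrightarrow> partial_proj m j x = x"
  by (induction j) (simp_all add: N_Suc split_upper_def a_minus_def additive_map_zero[OF coface_additive])

lemma dk_proj_additive: "additive_map (cs_obj X n) (cs_obj X n) (dk_proj n)"
  by (cases n) (auto simp: dk_proj_def partial_proj_additive intro!: additive_mapI obj.is_abelian_group
      simp del: partial_proj.simps)

lemma dk_proj_in_N: "x \<in> C n \<Longrightarrow> dk_proj n x \<in> N n"
  by (cases n) (simp_all add: dk_proj_def N_0 N_Suc partial_proj_ker partial_proj_closed del:
      partial_proj.simps)

lemma dk_proj_N: "x \<in> N n \<Longrightarrow> dk_proj n x = x"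
  by (cases n) (simp_all add: dk_proj_def partial_proj_N del: partial_proj.simps)

lemma dk_proj_coface: "i \<le> m \<Longrightarrow> y \<in> C m \<Longrightarrow> dk_proj (Suc m) (dd m (Suc i) y) = \<zero>\<^bsub>cs_obj X (Suc m)\<^esub>"
  by (simp add: dk_proj_def partial_proj_coface_zero del: partial_proj.simps)

lemma dk_proj_smult:
  assumes a: "a \<in> carrier k" and x: "x \<in> C n"
  shows "dk_proj n (a \<odot>\<^bsub>cs_obj X n\<^esub> x) = a \<odot>\<^bsub>cs_obj X n\<^esub> dk_proj n x"
proof (cases n)
  case 0
  then show ?thesis by (simp add: dk_proj_def)
next
  case (Suc m)
  have "partial_proj m j (a \<odot>\<^bsub>cs_obj X n\<^esub> x) = a \<odot>\<^bsub>cs_obj X n\<^esub> partial_proj m j x" if "j \<le> Suc m" for j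
    using that
  proof (induction j)
    case (Suc j)
    have y: "partial_proj m j x \<in> C n" using partial_proj_closed[of j m x] Suc x \<open>n = Suc m\<close> by simp
    then have "ss m j (a \<odot>\<^bsub>cs_obj X n\<^esub> partial_proj m j x) = a \<odot>\<^bsub>cs_obj X m\<^esub> ss m j (partial_proj m j x)"
      "dd m (Suc j) (a \<odot>\<^bsub>cs_obj X m\<^esub> ss m j (partial_proj m j x)) = a \<odot>\<^bsub>cs_obj X n\<^esub> dd m (Suc j) (ss m j
          (partial_proj m j x))"
      "dd m (Suc j) (ss m j (partial_proj m j x)) \<in> C n"
      using Suc.prems a \<open>n = Suc m\<close> by (simp_all add: codegen_D coface_D)
    then show ?case
      using Suc a y \<open>n = Suc m\<close>
      by (simp add: split_upper_def a_minus_def md.smult_r_distr md.smult_r_minus)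
  qed simp
  then show ?thesis using Suc by (simp add: dk_proj_def del: partial_proj.simps)
qed

text \<open>
  Each factor of the projection changes an element only by an element of the image of some \<open>d\<^bsup>j+1\<^esup>\<close>, so \<open>X\<^sup>n\<close>
  is spanned by the normalized elements and these images.
\<close>

lemma degenerate_induct [consumes 1, case_names normal coface add]:
  assumes x: "x \<in> C n"
    and N: "\<And>x. x \<in> N n \<Longrightarrow> Q x"
    and d: "\<And>m j y. n = Suc m \<Longrightarrow> j \<le> m \<Longrightarrow> y \<in> C m \<Longrightarrow> Q (dd m (Suc j) y)"
    and add: "\<And>x y. x \<in> C n \<Longrightarrow> y \<in> C n \<Longrightarrow> Q x \<Longrightarrow> Q y \<Longrightarrow> Q (x \<oplus>\<^bsub>cs_obj X n\<^esub> y)"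
  shows "Q x"
proof (cases n)
  case 0
  then show ?thesis using N x by (simp add: N_0)
next
  case (Suc m)
  have "Q x" if "Q (partial_proj m j x)" "j \<le> Suc m" for j
    using that
  proof (induction j)
    case (Suc j)
    have y: "partial_proj m j x \<in> C n" using partial_proj_closed[of j m x] Suc x \<open>n = Suc m\<close> by simp
    then have dy: "dd m (Suc j) (ss m j (partial_proj m j x)) \<in> C n" and sy: "ss m j (partial_proj m j x) \<in> C m"
      using Suc.prems \<open>n = Suc m\<close> by (simp_all add: codegen_D coface_D)
    have Py: "split_upper m j (partial_proj m j x) \<in> C n" using y Suc.prems \<open>n = Suc m\<close> by (simp add:
        split_upper_closed)
    have "Q (split_upper m j (partial_proj m j x) \<oplus>\<^bsub>cs_obj X n\<^esub> dd m (Suc j) (ss m j (partial_proj m j x)))"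
      using add[OF Py dy] d[OF \<open>n = Suc m\<close>, of j] Suc.prems sy by simp
    moreover have "split_upper m j (partial_proj m j x) \<oplus>\<^bsub>cs_obj X n\<^esub> dd m (Suc j) (ss m j (partial_proj m j
        x)) = partial_proj m j x"
      using y dy \<open>n = Suc m\<close> by (simp add: split_upper_def a_minus_def obj.a_assoc obj.l_neg)
    ultimately show ?case using Suc by simp
  qed simp
  moreover have "Q (partial_proj m (Suc m) x)"
    using N dk_proj_in_N[OF x] Suc by (simp add: dk_proj_def del: partial_proj.simps)
  ultimately show ?thesis by blast
qed

section \<open>The shuffle lemma\<close>

text \<open>
  In \<open>coface_word n A x\<close>, \<open>x\<close> is the image of a normalized element under the injection \<open>[n - |A|] \<rightarrow> [n]\<close> that
  misses exactly the points of \<open>A\<close>. The injection is built up by cofaces in an arbitrary order; the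
  cosimplicial identities make every point of \<open>A\<close> available as the last coface (\<open>coface_word_pull\<close>).
\<close>

inductive coface_word :: "nat \<Rightarrow> nat set \<Rightarrow> 'a \<Rightarrow> bool"
  where base: "x \<in> N n \<Longrightarrow> coface_word n {} x"
  | step: "coface_word n A x \<Longrightarrow> i \<le> Suc n \<Longrightarrow> coface_word (Suc n) (insert i (delta i ` A)) (dd n i x)"

lemma coface_word_closed: "coface_word n A x \<Longrightarrow> x \<in> C n"
  by (induction rule: coface_word.induct) (auto simp: N_carrier coface_D)

lemma coface_word_empty: "coface_word n {} x \<Longrightarrow> x \<in> N n"
  by (auto elim: coface_word.cases)

lemma delta_delta_le: "i \<le> j \<Longrightarrow> delta i ` delta j ` A = delta (Suc j) ` delta i ` A"
  unfolding image_image by (rule image_cong) (auto simp: delta_def)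

lemma coface_word_pull:
  "coface_word n A y \<Longrightarrow> j \<in> A \<Longrightarrow> \<exists>m x E. n = Suc m \<and> coface_word m E x \<and> y = dd m j x \<and> A = insert j (delta
      j ` E) \<and> j \<le> Suc m"
proof (induction arbitrary: j rule: coface_word.induct)
  case (step n A x i)
  show ?case
  proof (cases "j = i")
    case True
    then show ?thesis using step by blast
  next
    case False
    then obtain l where l: "l \<in> A" "j = delta i l" using step.prems by blast
    obtain m x' E where IH: "n = Suc m" "coface_word m E x'" "x = dd m l x'" "A = insert l (delta l ` E)"
        "l \<le> Suc m"
      using step.IH[OF l(1)] by blast
    note x' = coface_word_closed[OF IH(2)]
    show ?thesis
    proof (cases "l < i")
      case True
      then have j: "j = l" using l by (simp add: delta_def)
      obtain h where h: "i = Suc h" using True by (cases i) auto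
      have "dd n i x = dd (Suc m) l (dd m h x')"
        using coface_coface[of l i m x'] True step.hyps(2) IH x' h by simp
      moreover have "coface_word n (insert h (delta h ` E)) (dd m h x')"
        using coface_word.step[OF IH(2), of h] step.hyps(2) IH(1) h by simp
      moreover have "insert i (delta i ` A) = insert j (delta j ` insert h (delta h ` E))"
        using True h j IH(4) delta_delta_le[of l h E] by (simp add: insert_commute delta_def)
      moreover have "j \<le> Suc n" using True step.hyps(2) j by simp
      ultimately show ?thesis
        using j IH(1) by (intro exI[of _ n] exI[of _ "dd m h x'"] exI[of _ "insert h (delta h ` E)"]) simp
    next
      case False
      then have j: "j = Suc l" using l by (simp add: delta_def)
      have "dd n i x = dd (Suc m) (Suc l) (dd m i x')"
        using coface_coface[of i "Suc l" m x'] False IH x' by simp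
      moreover have "coface_word n (insert i (delta i ` E)) (dd m i x')"
        using coface_word.step[OF IH(2), of i] False IH by simp
      moreover have "insert i (delta i ` A) = insert j (delta j ` insert i (delta i ` E))"
        using False j IH(4) delta_delta_le[of i l E] by (simp add: insert_commute delta_def)
      moreover have "j \<le> Suc n" using j IH by simp
      ultimately show ?thesis
        using j IH(1) by (intro exI[of _ n] exI[of _ "dd m i x'"] exI[of _ "insert i (delta i ` E)"]) simp
    qed
  qed
qed simp

text \<open>
  If the image of the injection contains \<open>j\<close> and \<open>j + 1\<close>, then \<open>s\<^sup>j\<close> passes all cofaces and becomes a
  codegeneracy
  of the normalized element.
\<close>

lemma coface_word_ker: "coface_word n A y \<Longrightarrow> n = Suc m \<Longrightarrow> j \<le> m \<Longrightarrow> j \<notin> A \<Longrightarrow> Suc j \<notin> A \<Longrightarrow> ss m j y = \<zero>\<^bsub>cs_obj X m\<^esub>"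
proof (induction arbitrary: m j rule: coface_word.induct)
  case (base x n)
  then show ?case by (simp add: N_Suc)
next
  case (step n A x i)
  then have [simp]: "m = n" by simp
  have ij: "i \<noteq> j" "i \<noteq> Suc j" "j \<notin> delta i ` A" "Suc j \<notin> delta i ` A" using step.prems by auto
  then obtain l where l: "n = Suc l" using step.prems step.hyps(2) by (cases n) auto
  note x = coface_word_closed[OF step.hyps(1)]
  show ?case
  proof (cases "i < j")
    case True
    then obtain h where h: "j = Suc h" by (cases j) auto
    have "h \<notin> A" "Suc h \<notin> A"
      using ij True h unfolding mem_delta_image by (auto split: if_splits)
    then have "ss l h x = \<zero>\<^bsub>cs_obj X l\<^esub>" using step.IH[of l h] l h step.prems by simp
    then show ?thesis
      using codegen_coface_less[OF True, of l x] x l h step.prems True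
      by (simp add: additive_map_zero[OF coface_additive])
  next
    case False
    then have i: "Suc j < i" using ij by simp
    then have "j \<notin> A" "Suc j \<notin> A"
      using ij unfolding mem_delta_image by (auto split: if_splits)
    then have "ss l j x = \<zero>\<^bsub>cs_obj X l\<^esub>" using step.IH[of l j] l i step.hyps(2) by simp
    then show ?thesis
      using codegen_coface_greater[OF i, of l x] x l step.hyps(2) i
      by (simp add: additive_map_zero[OF coface_additive])
  qed
qed

text \<open>
  The injections that hit \<open>0\<close> suffice to span \<open>X\<^sup>n\<close>; those that miss \<open>0\<close> only occur when words are moved.
\<close>

lemma coface_word_span [consumes 1, case_names image add]:
  assumes "x \<in> C n" and "\<And>A x. A \<subseteq> {1..n} \<Longrightarrow> coface_word n A x \<Longrightarrow> Q x"
    and "\<And>x y. x \<in> C n \<Longrightarrow> y \<in> C n \<Longrightarrow> Q x \<Longrightarrow> Q y \<Longrightarrow> Q (x \<oplus>\<^bsub>cs_obj X n\<^esub> y)"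
  shows "Q x"
  using assms
proof (induction n arbitrary: x Q)
  case 0
  then show ?case using coface_word.base[of x 0] by (simp add: N_0)
next
  case (Suc m)
  from Suc.prems(1) show ?case
  proof (induction rule: degenerate_induct)
    case (normal x)
    then show ?case using coface_word.base Suc.prems(2) by blast
  next
    case (coface l j y)
    have l: "l = m" and j: "j \<le> m" and y: "y \<in> C m" using coface by simp_all
    have "Q (dd m (Suc j) y)"
    proof (rule Suc.IH[of y "\<lambda>y. Q (dd m (Suc j) y)"])
      fix A x assume A: "A \<subseteq> {1..m}" "coface_word m A x"
      have "insert (Suc j) (delta (Suc j) ` A) \<subseteq> {1..Suc m}"
        using delta_range[OF A(1), of "Suc j"] j by simp
      moreover have "coface_word (Suc m) (insert (Suc j) (delta (Suc j) ` A)) (dd m (Suc j) x)"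
        using coface_word.step[OF A(2), of "Suc j"] j by simp
      ultimately show "Q (dd m (Suc j) x)" using Suc.prems(2) by blast
    qed (use j y Suc.prems(3) in \<open>simp_all add: coface_D\<close>)
    then show ?case by (simp only: l)
  next
    case (add x y)
    then show ?case using Suc.prems(3) by blast
  qed
qed

lemma coface_word_move_up:
  assumes "coface_word (Suc m) A y" "i \<in> A" "Suc i \<notin> A" "i \<le> m"
  shows "\<exists>b\<in>C m. y = dd m i b \<and> coface_word (Suc m) (insert (Suc i) (A - {i})) (dd m (Suc i) b)"
proof -
  obtain b E where b: "coface_word m E b" "y = dd m i b" "A = insert i (delta i ` E)"
    using coface_word_pull[OF assms(1,2)] by auto
  have "Suc i \<notin> delta i ` E" using assms(3) b(3) by blast
  then have "i \<notin> E" unfolding mem_delta_image by simp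
  then have "delta (Suc i) ` E = delta i ` E" by (intro image_cong) (auto simp: delta_def less_Suc_eq)
  moreover have "i \<notin> delta i ` E" using delta_neq by (metis imageE)
  ultimately have "insert (Suc i) (delta (Suc i) ` E) = insert (Suc i) (A - {i})" using b(3) by auto
  then show ?thesis using coface_word.step[OF b(1), of "Suc i"] b coface_word_closed[OF b(1)] assms(4) by auto
qed

lemma coface_word_move_down:
  assumes "coface_word (Suc m) A y" "Suc i \<in> A" "i \<notin> A" "i \<le> m"
  shows "\<exists>b\<in>C m. y = dd m (Suc i) b \<and> coface_word (Suc m) (insert i (A - {Suc i})) (dd m i b)"
proof -
  obtain b E where b: "coface_word m E b" "y = dd m (Suc i) b" "A = insert (Suc i) (delta (Suc i) ` E)"
    using coface_word_pull[OF assms(1,2)] by auto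
  have "i \<notin> delta (Suc i) ` E" using assms(3) b(3) by blast
  then have "i \<notin> E" unfolding mem_delta_image by simp
  then have "delta i ` E = delta (Suc i) ` E" by (intro image_cong) (auto simp: delta_def less_Suc_eq)
  moreover have "Suc i \<notin> delta (Suc i) ` E" using delta_neq by (metis imageE)
  ultimately have "insert i (delta i ` E) = insert i (A - {Suc i})" using b(3) by auto
  then show ?thesis using coface_word.step[OF b(1), of i] b coface_word_closed[OF b(1)] assms(4) by auto
qed

lemma coface_word_front: "coface_word (p + q) {Suc p..p + q} x \<Longrightarrow> \<exists>f\<in>N p. x = coface_iter X p (Suc p) q f"
proof (induction q arbitrary: x)
  case 0
  then show ?case using coface_word_empty by auto
next
  case (Suc q)
  obtain m y E where y: "p + Suc q = Suc m" "coface_word m E y" "x = dd m (Suc p) y"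
    "{Suc p..p + Suc q} = insert (Suc p) (delta (Suc p) ` E)"
    using coface_word_pull[OF Suc.prems, of "Suc p"] by auto
  have "Suc p \<notin> delta (Suc p) ` E" using delta_neq by (metis imageE)
  then have "delta (Suc p) ` E = {Suc p..p + Suc q} - {Suc p}" using y(4) by auto
  also have "\<dots> = delta (Suc p) ` {Suc p..p + q}"
    by (auto simp: set_eq_iff mem_delta_image)
  finally have "E = {Suc p..p + q}" by (simp only: inj_image_eq_iff[OF delta_inj])
  then obtain f where "f \<in> N p" "y = coface_iter X p (Suc p) q f" using Suc.IH y(1,2) by auto
  then show ?case using y(1,3) by auto
qed

lemma coface_word_back: "coface_word (q + p) {..<p} y \<Longrightarrow> \<exists>g\<in>N q. y = coface_iter X q 0 p g"
proof (induction p arbitrary: y)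
  case 0
  then show ?case using coface_word_empty by auto
next
  case (Suc p)
  obtain m z E where z: "q + Suc p = Suc m" "coface_word m E z" "y = dd m 0 z" "{..<Suc p} = insert 0
      (delta 0 ` E)"
    using coface_word_pull[OF Suc.prems, of 0] by auto
  have "0 \<notin> delta 0 ` E" using delta_neq by (metis imageE)
  then have "delta 0 ` E = {..<Suc p} - {0}" using z(4) by auto
  also have "\<dots> = delta 0 ` {..<p}"
    by (auto simp: set_eq_iff mem_delta_image)
  finally have "E = {..<p}" by (simp only: inj_image_eq_iff[OF delta_inj])
  then obtain g where "g \<in> N q" "z = coface_iter X q 0 p g" using Suc.IH z(1,2) by auto
  then show ?case using z(1,3) by auto
qed

end

text \<open>
  The properties of the defect of multiplicativity of a map that is defined by its values on normalized
  elements. They force \<open>B\<close> to vanish on a pair of words with missing sets \<open>A\<close> and \<open>A'\<close>: if \<open>A\<close> and \<open>A'\<close>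
  meet, both
  words lie in the image of one coface; if they do not cover \<open>{1..n}\<close>, the gap is moved down to \<open>1\<close>, where both
  words lie in the kernel of \<open>s\<^sup>0\<close>; and if they partition \<open>{1..n}\<close>, they are sorted until the words are a front
  and a back image.
\<close>

locale shuffle_form = cosimplicial_algebra k X + M: abelian_group M
  for k :: "'k ring" and X :: "('k, 'a) cosimplicial" and M :: "('c, 'm) ring_scheme" +
  fixes n :: nat and B :: "'a \<Rightarrow> 'a \<Rightarrow> 'c"
  assumes B_closed: "x \<in> C n \<Longrightarrow> y \<in> C n \<Longrightarrow> B x y \<in> carrier M"
    and B_add_left: "x \<in> C n \<Longrightarrow> x' \<in> C n \<Longrightarrow> y \<in> C n \<Longrightarrow>
      B (x \<oplus>\<^bsub>cs_obj X n\<^esub> x') y = B x y \<oplus>\<^bsub>M\<^esub> B x' y"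
    and B_add_right: "x \<in> C n \<Longrightarrow> y \<in> C n \<Longrightarrow> y' \<in> C n \<Longrightarrow>
      B x (y \<oplus>\<^bsub>cs_obj X n\<^esub> y') = B x y \<oplus>\<^bsub>M\<^esub> B x y'"
    and B_ker: "n = Suc m \<Longrightarrow> j \<le> m \<Longrightarrow> x \<in> C n \<Longrightarrow> y \<in> C n \<Longrightarrow>
      ss m j x = \<zero>\<^bsub>cs_obj X m\<^esub> \<Longrightarrow> ss m j y = \<zero>\<^bsub>cs_obj X m\<^esub> \<Longrightarrow> B x y = \<zero>\<^bsub>M\<^esub>"
    and B_coface: "n = Suc m \<Longrightarrow> j \<le> m \<Longrightarrow> a \<in> C m \<Longrightarrow> b \<in> C m \<Longrightarrow>
      B (dd m (Suc j) a) (dd m (Suc j) b) = \<zero>\<^bsub>M\<^esub>"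
    and B_cup: "p + q = n \<Longrightarrow> f \<in> N p \<Longrightarrow> g \<in> N q \<Longrightarrow>
      B (coface_iter X p (Suc p) q f) (coface_iter X q 0 p g) = \<zero>\<^bsub>M\<^esub>"
begin

lemma B_left: "y \<in> C n \<Longrightarrow> additive_map (cs_obj X n) M (\<lambda>x. B x y)"
  by (intro additive_mapI obj.is_abelian_group M.abelian_group_axioms) (simp_all add: B_closed B_add_left)

lemma B_right: "x \<in> C n \<Longrightarrow> additive_map (cs_obj X n) M (B x)"
  by (intro additive_mapI obj.is_abelian_group M.abelian_group_axioms) (simp_all add: B_closed B_add_right)

lemma coface_diff_ker:
  assumes "j \<le> m" "b \<in> C m"
  shows "ss m j (dd m (Suc j) b \<ominus>\<^bsub>cs_obj X (Suc m)\<^esub> dd m j b) = \<zero>\<^bsub>cs_obj X m\<^esub>"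
  using assms
  by (simp add: additive_map_minus[OF codegen_additive] coface_D codegen_coface_id obj.minus_zero_iff)

text \<open>The difference \<open>d\<^bsup>j+1\<^esup> b - d\<^sup>j b\<close> lies in the kernel of \<open>s\<^sup>j\<close>, and so does the other argument.\<close>

lemma B_move_right:
  assumes n: "n = Suc m" and j: "j \<le> m" and x: "x \<in> C n" "ss m j x = \<zero>\<^bsub>cs_obj X m\<^esub>" and b: "b \<in> C m"
  shows "B x (dd m (Suc j) b) = B x (dd m j b)"
proof -
  have d: "dd m (Suc j) b \<in> C n" "dd m j b \<in> C n" using n j b by (simp_all add: coface_D)
  have "B x (dd m (Suc j) b \<ominus>\<^bsub>cs_obj X n\<^esub> dd m j b) = \<zero>\<^bsub>M\<^esub>"
    using B_ker[OF n j x(1) _ x(2)] coface_diff_ker[OF j b] d n by simp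
  then show ?thesis
    using additive_map_minus[OF B_right[OF x(1)] d] M.minus_zero_iff B_closed[OF x(1)] d by simp
qed

lemma B_move_left:
  assumes n: "n = Suc m" and j: "j \<le> m" and x: "x \<in> C n" "ss m j x = \<zero>\<^bsub>cs_obj X m\<^esub>" and b: "b \<in> C m"
  shows "B (dd m (Suc j) b) x = B (dd m j b) x"
proof -
  have d: "dd m (Suc j) b \<in> C n" "dd m j b \<in> C n" using n j b by (simp_all add: coface_D)
  have "B (dd m (Suc j) b \<ominus>\<^bsub>cs_obj X n\<^esub> dd m j b) x = \<zero>\<^bsub>M\<^esub>"
    using B_ker[OF n j _ x(1) _ x(2)] coface_diff_ker[OF j b] d n by simp
  then show ?thesis
    using additive_map_minus[OF B_left[OF x(1)] d] M.minus_zero_iff B_closed[OF _ x(1)] d by simp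
qed

text \<open>Expand \<open>B(d\<^bsup>j+1\<^esup> a - d\<^sup>j a, d\<^bsup>j+1\<^esup> b - d\<^sup>j b) = 0\<close>; two of the four terms vanish by \<open>B_coface\<close>.\<close>

lemma B_swap:
  assumes n: "n = Suc m" and j: "1 \<le> j" "j \<le> m" and a: "a \<in> C m" and b: "b \<in> C m"
  shows "B (dd m j a) (dd m (Suc j) b) = \<ominus>\<^bsub>M\<^esub> B (dd m (Suc j) a) (dd m j b)"
proof -
  obtain i where i: "j = Suc i" "i \<le> m" using j by (cases j) auto
  have d: "dd m (Suc j) a \<in> C n" "dd m j a \<in> C n" "dd m (Suc j) b \<in> C n" "dd m j b \<in> C n"
    using n j a b by (simp_all add: coface_D)
  have dm: "dd m (Suc j) a \<ominus>\<^bsub>cs_obj X n\<^esub> dd m j a \<in> C n" "dd m (Suc j) b \<ominus>\<^bsub>cs_obj X n\<^esub> dd m j b \<in> C n"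
    using d by simp_all
  have z: "B (dd m j a) (dd m j b) = \<zero>\<^bsub>M\<^esub>" "B (dd m (Suc j) a) (dd m (Suc j) b) = \<zero>\<^bsub>M\<^esub>"
    using B_coface[OF n i(2) a b] B_coface[OF n j(2) a b] i by simp_all
  have "\<zero>\<^bsub>M\<^esub> = B (dd m (Suc j) a \<ominus>\<^bsub>cs_obj X n\<^esub> dd m j a) (dd m (Suc j) b \<ominus>\<^bsub>cs_obj X n\<^esub> dd m j b)"
    using B_ker[OF n j(2) dm] coface_diff_ker[OF j(2) a] coface_diff_ker[OF j(2) b] n by simp
  also have "\<dots> = (\<zero>\<^bsub>M\<^esub> \<ominus>\<^bsub>M\<^esub> B (dd m j a) (dd m (Suc j) b)) \<ominus>\<^bsub>M\<^esub> (B (dd m (Suc j) a) (dd m j b) \<ominus>\<^bsub>M\<^esub> \<zero>\<^bsub>M\<^esub>)"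
    using d dm z
    by (simp add: additive_map_minus[OF B_left] additive_map_minus[OF B_right])
  finally have "\<ominus>\<^bsub>M\<^esub> B (dd m j a) (dd m (Suc j) b) \<ominus>\<^bsub>M\<^esub> B (dd m (Suc j) a) (dd m j b) = \<zero>\<^bsub>M\<^esub>"
    using B_closed d by (simp add: a_minus_def)
  then have "\<ominus>\<^bsub>M\<^esub> B (dd m j a) (dd m (Suc j) b) = B (dd m (Suc j) a) (dd m j b)"
    using B_closed d by (simp add: M.minus_zero_iff)
  then show ?thesis using B_closed d by (metis M.minus_minus)
qed

text \<open>
  Induction on the gap \<open>j\<close>: if \<open>j - 1\<close> is missed by one word, moving it to \<open>j\<close> turns \<open>j - 1\<close> into a gap.
\<close>

lemma B_gap:
  "coface_word n A x \<Longrightarrow> coface_word n A' y \<Longrightarrow> A \<subseteq> {1..n} \<Longrightarrow> A' \<subseteq> {1..n} \<Longrightarrow> A \<inter> A' = {} \<Longrightarrow>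
    1 \<le> j \<Longrightarrow> j \<le> n \<Longrightarrow> j \<notin> A \<Longrightarrow> j \<notin> A' \<Longrightarrow> B x y = \<zero>\<^bsub>M\<^esub>"
proof (induction j arbitrary: A A' x y)
  case (Suc i)
  note xC = coface_word_closed[OF Suc.prems(1)] and yC = coface_word_closed[OF Suc.prems(2)]
  obtain m where m: "n = Suc m" "i \<le> m" using Suc.prems(7) by (cases n) auto
  show ?case
  proof (cases "i = 0")
    case True
    have "0 \<notin> A" "0 \<notin> A'" using Suc.prems(3,4) by auto
    then have "ss m 0 x = \<zero>\<^bsub>cs_obj X m\<^esub>" "ss m 0 y = \<zero>\<^bsub>cs_obj X m\<^esub>"
      using coface_word_ker[OF Suc.prems(1) m(1), of 0] coface_word_ker[OF Suc.prems(2) m(1), of 0]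
          Suc.prems True by auto
    then show ?thesis using B_ker[OF m(1) _ xC yC, of 0] by simp
  next
    case False
    then have i: "1 \<le> i" "i \<le> n" using m by auto
    consider "i \<notin> A" "i \<notin> A'" | "i \<in> A'" "i \<notin> A" | "i \<in> A" "i \<notin> A'"
      using Suc.prems(5) by blast
    then show ?thesis
    proof cases
      case 1
      then show ?thesis using Suc.IH[OF Suc.prems(1-5) i] by simp
    next
      case 2
      obtain b where b: "b \<in> C m" "y = dd m i b" "coface_word n (insert (Suc i) (A' - {i})) (dd m (Suc i) b)"
        using coface_word_move_up[of m A' y i] Suc.prems 2 m by auto
      have "ss m i x = \<zero>\<^bsub>cs_obj X m\<^esub>" using coface_word_ker[OF Suc.prems(1) m(1,2)] 2 Suc.prems by simp
      then have "B x y = B x (dd m (Suc i) b)"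
        using B_move_right[OF m xC _ b(1)] b(2) by simp
      also have "\<dots> = \<zero>\<^bsub>M\<^esub>"
        by (rule Suc.IH[OF Suc.prems(1) b(3) Suc.prems(3) _ _ i]) (use Suc.prems 2 in auto)
      finally show ?thesis .
    next
      case 3
      obtain b where b: "b \<in> C m" "x = dd m i b" "coface_word n (insert (Suc i) (A - {i})) (dd m (Suc i) b)"
        using coface_word_move_up[of m A x i] Suc.prems 3 m by auto
      have "ss m i y = \<zero>\<^bsub>cs_obj X m\<^esub>" using coface_word_ker[OF Suc.prems(2) m(1,2)] 3 Suc.prems by simp
      then have "B x y = B (dd m (Suc i) b) y"
        using B_move_left[OF m yC _ b(1)] b(2) by simp
      also have "\<dots> = \<zero>\<^bsub>M\<^esub>"
        by (rule Suc.IH[OF b(3) Suc.prems(2) _ Suc.prems(4) _ i]) (use Suc.prems 3 in auto)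
      finally show ?thesis .
    qed
  qed
qed simp

text \<open>
  From \<open>{1..p}\<close> the missing set of \<open>y\<close> is shifted, point by point, to \<open>{0..p-1}\<close>, where \<open>y\<close> is a back image. In
  between it is \<open>{0..p}\<close> without one point \<open>i\<close>.
\<close>

lemma B_sorted:
  assumes x: "coface_word n {Suc p..n} x" and p: "p \<le> n"
  shows "i \<le> p \<Longrightarrow> coface_word n ({..p} - {i}) y \<Longrightarrow> B x y = \<zero>\<^bsub>M\<^esub>"
proof (induction "p - i" arbitrary: i y)
  case 0
  then have "i = p" by simp
  then have "{..p} - {i} = {..<p}" by auto
  then have y: "coface_word ((n - p) + p) {..<p} y" using 0 p by simp
  obtain g where g: "g \<in> N (n - p)" "y = coface_iter X (n - p) 0 p g" using coface_word_back[OF y] by blast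
  have "coface_word (p + (n - p)) {Suc p..p + (n - p)} x" using x p by simp
  then obtain f where "f \<in> N p" "x = coface_iter X p (Suc p) (n - p) f" using coface_word_front by blast
  then show ?case using B_cup[of p "n - p" f g] g p by simp
next
  case (Suc d)
  then have i: "i < p" by simp
  obtain m where m: "n = Suc m" "i \<le> m" using i p by (cases n) auto
  obtain b where b: "b \<in> C m" "y = dd m (Suc i) b" "coface_word n (insert i ({..p} - {i} - {Suc i})) (dd m i b)"
    using coface_word_move_down[of m "{..p} - {i}" y i] Suc.prems i m by auto
  have "insert i ({..p} - {i} - {Suc i}) = {..p} - {Suc i}" using i by auto
  then have "B x (dd m i b) = \<zero>\<^bsub>M\<^esub>"
    using Suc.hyps(1)[of "Suc i"] Suc.hyps(2) i b(3) by simp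
  moreover have "ss m i x = \<zero>\<^bsub>cs_obj X m\<^esub>" using coface_word_ker[OF x m] i by simp
  ultimately show ?case using B_move_right[OF m coface_word_closed[OF x] _ b(1)] b(2) by simp
qed

text \<open>
  Swapping \<open>i \<in> A\<close> with \<open>i + 1 \<in> A'\<close> lowers the sum of the elements of \<open>A'\<close>. When no swap is possible,
  \<open>A'\<close> is an
  initial segment of \<open>{1..n}\<close>.
\<close>

lemma B_partition:
  "coface_word n A x \<Longrightarrow> coface_word n A' y \<Longrightarrow> A \<inter> A' = {} \<Longrightarrow> A \<union> A' = {1..n} \<Longrightarrow> B x y = \<zero>\<^bsub>M\<^esub>"
proof (induction "\<Sum>A'" arbitrary: A A' x y rule: less_induct)
  case less
  note xC = coface_word_closed[OF less.prems(1)] and yC = coface_word_closed[OF less.prems(2)]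
  have fin: "finite A'" using less.prems(4) by (metis finite_Un finite_atLeastAtMost)
  show ?case
  proof (cases "\<exists>i. 1 \<le> i \<and> i \<notin> A' \<and> Suc i \<in> A'")
    case True
    then obtain i where i: "1 \<le> i" "i \<notin> A'" "Suc i \<in> A'" by blast
    then have "Suc i \<le> n" using less.prems(4) by auto
    then obtain m where m: "n = Suc m" "i \<le> m" by (cases n) auto
    have iA: "i \<in> A" "Suc i \<notin> A" using less.prems i m by auto
    obtain a where a: "a \<in> C m" "x = dd m i a" "coface_word n (insert (Suc i) (A - {i})) (dd m (Suc i) a)"
      using coface_word_move_up[of m A x i] less.prems(1) iA m by auto
    obtain b where b: "b \<in> C m" "y = dd m (Suc i) b" "coface_word n (insert i (A' - {Suc i})) (dd m i b)"
      using coface_word_move_down[of m A' y i] less.prems(2) i m by auto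
    have "\<Sum>A' = Suc i + \<Sum>(A' - {Suc i})" using sum.remove[OF fin i(3), of "\<lambda>x. x"] by simp
    then have "\<Sum>(insert i (A' - {Suc i})) < \<Sum>A'" using fin i(2) by simp
    moreover have "insert (Suc i) (A - {i}) \<inter> insert i (A' - {Suc i}) = {}"
      using less.prems(3) by auto
    moreover have "insert (Suc i) (A - {i}) \<union> insert i (A' - {Suc i}) = {1..n}"
      using less.prems(4) i iA by blast
    ultimately have "B (dd m (Suc i) a) (dd m i b) = \<zero>\<^bsub>M\<^esub>"
      using less.hyps[OF _ a(3) b(3)] by blast
    then show ?thesis using B_swap[OF m(1) i(1) m(2) a(1) b(1)] a(2) b(2) by simp
  next
    case False
    define p where "p = Max (insert 0 A')"
    have A'p: "A' \<subseteq> {1..p}"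
      using fin less.prems(4) unfolding p_def by auto
    have "l \<in> A'" if "1 \<le> l" "l \<le> p" for l
      using that(2,1)
    proof (induction l rule: inc_induct)
      case base
      then have "p \<noteq> 0" by simp
      then show ?case using Max_in[of "insert 0 A'"] fin unfolding p_def by auto
    next
      case (step l)
      then show ?case using False by auto
    qed
    then have A': "A' = {1..p}" using A'p by auto
    have "p \<le> n" using A' less.prems(4) by (cases "p = 0") auto
    moreover have "A = {1..n} - {1..p}" using A' less.prems(3,4) by blast
    then have "A = {Suc p..n}" by auto
    moreover have "{1..p} = {..p} - {0}" by auto
    ultimately show ?thesis using B_sorted[of p x 0 y] less.prems(1,2) A' by simp
  qed
qed

theorem shuffle_lemma:
  assumes x: "x \<in> C n" and y: "y \<in> C n"
  shows "B x y = \<zero>\<^bsub>M\<^esub>"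
  using x
proof (induction rule: coface_word_span)
  case (image A x)
  note A = image and xC = coface_word_closed[OF image(2)]
  show ?case
    using y
  proof (induction rule: coface_word_span)
    case (image A' y)
    show ?case
    proof (cases "A \<inter> A' = {}")
      case True
      show ?thesis
      proof (cases "A \<union> A' = {1..n}")
        case True
        then show ?thesis using B_partition[OF A(2) image(2) \<open>A \<inter> A' = {}\<close>] by simp
      next
        case False
        then have "\<not> {1..n} \<subseteq> A \<union> A'" using A(1) image(1) by blast
        then obtain j where "j \<in> {1..n}" "j \<notin> A \<union> A'" by blast
        then have "1 \<le> j" "j \<le> n" "j \<notin> A" "j \<notin> A'" by auto
        then show ?thesis using B_gap[OF A(2) image(2) A(1) image(1) \<open>A \<inter> A' = {}\<close>] by blast
      qed
    next
      case False
      then obtain j where j: "j \<in> A" "j \<in> A'" by blast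
      obtain m a E where a: "n = Suc m" "coface_word m E a" "x = dd m j a" "j \<le> Suc m"
        using coface_word_pull[OF A(2) j(1)] by blast
      obtain m' b E' where b: "n = Suc m'" "coface_word m' E' b" "y = dd m' j b"
        using coface_word_pull[OF image(2) j(2)] by blast
      have "1 \<le> j" using A(1) j(1) by auto
      then obtain i where i: "j = Suc i" "i \<le> m" using a(4) by (cases j) auto
      have "m' = m" using a b by simp
      then show ?thesis
        using B_coface[OF a(1) i(2) coface_word_closed[OF a(2)]] coface_word_closed[OF b(2)] a(3) b(3) i by simp
    qed
  next
    case (add y y')
    then show ?case using B_add_right[OF xC] by simp
  qed
next
  case (add x x')
  then show ?case using B_add_left[OF _ _ y] by simp
qed

end

section \<open>The adjunction\<close>

context dg_algebra
begin

lemma K_ker_coeff: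
  assumes c: "c \<in> KC (Suc m)" and j: "j \<le> m" and z: "cs_codegen K m j c = \<zero>\<^bsub>cs_obj K m\<^esub>"
    and \<alpha>: "\<alpha> \<subseteq> {1..Suc m}" "Suc j \<notin> \<alpha>"
  shows "c \<alpha> = \<zero>\<^bsub>dg_gr Y (card \<alpha>)\<^esub>"
proof -
  have r: "sigma j ` \<alpha> \<subseteq> {1..m}" using sigma_minus_range \<alpha> j by blast
  have D: "delta (Suc j) ` sigma j ` \<alpha> = \<alpha>" using delta_sigma_image \<alpha> by blast
  then have "card (sigma j ` \<alpha>) = card \<alpha>" using card_delta by metis
  then show ?thesis using codegen_apply[OF c r j] z D K_zero_apply[OF r] by simp
qed

text \<open>
  In every summand the point \<open>j + 1\<close> is missing from one of the two index sets, and there the coefficient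
  is one of
  \<open>s\<^sup>j c\<close> or \<open>s\<^sup>j c'\<close>.
\<close>

lemma K_ker_mult_top:
  assumes c: "c \<in> KC (Suc m)" "c' \<in> KC (Suc m)" and j: "j \<le> m"
    and z: "cs_codegen K m j c = \<zero>\<^bsub>cs_obj K m\<^esub>" "cs_codegen K m j c' = \<zero>\<^bsub>cs_obj K m\<^esub>"
  shows "(c \<otimes>\<^bsub>cs_obj K (Suc m)\<^esub> c') {1..Suc m} = \<zero>\<^bsub>dg_gr Y (Suc m)\<^esub>"
proof -
  let ?T = "{1..Suc m}"
  note \<gamma> = subset_refl[of ?T]
  have "(c \<otimes>\<^bsub>cs_obj K (Suc m)\<^esub> c') ?T = \<zero>\<^bsub>dg_gr Y (card ?T)\<^esub>"
    unfolding K_mult_apply[OF c \<gamma>]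
  proof (rule gr.finsum_zero')
    fix \<alpha> assume "\<alpha> \<in> Pow ?T"
    then have \<alpha>: "\<alpha> \<subseteq> ?T" by simp
    show "shuffle_term ?T \<alpha> (c \<alpha>) (c' (?T - \<alpha>)) = \<zero>\<^bsub>dg_gr Y (card ?T)\<^esub>"
      by (rule shuffle_term_zero[OF \<gamma> \<alpha> K_sub(1)[OF c(1) \<gamma> \<alpha>] K_sub(2)[OF c(2) \<gamma>]])
        (use K_ker_coeff[OF c(1) j z(1) \<alpha>] K_ker_coeff[OF c(2) j z(2) Diff_subset, of \<alpha>] in blast)
  qed
  then show ?thesis by simp
qed

lemma K_J_zero:
  assumes "c \<in> differentiating K n"
  shows "c {1..n} = \<zero>\<^bsub>dg_gr Y n\<^esub>"
proof -
  interpret KK: cosimplicial_algebra k K by (rule K_cosimplicial)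
  have E: "additive_map (cs_obj K n) (dg_gr Y n) (\<lambda>c. c {1..n})" using K_eval_additive[of "{1..n}" n] by simp
  show ?thesis
  proof (rule conjunct2[OF KK.J_induct[OF assms, where P = "\<lambda>c. c {1..n} = \<zero>\<^bsub>dg_gr Y n\<^esub>"]])
    fix j y assume j: "1 \<le> j" "j \<le> n" and y: "y \<in> KK.sq n j"
    obtain m i where m: "n = Suc m" "j = Suc i" "i \<le> m" using j by (cases n; cases j) auto
    have "y \<in> KC n \<and> y {1..n} = \<zero>\<^bsub>dg_gr Y n\<^esub>"
      using y unfolding KK.sq_def
    proof (induction rule: ideal_prod.induct)
      case (prod a b)
      then have "a \<in> KC n" "b \<in> KC n" "cs_codegen K m i a = \<zero>\<^bsub>cs_obj K m\<^esub>" "cs_codegen K m i b = \<zero>\<^bsub>cs_obj K m\<^esub>"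
        using m by (simp_all add: KK.ker_Suc del: K_simps)
      then show ?case using K_ker_mult_top[of a m b i] K_mult_closed m by (simp del: K_simps)
    next
      case (sum a b)
      then show ?case using additive_map_add[OF E, of a b] K_add_closed[of a n b] by (simp del: K_simps)
    qed
    then show "y {1..n} = \<zero>\<^bsub>dg_gr Y n\<^esub>" by blast
  next
    fix y z assume "y \<in> normalized K n" "z \<in> normalized K n" "y {1..n} = \<zero>\<^bsub>dg_gr Y n\<^esub>" "z {1..n} = \<zero>\<^bsub>dg_gr Y n\<^esub>"
    then show "(y \<oplus>\<^bsub>cs_obj K n\<^esub> z) {1..n} = \<zero>\<^bsub>dg_gr Y n\<^esub>"
      using additive_map_add[OF E] KK.N_carrier by (simp del: K_simps)
  qed (rule additive_map_zero[OF E])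
qed

text \<open>
  Agreement of top coefficients extends from normalized elements to all of \<open>X\<^sup>n\<close>, because the top coefficient
  vanishes on the images of \<open>d\<^sup>1, \<dots>, d\<^sup>n\<close>. Agreement of all coefficients follows by induction along the
  codegeneracies.
\<close>

theorem cs_hom_K_eqI:
  assumes X: "cosimplicial_algebra k X" and F: "F \<in> cs_hom k X K" and F': "F' \<in> cs_hom k X K"
    and top: "\<And>n x. x \<in> normalized X n \<Longrightarrow> F n x {1..n} = F' n x {1..n}"
  shows "F = F'"
proof -
  interpret X: cosimplicial_algebra k X by fact
  note D = alg_hom_D[OF cs_hom_D(1)[OF F]] and D' = alg_hom_D[OF cs_hom_D(1)[OF F']]
  have tops: "F n x {1..n} = F' n x {1..n}" if "x \<in> X.C n" for n x
    using that
  proof (induction rule: X.degenerate_induct)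
    case (coface m j y)
    then show ?case
      using cs_hom_D(3)[OF F, of "Suc j" m y] cs_hom_D(3)[OF F', of "Suc j" m y]
        K_coface_top(1)[OF D(1)[of y m], of "Suc j"] K_coface_top(1)[OF D'(1)[of y m], of "Suc j"]
      by (simp del: K_simps)
  next
    case (add x y)
    then show ?case by (simp add: D(2) D'(2))
  qed (rule top)
  have "F n x = F' n x" if "x \<in> X.C n" for n x
    using that
  proof (induction n arbitrary: x)
    case 0
    show ?case by (rule K_joint_inj[OF D(1)[OF 0] D'(1)[OF 0] tops[OF 0]]) simp
  next
    case (Suc n)
    show ?case
    proof (rule K_joint_inj[OF D(1)[OF Suc.prems] D'(1)[OF Suc.prems] tops[OF Suc.prems]])
      fix m j assume "Suc n = Suc m" "j \<le> m"
      then have m: "m = n" "j \<le> n" by auto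
      show "cs_codegen K m j (F (Suc n) x) = cs_codegen K m j (F' (Suc n) x)"
        unfolding m(1) cs_hom_D(4)[OF F m(2) Suc.prems, symmetric] cs_hom_D(4)[OF F' m(2) Suc.prems, symmetric]
        using Suc.IH[of "cs_codegen X n j x"] m(2) Suc.prems by (simp add: X.codegen_D)
    qed
  qed
  then show ?thesis by (rule cs_hom_eqI[OF F F'])
qed

lemma cs_hom_K_normalized:
  assumes X: "cosimplicial_algebra k X" and F: "F \<in> cs_hom k X K"
  shows "(\<lambda>n. \<lambda>x\<in>normalized X n. F n x {1..n}) \<in> dg_hom k (normalization X) Y"
    and "x \<in> differentiating X n \<Longrightarrow> F n x {1..n} = \<zero>\<^bsub>dg_gr Y n\<^esub>"
proof -
  interpret M: cosimplicial_morphism k X K F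
    using X F K_cosimplicial by (simp add: cosimplicial_morphism_def cosimplicial_morphism_axioms_def)
  have "dg_comp (normalization X) (\<lambda>n. \<lambda>c\<in>normalized K n. c {1..n}) (\<lambda>n. restrict (F n) (normalized X n)) =
      (\<lambda>n. \<lambda>x\<in>normalized X n. F n x {1..n})"
    by (auto simp: dg_comp_def compose_def M.h_N fun_eq_iff restrict_def)
  then show "(\<lambda>n. \<lambda>x\<in>normalized X n. F n x {1..n}) \<in> dg_hom k (normalization X) Y"
    using dg_hom_comp[OF M.normalized_hom top_hom M.src.dg_algebra_XN] by simp
  show "F n x {1..n} = \<zero>\<^bsub>dg_gr Y n\<^esub>" if "x \<in> differentiating X n"
    by (rule K_J_zero[OF M.h_J[OF that]])
qed

end

text \<open>
  A morphism out of \<open>N'(X)\<close>, presented on \<open>X\<^sub>N\<close>. It has to kill only \<open>J\<close>: commuting with differentials, it then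
  kills \<open>J + \<delta>J\<close>.
\<close>

locale normalized_cochain = src: cosimplicial_algebra k X + tgt: dg_algebra k Y
  for k :: "'k ring" and X :: "('k, 'a) cosimplicial" and Y :: "('k, 'b) dga" +
  fixes \<psi> :: "nat \<Rightarrow> 'a \<Rightarrow> 'b"
  assumes \<psi>: "\<psi> \<in> dg_hom k (normalization X) Y"
    and kills: "x \<in> differentiating X n \<Longrightarrow> \<psi> n x = \<zero>\<^bsub>dg_gr Y n\<^esub>"
begin

declare tgt.K_simps [simp del]

lemmas \<psi>_D = dg_hom_D[OF \<psi>, simplified]

text \<open>
  The extension of \<open>\<psi>\<close> by zero on the images of \<open>d\<^sup>1, \<dots>, d\<^sup>n\<close>.
\<close>

definition \<tau> :: "nat \<Rightarrow> 'a \<Rightarrow> 'b"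
  where "\<tau> n x = \<psi> n (src.dk_proj n x)"

lemma \<tau>_closed: "x \<in> src.C n \<Longrightarrow> \<tau> n x \<in> tgt.G n"
  by (simp add: \<tau>_def \<psi>_D src.dk_proj_in_N)

lemma \<tau>_add: "x \<in> src.C n \<Longrightarrow> y \<in> src.C n \<Longrightarrow> \<tau> n (x \<oplus>\<^bsub>cs_obj X n\<^esub> y) = \<tau> n x \<oplus>\<^bsub>dg_gr Y n\<^esub> \<tau> n y"
  by (simp add: \<tau>_def additive_map_add[OF src.dk_proj_additive] \<psi>_D src.dk_proj_in_N)

lemma \<tau>_additive: "additive_map (cs_obj X n) (dg_gr Y n) (\<tau> n)"
  by (intro additive_mapI src.obj.is_abelian_group tgt.gr.abelian_group_axioms) (simp_all add: \<tau>_closed \<tau>_add)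

lemma \<tau>_smult: "a \<in> carrier k \<Longrightarrow> x \<in> src.C n \<Longrightarrow> \<tau> n (a \<odot>\<^bsub>cs_obj X n\<^esub> x) = a \<odot>\<^bsub>dg_gr Y n\<^esub> \<tau> n x"
  by (simp add: \<tau>_def src.dk_proj_smult \<psi>_D src.dk_proj_in_N)

lemma \<tau>_N: "x \<in> src.N n \<Longrightarrow> \<tau> n x = \<psi> n x"
  by (simp add: \<tau>_def src.dk_proj_N)

lemma \<tau>_coface: "i \<le> m \<Longrightarrow> y \<in> src.C m \<Longrightarrow> \<tau> (Suc m) (cs_coface X m (Suc i) y) = \<zero>\<^bsub>dg_gr Y (Suc m)\<^esub>"
  using additive_map_zero[OF dg_hom_additive[OF \<psi> src.dg_algebra_XN tgt.dg_algebra_axioms], of "Suc m"]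
  by (simp add: \<tau>_def src.dk_proj_coface)

lemma \<tau>_alt_diff:
  assumes x: "x \<in> src.C n"
  shows "\<tau> (Suc n) (alt_diff X n x) = \<tau> (Suc n) (cs_coface X n 0 x)"
proof -
  let ?R = "dg_gr Y (Suc n)"
  have "\<tau> (Suc n) (alt_diff X n x) =
      (\<Oplus>\<^bsub>?R\<^esub>i\<in>{0..Suc n}. \<tau> (Suc n) (signed (cs_obj X (Suc n)) i (cs_coface X n i x)))"
    unfolding alt_diff_def
    by (rule additive_map_finsum[OF \<tau>_additive]) (use x in \<open>auto simp: src.coface_D\<close>)
  also have "\<dots> = \<tau> (Suc n) (signed (cs_obj X (Suc n)) 0 (cs_coface X n 0 x))"
  proof (rule tgt.gr.finsum_single)
    fix i assume i: "i \<in> {0..Suc n}" "i \<noteq> 0"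
    then obtain j where "i = Suc j" "j \<le> n" by (cases i) auto
    then show "\<tau> (Suc n) (signed (cs_obj X (Suc n)) i (cs_coface X n i x)) = \<zero>\<^bsub>?R\<^esub>"
      using x by (simp add: additive_map_signed[OF \<tau>_additive] src.coface_D \<tau>_coface)
  qed (use x in \<open>auto simp: src.coface_D \<tau>_closed\<close>)
  finally show ?thesis by (simp add: signed_def)
qed

text \<open>
  On a normalized \<open>x\<close> the alternating sum and \<open>d\<^sup>0 x\<close> differ by cofaces that \<open>\<tau>\<close> kills; on the image of
  \<open>d\<^bsup>j+1\<^esup>\<close> both sides vanish.
\<close>

lemma \<tau>_coface_0:
  assumes "x \<in> src.C n"
  shows "\<tau> (Suc n) (cs_coface X n 0 x) = dg_diff Y n (\<tau> n x)"
  using assms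
proof (induction rule: src.degenerate_induct)
  case (normal x)
  then show ?case
    using \<tau>_alt_diff[of x n] src.N_carrier by (simp add: \<tau>_N src.alt_diff_N \<psi>_D)
next
  case (coface m j y)
  have "cs_coface X n 0 (cs_coface X m (Suc j) y) = cs_coface X n (Suc (Suc j)) (cs_coface X m 0 y)"
    using src.coface_coface[of 0 "Suc (Suc j)" m y] coface by simp
  then show ?case
    using coface \<tau>_coface[of "Suc j" n "cs_coface X m 0 y"] \<tau>_coface[of j m y]
    by (simp add: src.coface_D tgt.diff_zero)
next
  case (add x y)
  then show ?case by (simp add: src.coface_D \<tau>_add \<tau>_closed tgt.diff_add)
qed

text \<open>
  \<open>\<tau>\<close> kills the squares of the kernels of the codegeneracies, also outside the normalized elements:
  an element of such a square can be made normalized without leaving the square or changing \<open>\<tau>\<close>.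
\<close>

lemma \<tau>_split_upper: "i \<le> m \<Longrightarrow> w \<in> src.C (Suc m) \<Longrightarrow> \<tau> (Suc m) (src.split_upper m i w) = \<tau> (Suc m) w"
  unfolding src.split_upper_def
  by (subst additive_map_minus[OF \<tau>_additive])
    (simp_all add: src.coface_D src.codegen_D \<tau>_coface \<tau>_closed a_minus_def)

lemma \<tau>_split_lower: "1 \<le> i \<Longrightarrow> i \<le> m \<Longrightarrow> w \<in> src.C (Suc m) \<Longrightarrow> \<tau> (Suc m) (src.split_lower m i w) = \<tau> (Suc m) w"
  unfolding src.split_lower_def using \<tau>_coface[of "i - 1" m "cs_codegen X m i w"]
  by (subst additive_map_minus[OF \<tau>_additive])
    (simp_all add: src.coface_D src.codegen_D \<tau>_closed a_minus_def)

lemma sq_ker: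
  assumes "w \<in> src.sq (Suc m) (Suc j)" "j \<le> m"
  shows "cs_codegen X m j w = \<zero>\<^bsub>cs_obj X m\<^esub>"
  using src.obj.ideal_prod_inter[OF src.ker_ideal[OF assms(2)] src.ker_ideal[OF assms(2)]] assms(1)
  by (auto simp: src.sq_def src.ker_Suc)

lemma sq_minus_ds:
  assumes w: "w \<in> src.sq (Suc m) (Suc j)" and j: "j \<le> m" and c: "c \<le> Suc m" "i \<le> m"
    and pres: "\<And>x. x \<in> src.C (Suc m) \<Longrightarrow> cs_codegen X m j x = \<zero>\<^bsub>cs_obj X m\<^esub> \<Longrightarrow>
      cs_codegen X m j (cs_coface X m c (cs_codegen X m i x)) = \<zero>\<^bsub>cs_obj X m\<^esub>"
  shows "w \<ominus>\<^bsub>cs_obj X (Suc m)\<^esub> cs_coface X m c (cs_codegen X m i w) \<in> src.sq (Suc m) (Suc j)"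
proof -
  have "cs_coface X m c (cs_codegen X m i w) \<in> src.sq (Suc m) (Suc j)"
    unfolding src.sq_def
    by (rule src.sq_hom[where h = "\<lambda>x. cs_coface X m c (cs_codegen X m i x)" and n = "Suc m" and j = "Suc j"])
      (use w j c pres in \<open>auto intro: alg_hom_comp src.codegen_hom src.coface_hom simp: src.ker_Suc
          src.ds_closed\<close>)
  then show ?thesis using w j by (simp add: a_minus_def src.sq_add src.sq_neg)
qed

lemma sq_split_upper: "w \<in> src.sq (Suc m) (Suc j) \<Longrightarrow> j < i \<Longrightarrow> i \<le> m \<Longrightarrow>
    src.split_upper m i w \<in> src.sq (Suc m) (Suc j)"
  unfolding src.split_upper_def by (rule sq_minus_ds) (simp_all add: src.ds_ker_low)

lemma sq_split_lower: "w \<in> src.sq (Suc m) (Suc j) \<Longrightarrow> i < j \<Longrightarrow> j \<le> m \<Longrightarrow>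
    src.split_lower m i w \<in> src.sq (Suc m) (Suc j)"
  unfolding src.split_lower_def by (rule sq_minus_ds) (simp_all add: src.ds_ker_high)

lemma \<tau>_sq:
  assumes w: "w \<in> src.sq (Suc m) (Suc j)" and j: "j \<le> m"
  shows "\<tau> (Suc m) w = \<zero>\<^bsub>dg_gr Y (Suc m)\<^esub>"
proof -
  let ?Z = "\<lambda>i w. cs_codegen X m i w = \<zero>\<^bsub>cs_obj X m\<^esub>"
  \<comment> \<open>Elements of the square that \<open>\<tau>\<close> does not distinguish from \<open>w\<close>; the aim is a normalized one.\<close>
  define S where "S = {v \<in> src.sq (Suc m) (Suc j). \<tau> (Suc m) v = \<tau> (Suc m) w}"
  have SC: "v \<in> src.C (Suc m)" if "v \<in> S" for v
    using that src.sq_carrier[of "Suc j" "Suc m" v] j by (simp add: S_def)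
  have final: "\<tau> (Suc m) w = \<zero>\<^bsub>dg_gr Y (Suc m)\<^esub>" if v: "v \<in> S" "\<And>i. i \<le> m \<Longrightarrow> ?Z i v" for v
  proof -
    have N: "v \<in> src.N (Suc m)" using v SC by (simp add: src.N_Suc)
    then have "v \<in> src.J (Suc m)" using v(1) j src.sq_J[of "Suc j" "Suc m" v] by (simp add: S_def)
    then have "\<tau> (Suc m) v = \<zero>\<^bsub>dg_gr Y (Suc m)\<^esub>" using kills \<tau>_N[OF N] by simp
    then show ?thesis using v(1) by (simp add: S_def)
  qed
  \<comment> \<open>The factors \<open>1 - d\<^bsup>i+1\<^esup> s\<^sup>i\<close>, \<open>i > j\<close>, applied upwards, change \<open>w\<close> by elements that \<open>\<tau>\<close> kills.\<close>
  have high: "\<exists>v\<in>S. \<forall>i. j < i \<longrightarrow> i \<le> l \<longrightarrow> ?Z i v" if "l \<le> m" for l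
    using that
  proof (induction l)
    case 0
    then show ?case using w by (auto simp: S_def)
  next
    case (Suc l)
    then obtain v where v: "v \<in> S" "\<And>i. j < i \<Longrightarrow> i \<le> l \<Longrightarrow> ?Z i v" by auto
    show ?case
    proof (cases "j < Suc l")
      case True
      have "src.split_upper m (Suc l) v \<in> S"
        using v(1) sq_split_upper[of v m j "Suc l"] True Suc.prems \<tau>_split_upper[of "Suc l" m v] SC by
            (simp add: S_def)
      moreover have "?Z i (src.split_upper m (Suc l) v)" if "j < i" "i \<le> Suc l" for i
        using that Suc.prems SC[OF v(1)] v(2)[of i] src.split_upper_ker[of "Suc l" m v]
            src.split_upper_pres[of i "Suc l" m v]
        by (cases "i = Suc l") auto
      ultimately show ?thesis by blast
    next
      case False
      then show ?thesis using v(1) by (intro bexI[of _ v]) auto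
    qed
  qed
  \<comment> \<open>Then \<open>1 - d\<^sup>i s\<^sup>i\<close> for \<open>i = j - 1, \<dots>, 1\<close>; the case \<open>i = 0\<close> is excluded, since \<open>\<tau>\<close> does not kill the
    image of \<open>d\<^sup>0\<close>.\<close>
  have low: "\<exists>v\<in>S. \<forall>i. l \<le> i \<longrightarrow> i \<le> m \<longrightarrow> ?Z i v" if "1 \<le> l \<or> j = 0" "l \<le> j" for l
    using that(2,1)
  proof (induction l rule: inc_induct)
    case base
    obtain v where v: "v \<in> S" "\<And>i. j < i \<Longrightarrow> i \<le> m \<Longrightarrow> ?Z i v" using high[OF order_refl] by auto
    moreover have "?Z j v" using v(1) sq_ker[of v m j] j by (simp add: S_def)
    ultimately show ?case by (metis le_neq_implies_less)
  next
    case (step l)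
    then have l: "1 \<le> l" "l < j" by auto
    obtain v where v: "v \<in> S" "\<And>i. Suc l \<le> i \<Longrightarrow> i \<le> m \<Longrightarrow> ?Z i v" using step.IH l by auto
    have "src.split_lower m l v \<in> S"
      using v(1) sq_split_lower[of v m j l] l j \<tau>_split_lower[of l m v] SC by (simp add: S_def)
    moreover have "?Z i (src.split_lower m l v)" if "l \<le> i" "i \<le> m" for i
      using that SC[OF v(1)] v(2)[of i] src.split_lower_ker[of l m v] src.split_lower_pres[of l i m v]
      by (cases "i = l") auto
    ultimately show ?case by blast
  qed
  show ?thesis
  proof (cases "j = 0")
    case True
    then obtain v where "v \<in> S" "\<And>i. i \<le> m \<Longrightarrow> ?Z i v" using low[of 0] by auto
    then show ?thesis by (rule final)
  next
    case False
    then obtain h l where hl: "j = Suc h" "m = Suc l" using j by (cases j; cases m) auto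
    obtain v where v: "v \<in> S" "\<And>i. 1 \<le> i \<Longrightarrow> i \<le> m \<Longrightarrow> ?Z i v" using low[of 1] False by auto
    \<comment> \<open>For \<open>i = 0\<close>: \<open>s\<^sup>0 v\<close> is normalized and lies in \<open>J\<close>, so \<open>\<tau>(d\<^sup>0 s\<^sup>0 v) = d \<psi>(s\<^sup>0 v) = 0\<close>.\<close>
    let ?z = "cs_codegen X m 0 v"
    have zN: "?z \<in> src.N m"
      using v(2) SC[OF v(1)] src.codegen_codegen[of 0 _ l v] hl
      by (simp add: src.N_Suc src.codegen_D additive_map_zero[OF src.codegen_additive])
    have "?z \<in> src.sq m j"
      unfolding src.sq_def
    proof (rule src.sq_hom[OF src.codegen_hom, where j = "Suc j"])
      fix x assume "x \<in> src.I (Suc m) (Suc j)"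
      then show "cs_codegen X m 0 x \<in> src.I m j"
        using src.codegen_codegen[of 0 h l x] hl j
        by (simp add: src.ker_Suc src.codegen_D additive_map_zero[OF src.codegen_additive])
    qed (use v(1) j in \<open>auto simp: S_def\<close>)
    then have "?z \<in> src.J m" using zN False j by (intro src.sq_J) auto
    then have "\<tau> m ?z = \<zero>\<^bsub>dg_gr Y m\<^esub>" using kills \<tau>_N[OF zN] by simp
    then have "\<tau> (Suc m) (cs_coface X m 0 ?z) = \<zero>\<^bsub>dg_gr Y (Suc m)\<^esub>"
      using \<tau>_coface_0[OF src.N_carrier[OF zN]] by (simp add: tgt.diff_zero)
    then have "\<tau> (Suc m) (src.split_lower m 0 v) = \<tau> (Suc m) v"
      unfolding src.split_lower_def using SC[OF v(1)] zN
      by (subst additive_map_minus[OF \<tau>_additive]) (simp_all add: src.coface_D src.N_carrier \<tau>_closed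
          a_minus_def)
    then have "src.split_lower m 0 v \<in> S" using v(1) sq_split_lower[of v m j 0] False j by (simp add: S_def)
    moreover have "?Z i (src.split_lower m 0 v)" if "i \<le> m" for i
      using that SC[OF v(1)] v(2)[of i] src.split_lower_ker[of 0 m v] src.split_lower_pres[of 0 i m v]
      by (cases "i = 0") auto
    ultimately show ?thesis by (rule final)
  qed
qed

text \<open>
  The family with top coefficient \<open>\<tau> x\<close> whose codegeneracies are the lifts of those of \<open>x\<close>. The
  coefficient at \<open>\<alpha>\<close>
  is read off from the codegeneracy at the largest missing point; by \<open>lift_codegen_coeff\<close> every missing point
  gives the same value.
\<close>

primrec lift :: "nat \<Rightarrow> 'a \<Rightarrow> nat set \<Rightarrow> 'b"
  where
    "lift 0 x = (\<lambda>\<alpha>\<in>Pow {1..0}. \<tau> 0 x)"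
  | "lift (Suc m) x = (\<lambda>\<alpha>\<in>Pow {1..Suc m}.
      if \<alpha> = {1..Suc m} then \<tau> (Suc m) x
      else lift m (cs_codegen X m (Max ({1..Suc m} - \<alpha>) - 1) x) (sigma (Max ({1..Suc m} - \<alpha>) - 1) ` \<alpha>))"

lemma lift_top: "lift n x {1..n} = \<tau> n x"
  by (cases n) simp_all

lemma max_gap:
  assumes "\<alpha> \<subseteq> {1..Suc m}" "\<alpha> \<noteq> {1..Suc m}"
  obtains h where "Max ({1..Suc m} - \<alpha>) = Suc h" "h \<le> m" "Suc h \<notin> \<alpha>"
    "\<And>i. Suc i \<notin> \<alpha> \<Longrightarrow> i \<le> m \<Longrightarrow> i \<le> h"
proof -
  let ?D = "{1..Suc m} - \<alpha>"
  have D: "finite ?D" "?D \<noteq> {}" using assms by auto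
  have M: "Max ?D \<in> ?D" by (rule Max_in[OF D])
  then obtain h where h: "Max ?D = Suc h" by (cases "Max ?D") auto
  moreover have "i \<le> h" if "Suc i \<notin> \<alpha>" "i \<le> m" for i
  proof -
    have "Suc i \<le> Max ?D" by (rule Max_ge[OF D(1)]) (use that in auto)
    then show ?thesis using h by simp
  qed
  ultimately show ?thesis using that[of h] M by auto
qed

lemma lift_closed: "x \<in> src.C n \<Longrightarrow> lift n x \<in> tgt.KC n"
proof (induction n arbitrary: x)
  case 0
  then show ?case by (simp only: lift.simps tgt.K_simps restrict_PiE_iff) (auto simp: \<tau>_closed)
next
  case (Suc m)
  have "lift (Suc m) x \<alpha> \<in> tgt.G (card \<alpha>)" if \<alpha>: "\<alpha> \<subseteq> {1..Suc m}" for \<alpha>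
  proof (cases "\<alpha> = {1..Suc m}")
    case True
    then show ?thesis using \<tau>_closed[OF Suc.prems] lift_top[of "Suc m" x] by (simp del: lift.simps)
  next
    case False
    obtain h where h: "Max ({1..Suc m} - \<alpha>) = Suc h" "h \<le> m" "Suc h \<notin> \<alpha>"
      using max_gap[OF \<alpha> False] by metis
    have r: "sigma h ` \<alpha> \<subseteq> {1..m}" using sigma_minus_range[OF \<alpha> h(3,2)] .
    have "card (sigma h ` \<alpha>) = card \<alpha>" using tgt.card_sigma[of h \<alpha>] h(3) by simp
    then show ?thesis
      using tgt.K_mem[OF Suc.IH[of "cs_codegen X m h x"] r] Suc.prems h False \<alpha> by (simp add: src.codegen_D)
  qed
  moreover have "lift (Suc m) x \<in> extensional (Pow {1..Suc m})"
    by (simp only: lift.simps restrict_extensional)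
  ultimately show ?case by (simp add: tgt.K_simps PiE_iff del: lift.simps)
qed

lemma lift_codegen_coeff:
  "x \<in> src.C (Suc m) \<Longrightarrow> \<alpha> \<subseteq> {1..Suc m} \<Longrightarrow> j \<le> m \<Longrightarrow> Suc j \<notin> \<alpha> \<Longrightarrow>
    lift (Suc m) x \<alpha> = lift m (cs_codegen X m j x) (sigma j ` \<alpha>)"
proof (induction m arbitrary: x \<alpha> j rule: less_induct)
  case (less m)
  note \<alpha> = less.prems(2)
  have ne: "\<alpha> \<noteq> {1..Suc m}" using less.prems by auto
  obtain h where h: "Max ({1..Suc m} - \<alpha>) = Suc h" "h \<le> m" "Suc h \<notin> \<alpha>"
    "\<And>i. Suc i \<notin> \<alpha> \<Longrightarrow> i \<le> m \<Longrightarrow> i \<le> h"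
    using max_gap[OF \<alpha> ne] by blast
  have L: "lift (Suc m) x \<alpha> = lift m (cs_codegen X m h x) (sigma h ` \<alpha>)" using ne \<alpha> h(1) by simp
  show ?case
  proof (cases "j = h")
    case False
    then have jh: "j < h" using h(4)[of j] less.prems by simp
    then obtain l g where l: "m = Suc l" "h = Suc g" using h(2) by (cases m; cases h) auto
    have r: "sigma h ` \<alpha> \<subseteq> {1..Suc l}" "sigma j ` \<alpha> \<subseteq> {1..Suc l}"
      using sigma_minus_range[OF \<alpha> h(3,2)] sigma_minus_range[OF \<alpha> less.prems(4,3)] l by simp_all
    have ni: "Suc j \<notin> sigma h ` \<alpha>" "Suc g \<notin> sigma j ` \<alpha>"
      using jh l h(3) less.prems(4) unfolding mem_sigma_image by (auto simp: less_Suc_eq)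
    have "lift m (cs_codegen X m h x) (sigma h ` \<alpha>) = lift l (cs_codegen X l j (cs_codegen X m h x))
        (sigma j ` sigma h ` \<alpha>)"
      using less.IH[of l "cs_codegen X m h x" "sigma h ` \<alpha>" j] l r ni jh h(2) less.prems(1) by (simp add:
          src.codegen_D del: lift.simps)
    also have "\<dots> = lift l (cs_codegen X l g (cs_codegen X m j x)) (sigma g ` sigma j ` \<alpha>)"
      using src.codegen_codegen[of j g l x] sigma_sigma_image[OF jh, of \<alpha>] jh l h(2) less.prems(1) by simp
    also have "\<dots> = lift m (cs_codegen X m j x) (sigma j ` \<alpha>)"
      using less.IH[of l "cs_codegen X m j x" "sigma j ` \<alpha>" g] l r ni jh h(2) less.prems(1,3) by (simp
          add: src.codegen_D del: lift.simps)
    finally show ?thesis using L by simp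
  qed (use L in simp)
qed

lemma lift_codegen:
  assumes x: "x \<in> src.C (Suc m)" and j: "j \<le> m"
  shows "cs_codegen (denorm Y) m j (lift (Suc m) x) = lift m (cs_codegen X m j x)"
proof (rule tgt.K_eqI[OF tgt.codegen_closed[OF lift_closed[OF x]] lift_closed])
  show "cs_codegen X m j x \<in> src.C m" using x j by (simp add: src.codegen_D)
  fix \<gamma> assume \<gamma>: "\<gamma> \<subseteq> {1..m}"
  have "Suc j \<notin> delta (Suc j) ` \<gamma>" using delta_neq by (metis imageE)
  then show "cs_codegen (denorm Y) m j (lift (Suc m) x) \<gamma> = lift m (cs_codegen X m j x) \<gamma>"
    using tgt.codegen_apply[OF lift_closed[OF x] \<gamma> j] lift_codegen_coeff[OF x delta_range[OF \<gamma>] j]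
    by (simp del: lift.simps)
qed

declare lift.simps [simp del]

lemma lift_eqI:
  assumes x: "x \<in> src.C n" and c: "c \<in> tgt.KC n" and top: "c {1..n} = \<tau> n x"
    and s: "\<And>m j. n = Suc m \<Longrightarrow> j \<le> m \<Longrightarrow> cs_codegen (denorm Y) m j c = lift m (cs_codegen X m j x)"
  shows "lift n x = c"
proof (rule tgt.K_joint_inj[OF lift_closed[OF x] c])
  show "lift n x {1..n} = c {1..n}" using top lift_top[of n x] by simp
  show "cs_codegen (denorm Y) m j (lift n x) = cs_codegen (denorm Y) m j c" if "n = Suc m" "j \<le> m" for m j
    using lift_codegen[of x m j] s[OF that] x that by simp
qed

lemma lift_add:
  "x \<in> src.C n \<Longrightarrow> y \<in> src.C n \<Longrightarrow> lift n (x \<oplus>\<^bsub>cs_obj X n\<^esub> y) = lift n x \<oplus>\<^bsub>cs_obj (denorm Y) n\<^esub> lift n y"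
proof (induction n arbitrary: x y)
  case 0
  then show ?case
    by (intro lift_eqI) (auto simp: tgt.K_add_closed lift_closed tgt.K_add_apply lift_top[of 0,
        simplified] \<tau>_add)
next
  case (Suc n)
  show ?case
  proof (rule lift_eqI)
    show "(lift (Suc n) x \<oplus>\<^bsub>cs_obj (denorm Y) (Suc n)\<^esub> lift (Suc n) y) {1..Suc n} = \<tau> (Suc n) (x \<oplus>\<^bsub>cs_obj X
        (Suc n)\<^esub> y)"
      using Suc.prems tgt.K_add_apply[of "{1..Suc n}" "Suc n"] by (simp only: lift_top \<tau>_add subset_refl) simp
    fix m j assume "Suc n = Suc m" "j \<le> m"
    then have m: "m = n" "j \<le> n" by auto
    show "cs_codegen (denorm Y) m j (lift (Suc n) x \<oplus>\<^bsub>cs_obj (denorm Y) (Suc n)\<^esub> lift (Suc n) y) =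
        lift m (cs_codegen X m j (x \<oplus>\<^bsub>cs_obj X (Suc n)\<^esub> y))"
      using Suc m by (simp add: tgt.K_codegen_add lift_closed lift_codegen src.codegen_D)
  qed (use Suc.prems tgt.K_add_closed lift_closed in auto)
qed

lemma lift_smult:
  assumes a: "a \<in> carrier k"
  shows "x \<in> src.C n \<Longrightarrow> lift n (a \<odot>\<^bsub>cs_obj X n\<^esub> x) = a \<odot>\<^bsub>cs_obj (denorm Y) n\<^esub> lift n x"
proof (induction n arbitrary: x)
  case 0
  then show ?case
    using a by (intro lift_eqI) (auto simp: tgt.K_smult_closed lift_closed tgt.K_smult_apply lift_top[of
        0, simplified] \<tau>_smult)
next
  case (Suc n)
  show ?case
  proof (rule lift_eqI)
    show "(a \<odot>\<^bsub>cs_obj (denorm Y) (Suc n)\<^esub> lift (Suc n) x) {1..Suc n} = \<tau> (Suc n) (a \<odot>\<^bsub>cs_obj X (Suc n)\<^esub> x)"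
      using Suc.prems a tgt.K_smult_apply[of "{1..Suc n}" "Suc n"] by (simp only: lift_top \<tau>_smult
          subset_refl) simp
    fix m j assume "Suc n = Suc m" "j \<le> m"
    then have m: "m = n" "j \<le> n" by auto
    show "cs_codegen (denorm Y) m j (a \<odot>\<^bsub>cs_obj (denorm Y) (Suc n)\<^esub> lift (Suc n) x) =
        lift m (cs_codegen X m j (a \<odot>\<^bsub>cs_obj X (Suc n)\<^esub> x))"
      using Suc m a by (simp add: tgt.K_codegen_smult lift_closed lift_codegen src.codegen_D)
  qed (use Suc.prems a tgt.K_smult_closed lift_closed in auto)
qed

lemma \<tau>_one: "\<tau> n \<one>\<^bsub>cs_obj X n\<^esub> = (if n = 0 then dg_one Y else \<zero>\<^bsub>dg_gr Y n\<^esub>)"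
proof (cases n)
  case 0
  then show ?thesis using \<tau>_N[of "\<one>\<^bsub>cs_obj X 0\<^esub>" 0] by (simp add: src.N_0 \<psi>_D)
next
  case (Suc m)
  then show ?thesis using \<tau>_coface[of 0 m "\<one>\<^bsub>cs_obj X m\<^esub>"] by (simp add: src.coface_D)
qed

lemma lift_one: "lift n \<one>\<^bsub>cs_obj X n\<^esub> = \<one>\<^bsub>cs_obj (denorm Y) n\<^esub>"
proof (induction n)
  case 0
  show ?case by (rule lift_eqI) (auto simp: tgt.K_one_closed tgt.K_one_apply \<tau>_one)
next
  case (Suc n)
  show ?case
  proof (rule lift_eqI)
    show "\<one>\<^bsub>cs_obj (denorm Y) (Suc n)\<^esub> {1..Suc n} = \<tau> (Suc n) \<one>\<^bsub>cs_obj X (Suc n)\<^esub>"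
      using tgt.K_one_apply[of "{1..Suc n}" "Suc n"] by (simp add: \<tau>_one)
    fix m j assume "Suc n = Suc m" "j \<le> m"
    then have m: "m = n" "j \<le> n" by auto
    show "cs_codegen (denorm Y) m j \<one>\<^bsub>cs_obj (denorm Y) (Suc n)\<^esub> = lift m (cs_codegen X m j \<one>\<^bsub>cs_obj X (Suc n)\<^esub>)"
      using Suc m by (simp add: tgt.K_codegen_one src.codegen_D)
  qed (simp_all add: tgt.K_one_closed)
qed

lemma lift_coface:
  "x \<in> src.C n \<Longrightarrow> i \<le> Suc n \<Longrightarrow> lift (Suc n) (cs_coface X n i x) = cs_coface (denorm Y) n i (lift n x)"
proof (induction n arbitrary: x i)
  case (0 x i)
  have i: "i = 0 \<or> i = Suc 0" using 0 by auto
  show ?case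
  proof (rule lift_eqI)
    show "cs_coface (denorm Y) 0 i (lift 0 x) {1..Suc 0} = \<tau> (Suc 0) (cs_coface X 0 i x)"
      using i tgt.K_coface_top[OF lift_closed[OF 0(1)]] \<tau>_coface[of 0 0 x] \<tau>_coface_0[of x 0] lift_top[of
          0 x] 0(1) by auto
    fix m j assume m: "Suc 0 = Suc m" "j \<le> m"
    then have m: "m = 0" "j = 0" by auto
    show "cs_codegen (denorm Y) m j (cs_coface (denorm Y) 0 i (lift 0 x)) = lift m (cs_codegen X m j
        (cs_coface X 0 i x))"
      unfolding m using tgt.K_codegen_coface_id[OF _ i lift_closed[OF 0(1)]] src.codegen_coface_id[OF _ i
          0(1)] by simp
  qed (use 0 tgt.coface_closed lift_closed in \<open>auto simp: src.coface_D\<close>)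
next
  case (Suc n x i)
  note x = Suc.prems(1) and L = lift_closed[OF Suc.prems(1)]
  show ?case
  proof (rule lift_eqI)
    show "cs_coface (denorm Y) (Suc n) i (lift (Suc n) x) {1..Suc (Suc n)} = \<tau> (Suc (Suc n)) (cs_coface X
        (Suc n) i x)"
    proof (cases i)
      case 0
      then show ?thesis using tgt.K_coface_top(2)[OF L] \<tau>_coface_0[OF x] lift_top[of "Suc n" x] by simp
    next
      case (Suc l)
      then show ?thesis using tgt.K_coface_top(1)[OF L, of i] \<tau>_coface[OF _ x, of l] \<open>i \<le> Suc (Suc n)\<close> by simp
    qed
    fix m j assume "Suc (Suc n) = Suc m" "j \<le> m"
    then have m: "m = Suc n" and j: "j \<le> Suc n" by auto
    consider "i < j" | "i = j \<or> i = Suc j" | "Suc j < i" by linarith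
    then show "cs_codegen (denorm Y) m j (cs_coface (denorm Y) (Suc n) i (lift (Suc n) x)) =
        lift m (cs_codegen X m j (cs_coface X (Suc n) i x))"
      unfolding m
    proof cases
      case 1
      then have j1: "j - 1 \<le> n" "i \<le> Suc n" using j by auto
      show "cs_codegen (denorm Y) (Suc n) j (cs_coface (denorm Y) (Suc n) i (lift (Suc n) x)) =
          lift (Suc n) (cs_codegen X (Suc n) j (cs_coface X (Suc n) i x))"
        unfolding tgt.K_codegen_coface_less[OF 1 j L] src.codegen_coface_less[OF 1 j x] lift_codegen[OF x j1(1)]
        by (rule Suc.IH[symmetric, OF src.codegen_D(1)[OF j1(1) x] j1(2)])
    next
      case 2
      show "cs_codegen (denorm Y) (Suc n) j (cs_coface (denorm Y) (Suc n) i (lift (Suc n) x)) =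
          lift (Suc n) (cs_codegen X (Suc n) j (cs_coface X (Suc n) i x))"
        unfolding tgt.K_codegen_coface_id[OF j 2 L] src.codegen_coface_id[OF j 2 x] ..
    next
      case 3
      then have j1: "j \<le> n" "i - 1 \<le> Suc n" using Suc.prems(2) by auto
      show "cs_codegen (denorm Y) (Suc n) j (cs_coface (denorm Y) (Suc n) i (lift (Suc n) x)) =
          lift (Suc n) (cs_codegen X (Suc n) j (cs_coface X (Suc n) i x))"
        unfolding tgt.K_codegen_coface_greater[OF 3 Suc.prems(2) L] src.codegen_coface_greater[OF 3
            Suc.prems(2) x] lift_codegen[OF x j1(1)]
        by (rule Suc.IH[symmetric, OF src.codegen_D(1)[OF j1(1) x] j1(2)])
    qed
  qed (use Suc.prems tgt.coface_closed lift_closed in \<open>auto simp: src.coface_D\<close>)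
qed

lemma lift_iter: "c \<le> Suc n \<Longrightarrow> x \<in> src.C n \<Longrightarrow>
    lift (n + q) (coface_iter X n c q x) = coface_iter (denorm Y) n c q (lift n x)"
  by (induction q) (simp_all add: lift_coface src.iter_closed)

lemma lift_N:
  assumes x: "x \<in> src.N n"
  shows "lift n x \<in> normalized (denorm Y) n"
proof -
  interpret KK: cosimplicial_algebra k "denorm Y" by (rule tgt.K_cosimplicial)
  have z: "lift m \<zero>\<^bsub>cs_obj X m\<^esub> = \<zero>\<^bsub>cs_obj (denorm Y) m\<^esub>" for m
    by (rule additive_map_zero) (intro additive_mapI src.obj.is_abelian_group KK.obj.is_abelian_group
        lift_closed lift_add; assumption)
  show ?thesis
  proof (cases n)
    case 0
    then show ?thesis using lift_closed[OF src.N_carrier[OF x]] by (simp add: KK.N_0)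
  next
    case (Suc m)
    then show ?thesis
      using lift_closed[OF src.N_carrier[OF x]] x lift_codegen[of x m] z by (simp add: KK.N_Suc src.N_Suc)
  qed
qed

text \<open>
  The difference of the two sides is a \<^locale>\<open>shuffle_form\<close>. On front and back images this is the
  multiplicativity of \<open>\<psi>\<close>.
\<close>

lemma lift_mult_top:
  assumes x: "x \<in> src.C n" and y: "y \<in> src.C n"
  shows "(lift n x \<otimes>\<^bsub>cs_obj (denorm Y) n\<^esub> lift n y) {1..n} = \<tau> n (x \<otimes>\<^bsub>cs_obj X n\<^esub> y)"
proof -
  interpret KK: cosimplicial_algebra k "denorm Y" by (rule tgt.K_cosimplicial)
  let ?K = "cs_obj (denorm Y) n" and ?R = "dg_gr Y n"
  define pr where "pr x y = (lift n x \<otimes>\<^bsub>?K\<^esub> lift n y) {1..n}" for x y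
  define B where "B x y = \<tau> n (x \<otimes>\<^bsub>cs_obj X n\<^esub> y) \<ominus>\<^bsub>?R\<^esub> pr x y" for x y
  have E: "additive_map ?K ?R (\<lambda>c. c {1..n})" using tgt.K_eval_additive[of "{1..n}" n] by simp
  have prC: "pr x y \<in> carrier ?R" if "x \<in> src.C n" "y \<in> src.C n" for x y
    unfolding pr_def using that by (intro additive_map_closed[OF E] tgt.K_mult_closed lift_closed)
  have tC: "\<tau> n (x \<otimes>\<^bsub>cs_obj X n\<^esub> y) \<in> carrier ?R" if "x \<in> src.C n" "y \<in> src.C n" for x y
    using that by (simp add: \<tau>_closed)
  have prl: "pr (x \<oplus>\<^bsub>cs_obj X n\<^esub> x') y = pr x y \<oplus>\<^bsub>?R\<^esub> pr x' y" if "x \<in> src.C n" "x' \<in> src.C n" "y \<in> src.C n"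
      for x x' y
    using that unfolding pr_def
    by (simp add: lift_add lift_closed KK.obj.l_distr tgt.K_add_apply[of "{1..n}" n, simplified])
  have prr: "pr x (y \<oplus>\<^bsub>cs_obj X n\<^esub> y') = pr x y \<oplus>\<^bsub>?R\<^esub> pr x y'" if "x \<in> src.C n" "y \<in> src.C n" "y' \<in> src.C n"
      for x y y'
    using that unfolding pr_def
    by (simp add: lift_add lift_closed KK.obj.r_distr tgt.K_add_apply[of "{1..n}" n, simplified])
  interpret S: shuffle_form k X ?R n B
  proof (intro shuffle_form.intro shuffle_form_axioms.intro src.cosimplicial_algebra_axioms
      tgt.gr.abelian_group_axioms)
    fix x y assume xy: "x \<in> src.C n" "y \<in> src.C n"
    show "B x y \<in> carrier ?R" using xy by (simp add: B_def prC tC)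
    fix x' assume x': "x' \<in> src.C n"
    show "B (x \<oplus>\<^bsub>cs_obj X n\<^esub> x') y = B x y \<oplus>\<^bsub>?R\<^esub> B x' y"
      using xy x' prC tC
      by (simp add: B_def prl src.obj.l_distr \<tau>_add a_minus_def tgt.gr.minus_add tgt.gr.a_ac)
    show "B x (y \<oplus>\<^bsub>cs_obj X n\<^esub> x') = B x y \<oplus>\<^bsub>?R\<^esub> B x x'"
      using xy x' prC tC
      by (simp add: B_def prr src.obj.r_distr \<tau>_add a_minus_def tgt.gr.minus_add tgt.gr.a_ac)
  next
    fix m j x y assume n: "n = Suc m" and j: "j \<le> m" and xy: "x \<in> src.C n" "y \<in> src.C n"
      and z: "cs_codegen X m j x = \<zero>\<^bsub>cs_obj X m\<^esub>" "cs_codegen X m j y = \<zero>\<^bsub>cs_obj X m\<^esub>"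
    have z0: "lift m \<zero>\<^bsub>cs_obj X m\<^esub> = \<zero>\<^bsub>cs_obj (denorm Y) m\<^esub>"
      by (rule additive_map_zero) (intro additive_mapI src.obj.is_abelian_group KK.obj.is_abelian_group
          lift_closed lift_add; assumption)
    have "x \<otimes>\<^bsub>cs_obj X n\<^esub> y \<in> src.sq (Suc m) (Suc j)"
      unfolding src.sq_def n using xy z n by (intro ideal_prod.prod) (simp_all add: src.ker_Suc)
    then have "\<tau> n (x \<otimes>\<^bsub>cs_obj X n\<^esub> y) = \<zero>\<^bsub>?R\<^esub>" using \<tau>_sq[OF _ j] n by simp
    moreover have "pr x y = \<zero>\<^bsub>?R\<^esub>"
      unfolding pr_def n
      by (rule tgt.K_ker_mult_top[OF _ _ j]) (use xy n z j z0 in \<open>simp_all add: lift_closed lift_codegen\<close>)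
    ultimately show "B x y = \<zero>\<^bsub>?R\<^esub>" by (simp add: B_def a_minus_def)
  next
    fix m j a b assume n: "n = Suc m" and j: "j \<le> m" and ab: "a \<in> src.C m" "b \<in> src.C m"
    let ?a = "cs_coface X m (Suc j) a" and ?b = "cs_coface X m (Suc j) b"
    have "?a \<otimes>\<^bsub>cs_obj X n\<^esub> ?b = cs_coface X m (Suc j) (a \<otimes>\<^bsub>cs_obj X m\<^esub> b)"
      using n j ab by (simp add: src.coface_D)
    then have "\<tau> n (?a \<otimes>\<^bsub>cs_obj X n\<^esub> ?b) = \<zero>\<^bsub>?R\<^esub>" using \<tau>_coface[of j m] n j ab by simp
    moreover have "pr ?a ?b = \<zero>\<^bsub>?R\<^esub>"
      using tgt.K_coface_mult_top[OF lift_closed[OF ab(1)] lift_closed[OF ab(2)], of "Suc j"] n j ab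
      by (simp add: pr_def lift_coface)
    ultimately show "B ?a ?b = \<zero>\<^bsub>?R\<^esub>" by (simp add: B_def a_minus_def)
  next
    fix p q f g assume pq: "p + q = n" and fg: "f \<in> src.N p" "g \<in> src.N q"
    note fgC = src.N_carrier[OF fg(1)] src.N_carrier[OF fg(2)]
    let ?F = "coface_iter X p (Suc p) q f" and ?G = "coface_iter X q 0 p g"
    have "\<tau> n (?F \<otimes>\<^bsub>cs_obj X n\<^esub> ?G) = dg_mult Y p q (\<psi> p f) (\<psi> q g)"
      using \<tau>_N[OF src.cup_N[OF fg]] pq \<psi>_D(5)[OF fg] by (simp add: cup_def)
    moreover have "pr ?F ?G = dg_mult Y p q (\<psi> p f) (\<psi> q g)"
      using tgt.K_front_back_top(1)[OF lift_N[OF fg(1)] lift_closed[OF fgC(2)]] pq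
        lift_iter[of "Suc p" p f q, OF _ fgC(1)] lift_iter[of 0 q g p, OF _ fgC(2)]
      by (simp add: pr_def lift_top[simplified] \<tau>_N fg add.commute)
    ultimately show "B ?F ?G = \<zero>\<^bsub>?R\<^esub>"
      using tgt.mult_closed[OF \<psi>_D(1)[OF fg(1)] \<psi>_D(1)[OF fg(2)]] pq by (simp add: B_def tgt.gr.minus_zero_iff)
  qed
  have "B x y = \<zero>\<^bsub>?R\<^esub>" using S.shuffle_lemma[OF x y] .
  then show ?thesis
    using prC[OF x y] tC[OF x y] by (simp add: B_def tgt.gr.minus_zero_iff pr_def)
qed

lemma lift_mult:
  "x \<in> src.C n \<Longrightarrow> y \<in> src.C n \<Longrightarrow> lift n (x \<otimes>\<^bsub>cs_obj X n\<^esub> y) = lift n x \<otimes>\<^bsub>cs_obj (denorm Y) n\<^esub> lift n y"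
proof (induction n arbitrary: x y)
  case 0
  show ?case
    by (rule lift_eqI) (use 0 lift_mult_top[OF 0] in \<open>auto simp: tgt.K_mult_closed lift_closed\<close>)
next
  case (Suc n)
  show ?case
  proof (rule lift_eqI)
    fix m j assume "Suc n = Suc m" "j \<le> m"
    then have m: "m = n" "j \<le> n" by auto
    show "cs_codegen (denorm Y) m j (lift (Suc n) x \<otimes>\<^bsub>cs_obj (denorm Y) (Suc n)\<^esub> lift (Suc n) y) =
        lift m (cs_codegen X m j (x \<otimes>\<^bsub>cs_obj X (Suc n)\<^esub> y))"
      using Suc m by (simp add: tgt.K_codegen_mult lift_closed lift_codegen src.codegen_D)
  qed (use Suc.prems lift_mult_top[OF Suc.prems] in \<open>auto simp: tgt.K_mult_closed lift_closed\<close>)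
qed

definition lift_hom :: "nat \<Rightarrow> 'a \<Rightarrow> nat set \<Rightarrow> 'b"
  where "lift_hom n = restrict (lift n) (src.C n)"

theorem lift_hom_cs_hom: "lift_hom \<in> cs_hom k X (denorm Y)"
proof (rule cs_homI)
  show "lift_hom n \<in> alg_hom k (cs_obj X n) (cs_obj (denorm Y) n)" for n
    unfolding lift_hom_def
    by (rule alg_hom_restrict[OF _ src.obj_algebra], rule alg_homI)
      (simp_all add: lift_closed lift_add lift_mult lift_one lift_smult)
qed (simp_all add: lift_hom_def src.coface_D src.codegen_D lift_coface lift_codegen)

lemma lift_hom_top: "x \<in> src.N n \<Longrightarrow> lift_hom n x {1..n} = \<psi> n x"
  using lift_top[of n x] by (simp add: lift_hom_def src.N_carrier \<tau>_N)

end

lemma (in cosimplicial_algebra) kills_differentiating_ideal: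
  assumes Y: "dg_algebra k Y" and \<psi>: "\<psi> \<in> dg_hom k XN Y"
    and kills: "\<And>n x. x \<in> J n \<Longrightarrow> \<psi> n x = \<zero>\<^bsub>dg_gr Y n\<^esub>"
    and x: "x \<in> differentiating_ideal X n"
  shows "\<psi> n x = \<zero>\<^bsub>dg_gr Y n\<^esub>"
proof -
  interpret Y: dg_algebra k Y by fact
  note D = dg_hom_D[OF \<psi>, simplified]
  show ?thesis
    using x unfolding differentiating_ideal_explicit
    by (cases rule: Jhat_cases) (simp_all add: kills D J_N alt_diff_N Y.diff_zero)
qed

text \<open>
  The transpose of a morphism out of \<open>abs_diff X\<close> under the adjunction.
\<close>

definition adjunct ::
    "('k, 'a) cosimplicial \<Rightarrow> (nat \<Rightarrow> 'a set \<Rightarrow> 'b) \<Rightarrow> nat \<Rightarrow> 'a \<Rightarrow> nat set \<Rightarrow> 'b"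
  where "adjunct X \<phi> = normalized_cochain.lift_hom X (\<lambda>n. \<lambda>x\<in>normalized X n.
    \<phi> n (dg_quotient.cls (normalization X) (differentiating_ideal X) n x))"

context cosimplicial_algebra
begin

lemma normalized_cochain_hom:
  assumes Y: "dg_algebra k Y" and \<phi>: "\<phi> \<in> dg_hom k (abs_diff X) Y"
  shows "normalized_cochain k X Y (\<lambda>n. \<lambda>x\<in>N n. \<phi> n (nd.cls n x))"
proof (intro normalized_cochain.intro normalized_cochain_axioms.intro cosimplicial_algebra_axioms Y)
  interpret Y: dg_algebra k Y by fact
  show "(\<lambda>n. \<lambda>x\<in>N n. \<phi> n (nd.cls n x)) \<in> dg_hom k XN Y"
    using nd.restrict_hom[OF \<phi>[unfolded abs_diff_def]] by simp
  fix n x assume x: "x \<in> J n"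
  have add: "additive_map (dg_gr (abs_diff X) n) (dg_gr Y n) (\<phi> n)"
    by (rule dg_hom_additive[OF \<phi> _ Y]) (simp add: abs_diff_def nd.dg_algebra_Q)
  have "x \<in> differentiating_ideal X n" using J_Jhat[OF x] by (simp add: differentiating_ideal_explicit)
  then have "nd.cls n x = \<zero>\<^bsub>dg_gr (abs_diff X) n\<^esub>"
    using nd.cls_eq_zero[of x n] J_N[OF x] nd.zero_Q[of n] by (simp add: abs_diff_def)
  then show "(\<lambda>x\<in>N n. \<phi> n (nd.cls n x)) x = \<zero>\<^bsub>dg_gr Y n\<^esub>"
    using J_N[OF x] additive_map_zero[OF add] by simp
qed

lemma adjunct_cs_hom:
  "dg_algebra k Y \<Longrightarrow> \<phi> \<in> dg_hom k (abs_diff X) Y \<Longrightarrow> adjunct X \<phi> \<in> cs_hom k X (denorm Y)"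
  unfolding adjunct_def by (rule normalized_cochain.lift_hom_cs_hom[OF normalized_cochain_hom])

lemma adjunct_top:
  "dg_algebra k Y \<Longrightarrow> \<phi> \<in> dg_hom k (abs_diff X) Y \<Longrightarrow> x \<in> N n \<Longrightarrow>
    adjunct X \<phi> n x {1..n} = \<phi> n (nd.cls n x)"
  unfolding adjunct_def by (subst normalized_cochain.lift_hom_top[OF normalized_cochain_hom]) simp_all

text \<open>
  The inverse takes \<open>F\<close> to its top coefficients on normalized elements, which factor through the quotient.
\<close>

theorem adjunct_bij:
  assumes Y: "dg_algebra k Y"
  shows "bij_betw (adjunct X) (dg_hom k (abs_diff X) Y) (cs_hom k X (denorm Y))"
proof (rule bij_betwI')
  interpret Y: dg_algebra k Y by fact
  fix \<phi> assume \<phi>: "\<phi> \<in> dg_hom k (abs_diff X) Y"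
  show "adjunct X \<phi> \<in> cs_hom k X (denorm Y)" by (rule adjunct_cs_hom[OF Y \<phi>])
  fix \<phi>' assume \<phi>': "\<phi>' \<in> dg_hom k (abs_diff X) Y"
  show "adjunct X \<phi> = adjunct X \<phi>' \<longleftrightarrow> \<phi> = \<phi>'"
  proof
    assume eq: "adjunct X \<phi> = adjunct X \<phi>'"
    show "\<phi> = \<phi>'"
    proof (rule abs_diff_hom_eqI[OF cosimplicial_algebra_axioms \<phi> \<phi>'])
      show "\<phi> n (nd.cls n x) = \<phi>' n (nd.cls n x)" if "x \<in> N n" for n x
        using adjunct_top[OF Y \<phi> that] adjunct_top[OF Y \<phi>' that] eq by simp
    qed
  qed simp
next
  interpret Y: dg_algebra k Y by fact
  fix F assume F: "F \<in> cs_hom k X (denorm Y)"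
  define \<psi> where "\<psi> = (\<lambda>n. \<lambda>x\<in>N n. F n x {1..n})"
  note \<psi> = Y.cs_hom_K_normalized(1)[OF cosimplicial_algebra_axioms F, folded \<psi>_def]
  have kills: "\<psi> n x = \<zero>\<^bsub>dg_gr Y n\<^esub>" if "x \<in> differentiating_ideal X n" for n x
    using Y \<psi> _ that
  proof (rule kills_differentiating_ideal)
    show "\<psi> n x = \<zero>\<^bsub>dg_gr Y n\<^esub>" if "x \<in> J n" for n x
      using Y.cs_hom_K_normalized(2)[OF cosimplicial_algebra_axioms F that] J_N[OF that] by (simp add: \<psi>_def)
  qed
  have \<phi>: "nd.quot_lift \<psi> \<in> dg_hom k (abs_diff X) Y"
    unfolding abs_diff_def by (rule nd.quot_lift_hom[OF Y \<psi> kills])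
  have "F = adjunct X (nd.quot_lift \<psi>)"
  proof (rule Y.cs_hom_K_eqI[OF cosimplicial_algebra_axioms F adjunct_cs_hom[OF Y \<phi>]])
    show "F n x {1..n} = adjunct X (nd.quot_lift \<psi>) n x {1..n}" if x: "x \<in> N n" for n x
    proof -
      have "nd.quot_lift \<psi> n (nd.cls n x) = \<psi> n x" by (rule nd.quot_lift_cls[OF Y \<psi> kills]) (simp_all add: x)
      then show ?thesis unfolding adjunct_top[OF Y \<phi> x] using x by (simp add: \<psi>_def)
    qed
  qed
  with \<phi> show "\<exists>\<phi>\<in>dg_hom k (abs_diff X) Y. F = adjunct X \<phi>" by blast
qed

text \<open>
  Under the unit \<open>X \<rightarrow> K(N'(X))\<close>, the product of the front image of \<open>x\<close> and the back image of \<open>y\<close> has top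
  coefficient \<open>x y\<close>, and in the opposite order \<open>y x\<close> up to the Koszul sign.
\<close>

theorem abs_diff_graded_commutative:
  assumes "cs_commutative X"
  shows "graded_commutative (abs_diff X)"
proof -
  let ?A = "abs_diff X"
  have A: "dg_algebra k ?A" unfolding abs_diff_def by (rule nd.dg_algebra_Q)
  interpret A: dg_algebra k ?A by fact
  interpret R: normalized_cochain k X ?A "\<lambda>n. \<lambda>x\<in>N n. dg_id ?A n (nd.cls n x)"
    by (rule normalized_cochain_hom[OF A dg_hom_id[OF A]])
  have top: "R.lift n x {1..n} = nd.cls n x" if "x \<in> N n" for n x
    using that R.lift_hom_top[OF that, unfolded R.lift_hom_def] nd.cls_closed[of x n]
    by (simp add: N_carrier dg_id_def abs_diff_def)
  have comm: "dg_mult ?A p q (nd.cls p x) (nd.cls q y) =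
      signed (dg_gr ?A (p + q)) (p * q) (dg_mult ?A q p (nd.cls q y) (nd.cls p x))"
    if x: "x \<in> N p" and y: "y \<in> N q" for p q x y
  proof -
    let ?K = "cs_obj (denorm ?A) (p + q)"
    let ?F = "coface_iter X p (Suc p) q x" and ?B = "coface_iter X q 0 p y"
    have cl: "?F \<in> C (p + q)" "?B \<in> C (p + q)"
      using front_closed[of x p q] back_closed[of y q p] x y by (simp_all add: N_carrier)
    have LF: "R.lift (p + q) ?F = coface_iter (denorm ?A) p (Suc p) q (R.lift p x)"
      by (rule R.lift_iter) (simp_all add: x N_carrier)
    have LB: "R.lift (p + q) ?B = coface_iter (denorm ?A) q 0 p (R.lift q y)"
      using R.lift_iter[of 0 q y p] y by (simp add: N_carrier add.commute)
    have "?F \<otimes>\<^bsub>cs_obj X (p + q)\<^esub> ?B = ?B \<otimes>\<^bsub>cs_obj X (p + q)\<^esub> ?F"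
      using assms cl by (simp add: cs_commutative_def cring.cring_simprules(14))
    then have "R.lift (p + q) ?F \<otimes>\<^bsub>?K\<^esub> R.lift (p + q) ?B = R.lift (p + q) ?B \<otimes>\<^bsub>?K\<^esub> R.lift (p + q) ?F"
      using R.lift_mult[OF cl] R.lift_mult[OF cl(2,1)] by simp
    then show ?thesis
      using A.K_front_back_top[OF R.lift_N[OF x] R.lift_closed[OF N_carrier[OF y]]]
      by (simp add: LF LB top[simplified] x y)
  qed
  show ?thesis
    unfolding graded_commutative_def
  proof (intro allI ballI)
    fix p q S T assume "S \<in> carrier (dg_gr ?A p)" "T \<in> carrier (dg_gr ?A q)"
    then obtain x y where "x \<in> N p" "S = nd.cls p x" "y \<in> N q" "T = nd.cls q y"
      unfolding abs_diff_def by (elim nd.cls_cases) simp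
    with comm[of x p y q]
    show "dg_mult ?A p q S T = signed (dg_gr ?A (p + q)) (p * q) (dg_mult ?A q p T S)" by blast
  qed
qed

end

theorem adjunct_natural:
  assumes X: "cosimplicial_algebra k X" and X': "cosimplicial_algebra k X'"
    and Y: "dg_algebra k Y" and Y': "dg_algebra k Y'"
    and h: "h \<in> cs_hom k X' X" and g: "g \<in> dg_hom k Y Y'" and \<psi>: "\<psi> \<in> dg_hom k (abs_diff X) Y"
  shows "adjunct X' (dg_comp (abs_diff X') g (dg_comp (abs_diff X') \<psi> (abs_diff_map X' X h))) =
    cs_comp X' (denorm_map Y Y' g) (cs_comp X' (adjunct X \<psi>) h)"
proof -
  interpret H: cosimplicial_morphism k X' X h
    using X X' h by (simp add: cosimplicial_morphism_def cosimplicial_morphism_axioms_def)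
  interpret Y': dg_algebra k Y' by fact
  have A: "dg_algebra k (abs_diff X')" unfolding abs_diff_def by (rule H.src.nd.dg_algebra_Q)
  note T = H.tgt.adjunct_cs_hom[OF Y \<psi>]
  note hom1 = dg_hom_comp[OF dg_hom_comp[OF H.abs_diff_map_hom \<psi> A] g A]
  note hom2 = cs_hom_comp[OF cs_hom_comp[OF h T X'] denorm_map_hom[OF Y Y' g] X']
  show ?thesis
  proof (rule Y'.cs_hom_K_eqI[OF X' H.src.adjunct_cs_hom[OF Y' hom1] hom2])
    fix n x assume x: "x \<in> normalized X' n"
    have c: "adjunct X \<psi> n (h n x) \<in> carrier (cs_obj (denorm Y) n)"
      using alg_hom_D(1)[OF cs_hom_D(1)[OF T]] H.tgt.N_carrier[OF H.h_N[OF x]] by simp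
    have q: "H.src.nd.cls n x \<in> carrier (dg_gr (abs_diff X') n)"
      using H.src.nd.cls_closed[of x n] x by (simp add: abs_diff_def)
    show "adjunct X' (dg_comp (abs_diff X') g (dg_comp (abs_diff X') \<psi> (abs_diff_map X' X h))) n x {1..n} =
        cs_comp X' (denorm_map Y Y' g) (cs_comp X' (adjunct X \<psi>) h) n x {1..n}"
      unfolding H.src.adjunct_top[OF Y' hom1 x]
      using x q denorm_map_apply[OF c subset_refl, of Y' g] H.tgt.adjunct_top[OF Y \<psi> H.h_N[OF x]]
      by (simp add: dg_comp_def cs_comp_def compose_def H.abs_diff_map_cls H.src.N_carrier)
  qed
qed

text \<open>
  The top coefficient identifies the normalization of \<open>K(Y)\<close> with \<open>Y\<close>, so a morphism \<open>K(Y) \<rightarrow> K(Z)\<close>, which is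
  determined on normalized elements, comes from a morphism \<open>Y \<rightarrow> Z\<close>.
\<close>

theorem denorm_fully_faithful:
  fixes k :: "'k ring"
  shows "fully_faithful (dgAlg k :: (('k, 'b) dga, _) category) (cAlg k) denorm denorm_map"
proof -
  have "bij_betw (denorm_map Y Z) (dg_hom k Y Z) (cs_hom k (denorm Y) (denorm Z))"
    if Y: "dg_algebra k Y" and Z: "dg_algebra k Z" for Y Z :: "('k, 'b) dga"
  proof (rule bij_betwI')
    interpret Y: dg_algebra k Y by fact
    interpret Z: dg_algebra k Z by fact
    interpret K: cosimplicial_algebra k "denorm Y" by (rule Y.K_cosimplicial)
    note [simp del] = Y.K_simps Z.K_simps
    note in_K = K.N_carrier[OF Y.top_incl_N]
    fix \<phi> assume \<phi>: "\<phi> \<in> dg_hom k Y Z"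
    show "denorm_map Y Z \<phi> \<in> cs_hom k (denorm Y) (denorm Z)" by (rule denorm_map_hom[OF Y Z \<phi>])
    have val: "denorm_map Y Z \<phi> n (Y.top_incl n f) {1..n} = \<phi> n f"
      if "f \<in> carrier (dg_gr Y n)" for \<phi> :: "nat \<Rightarrow> 'b \<Rightarrow> 'b" and n f
      using denorm_map_apply[OF in_K[OF that] subset_refl, of Z \<phi>] Y.top_incl_top[OF that] by simp
    fix \<phi>' assume \<phi>': "\<phi>' \<in> dg_hom k Y Z"
    show "denorm_map Y Z \<phi> = denorm_map Y Z \<phi>' \<longleftrightarrow> \<phi> = \<phi>'"
    proof
      assume eq: "denorm_map Y Z \<phi> = denorm_map Y Z \<phi>'"
      show "\<phi> = \<phi>'"
      proof (rule dg_hom_eqI[OF \<phi> \<phi>'])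
        show "\<phi> n f = \<phi>' n f" if "f \<in> carrier (dg_gr Y n)" for n f
          using val[OF that, of \<phi>] val[OF that, of \<phi>'] eq by simp
      qed
    qed simp
  next
    interpret Y: dg_algebra k Y by fact
    interpret Z: dg_algebra k Z by fact
    interpret K: cosimplicial_algebra k "denorm Y" by (rule Y.K_cosimplicial)
    note [simp del] = Y.K_simps Z.K_simps
    fix F assume F: "F \<in> cs_hom k (denorm Y) (denorm Z)"
    let ?\<nu> = "\<lambda>n. \<lambda>c\<in>normalized (denorm Y) n. F n c {1..n}"
    define \<phi> where "\<phi> = dg_comp Y ?\<nu> Y.top_incl"
    have \<phi>: "\<phi> \<in> dg_hom k Y Z"
      unfolding \<phi>_def by (rule dg_hom_comp[OF Y.top_incl_hom Z.cs_hom_K_normalized(1)[OF Y.K_cosimplicial F] Y])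
    have "F = denorm_map Y Z \<phi>"
    proof (rule Z.cs_hom_K_eqI[OF Y.K_cosimplicial F denorm_map_hom[OF Y Z \<phi>]])
      fix n c assume c: "c \<in> normalized (denorm Y) n"
      note cK = K.N_carrier[OF c]
      have m: "c {1..n} \<in> carrier (dg_gr Y n)" using Y.K_mem[OF cK, of "{1..n}"] by simp
      have "Y.top_incl n (c {1..n}) = c"
        by (rule Y.K_N_eqI[OF Y.top_incl_N[OF m] c]) (rule Y.top_incl_top[OF m])
      then show "F n c {1..n} = denorm_map Y Z \<phi> n c {1..n}"
        using denorm_map_apply[OF cK subset_refl, of Z \<phi>] c m by (simp add: \<phi>_def dg_comp_def compose_def)
    qed
    with \<phi> show "\<exists>\<phi>\<in>dg_hom k Y Z. F = denorm_map Y Z \<phi>" by blast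
  qed
  then show ?thesis by (simp add: fully_faithful_def cAlg_def dgAlg_def)
qed

section \<open>Smooth functions on open subsets of Euclidean space\<close>

lemma Euclidean_box_nbhd:
  assumes V: "openin (Euclidean_space e) V" and z: "z \<in> V"
  obtains \<delta> where "\<delta> > 0"
    "\<And>y. y \<in> topspace (Euclidean_space e) \<Longrightarrow> (\<And>j. j < e \<Longrightarrow> \<bar>y j - z j\<bar> < \<delta>) \<Longrightarrow> y \<in> V"
proof -
  obtain T where T: "openin (powertop_real UNIV) T" "V = T \<inter> {x. \<forall>i\<ge>e. x i = 0}"
    using V by (auto simp: Euclidean_space_def openin_subtopology)
  have zT: "z \<in> T" and z0: "z j = 0" if "j \<ge> e" for j using z T(2) that by auto
  obtain B :: "nat \<Rightarrow> real set" where B: "\<And>i. open (B i)" "z \<in> Pi\<^sub>E UNIV B" "Pi\<^sub>E UNIV B \<subseteq> T"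
    using T(1) z T(2) unfolding openin_product_topology_alt by force
  have "\<exists>\<delta>>0. \<forall>y. \<bar>y - z j\<bar> < \<delta> \<longrightarrow> y \<in> B j" for j
  proof -
    have "z j \<in> B j" using B(2) by auto
    then show ?thesis using B(1)[of j] unfolding open_dist by (auto simp: dist_real_def)
  qed
  then obtain d where d: "\<And>j. d j > 0" "\<And>j y. \<bar>y - z j\<bar> < d j \<Longrightarrow> y \<in> B j" by metis
  define \<delta> where "\<delta> = Min (insert 1 (d ` {..<e}))"
  show thesis
  proof (rule that)
    show "\<delta> > 0" unfolding \<delta>_def using d(1) by (subst Min_gr_iff) auto
    fix y assume y: "y \<in> topspace (Euclidean_space e)" and yz: "\<And>j. j < e \<Longrightarrow> \<bar>y j - z j\<bar> < \<delta>"
    have y0: "y j = 0" if "j \<ge> e" for j using y that by (simp add: topspace_Euclidean_space)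
    have "y j \<in> B j" for j
    proof (cases "j < e")
      case True
      then have "\<delta> \<le> d j" unfolding \<delta>_def by (intro Min_le) auto
      then show ?thesis using yz[OF True] d(2)[of "y j" j] by linarith
    next
      case False
      then show ?thesis using y0[of j] z0[of j] d(1)[of j] d(2)[of "y j" j] by simp
    qed
    then have "y \<in> T" using B(3) by auto
    then show "y \<in> V" using T(2) y0 by auto
  qed
qed

lemma Euclidean_line_nbhd:
  assumes U: "openin (Euclidean_space d) U" and x: "x \<in> U" and i: "i < d"
  shows "\<forall>\<^sub>F t in nhds (x i). x(i := t) \<in> U"
proof -
  obtain \<delta> where \<delta>: "\<delta> > 0"
    "\<And>y. y \<in> topspace (Euclidean_space d) \<Longrightarrow> (\<And>j. j < d \<Longrightarrow> \<bar>y j - x j\<bar> < \<delta>) \<Longrightarrow> y \<in> U"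
    using Euclidean_box_nbhd[OF U x] by metis
  have "x \<in> topspace (Euclidean_space d)" using openin_subset[OF U] x by blast
  then have "x(i := t) \<in> topspace (Euclidean_space d)" for t using i by (auto simp: topspace_Euclidean_space)
  then have "x(i := t) \<in> U" if "dist t (x i) < \<delta>" for t
    using \<delta>(1) that by (intro \<delta>(2)) (auto simp: dist_real_def)
  then show ?thesis using \<delta>(1) unfolding eventually_nhds_metric by blast
qed

lemma partial_cong:
  assumes U: "openin (Euclidean_space d) U" and x: "x \<in> U" and i: "i < d"
    and eq: "\<And>x. x \<in> U \<Longrightarrow> f x = g x"
    and D: "((\<lambda>t. f (x(i := t))) has_real_derivative D) (at (x i))"
  shows "((\<lambda>t. g (x(i := t))) has_real_derivative D) (at (x i))"
proof -
  have "\<forall>\<^sub>F t in nhds (x i). f (x(i := t)) = g (x(i := t))"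
    by (rule eventually_mono[OF Euclidean_line_nbhd[OF U x i]]) (rule eq)
  from iffD1[OF DERIV_cong_ev[OF refl this refl] D] show ?thesis .
qed

lemma Cr_on_partial:
  assumes "Cr_on d (Suc r) U f" "i < d"
  obtains g where "\<And>x. x \<in> U \<Longrightarrow> ((\<lambda>t. f (x(i := t))) has_real_derivative g x) (at (x i))" "Cr_on d r U g"
proof -
  from assms have "\<exists>g. (\<forall>x\<in>U. ((\<lambda>t. f (x(i := t))) has_real_derivative g x) (at (x i))) \<and> Cr_on d r U g"
    by simp
  then show thesis using that by blast
qed

lemma Cr_on_cong:
  assumes U: "openin (Euclidean_space d) U" and eq: "\<And>x. x \<in> U \<Longrightarrow> f x = g x" and f: "Cr_on d r U f"
  shows "Cr_on d r U g"
proof -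
  have c: "continuous_map (subtopology (Euclidean_space d) U) euclideanreal f \<Longrightarrow>
      continuous_map (subtopology (Euclidean_space d) U) euclideanreal g"
    by (erule continuous_map_eq) (simp add: eq)
  show ?thesis
  proof (cases r)
    case 0
    then show ?thesis using f c by simp
  next
    case (Suc r')
    have "\<exists>g'. (\<forall>x\<in>U. ((\<lambda>t. g (x(i := t))) has_real_derivative g' x) (at (x i))) \<and> Cr_on d r' U g'" if i:
        "i < d" for i
    proof -
      obtain f' where f': "\<And>x. x \<in> U \<Longrightarrow> ((\<lambda>t. f (x(i := t))) has_real_derivative f' x) (at (x i))" "Cr_on d
          r' U f'"
        using Cr_on_partial[OF f[unfolded Suc] i] by metis
      show ?thesis using partial_cong[where f = f and g = g, OF U _ i eq f'(1)] f'(2) by blast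
    qed
    then show ?thesis using f c unfolding Suc by simp
  qed
qed

lemma Cr_on_continuous: "Cr_on d r U f \<Longrightarrow> continuous_map (subtopology (Euclidean_space d) U) euclideanreal f"
  by (cases r) auto

lemma Cr_on_Suc_D: "Cr_on d (Suc r) U f \<Longrightarrow> Cr_on d r U f"
proof (induction r arbitrary: f)
  case (Suc r)
  then show ?case by (subst Cr_on.simps(2)) (force simp del: Cr_on.simps(2) simp: Cr_on.simps(2)[of d "Suc r"])
qed simp

lemma Cr_on_const: "Cr_on d r U (\<lambda>x. c)"
proof (induction r arbitrary: c)
  case (Suc r)
  then show ?case by (auto intro!: exI[of _ "\<lambda>x. 0"])
qed simp

lemma Cr_on_add: "Cr_on d r U f \<Longrightarrow> Cr_on d r U g \<Longrightarrow> Cr_on d r U (\<lambda>x. f x + g x)"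
proof (induction r arbitrary: f g)
  case 0
  then show ?case by (simp add: continuous_map_add)
next
  case (Suc r)
  have "\<exists>D. (\<forall>x\<in>U. ((\<lambda>t. f (x(i := t)) + g (x(i := t))) has_real_derivative D x) (at (x i))) \<and> Cr_on d r U D"
    if i: "i < d" for i
  proof -
    obtain f' where f': "\<And>x. x \<in> U \<Longrightarrow> ((\<lambda>t. f (x(i := t))) has_real_derivative f' x) (at (x i))" "Cr_on d r U f'"
      using Cr_on_partial[OF Suc.prems(1) i] by metis
    obtain g' where g': "\<And>x. x \<in> U \<Longrightarrow> ((\<lambda>t. g (x(i := t))) has_real_derivative g' x) (at (x i))" "Cr_on d r U g'"
      using Cr_on_partial[OF Suc.prems(2) i] by metis
    have "((\<lambda>t. f (x(i := t)) + g (x(i := t))) has_real_derivative f' x + g' x) (at (x i))" if "x \<in> U" for x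
      using DERIV_add[OF f'(1)[OF that] g'(1)[OF that]] .
    then show ?thesis using Suc.IH[OF f'(2) g'(2)] by (intro exI[of _ "\<lambda>x. f' x + g' x"]) simp
  qed
  then show ?case using Suc.prems by (simp add: continuous_map_add)
qed

lemma Cr_on_mult: "Cr_on d r U f \<Longrightarrow> Cr_on d r U g \<Longrightarrow> Cr_on d r U (\<lambda>x. f x * g x)"
proof (induction r arbitrary: f g)
  case 0
  then show ?case by (simp add: continuous_map_real_mult)
next
  case (Suc r)
  have "\<exists>D. (\<forall>x\<in>U. ((\<lambda>t. f (x(i := t)) * g (x(i := t))) has_real_derivative D x) (at (x i))) \<and> Cr_on d r U D"
    if i: "i < d" for i
  proof -
    obtain f' where f': "\<And>x. x \<in> U \<Longrightarrow> ((\<lambda>t. f (x(i := t))) has_real_derivative f' x) (at (x i))" "Cr_on d r U f'"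
      using Cr_on_partial[OF Suc.prems(1) i] by metis
    obtain g' where g': "\<And>x. x \<in> U \<Longrightarrow> ((\<lambda>t. g (x(i := t))) has_real_derivative g' x) (at (x i))" "Cr_on d r U g'"
      using Cr_on_partial[OF Suc.prems(2) i] by metis
    have "((\<lambda>t. f (x(i := t)) * g (x(i := t))) has_real_derivative f' x * g x + g' x * f x) (at (x i))"
      if "x \<in> U" for x
      using DERIV_mult[OF f'(1)[OF that] g'(1)[OF that]] by simp
    then show ?thesis
      using Cr_on_add[OF Suc.IH[OF f'(2) Cr_on_Suc_D[OF Suc.prems(2)]] Suc.IH[OF g'(2) Cr_on_Suc_D[OF
          Suc.prems(1)]]]
      by (intro exI[of _ "\<lambda>x. f' x * g x + g' x * f x"]) simp
  qed
  then show ?case using Suc.prems by (simp add: continuous_map_real_mult)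
qed

lemma Cr_on_sum: "(\<And>j. j < m \<Longrightarrow> Cr_on d r U (f j)) \<Longrightarrow> Cr_on d r U (\<lambda>x. \<Sum>j<m. f j x)" for m :: nat
  by (induction m) (auto intro: Cr_on_const Cr_on_add)

text \<open>
  Partial derivatives are unique, so those found locally fit together.
\<close>

lemma Cr_on_locality:
  assumes U: "U \<subseteq> topspace (Euclidean_space d)"
    and loc: "\<And>x. x \<in> U \<Longrightarrow> \<exists>V. openin (Euclidean_space d) V \<and> x \<in> V \<and> V \<subseteq> U \<and> Cr_on d r V f"
  shows "Cr_on d r U f"
proof -
  have cont: "continuous_map (subtopology (Euclidean_space d) U) euclideanreal f"
    if *: "\<And>x. x \<in> U \<Longrightarrow> \<exists>V. openin (Euclidean_space d) V \<and> x \<in> V \<and> V \<subseteq> U \<and> Cr_on d r V f" for f r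
  proof -
    have "\<forall>x\<in>U. \<exists>V. openin (Euclidean_space d) V \<and> x \<in> V \<and> V \<subseteq> U \<and> Cr_on d r V f" using * by blast
    from bchoice[OF this] obtain V where
      V: "\<And>x. x \<in> U \<Longrightarrow> openin (Euclidean_space d) (V x) \<and> x \<in> V x \<and> V x \<subseteq> U \<and> Cr_on d r (V x) f"
      by blast
    show ?thesis
    proof (rule pasting_lemma[where I = U and T = V and f = "\<lambda>_. f"])
      fix x assume x: "x \<in> U"
      have "V x \<inter> U = V x" "U \<inter> V x = V x" using V[OF x] by auto
      then show "openin (subtopology (Euclidean_space d) U) (V x)"
        and "continuous_map (subtopology (subtopology (Euclidean_space d) U) (V x)) euclideanreal f"
        using V[OF x] Cr_on_continuous[of d r "V x" f] by (auto simp: openin_subtopology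
            subtopology_subtopology)
    qed (use V in auto)
  qed
  show ?thesis
    using loc
  proof (induction r arbitrary: f)
    case 0
    then show ?case using cont[of 0 f] by simp
  next
    case (Suc r f)
    have "\<exists>g. (\<forall>x\<in>U. ((\<lambda>t. f (x(i := t))) has_real_derivative g x) (at (x i))) \<and> Cr_on d r U g"
      if i: "i < d" for i
    proof -
      define g where "g x = (THE D. ((\<lambda>t. f (x(i := t))) has_real_derivative D) (at (x i)))" for x
      have loc: "\<exists>V. openin (Euclidean_space d) V \<and> x \<in> V \<and> V \<subseteq> U \<and> Cr_on d r V g"
        "((\<lambda>t. f (x(i := t))) has_real_derivative g x) (at (x i))" if x: "x \<in> U" for x
      proof -
        obtain V where V: "openin (Euclidean_space d) V" "x \<in> V" "V \<subseteq> U" "Cr_on d (Suc r) V f"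
          using Suc.prems[OF x] by blast
        obtain h where h: "\<And>y. y \<in> V \<Longrightarrow> ((\<lambda>t. f (y(i := t))) has_real_derivative h y) (at (y i))" "Cr_on d r V h"
          using Cr_on_partial[OF V(4) i] by metis
        have gh: "h y = g y" if "y \<in> V" for y
          unfolding g_def by (rule the_equality[symmetric]) (use h(1)[OF that] DERIV_unique in blast)+
        show "\<exists>V. openin (Euclidean_space d) V \<and> x \<in> V \<and> V \<subseteq> U \<and> Cr_on d r V g"
          using V Cr_on_cong[OF V(1) gh h(2)] by blast
        show "((\<lambda>t. f (x(i := t))) has_real_derivative g x) (at (x i))"
          using h(1)[OF V(2)] gh[OF V(2)] by simp
      qed
      have "Cr_on d r U g" by (rule Suc.IH) (rule loc(1))
      then show ?thesis using loc(2) by blast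
    qed
    then show ?case using cont[OF Suc.prems] by simp
  qed
qed

text \<open>
  The chain rule along a curve, from continuous partial derivatives: moving the coordinates one at a time
  turns an increment of \<open>f\<close> into a sum of increments in a single coordinate, to each of which the mean
  value theorem applies.
\<close>

lemma partial_derivatives_increment:
  fixes f g :: "(nat \<Rightarrow> real) \<Rightarrow> real" and c :: "real \<Rightarrow> nat \<Rightarrow> real"
  assumes V: "openin (Euclidean_space e) V" and z: "c t0 \<in> V" and m: "m < e"
    and f: "\<And>y. y \<in> V \<Longrightarrow> ((\<lambda>s. f (y(m := s))) has_real_derivative g y) (at (y m))"
    and g: "continuous_map (subtopology (Euclidean_space e) V) euclideanreal g"
    and c: "\<And>j. j < e \<Longrightarrow> ((\<lambda>t. c t j) has_real_derivative c' j) (at t0)"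
  shows "((\<lambda>t. f (\<lambda>j. if j < Suc m then c t j else c t0 j) - f (\<lambda>j. if j < m then c t j else c t0 j))
    has_real_derivative g (c t0) * c' m) (at t0)"
proof -
  define w where "w t s = (\<lambda>j. if j < m then c t j else c t0 j)(m := s)" for t s
  have w: "w t (c t m) = (\<lambda>j. if j < Suc m then c t j else c t0 j)"
    "w t (c t0 m) = (\<lambda>j. if j < m then c t j else c t0 j)" for t
    by (auto simp: w_def fun_eq_iff less_Suc_eq)
  have z0: "c t0 j = 0" if "j \<ge> e" for j
    using openin_subset[OF V] z that by (auto simp: topspace_Euclidean_space)
  have wE: "w t s \<in> topspace (Euclidean_space e)" for t s
    using m z0 by (auto simp: topspace_Euclidean_space w_def)
  \<comment> \<open>The difference quotient in the \<open>m\<close>-th coordinate, extended by its limit where the coordinate does not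
    move.\<close>
  define G where "G t = (if c t m = c t0 m then g (c t0) else (f (w t (c t m)) - f (w t (c t0 m))) / (c t
      m - c t0 m))" for t
  have G: "f (w t (c t m)) - f (w t (c t0 m)) = G t * (c t m - c t0 m)" for t by (simp add: G_def)
  have lim: "(G \<longlongrightarrow> g (c t0)) (at t0)"
  proof (rule tendstoI)
    fix \<epsilon> :: real assume \<epsilon>: "\<epsilon> > 0"
    define V' where "V' = {y \<in> V. g y \<in> ball (g (c t0)) \<epsilon>}"
    have VE: "V \<subseteq> topspace (Euclidean_space e)" using openin_subset[OF V] .
    have "openin (subtopology (Euclidean_space e) V) {y \<in> topspace (subtopology (Euclidean_space e) V). g
        y \<in> ball (g (c t0)) \<epsilon>}"
      by (rule openin_continuous_map_preimage[OF g]) simp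
    also have "{y \<in> topspace (subtopology (Euclidean_space e) V). g y \<in> ball (g (c t0)) \<epsilon>} = V'"
      using VE by (auto simp: V'_def)
    finally have V': "openin (Euclidean_space e) V'" using V openin_trans_full by blast
    have "c t0 \<in> V'" using z \<epsilon> by (simp add: V'_def)
    then obtain \<delta> where \<delta>: "\<delta> > 0"
      "\<And>y. y \<in> topspace (Euclidean_space e) \<Longrightarrow> (\<And>j. j < e \<Longrightarrow> \<bar>y j - c t0 j\<bar> < \<delta>) \<Longrightarrow> y \<in> V'"
      using Euclidean_box_nbhd[OF V'] by metis
    have "\<forall>\<^sub>F t in at t0. \<forall>j\<in>{..<e}. dist (c t j) (c t0 j) < \<delta>"
    proof (rule eventually_ball_finite)
      show "\<forall>j\<in>{..<e}. \<forall>\<^sub>F t in at t0. dist (c t j) (c t0 j) < \<delta>"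
        using DERIV_isCont[OF c] \<delta>(1) by (auto simp: isCont_def tendsto_iff)
    qed simp
    then show "\<forall>\<^sub>F t in at t0. dist (G t) (g (c t0)) < \<epsilon>"
    proof (rule eventually_mono)
      fix t assume t: "\<forall>j\<in>{..<e}. dist (c t j) (c t0 j) < \<delta>"
      have wV: "w t s \<in> V'" if "\<bar>s - c t0 m\<bar> \<le> \<bar>c t m - c t0 m\<bar>" for s
      proof (rule \<delta>(2)[OF wE])
        fix j assume "j < e"
        then show "\<bar>w t s j - c t0 j\<bar> < \<delta>"
          using t m that \<delta>(1) by (fastforce simp: w_def dist_real_def)
      qed
      have D: "((\<lambda>s. f (w t s)) has_real_derivative g (w t s)) (at s)"
        if "\<bar>s - c t0 m\<bar> \<le> \<bar>c t m - c t0 m\<bar>" for s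
        using f[of "w t s"] wV[OF that] by (simp add: V'_def w_def)
      have "\<exists>s. \<bar>s - c t0 m\<bar> \<le> \<bar>c t m - c t0 m\<bar> \<and> G t = g (w t s)" if ne: "c t m \<noteq> c t0 m"
      proof (cases "c t0 m < c t m")
        case True
        then obtain s where "c t0 m < s" "s < c t m"
          "f (w t (c t m)) - f (w t (c t0 m)) = (c t m - c t0 m) * g (w t s)"
          using MVT2[of "c t0 m" "c t m" "\<lambda>s. f (w t s)" "\<lambda>s. g (w t s)"] D by auto
        then show ?thesis using ne by (intro exI[of _ s]) (simp add: G_def)
      next
        case False
        then have lt: "c t m < c t0 m" using ne by simp
        then obtain s where "c t m < s" "s < c t0 m"
          "f (w t (c t0 m)) - f (w t (c t m)) = (c t0 m - c t m) * g (w t s)"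
          using MVT2[of "c t m" "c t0 m" "\<lambda>s. f (w t s)" "\<lambda>s. g (w t s)"] D by auto
        then show ?thesis using ne by (intro exI[of _ s]) (simp add: G_def field_simps)
      qed
      then show "dist (G t) (g (c t0)) < \<epsilon>"
        using wV \<epsilon> by (cases "c t m = c t0 m") (auto simp: V'_def dist_commute G_def)
    qed
  qed
  have "((\<lambda>t. (c t m - c t0 m) / (t - t0)) \<longlongrightarrow> c' m) (at t0)"
    using c[OF m] by (simp add: has_field_derivative_iff)
  from tendsto_mult[OF lim this]
  have "((\<lambda>t. (f (w t (c t m)) - f (w t (c t0 m))) / (t - t0)) \<longlongrightarrow> g (c t0) * c' m) (at t0)"
    by (simp add: G)
  then have "((\<lambda>t. f (w t (c t m)) - f (w t (c t0 m))) has_real_derivative g (c t0) * c' m) (at t0)"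
    by (simp add: has_field_derivative_iff)
  then show ?thesis unfolding w .
qed

lemma chain_rule_curve:
  fixes f :: "(nat \<Rightarrow> real) \<Rightarrow> real" and c :: "real \<Rightarrow> nat \<Rightarrow> real"
  assumes V: "openin (Euclidean_space e) V" and z: "c t0 \<in> V"
    and f: "\<And>j y. j < e \<Longrightarrow> y \<in> V \<Longrightarrow> ((\<lambda>s. f (y(j := s))) has_real_derivative g j y) (at (y j))"
    and g: "\<And>j. j < e \<Longrightarrow> continuous_map (subtopology (Euclidean_space e) V) euclideanreal (g j)"
    and c: "\<And>j. j < e \<Longrightarrow> ((\<lambda>t. c t j) has_real_derivative c' j) (at t0)"
    and near: "\<forall>\<^sub>F t in nhds t0. c t \<in> topspace (Euclidean_space e)"
  shows "((\<lambda>t. f (c t)) has_real_derivative (\<Sum>j<e. g j (c t0) * c' j)) (at t0)"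
proof -
  have "((\<lambda>t. f (\<lambda>j. if j < m then c t j else c t0 j)) has_real_derivative (\<Sum>j<m. g j (c t0) * c' j)) (at t0)"
    if "m \<le> e" for m
    using that
  proof (induction m)
    case (Suc m)
    then have m: "m < e" by simp
    from DERIV_add[OF Suc.IH partial_derivatives_increment[OF V z m f[OF m] g[OF m] c]] m
    show ?case by simp
  qed simp
  from this[of e] have "((\<lambda>t. f (\<lambda>j. if j < e then c t j else c t0 j)) has_real_derivative (\<Sum>j<e. g j (c
      t0) * c' j)) (at t0)"
    by simp
  moreover have "\<forall>\<^sub>F t in nhds t0. f (\<lambda>j. if j < e then c t j else c t0 j) = f (c t)"
    using near
  proof (rule eventually_mono)
    fix t assume "c t \<in> topspace (Euclidean_space e)"
    moreover have "c t0 \<in> topspace (Euclidean_space e)" using openin_subset[OF V] z by blast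
    ultimately have "(\<lambda>j. if j < e then c t j else c t0 j) = c t" by (auto simp: topspace_Euclidean_space
        fun_eq_iff)
    then show "f (\<lambda>j. if j < e then c t j else c t0 j) = f (c t)" by simp
  qed
  ultimately show ?thesis using iffD1[OF DERIV_cong_ev[OF refl _ refl]] by fast
qed

text \<open>
  By the chain rule the partial derivatives of \<open>f \<circ> H\<close> are sums of products of functions of the same kind, one
  order of differentiability lower.
\<close>

lemma Cr_on_compose:
  assumes U: "openin (Euclidean_space d) U" and V: "openin (Euclidean_space e) V" and H: "\<And>x. x \<in> U \<Longrightarrow> H x \<in> V"
    and f: "Cr_on e r V f" and h: "\<And>j. j < e \<Longrightarrow> Cr_on d r U (\<lambda>x. H x j)"
  shows "Cr_on d r U (\<lambda>x. f (H x))"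
proof -
  have VE: "V \<subseteq> topspace (Euclidean_space e)" using openin_subset[OF V] .
  have cont: "continuous_map (subtopology (Euclidean_space d) U) euclideanreal (\<lambda>x. f (H x))"
    if f: "Cr_on e r V f" and h: "\<And>j. j < e \<Longrightarrow> Cr_on d r U (\<lambda>x. H x j)" for r f
  proof -
    have "continuous_map (subtopology (Euclidean_space d) U) euclideanreal (\<lambda>x. H x j)" for j
    proof (cases "j < e")
      case True
      then show ?thesis by (rule Cr_on_continuous[OF h])
    next
      case False
      then have z: "0 = H x j" if "x \<in> U" for x using subsetD[OF VE H[OF that]] by (simp add:
          topspace_Euclidean_space)
      show ?thesis by (rule continuous_map_eq[of _ _ "\<lambda>x. 0"]) (simp_all add: z)
    qed
    then have "continuous_map (subtopology (Euclidean_space d) U) (powertop_real UNIV) H"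
      by (simp only: continuous_map_componentwise_UNIV) blast
    moreover have "H \<in> topspace (subtopology (Euclidean_space d) U) \<rightarrow> V" using H by simp
    moreover have "H \<in> topspace (subtopology (Euclidean_space d) U) \<rightarrow> {x. \<forall>i\<ge>e. x i = 0}"
      using H VE by (simp add: Pi_iff subset_iff topspace_Euclidean_space[symmetric])
    ultimately have "continuous_map (subtopology (Euclidean_space d) U) (subtopology (Euclidean_space e) V) H"
      unfolding Euclidean_space_def[of e] continuous_map_in_subtopology by blast
    from continuous_map_compose[OF this Cr_on_continuous[OF f]] show ?thesis by (simp add: o_def)
  qed
  show ?thesis
    using f h
  proof (induction r arbitrary: f)
    case 0
    then show ?case using cont[OF 0] by simp
  next
    case (Suc r f)
    have "\<exists>g. (\<forall>x\<in>U. ((\<lambda>t. f (H (x(i := t)))) has_real_derivative g x) (at (x i))) \<and> Cr_on d r U g"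
      if i: "i < d" for i
    proof -
      have "\<forall>j\<in>{..<e}. \<exists>g.
          (\<forall>y\<in>V. ((\<lambda>s. f (y(j := s))) has_real_derivative g y) (at (y j))) \<and> Cr_on e r V g"
        using Suc.prems(1) by simp
      from bchoice[OF this] obtain g where g: "\<And>j y. j < e \<Longrightarrow> y \<in> V \<Longrightarrow>
          ((\<lambda>s. f (y(j := s))) has_real_derivative g j y) (at (y j))"
          "\<And>j. j < e \<Longrightarrow> Cr_on e r V (g j)"
        by auto
      have "\<forall>j\<in>{..<e}. \<exists>h'.
          (\<forall>x\<in>U. ((\<lambda>t. H (x(i := t)) j) has_real_derivative h' x) (at (x i))) \<and> Cr_on d r U h'"
        using Suc.prems(2) i by simp
      from bchoice[OF this] obtain h' where h': "\<And>j x. j < e \<Longrightarrow> x \<in> U \<Longrightarrow>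
          ((\<lambda>t. H (x(i := t)) j) has_real_derivative h' j x) (at (x i))"
          "\<And>j. j < e \<Longrightarrow> Cr_on d r U (h' j)"
        by auto
      have "((\<lambda>t. f (H (x(i := t)))) has_real_derivative (\<Sum>j<e. g j (H x) * h' j x)) (at (x i))" if x: "x
          \<in> U" for x
      proof -
        have "\<forall>\<^sub>F t in nhds (x i). H (x(i := t)) \<in> topspace (Euclidean_space e)"
          by (rule eventually_mono[OF Euclidean_line_nbhd[OF U x i]]) (use H VE in blast)
        moreover have "H (x(i := x i)) \<in> V" using H[OF x] by simp
        ultimately have "((\<lambda>t. f (H (x(i := t)))) has_real_derivative (\<Sum>j<e. g j (H (x(i := x i))) * h' j
            x)) (at (x i))"
          by (intro chain_rule_curve[where c = "\<lambda>t. H (x(i := t))" and c' = "\<lambda>j. h' j x", OF V])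
            (simp_all only: g(1) Cr_on_continuous[OF g(2)] h'(1)[OF _ x])
        then show ?thesis by simp
      qed
      moreover have "Cr_on d r U (\<lambda>x. \<Sum>j<e. g j (H x) * h' j x)"
      proof (rule Cr_on_sum, rule Cr_on_mult)
        fix j assume j: "j < e"
        show "Cr_on d r U (\<lambda>x. g j (H x))"
          by (rule Suc.IH[OF g(2)[OF j]]) (rule Cr_on_Suc_D[OF Suc.prems(2)])
        show "Cr_on d r U (h' j)" by (rule h'(2)[OF j])
      qed
      ultimately show ?thesis by (intro exI[of _ "\<lambda>x. \<Sum>j<e. g j (H x) * h' j x"] conjI ballI)
    qed
    then show ?case using cont[OF Suc.prems] by simp
  qed
qed

section \<open>The cosimplicial algebra of smooth functions on a simplicial manifold\<close>

context smooth_manifold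
begin

lemma chart_facts:
  assumes c: "(d, U, \<phi>) \<in> mf_atlas M"
  shows "openin (mf_top M) U" "U \<subseteq> topspace (mf_top M)" "openin (Euclidean_space d) (\<phi> ` U)"
    and "p \<in> U \<Longrightarrow> inv_into U \<phi> (\<phi> p) = p"
    and "openin (mf_top M) W \<Longrightarrow> W \<subseteq> U \<Longrightarrow> openin (Euclidean_space d) (\<phi> ` W)"
proof -
  note ch = charts[OF c]
  show U: "openin (mf_top M) U" "U \<subseteq> topspace (mf_top M)" "openin (Euclidean_space d) (\<phi> ` U)"
    using ch openin_subset by auto
  have top: "topspace (subtopology (mf_top M) U) = U" using U(2) by auto
  show "inv_into U \<phi> (\<phi> p) = p" if "p \<in> U"
    using ch homeomorphic_imp_injective_map[of "subtopology (mf_top M) U" _ \<phi>] that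
    unfolding top by (auto intro: inv_into_f_f)
  show "openin (Euclidean_space d) (\<phi> ` W)" if W: "openin (mf_top M) W" "W \<subseteq> U"
  proof -
    have "openin (subtopology (mf_top M) U) W" using W by (auto simp: openin_subtopology)
    then have "openin (subtopology (Euclidean_space d) (\<phi> ` U)) (\<phi> ` W)"
      using ch homeomorphic_imp_open_map[of "subtopology (mf_top M) U" _ \<phi>] by (simp add: open_map_def)
    then show ?thesis using U(3) openin_trans_full by blast
  qed
qed

lemma smooth_functionsD:
  assumes "f \<in> smooth_functions M"
  shows "f \<in> extensional (topspace (mf_top M))"
    and "(d, U, \<phi>) \<in> mf_atlas M \<Longrightarrow> Cr_on d r (\<phi> ` U) (\<lambda>x. f (inv_into U \<phi> x))"
  using assms by (auto simp: smooth_functions_def smooth_on_def)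

lemma smooth_functionsI:
  assumes "\<And>d U \<phi> r. (d, U, \<phi>) \<in> mf_atlas M \<Longrightarrow> Cr_on d r (\<phi> ` U) (\<lambda>x. f (inv_into U \<phi> x))"
  shows "(\<lambda>p\<in>topspace (mf_top M). f p) \<in> smooth_functions M"
proof -
  have "Cr_on d r (\<phi> ` U) (\<lambda>x. (\<lambda>p\<in>topspace (mf_top M). f p) (inv_into U \<phi> x))"
    if c: "(d, U, \<phi>) \<in> mf_atlas M" for d U \<phi> r
    by (rule Cr_on_cong[OF chart_facts(3)[OF c] _ assms[OF c]])
      (use chart_facts(2)[OF c] in \<open>auto simp: chart_facts(4)[OF c]\<close>)
  then show ?thesis by (auto simp: smooth_functions_def smooth_on_def)
qed

lemma smooth_functions_closed:
  shows "(\<lambda>p\<in>topspace (mf_top M). c) \<in> smooth_functions M"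
    and "f \<in> smooth_functions M \<Longrightarrow> g \<in> smooth_functions M \<Longrightarrow>
      (\<lambda>p\<in>topspace (mf_top M). f p + g p) \<in> smooth_functions M"
    and "f \<in> smooth_functions M \<Longrightarrow> g \<in> smooth_functions M \<Longrightarrow>
      (\<lambda>p\<in>topspace (mf_top M). f p * g p) \<in> smooth_functions M"
    and "f \<in> smooth_functions M \<Longrightarrow> (\<lambda>p\<in>topspace (mf_top M). c * f p) \<in> smooth_functions M"
  by (rule smooth_functionsI; simp add: Cr_on_const Cr_on_add Cr_on_mult smooth_functionsD)+

lemma smooth_algebra_simps:
  "carrier (smooth_algebra M) = smooth_functions M"
  "f \<otimes>\<^bsub>smooth_algebra M\<^esub> g = (\<lambda>p\<in>topspace (mf_top M). f p * g p)"
  "\<one>\<^bsub>smooth_algebra M\<^esub> = (\<lambda>p\<in>topspace (mf_top M). 1)"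
  "\<zero>\<^bsub>smooth_algebra M\<^esub> = (\<lambda>p\<in>topspace (mf_top M). 0)"
  "f \<oplus>\<^bsub>smooth_algebra M\<^esub> g = (\<lambda>p\<in>topspace (mf_top M). f p + g p)"
  "a \<odot>\<^bsub>smooth_algebra M\<^esub> f = (\<lambda>p\<in>topspace (mf_top M). a * f p)"
  by (simp_all add: smooth_algebra_def)

lemma smooth_algebra_algebra: "assoc_algebra (ring_of_type_algebra :: real ring) (smooth_algebra M)"
proof -
  let ?A = "smooth_algebra M" and ?k = "ring_of_type_algebra :: real ring"
  have r: "restrict f (topspace (mf_top M)) = f" if "f \<in> smooth_functions M" for f
    using smooth_functionsD(1)[OF that] by (rule extensional_restrict)
  note simps = smooth_algebra_simps smooth_functions_closed r algebra_simps
  have ab: "abelian_group ?A"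
  proof (rule abelian_groupI)
    show "\<exists>g\<in>carrier ?A. g \<oplus>\<^bsub>?A\<^esub> f = \<zero>\<^bsub>?A\<^esub>" if "f \<in> carrier ?A" for f
      using that smooth_functions_closed(4)[of f "-1"]
      by (intro bexI[of _ "\<lambda>p\<in>topspace (mf_top M). -1 * f p"]) (auto simp: smooth_algebra_simps
          restrict_def fun_eq_iff)
  qed (simp_all add: simps cong: restrict_cong)
  have ring: "ring ?A"
    by (rule ringI[OF ab], rule monoidI) (simp_all add: simps cong: restrict_cong)
  have "Module.module ?k ?A"
    by (rule moduleI[OF cring_from_type_algebra ab])
      (simp_all add: simps ring_of_type_algebra_def cong: restrict_cong)
  then show ?thesis
    using ring by (simp add: assoc_algebra_def simps cong: restrict_cong)
qed

end

text \<open>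
  Smoothness is local, and near a point the pullback is a composite of \<open>f\<close> in a chart of the target with the
  coordinate expression of \<open>F\<close>.
\<close>

lemma pullback_smooth:
  assumes M: "smooth_manifold M" and N: "smooth_manifold N" and F: "smooth_map M N F"
    and f: "f \<in> smooth_functions N"
  shows "(\<lambda>p\<in>topspace (mf_top M). f (F p)) \<in> smooth_functions M"
proof -
  interpret M: smooth_manifold M by fact
  interpret N: smooth_manifold N by fact
  have cont: "continuous_map (mf_top M) (mf_top N) F" using F by (simp add: smooth_map_def)
  show ?thesis
  proof (rule M.smooth_functionsI)
    fix d U \<phi> r assume c: "(d, U, \<phi>) \<in> mf_atlas M"
    note U = M.chart_facts[OF c]
    show "Cr_on d r (\<phi> ` U) (\<lambda>x. f (F (inv_into U \<phi> x)))"
    proof (rule Cr_on_locality[OF openin_subset[OF U(3)]])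
      fix x assume "x \<in> \<phi> ` U"
      then obtain p where p: "p \<in> U" "x = \<phi> p" by blast
      then have "F p \<in> topspace (mf_top N)" using U(2) cont by (auto simp: continuous_map_def)
      then obtain e V \<psi> where c': "(e, V, \<psi>) \<in> mf_atlas N" and pV: "F p \<in> V"
        unfolding N.covering[symmetric] by auto
      note V = N.chart_facts[OF c']
      define W where "W = {p \<in> U. F p \<in> V}"
      have "W = U \<inter> {p \<in> topspace (mf_top M). F p \<in> V}" using U(2) by (auto simp: W_def)
      then have "openin (mf_top M) W" using U(1) openin_continuous_map_preimage[OF cont V(1)] by auto
      then have W: "openin (Euclidean_space d) (\<phi> ` W)" by (rule U(5)) (auto simp: W_def)
      have inv: "inv_into U \<phi> (\<phi> q) = q" if "q \<in> W" for q using U(4) that by (simp add: W_def)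
      have "Cr_on d r (\<phi> ` W) (\<lambda>x. f (inv_into V \<psi> (\<psi> (F (inv_into U \<phi> x)))))"
      proof (rule Cr_on_compose[where f = "\<lambda>y. f (inv_into V \<psi> y)" and H = "\<lambda>x. \<psi> (F (inv_into U \<phi> x))",
          OF W V(3)])
        show "\<psi> (F (inv_into U \<phi> x)) \<in> \<psi> ` V" if "x \<in> \<phi> ` W" for x using that inv by (auto simp: W_def)
        show "Cr_on e r (\<psi> ` V) (\<lambda>y. f (inv_into V \<psi> y))" by (rule N.smooth_functionsD(2)[OF f c'])
        show "Cr_on d r (\<phi> ` W) (\<lambda>x. \<psi> (F (inv_into U \<phi> x)) j)" if "j < e" for j
          using F c c' that by (fastforce simp: smooth_map_def smooth_on_def W_def)
      qed
      then have "Cr_on d r (\<phi> ` W) (\<lambda>x. f (F (inv_into U \<phi> x)))"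
        by (rule Cr_on_cong[OF W, rotated]) (auto simp: inv V(4) W_def)
      then show "\<exists>W. openin (Euclidean_space d) W \<and> x \<in> W \<and> W \<subseteq> \<phi> ` U \<and> Cr_on d r W (\<lambda>x. f (F (inv_into U
          \<phi> x)))"
        using W p pV by (intro exI[of _ "\<phi> ` W"]) (auto simp: W_def)
    qed
  qed
qed

lemma pullback_hom:
  assumes M: "smooth_manifold M" and N: "smooth_manifold N" and F: "smooth_map M N F"
  shows "(\<lambda>f. \<lambda>p\<in>topspace (mf_top M). f (F p)) \<in>
    alg_hom (ring_of_type_algebra :: real ring) (smooth_algebra N) (smooth_algebra M)"
proof -
  interpret M: smooth_manifold M by fact
  interpret N: smooth_manifold N by fact
  have "F p \<in> topspace (mf_top N)" if "p \<in> topspace (mf_top M)" for p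
    using F that by (auto simp: smooth_map_def continuous_map_def)
  then show ?thesis
    by (intro alg_homI) (simp_all add: M.smooth_algebra_simps N.smooth_algebra_simps pullback_smooth[OF M
        N F] cong: restrict_cong)
qed

context simplicial_manifold
begin

abbreviation XG where "XG \<equiv> sm_functions G"

lemma XG_simps:
  "cs_obj XG n = smooth_algebra (sm_obj G n)"
  "cs_coface XG n i f = (\<lambda>p\<in>sm_points G (Suc n). f (sm_face G n i p))"
  "cs_codegen XG n j f = (\<lambda>p\<in>sm_points G n. f (sm_degen G n j p))"
  by (simp_all add: sm_functions_def)

lemma face_point: "i \<le> Suc n \<Longrightarrow> p \<in> sm_points G (Suc n) \<Longrightarrow> sm_face G n i p \<in> sm_points G n"
  and degen_point: "j \<le> n \<Longrightarrow> p \<in> sm_points G n \<Longrightarrow> sm_degen G n j p \<in> sm_points G (Suc n)"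
  using face_smooth[of i n] degen_smooth[of j n] by (auto simp: smooth_map_def sm_points_def
      continuous_map_def Pi_iff)

theorem smooth_functions_cosimplicial: "cosimplicial_algebra (ring_of_type_algebra :: real ring) XG"
proof (rule cosimplicial_algebra.intro)
  show "assoc_algebra (ring_of_type_algebra :: real ring) (cs_obj XG n)" for n
    using smooth_manifold.smooth_algebra_algebra[OF obj_manifold] by (simp add: XG_simps)
  show "cs_coface XG n i \<in> alg_hom ring_of_type_algebra (cs_obj XG n) (cs_obj XG (Suc n))" if "i \<le> Suc n"
      for n i
    using pullback_hom[OF obj_manifold obj_manifold face_smooth[OF that]] by (simp add: sm_functions_def
        sm_points_def)
  show "cs_codegen XG n j \<in> alg_hom ring_of_type_algebra (cs_obj XG (Suc n)) (cs_obj XG n)" if "j \<le> n" for n j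
    using pullback_hom[OF obj_manifold obj_manifold degen_smooth[OF that]] by (simp add: sm_functions_def
        sm_points_def)
  fix n i j
  show "cs_coface XG (Suc n) j (cs_coface XG n i f) = cs_coface XG (Suc n) i (cs_coface XG n (j - 1) f)"
    if "i < j" "j \<le> Suc (Suc n)" for f
    unfolding XG_simps using that by (intro restrict_ext) (simp add: face_point face_face)
  show "cs_codegen XG n j (cs_codegen XG (Suc n) i f) = cs_codegen XG n i (cs_codegen XG (Suc n) (Suc j) f)"
    if "i \<le> j" "j \<le> n" for f
    unfolding XG_simps using that by (intro restrict_ext) (simp add: degen_point degen_degen)
  show "cs_codegen XG (Suc n) j (cs_coface XG (Suc n) i f) = cs_coface XG n i (cs_codegen XG n (j - 1) f)"
    if "i < j" "j \<le> Suc n" for f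
    unfolding XG_simps using that by (intro restrict_ext) (simp add: degen_point face_point face_degen_less)
  show "cs_codegen XG (Suc n) j (cs_coface XG (Suc n) i f) = cs_coface XG n (i - 1) (cs_codegen XG n j f)"
    if "Suc j < i" "i \<le> Suc (Suc n)" for f
  proof -
    have "0 < i" using that by simp
    then obtain l where "i = Suc l" using gr0_implies_Suc by blast
    with that show ?thesis
      unfolding XG_simps by (intro restrict_ext) (simp add: degen_point face_point face_degen_greater)
  qed
  show "cs_codegen XG n j (cs_coface XG n i f) = f"
    if "j \<le> n" "i = j \<or> i = Suc j" "f \<in> carrier (cs_obj XG n)" for f
  proof -
    interpret M: smooth_manifold "sm_obj G n" by (rule obj_manifold)
    have "(\<lambda>p\<in>sm_points G n. f p) = f"
      using that(3) M.smooth_functionsD(1) unfolding XG_simps M.smooth_algebra_simps sm_points_def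
      by (intro extensional_restrict)
    moreover have "cs_codegen XG n j (cs_coface XG n i f) = (\<lambda>p\<in>sm_points G n. f p)"
      unfolding XG_simps using that by (intro restrict_ext) (simp add: degen_point face_degen_id)
    ultimately show ?thesis by simp
  qed
qed

lemma codegen_ker_vanishing: "1 \<le> j \<Longrightarrow> j \<le> n \<Longrightarrow> codegen_ker XG n j = vanishing_ideal G n j"
proof -
  assume j: "1 \<le> j" "j \<le> n"
  interpret M: smooth_manifold "sm_obj G n" by (rule obj_manifold)
  interpret M': smooth_manifold "sm_obj G (n - 1)" by (rule obj_manifold)
  show ?thesis
    unfolding codegen_ker_def a_kernel_def' vanishing_ideal_def XG_simps M.smooth_algebra_simps
        M'.smooth_algebra_simps
    by (auto simp: fun_eq_iff restrict_def sm_points_def)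
qed

text \<open>
  The pullback \<open>s\<^sub>j\<^sup>*\<close> kills exactly the functions that vanish on the image of \<open>s\<^sub>j\<close>. Hence the two algebras of
  normalized cochains and the two ideals coincide.
\<close>

theorem CE_algebra_eq: "CE_algebra G = abs_diff XG"
proof -
  interpret X: cosimplicial_algebra "ring_of_type_algebra :: real ring" XG by (rule
      smooth_functions_cosimplicial)
  have N: "normalized XG n = sm_normalized G n" for n
    using smooth_manifold.smooth_algebra_simps(1)[OF obj_manifold]
    by (auto simp: normalized_def sm_normalized_def codegen_ker_vanishing XG_simps)
  have XN: "normalization XG = sm_cochains G"
    by (simp add: normalization_def sm_cochains_def N XG_simps)
  have J: "differentiating XG n = sm_J G n" for n
  proof -
    have "ideal_prod (cs_obj XG n) (codegen_ker XG n j) (codegen_ker XG n j) \<inter> normalized XG n =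
        sm_normalized G n \<inter> ideal_prod (smooth_algebra (sm_obj G n)) (vanishing_ideal G n j)
            (vanishing_ideal G n j)"
      if "j \<in> {1..n}" for j
      using that by (auto simp: codegen_ker_vanishing N XG_simps)
    then have "(\<Pi> j\<in>{1..n}. ideal_prod (cs_obj XG n) (codegen_ker XG n j) (codegen_ker XG n j) \<inter>
        normalized XG n) =
        (\<Pi> j\<in>{1..n}. sm_normalized G n \<inter> ideal_prod (smooth_algebra (sm_obj G n)) (vanishing_ideal G n j)
            (vanishing_ideal G n j))"
      unfolding Pi_def by blast
    then show ?thesis by (simp add: differentiating_def sm_J_def XG_simps)
  qed
  have "differentiating_ideal XG = sm_Jhat G"
    unfolding X.differentiating_ideal_explicit
    by (rule ext) (simp add: explicit_ideal_def sm_Jhat_def J XG_simps split: nat.split)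
  then show ?thesis by (simp add: CE_algebra_def abs_diff_def XN)
qed

lemma abs_diff_CE_isomorphic:
  "dg_isomorphic (ring_of_type_algebra :: real ring) (abs_diff XG) (CE_algebra G)"
proof -
  interpret X: cosimplicial_algebra "ring_of_type_algebra :: real ring" XG by (rule
      smooth_functions_cosimplicial)
  have A: "dg_algebra (ring_of_type_algebra :: real ring) (abs_diff XG)"
    unfolding abs_diff_def by (rule X.nd.dg_algebra_Q)
  have "bij_betw (dg_id (abs_diff XG) n) (carrier (dg_gr (abs_diff XG) n)) (carrier (dg_gr (abs_diff XG)
      n))" for n
    by (rule bij_betw_cong[THEN iffD2, OF _ bij_betw_id]) (simp add: dg_id_def)
  then show ?thesis
    unfolding CE_algebra_eq dg_isomorphic_def using A dg_hom_id[OF A] by blast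
qed

end

section \<open>The adjunction theorem\<close>

theorem theorem5p2p5:
  fixes k :: "'k ring"
  assumes "field k"
  shows
    "is_functor (cAlg k :: (('k, 'a) cosimplicial, _) category) (dgAlg k) abs_diff abs_diff_map \<and>
     is_functor (dgAlg k :: (('k, 'b) dga, _) category) (cAlg k) denorm denorm_map \<and>
     (\<exists>\<Phi>.
        (\<forall>X\<in>Ob (cAlg k :: (('k, 'a) cosimplicial, _) category).
         \<forall>Y\<in>Ob (dgAlg k :: (('k, 'b) dga, _) category).
           bij_betw (\<Phi> X Y) (dg_hom k (abs_diff X) Y) (cs_hom k X (denorm Y))) \<and>
        (\<forall>X\<in>Ob (cAlg k). \<forall>X'\<in>Ob (cAlg k). \<forall>Y\<in>Ob (dgAlg k). \<forall>Y'\<in>Ob (dgAlg k).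
         \<forall>h\<in>cs_hom k X' X. \<forall>g\<in>dg_hom k Y Y'. \<forall>\<psi>\<in>dg_hom k (abs_diff X) Y.
           \<Phi> X' Y' (dg_comp (abs_diff X') g (dg_comp (abs_diff X') \<psi> (abs_diff_map X' X h))) =
           cs_comp X' (denorm_map Y Y' g) (cs_comp X' (\<Phi> X Y \<psi>) h))) \<and>
     fully_faithful (dgAlg k :: (('k, 'b) dga, _) category) (cAlg k) denorm denorm_map \<and>
     (\<forall>X :: ('k, 'a) cosimplicial.
        cosimplicial_algebra k X \<and> cs_commutative X \<longrightarrow> graded_commutative (abs_diff X)) \<and>
     (\<forall>G :: 'p simplicial. simplicial_manifold G \<longrightarrow>
        cosimplicial_algebra (ring_of_type_algebra :: real ring) (sm_functions G) \<and>
        dg_isomorphic (ring_of_type_algebra :: real ring) (abs_diff (sm_functions G)) (CE_algebra G))"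
proof (intro conjI)
  show "\<exists>\<Phi>.
      (\<forall>X\<in>Ob (cAlg k :: (('k, 'a) cosimplicial, _) category).
       \<forall>Y\<in>Ob (dgAlg k :: (('k, 'b) dga, _) category).
         bij_betw (\<Phi> X Y) (dg_hom k (abs_diff X) Y) (cs_hom k X (denorm Y))) \<and>
      (\<forall>X\<in>Ob (cAlg k). \<forall>X'\<in>Ob (cAlg k). \<forall>Y\<in>Ob (dgAlg k). \<forall>Y'\<in>Ob (dgAlg k).
       \<forall>h\<in>cs_hom k X' X. \<forall>g\<in>dg_hom k Y Y'. \<forall>\<psi>\<in>dg_hom k (abs_diff X) Y.
         \<Phi> X' Y' (dg_comp (abs_diff X') g (dg_comp (abs_diff X') \<psi> (abs_diff_map X' X h))) =
         cs_comp X' (denorm_map Y Y' g) (cs_comp X' (\<Phi> X Y \<psi>) h))"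
    by (intro exI[of _ "\<lambda>X Y. adjunct X"] conjI ballI)
      (simp_all add: cAlg_def dgAlg_def cosimplicial_algebra.adjunct_bij adjunct_natural)
  show "\<forall>X :: ('k, 'a) cosimplicial.
      cosimplicial_algebra k X \<and> cs_commutative X \<longrightarrow> graded_commutative (abs_diff X)"
    by (blast intro: cosimplicial_algebra.abs_diff_graded_commutative)
  show "\<forall>G :: 'p simplicial. simplicial_manifold G \<longrightarrow>
      cosimplicial_algebra (ring_of_type_algebra :: real ring) (sm_functions G) \<and>
      dg_isomorphic (ring_of_type_algebra :: real ring) (abs_diff (sm_functions G)) (CE_algebra G)"
    by (blast intro: simplicial_manifold.smooth_functions_cosimplicial
        simplicial_manifold.abs_diff_CE_isomorphic)
qed (rule abs_diff_functor denorm_functor denorm_fully_faithful)+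

end
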